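(* Let $H$ be a Hopf algebra over a field $\Bbbk$ (with bijective antipode) that is a twisted Calabi-Yau (CY) algebra, with left homological integral $\int^l_H={}_\xi\Bbbk$, where $\xi:H\to\Bbbk$ is an algebra homomorphism, and let $\sigma$ be a 2-cocycle on $H$. Then the right cleft object ${}_\sigma H$ is a twisted CY algebra with Nakayama automorphism $\mu$ defined by $$\mu(x)=S^{-1}_{\sigma,1}(S^{-1}_{1,\sigma}(x_1))\,\xi S(x_2)$$ for any $x\in{}_\sigma H$.
   Context: Everything is over a field $\Bbbk$; $\otimes=\otimes_\Bbbk$; $B^e=B\otimes B^{op}$; sumless Sweedler notation is used; Hopf algebras have bijective antipode $S$ and counit $\varepsilon$. $\xi S$ denotes the composite $\xi\circ S$. Twisted CY algebras: an algebra $B$ is twisted CY of dimension $d$ if (i) $B$ is homologically smooth, i.e. $B$ has a bounded resolution by finitely generated projective $B^e$-modules, and (ii) there is an automorphism $\mu$ of $B$ with $\operatorname{Ext}^i_{B^e}(B,B^e)=0$ for $i\ne d$ and $\operatorname{Ext}^d_{B^e}(B,B^e)\cong B^\mu$ as $B^e$-modules. Here $B^\mu$ is $B$ with bimodule structure $a\cdot m\cdot b=am\mu(b)$. Such $\mu$, unique up to inner automorphisms, is called the Nakayama automorphism. Homological integral: if $H$ is a twisted CY Hopf algebra of dimension $d$, then $\operatorname{Ext}^i_H({}_H\Bbbk,{}_HH)=0$ for $i\neq d$, and the left homological integral $\int^l_H:=\operatorname{Ext}^d_H({}_H\Bbbk,{}_HH)$ is a 1-dimensional (right) $H$-module. The notation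 ${}_\xi\Bbbk$ stands for the 1-dimensional module on which $H$ acts through the algebra homomorphism $\xi:H\to\Bbbk$. 2-cocycles: a 2-cocycle on $H$ is a convolution invertible linear map $\sigma:H\otimes H\to\Bbbk$ with $\sigma(h_1,k_1)\sigma(h_2k_2,l)=\sigma(k_1,l_1)\sigma(h,k_2l_2)$ and $\sigma(h,1)=\sigma(1,h)=\varepsilon(h)$ for all $h,k,l\in H$; $\sigma^{-1}$ is its convolution inverse, and $1$, used as a cocycle, denotes the trivial cocycle $\varepsilon\otimes\varepsilon$. For 2-cocycles $\sigma,\tau$, $H(\sigma,\tau)$ is the vector space $H$ with multiplication $h\cdot k=\sigma(h_1,k_1)h_2k_2\tau^{-1}(h_3,k_3)$. The right cleft object ${}_\sigma H$ is the algebra $H(\sigma,1)$, i.e. $H$ with product $\sigma(h_1,k_1)h_2k_2$. The maps $S_{\sigma,\tau}:H(\sigma,\tau)\to H(\tau,\sigma)$, $$S_{\sigma,\tau}(h)=\sigma(h_1,S(h_2))S(h_3)\tau^{-1}(S(h_4),h_5),$$ are linear bijections, with inverses $S^{-1}_{\sigma,\tau}:H(\tau,\sigma)\to H(\sigma,\tau)$.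
   Formalization: The integral equals the module given by ξ after turning this right module into a left one by the antipode: e·S(h)=ξ(h)e. With e·h=ξ(h)e the formula fails, e.g. for U(g) with [x,y]=y and trivial σ, where e·x=e and μ(x)=x+1. *)

theory Defs
  imports "HOL-Algebra.Module" "HOL-Algebra.AbelCoset"
begin

section \<open>Left modules over a not necessarily commutative ring\<close>

text \<open>
  The locale \<^locale>\<open>module\<close> of the library asks for a commutative ring of scalars.
  Modules over noncommutative rings use the same records.  Fields of a record that have no
  meaning for a module (the multiplication and the unit) are \<^const>\<open>undefined\<close>.
\<close>

locale lmodule = R?: ring R + M?: abelian_group M
  for R (structure) and M (structure) +
  assumes lsmult_closed:
      "\<lbrakk>a \<in> carrier R; x \<in> carrier M\<rbrakk> \<Longrightarrow> a \<odot>\<^bsub>M\<^esub> x \<in> carrier M"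
    and lsmult_l_distr:
      "\<lbrakk>a \<in> carrier R; b \<in> carrier R; x \<in> carrier M\<rbrakk> \<Longrightarrow>
        (a \<oplus>\<^bsub>R\<^esub> b) \<odot>\<^bsub>M\<^esub> x = a \<odot>\<^bsub>M\<^esub> x \<oplus>\<^bsub>M\<^esub> b \<odot>\<^bsub>M\<^esub> x"
    and lsmult_r_distr:
      "\<lbrakk>a \<in> carrier R; x \<in> carrier M; y \<in> carrier M\<rbrakk> \<Longrightarrow>
        a \<odot>\<^bsub>M\<^esub> (x \<oplus>\<^bsub>M\<^esub> y) = a \<odot>\<^bsub>M\<^esub> x \<oplus>\<^bsub>M\<^esub> a \<odot>\<^bsub>M\<^esub> y"
    and lsmult_assoc:
      "\<lbrakk>a \<in> carrier R; b \<in> carrier R; x \<in> carrier M\<rbrakk> \<Longrightarrow>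
        (a \<otimes>\<^bsub>R\<^esub> b) \<odot>\<^bsub>M\<^esub> x = a \<odot>\<^bsub>M\<^esub> (b \<odot>\<^bsub>M\<^esub> x)"
    and lsmult_one: "x \<in> carrier M \<Longrightarrow> \<one>\<^bsub>R\<^esub> \<odot>\<^bsub>M\<^esub> x = x"

definition module_hom ::
    "('r, 'c) ring_scheme \<Rightarrow> ('r, 'm, 'd) module_scheme \<Rightarrow> ('r, 'n, 'e) module_scheme \<Rightarrow> ('m \<Rightarrow> 'n) set" where
  "module_hom R M N = {f \<in> carrier M \<rightarrow> carrier N.
     (\<forall>x\<in>carrier M. \<forall>y\<in>carrier M. f (x \<oplus>\<^bsub>M\<^esub> y) = f x \<oplus>\<^bsub>N\<^esub> f y) \<and>
     (\<forall>a\<in>carrier R. \<forall>x\<in>carrier M. f (a \<odot>\<^bsub>M\<^esub> x) = a \<odot>\<^bsub>N\<^esub> f x)}"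

definition module_isomorphic ::
    "('r, 'c) ring_scheme \<Rightarrow> ('r, 'm, 'd) module_scheme \<Rightarrow> ('r, 'n, 'e) module_scheme \<Rightarrow> bool" where
  "module_isomorphic R M N \<longleftrightarrow> (\<exists>f\<in>module_hom R M N. bij_betw f (carrier M) (carrier N))"

definition regular_module :: "('r, 'c) ring_scheme \<Rightarrow> ('r, 'r) module" where
  "regular_module R = \<lparr>carrier = carrier R, mult = mult R, one = one R,
     zero = zero R, add = add R, smult = mult R\<rparr>"

definition submodule_generated ::
    "('r, 'c) ring_scheme \<Rightarrow> ('r, 'm, 'd) module_scheme \<Rightarrow> 'm set \<Rightarrow> 'm set" where
  "submodule_generated R M X = \<Inter>{N. submodule N R M \<and> X \<subseteq> N}"

definition quotient_module ::
    "('r, 'm, 'd) module_scheme \<Rightarrow> 'm set \<Rightarrow> ('r, 'm set) module" where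
  "quotient_module M N = \<lparr>carrier = a_rcosets\<^bsub>M\<^esub> N, mult = undefined, one = undefined,
     zero = N, add = set_add M, smult = (\<lambda>r X. \<Union>x\<in>X. N +>\<^bsub>M\<^esub> (r \<odot>\<^bsub>M\<^esub> x))\<rparr>"

definition free_module :: "('r, 'c) ring_scheme \<Rightarrow> 'x set \<Rightarrow> ('r, 'x \<Rightarrow> 'r) module" where
  "free_module R X = \<lparr>
     carrier = {f. range f \<subseteq> carrier R \<and> finite {x. f x \<noteq> \<zero>\<^bsub>R\<^esub>} \<and> (\<forall>x. x \<notin> X \<longrightarrow> f x = \<zero>\<^bsub>R\<^esub>)},
     mult = undefined, one = undefined,
     zero = (\<lambda>x. \<zero>\<^bsub>R\<^esub>), add = (\<lambda>f g x. f x \<oplus>\<^bsub>R\<^esub> g x), smult = (\<lambda>a f x. a \<otimes>\<^bsub>R\<^esub> f x)\<rparr>"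

text \<open>
  Projective means direct summand of a free module.  Every module that is a summand of some
  free module is one of a free module on a set of its own elements, so that it is enough to
  let the basis range over sets of elements of the module.
\<close>

definition projective_module :: "('r, 'c) ring_scheme \<Rightarrow> ('r, 'm, 'd) module_scheme \<Rightarrow> bool" where
  "projective_module R P \<longleftrightarrow> lmodule R P \<and>
     (\<exists>X::'m set. \<exists>s\<in>module_hom R P (free_module R X). \<exists>p\<in>module_hom R (free_module R X) P.
        \<forall>x\<in>carrier P. p (s x) = x)"

definition finitely_generated_module ::
    "('r, 'c) ring_scheme \<Rightarrow> ('r, 'm, 'd) module_scheme \<Rightarrow> bool" where
  "finitely_generated_module R M \<longleftrightarrow>
     (\<exists>X. finite X \<and> X \<subseteq> carrier M \<and> submodule_generated R M X = carrier M)"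

section \<open>Projective resolutions and Ext\<close>

definition projective_resolution ::
    "('r, 'c) ring_scheme \<Rightarrow> ('r, 'm, 'd) module_scheme \<Rightarrow>
     (nat \<Rightarrow> ('r, 'u) module) \<Rightarrow> (nat \<Rightarrow> 'u \<Rightarrow> 'u) \<Rightarrow> ('u \<Rightarrow> 'm) \<Rightarrow> bool" where
  "projective_resolution R M P \<delta> \<epsilon> \<longleftrightarrow>
     (\<forall>n. projective_module R (P n)) \<and>
     (\<forall>n. \<delta> n \<in> module_hom R (P (Suc n)) (P n)) \<and>
     \<epsilon> \<in> module_hom R (P 0) M \<and>
     \<epsilon> ` carrier (P 0) = carrier M \<and>
     \<delta> 0 ` carrier (P 1) = {x \<in> carrier (P 0). \<epsilon> x = \<zero>\<^bsub>M\<^esub>} \<and>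
     (\<forall>n. \<delta> (Suc n) ` carrier (P (Suc (Suc n))) = {x \<in> carrier (P (Suc n)). \<delta> n x = \<zero>\<^bsub>P n\<^esub>})"

text \<open>
  The modules of a resolution have to live on a type fixed in advance.  On the type below every
  module on \<open>'m\<close> over a ring on \<open>'r\<close> has a free resolution, whose n-th term is the module of
  finitely supported functions on some set of lists: the cardinality of the set of lists over
  \<open>'r \<times> 'm\<close> bounds the number of generators needed in each degree.  Finitely
  generated projective modules over a ring on \<open>'r\<close> also have copies on this type.
\<close>

type_synonym ('r, 'm) resolution_carrier = "('r \<times> 'm) list \<Rightarrow> 'r"

definition chosen_resolution ::
    "('r, 'c) ring_scheme \<Rightarrow> ('r, 'm, 'd) module_scheme \<Rightarrow>
     (nat \<Rightarrow> ('r, ('r, 'm) resolution_carrier) module) \<times>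
     (nat \<Rightarrow> ('r, 'm) resolution_carrier \<Rightarrow> ('r, 'm) resolution_carrier)" where
  "chosen_resolution R M = (SOME (P, \<delta>). \<exists>\<epsilon>. projective_resolution R M P \<delta> \<epsilon>)"

text \<open>
  In the following, \<open>N\<close> is an R-S-bimodule: a left R-module with right S-action
  \<open>x \<cdot> s = act s x\<close>.  Then Hom and Ext into \<open>N\<close> are right S-modules.  A right module is
  encoded by the record whose scalar multiplication is \<open>s \<odot> x = x \<cdot> s\<close>.
\<close>

definition hom_module ::
    "('r, 'c) ring_scheme \<Rightarrow> ('r, 'm, 'd) module_scheme \<Rightarrow> ('r, 'n, 'e) module_scheme \<Rightarrow>
     ('s \<Rightarrow> 'n \<Rightarrow> 'n) \<Rightarrow> ('s, 'm \<Rightarrow> 'n) module" where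
  "hom_module R M N act = \<lparr>carrier = module_hom R M N \<inter> extensional (carrier M),
     mult = undefined, one = undefined,
     zero = (\<lambda>x\<in>carrier M. \<zero>\<^bsub>N\<^esub>), add = (\<lambda>f g. \<lambda>x\<in>carrier M. f x \<oplus>\<^bsub>N\<^esub> g x),
     smult = (\<lambda>s f. \<lambda>x\<in>carrier M. act s (f x))\<rparr>"

definition cocycles ::
    "('r, 'c) ring_scheme \<Rightarrow> (nat \<Rightarrow> ('r, 'u) module) \<Rightarrow> (nat \<Rightarrow> 'u \<Rightarrow> 'u) \<Rightarrow>
     ('r, 'n, 'e) module_scheme \<Rightarrow> ('s \<Rightarrow> 'n \<Rightarrow> 'n) \<Rightarrow> nat \<Rightarrow> ('u \<Rightarrow> 'n) set" where
  "cocycles R P \<delta> N act n =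
     {f \<in> carrier (hom_module R (P n) N act). \<forall>x\<in>carrier (P (Suc n)). f (\<delta> n x) = \<zero>\<^bsub>N\<^esub>}"

fun coboundaries ::
    "('r, 'c) ring_scheme \<Rightarrow> (nat \<Rightarrow> ('r, 'u) module) \<Rightarrow> (nat \<Rightarrow> 'u \<Rightarrow> 'u) \<Rightarrow>
     ('r, 'n, 'e) module_scheme \<Rightarrow> ('s \<Rightarrow> 'n \<Rightarrow> 'n) \<Rightarrow> nat \<Rightarrow> ('u \<Rightarrow> 'n) set" where
  "coboundaries R P \<delta> N act 0 = {\<zero>\<^bsub>hom_module R (P 0) N act\<^esub>}"
| "coboundaries R P \<delta> N act (Suc n) =
     (\<lambda>g. \<lambda>x\<in>carrier (P (Suc n)). g (\<delta> n x)) ` carrier (hom_module R (P n) N act)"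

definition Ext_module ::
    "('r, 'c) ring_scheme \<Rightarrow> ('r, 'm, 'd) module_scheme \<Rightarrow> ('r, 'n, 'e) module_scheme \<Rightarrow>
     ('s \<Rightarrow> 'n \<Rightarrow> 'n) \<Rightarrow> nat \<Rightarrow> ('s, (('r, 'm) resolution_carrier \<Rightarrow> 'n) set) module" where
  "Ext_module R M N act n = (case chosen_resolution R M of (P, \<delta>) \<Rightarrow>
     quotient_module ((hom_module R (P n) N act)\<lparr>carrier := cocycles R P \<delta> N act n\<rparr>)
       (coboundaries R P \<delta> N act n))"

definition Ext_regular ::
    "('r, 'c) ring_scheme \<Rightarrow> ('r, 'm, 'd) module_scheme \<Rightarrow> nat \<Rightarrow>
     ('r, (('r, 'm) resolution_carrier \<Rightarrow> 'r) set) module" where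
  "Ext_regular R M n = Ext_module R M (regular_module R) (\<lambda>s x. x \<otimes>\<^bsub>R\<^esub> s) n"

section \<open>Algebras over a field and their tensor products\<close>

locale assoc_algebra = K?: field K + module K A + ring A for K (structure) and A (structure) +
  assumes smult_mult_left:
      "\<lbrakk>a \<in> carrier K; x \<in> carrier A; y \<in> carrier A\<rbrakk> \<Longrightarrow>
        (a \<odot>\<^bsub>A\<^esub> x) \<otimes>\<^bsub>A\<^esub> y = a \<odot>\<^bsub>A\<^esub> (x \<otimes>\<^bsub>A\<^esub> y)"
    and smult_mult_right:
      "\<lbrakk>a \<in> carrier K; x \<in> carrier A; y \<in> carrier A\<rbrakk> \<Longrightarrow>
        x \<otimes>\<^bsub>A\<^esub> (a \<odot>\<^bsub>A\<^esub> y) = a \<odot>\<^bsub>A\<^esub> (x \<otimes>\<^bsub>A\<^esub> y)"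

definition algebra_hom ::
    "('k, 'c) ring_scheme \<Rightarrow> ('k, 'a, 'd) module_scheme \<Rightarrow> ('k, 'b, 'e) module_scheme \<Rightarrow> ('a \<Rightarrow> 'b) set" where
  "algebra_hom K A B = ring_hom A B \<inter> module_hom K A B"

type_synonym ('k, 'v, 'w) tensor = "('v \<times> 'w \<Rightarrow> 'k) set"

definition basis_vector :: "('k, 'c) ring_scheme \<Rightarrow> 'x \<Rightarrow> 'x \<Rightarrow> 'k" where
  "basis_vector K x = (\<lambda>y. if y = x then \<one>\<^bsub>K\<^esub> else \<zero>\<^bsub>K\<^esub>)"

definition tensor_relations ::
    "('k, 'c) ring_scheme \<Rightarrow> ('k, 'v, 'd) module_scheme \<Rightarrow> ('k, 'w, 'e) module_scheme \<Rightarrow>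
     ('v \<times> 'w \<Rightarrow> 'k) set" where
  "tensor_relations K V W =
    (let F = free_module K (carrier V \<times> carrier W); b = (\<lambda>v w. basis_vector K (v, w)) in
     {b (v \<oplus>\<^bsub>V\<^esub> v') w \<ominus>\<^bsub>F\<^esub> (b v w \<oplus>\<^bsub>F\<^esub> b v' w) | v v' w.
        v \<in> carrier V \<and> v' \<in> carrier V \<and> w \<in> carrier W} \<union>
     {b v (w \<oplus>\<^bsub>W\<^esub> w') \<ominus>\<^bsub>F\<^esub> (b v w \<oplus>\<^bsub>F\<^esub> b v w') | v w w'.
        v \<in> carrier V \<and> w \<in> carrier W \<and> w' \<in> carrier W} \<union>
     {b (a \<odot>\<^bsub>V\<^esub> v) w \<ominus>\<^bsub>F\<^esub> a \<odot>\<^bsub>F\<^esub> b v w | a v w.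
        a \<in> carrier K \<and> v \<in> carrier V \<and> w \<in> carrier W} \<union>
     {b v (a \<odot>\<^bsub>W\<^esub> w) \<ominus>\<^bsub>F\<^esub> a \<odot>\<^bsub>F\<^esub> b v w | a v w.
        a \<in> carrier K \<and> v \<in> carrier V \<and> w \<in> carrier W})"

definition tensor_null ::
    "('k, 'c) ring_scheme \<Rightarrow> ('k, 'v, 'd) module_scheme \<Rightarrow> ('k, 'w, 'e) module_scheme \<Rightarrow>
     ('v \<times> 'w \<Rightarrow> 'k) set" where
  "tensor_null K V W =
     submodule_generated K (free_module K (carrier V \<times> carrier W)) (tensor_relations K V W)"

definition tensor_module ::
    "('k, 'c) ring_scheme \<Rightarrow> ('k, 'v, 'd) module_scheme \<Rightarrow> ('k, 'w, 'e) module_scheme \<Rightarrow>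
     ('k, ('k, 'v, 'w) tensor) module" where
  "tensor_module K V W =
     quotient_module (free_module K (carrier V \<times> carrier W)) (tensor_null K V W)"

definition pure_tensor ::
    "('k, 'c) ring_scheme \<Rightarrow> ('k, 'v, 'd) module_scheme \<Rightarrow> ('k, 'w, 'e) module_scheme \<Rightarrow>
     'v \<Rightarrow> 'w \<Rightarrow> ('k, 'v, 'w) tensor" where
  "pure_tensor K V W v w =
     tensor_null K V W +>\<^bsub>free_module K (carrier V \<times> carrier W)\<^esub> basis_vector K (v, w)"

text \<open>
  The linear map out of a tensor product that is induced by a bilinear map \<open>f\<close> with values in
  \<open>U\<close>, computed on a representative.  It is meaningful only for bilinear \<open>f\<close>.
\<close>

definition tensor_lift ::
    "('k, 'c) ring_scheme \<Rightarrow> ('k, 'u, 'd) module_scheme \<Rightarrow> ('v \<Rightarrow> 'w \<Rightarrow> 'u) \<Rightarrow>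
     ('k, 'v, 'w) tensor \<Rightarrow> 'u" where
  "tensor_lift K U f t = (let c = (SOME c. c \<in> t) in
     \<Oplus>\<^bsub>U\<^esub>p\<in>{p. c p \<noteq> \<zero>\<^bsub>K\<^esub>}. c p \<odot>\<^bsub>U\<^esub> f (fst p) (snd p))"

definition tensor_algebra ::
    "('k, 'c) ring_scheme \<Rightarrow> ('k, 'a, 'd) module_scheme \<Rightarrow> ('k, 'b, 'e) module_scheme \<Rightarrow>
     ('k, ('k, 'a, 'b) tensor) module" where
  "tensor_algebra K A B = (tensor_module K A B)\<lparr>
     mult := (\<lambda>s t. tensor_lift K (tensor_module K A B) (\<lambda>a b.
       tensor_lift K (tensor_module K A B) (\<lambda>a' b'.
         pure_tensor K A B (a \<otimes>\<^bsub>A\<^esub> a') (b \<otimes>\<^bsub>B\<^esub> b')) t) s),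
     one := pure_tensor K A B \<one>\<^bsub>A\<^esub> \<one>\<^bsub>B\<^esub>\<rparr>"

definition opposite_algebra :: "('k, 'a, 'd) module_scheme \<Rightarrow> ('k, 'a, 'd) module_scheme" where
  "opposite_algebra A = A\<lparr>mult := (\<lambda>x y. y \<otimes>\<^bsub>A\<^esub> x)\<rparr>"

definition enveloping_algebra ::
    "('k, 'c) ring_scheme \<Rightarrow> ('k, 'a, 'd) module_scheme \<Rightarrow> ('k, ('k, 'a, 'a) tensor) module" where
  "enveloping_algebra K B = tensor_algebra K B (opposite_algebra B)"

section \<open>Twisted Calabi-Yau algebras\<close>

text \<open>
  The bimodule \<open>B\<^sup>\<mu>\<close>, with \<open>a \<cdot> m \<cdot> b = a m \<mu>(b)\<close>, as a left module over the enveloping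
  algebra: \<open>(a \<otimes> b) m = a \<cdot> m \<cdot> b\<close>.
\<close>

definition twisted_bimodule ::
    "('k, 'c) ring_scheme \<Rightarrow> ('k, 'a, 'd) module_scheme \<Rightarrow> ('a \<Rightarrow> 'a) \<Rightarrow>
     (('k, 'a, 'a) tensor, 'a) module" where
  "twisted_bimodule K B \<mu> = \<lparr>carrier = carrier B, mult = undefined, one = undefined,
     zero = zero B, add = add B,
     smult = (\<lambda>t m. tensor_lift K B (\<lambda>a b. a \<otimes>\<^bsub>B\<^esub> m \<otimes>\<^bsub>B\<^esub> \<mu> b) t)\<rparr>"

definition homologically_smooth ::
    "('k, 'c) ring_scheme \<Rightarrow> ('k, 'a, 'd) module_scheme \<Rightarrow> bool" where
  "homologically_smooth K B \<longleftrightarrow>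
     (\<exists>(P :: nat \<Rightarrow> (('k, 'a, 'a) tensor, (('k, 'a, 'a) tensor, 'a) resolution_carrier) module) \<delta> \<epsilon>.
        projective_resolution (enveloping_algebra K B) (twisted_bimodule K B id) P \<delta> \<epsilon> \<and>
        (\<forall>n. finitely_generated_module (enveloping_algebra K B) (P n)) \<and>
        (\<exists>m. \<forall>n\<ge>m. carrier (P n) = {\<zero>\<^bsub>P n\<^esub>}))"

definition tensor_flip ::
    "('k, 'c) ring_scheme \<Rightarrow> ('k, 'a, 'd) module_scheme \<Rightarrow>
     ('k, 'a, 'a) tensor \<Rightarrow> ('k, 'a, 'a) tensor" where
  "tensor_flip K B t =
     tensor_lift K (enveloping_algebra K B) (\<lambda>a b. pure_tensor K B (opposite_algebra B) b a) t"

text \<open>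
  The Ext of \<open>B\<close> with values in its enveloping algebra is a right module over the enveloping
  algebra (by right multiplication, i.e. by the inner bimodule structure
  \<open>a \<cdot> (x \<otimes> y) \<cdot> b = x b \<otimes> a y\<close>).  As usual it is regarded as a bimodule, i.e. as a left
  module, by \<open>(a \<otimes> b) e = a \<cdot> e \<cdot> b = e (b \<otimes> a)\<close>.
\<close>

definition Ext_enveloping ::
    "('k, 'c) ring_scheme \<Rightarrow> ('k, 'a, 'd) module_scheme \<Rightarrow> nat \<Rightarrow>
     (('k, 'a, 'a) tensor,
      ((('k, 'a, 'a) tensor, 'a) resolution_carrier \<Rightarrow> ('k, 'a, 'a) tensor) set) module" where
  "Ext_enveloping K B n =
     (let E = Ext_regular (enveloping_algebra K B) (twisted_bimodule K B id) n
      in E\<lparr>smult := (\<lambda>t e. tensor_flip K B t \<odot>\<^bsub>E\<^esub> e)\<rparr>)"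

definition nakayama_automorphism ::
    "('k, 'c) ring_scheme \<Rightarrow> ('k, 'a, 'd) module_scheme \<Rightarrow> nat \<Rightarrow> ('a \<Rightarrow> 'a) \<Rightarrow> bool" where
  "nakayama_automorphism K B d \<mu> \<longleftrightarrow>
     \<mu> \<in> algebra_hom K B B \<and> bij_betw \<mu> (carrier B) (carrier B) \<and>
     (\<forall>i. i \<noteq> d \<longrightarrow> carrier (Ext_enveloping K B i) = {\<zero>\<^bsub>Ext_enveloping K B i\<^esub>}) \<and>
     module_isomorphic (enveloping_algebra K B) (Ext_enveloping K B d) (twisted_bimodule K B \<mu>)"

definition twisted_CY_with ::
    "('k, 'c) ring_scheme \<Rightarrow> ('k, 'a, 'd) module_scheme \<Rightarrow> nat \<Rightarrow> ('a \<Rightarrow> 'a) \<Rightarrow> bool" where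
  "twisted_CY_with K B d \<mu> \<longleftrightarrow>
     assoc_algebra K B \<and> homologically_smooth K B \<and> nakayama_automorphism K B d \<mu>"

definition twisted_CY ::
    "('k, 'c) ring_scheme \<Rightarrow> ('k, 'a, 'd) module_scheme \<Rightarrow> nat \<Rightarrow> bool" where
  "twisted_CY K B d \<longleftrightarrow> (\<exists>\<mu>. twisted_CY_with K B d \<mu>)"

section \<open>Hopf algebras\<close>

record ('k, 'h) hopf = "('k, 'h) module" +
  comult :: "'h \<Rightarrow> ('k, 'h, 'h) tensor"
  counit :: "'h \<Rightarrow> 'k"
  antipode :: "'h \<Rightarrow> 'h"

text \<open>
  Sweedler sums: \<open>sweedler2 K H U h (\<lambda>h1 h2. f h1 h2)\<close> is the sum of the \<open>f(h1,h2)\<close>, formed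
  in the vector space \<open>U\<close>, for bilinear \<open>f\<close>; similarly for iterated comultiplications.
\<close>

definition sweedler2 ::
    "('k, 'c) ring_scheme \<Rightarrow> ('k, 'h, 'd) hopf_scheme \<Rightarrow> ('k, 'u, 'e) module_scheme \<Rightarrow> 'h \<Rightarrow>
     ('h \<Rightarrow> 'h \<Rightarrow> 'u) \<Rightarrow> 'u" where
  "sweedler2 K H U h f = tensor_lift K U f (comult H h)"

definition sweedler3 ::
    "('k, 'c) ring_scheme \<Rightarrow> ('k, 'h, 'd) hopf_scheme \<Rightarrow> ('k, 'u, 'e) module_scheme \<Rightarrow> 'h \<Rightarrow>
     ('h \<Rightarrow> 'h \<Rightarrow> 'h \<Rightarrow> 'u) \<Rightarrow> 'u" where
  "sweedler3 K H U h f = sweedler2 K H U h (\<lambda>a b. sweedler2 K H U b (f a))"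

definition sweedler4 ::
    "('k, 'c) ring_scheme \<Rightarrow> ('k, 'h, 'd) hopf_scheme \<Rightarrow> ('k, 'u, 'e) module_scheme \<Rightarrow> 'h \<Rightarrow>
     ('h \<Rightarrow> 'h \<Rightarrow> 'h \<Rightarrow> 'h \<Rightarrow> 'u) \<Rightarrow> 'u" where
  "sweedler4 K H U h f = sweedler2 K H U h (\<lambda>a b. sweedler3 K H U b (f a))"

definition sweedler5 ::
    "('k, 'c) ring_scheme \<Rightarrow> ('k, 'h, 'd) hopf_scheme \<Rightarrow> ('k, 'u, 'e) module_scheme \<Rightarrow> 'h \<Rightarrow>
     ('h \<Rightarrow> 'h \<Rightarrow> 'h \<Rightarrow> 'h \<Rightarrow> 'h \<Rightarrow> 'u) \<Rightarrow> 'u" where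
  "sweedler5 K H U h f = sweedler2 K H U h (\<lambda>a b. sweedler4 K H U b (f a))"

locale hopf_algebra = assoc_algebra K H for K (structure) and H (structure) +
  assumes comult_hom: "comult H \<in> algebra_hom K H (tensor_algebra K H H)"
    and counit_hom: "counit H \<in> algebra_hom K H (regular_module K)"
    and antipode_linear: "antipode H \<in> module_hom K H H"
    and coassoc: "h \<in> carrier H \<Longrightarrow>
      (let T = tensor_module K H H; T3 = tensor_module K H T;
           t3 = (\<lambda>a b c. pure_tensor K H T a (pure_tensor K H H b c))
       in sweedler2 K H T3 h (\<lambda>x c. sweedler2 K H T3 x (\<lambda>a b. t3 a b c)) =
          sweedler2 K H T3 h (\<lambda>a x. sweedler2 K H T3 x (\<lambda>b c. t3 a b c)))"
    and counit_left: "h \<in> carrier H \<Longrightarrow> sweedler2 K H H h (\<lambda>a b. counit H a \<odot>\<^bsub>H\<^esub> b) = h"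
    and counit_right: "h \<in> carrier H \<Longrightarrow> sweedler2 K H H h (\<lambda>a b. counit H b \<odot>\<^bsub>H\<^esub> a) = h"
    and antipode_left: "h \<in> carrier H \<Longrightarrow>
      sweedler2 K H H h (\<lambda>a b. antipode H a \<otimes>\<^bsub>H\<^esub> b) = counit H h \<odot>\<^bsub>H\<^esub> \<one>\<^bsub>H\<^esub>"
    and antipode_right: "h \<in> carrier H \<Longrightarrow>
      sweedler2 K H H h (\<lambda>a b. a \<otimes>\<^bsub>H\<^esub> antipode H b) = counit H h \<odot>\<^bsub>H\<^esub> \<one>\<^bsub>H\<^esub>"

definition character_module ::
    "('k, 'c) ring_scheme \<Rightarrow> ('h \<Rightarrow> 'k) \<Rightarrow> ('h, 'k) module" where
  "character_module K \<xi> = \<lparr>carrier = carrier K, mult = undefined, one = undefined,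
     zero = zero K, add = add K, smult = (\<lambda>h x. \<xi> h \<otimes>\<^bsub>K\<^esub> x)\<rparr>"

text \<open>This is a right H-module, encoded by \<open>h \<odot> e = e \<cdot> h\<close>.\<close>

definition left_homological_integral ::
    "('k, 'c) ring_scheme \<Rightarrow> ('k, 'h, 'd) hopf_scheme \<Rightarrow> nat \<Rightarrow>
     ('h, (('h, 'k) resolution_carrier \<Rightarrow> 'h) set) module" where
  "left_homological_integral K H d = Ext_regular H (character_module K (counit H)) d"

text \<open>
  The left module of a right module over a Hopf algebra: \<open>h e = e \<cdot> S(h)\<close>.
\<close>

definition left_via_antipode ::
    "('k, 'h, 'd) hopf_scheme \<Rightarrow> ('h, 'm) module \<Rightarrow> ('h, 'm) module" where
  "left_via_antipode H E = E\<lparr>smult := (\<lambda>h e. antipode H h \<odot>\<^bsub>E\<^esub> e)\<rparr>"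

text \<open>
  In the equation \<open>\<integral> = \<^sub>\<xi>k\<close> the right-hand side is the left module on which \<open>h\<close> acts
  by \<open>\<xi>(h)\<close>, and the left-hand side is turned into a left module by the antipode.  Thus
  \<open>e \<cdot> S(h) = \<xi>(h) e\<close>, equivalently \<open>e \<cdot> h = \<xi>(S(h)) e\<close> (characters are invariant under the
  square of the antipode), for all \<open>e\<close> in the integral.  The side matters: for the enveloping
  algebra of the Lie algebra with \<open>[x,y] = y\<close> one has \<open>e \<cdot> x = e\<close>, and the Nakayama
  automorphism maps \<open>x\<close> to \<open>x + 1\<close>, which is \<open>x + \<xi>(S(x))\<close> for \<open>\<xi>\<close> as here.
\<close>

definition left_integral_is ::
    "('k, 'c) ring_scheme \<Rightarrow> ('k, 'h, 'd) hopf_scheme \<Rightarrow> nat \<Rightarrow> ('h \<Rightarrow> 'k) \<Rightarrow> bool" where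
  "left_integral_is K H d \<xi> \<longleftrightarrow>
     module_isomorphic H (left_via_antipode H (left_homological_integral K H d)) (character_module K \<xi>)"

section \<open>2-cocycles and cleft objects\<close>

text \<open>Linear maps from the tensor square of \<open>H\<close> to \<open>K\<close> are given as bilinear maps.\<close>

definition bilinear_form ::
    "('k, 'c) ring_scheme \<Rightarrow> ('k, 'h, 'd) module_scheme \<Rightarrow> ('h \<Rightarrow> 'h \<Rightarrow> 'k) \<Rightarrow> bool" where
  "bilinear_form K H \<sigma> \<longleftrightarrow>
     (\<forall>h\<in>carrier H. \<sigma> h \<in> module_hom K H (regular_module K)) \<and>
     (\<forall>k\<in>carrier H. (\<lambda>h. \<sigma> h k) \<in> module_hom K H (regular_module K))"

definition trivial_cocycle ::
    "('k, 'c) ring_scheme \<Rightarrow> ('k, 'h, 'd) hopf_scheme \<Rightarrow> 'h \<Rightarrow> 'h \<Rightarrow> 'k" where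
  "trivial_cocycle K H h k = counit H h \<otimes>\<^bsub>K\<^esub> counit H k"

definition convolution ::
    "('k, 'c) ring_scheme \<Rightarrow> ('k, 'h, 'd) hopf_scheme \<Rightarrow> ('h \<Rightarrow> 'h \<Rightarrow> 'k) \<Rightarrow> ('h \<Rightarrow> 'h \<Rightarrow> 'k) \<Rightarrow>
     'h \<Rightarrow> 'h \<Rightarrow> 'k" where
  "convolution K H \<sigma> \<tau> h k =
     sweedler2 K H (regular_module K) h (\<lambda>h1 h2. sweedler2 K H (regular_module K) k (\<lambda>k1 k2.
       \<sigma> h1 k1 \<otimes>\<^bsub>K\<^esub> \<tau> h2 k2))"

definition is_convolution_inverse ::
    "('k, 'c) ring_scheme \<Rightarrow> ('k, 'h, 'd) hopf_scheme \<Rightarrow> ('h \<Rightarrow> 'h \<Rightarrow> 'k) \<Rightarrow> ('h \<Rightarrow> 'h \<Rightarrow> 'k) \<Rightarrow> bool" where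
  "is_convolution_inverse K H \<sigma> \<tau> \<longleftrightarrow> bilinear_form K H \<tau> \<and>
     (\<forall>h\<in>carrier H. \<forall>k\<in>carrier H.
        convolution K H \<sigma> \<tau> h k = trivial_cocycle K H h k \<and>
        convolution K H \<tau> \<sigma> h k = trivial_cocycle K H h k)"

text \<open>The values on the carrier do not depend on the choice.\<close>

definition convolution_inverse ::
    "('k, 'c) ring_scheme \<Rightarrow> ('k, 'h, 'd) hopf_scheme \<Rightarrow> ('h \<Rightarrow> 'h \<Rightarrow> 'k) \<Rightarrow> 'h \<Rightarrow> 'h \<Rightarrow> 'k" where
  "convolution_inverse K H \<sigma> = (SOME \<tau>. is_convolution_inverse K H \<sigma> \<tau>)"

definition two_cocycle ::
    "('k, 'c) ring_scheme \<Rightarrow> ('k, 'h, 'd) hopf_scheme \<Rightarrow> ('h \<Rightarrow> 'h \<Rightarrow> 'k) \<Rightarrow> bool" where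
  "two_cocycle K H \<sigma> \<longleftrightarrow> bilinear_form K H \<sigma> \<and> (\<exists>\<tau>. is_convolution_inverse K H \<sigma> \<tau>) \<and>
     (\<forall>h\<in>carrier H. \<forall>k\<in>carrier H. \<forall>l\<in>carrier H.
        sweedler2 K H (regular_module K) h (\<lambda>h1 h2. sweedler2 K H (regular_module K) k (\<lambda>k1 k2.
          \<sigma> h1 k1 \<otimes>\<^bsub>K\<^esub> \<sigma> (h2 \<otimes>\<^bsub>H\<^esub> k2) l)) =
        sweedler2 K H (regular_module K) k (\<lambda>k1 k2. sweedler2 K H (regular_module K) l (\<lambda>l1 l2.
          \<sigma> k1 l1 \<otimes>\<^bsub>K\<^esub> \<sigma> h (k2 \<otimes>\<^bsub>H\<^esub> l2)))) \<and>
     (\<forall>h\<in>carrier H. \<sigma> h \<one>\<^bsub>H\<^esub> = counit H h \<and> \<sigma> \<one>\<^bsub>H\<^esub> h = counit H h)"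

text \<open>
  The usual notation for \<open>cocycle_twist K H \<sigma> \<tau>\<close> is \<open>H(\<sigma>,\<tau>)\<close>, and \<open>cocycle_antipode K H \<sigma> \<tau>\<close> is the
  linear bijection \<open>S\<^sub>\<sigma>\<^sub>,\<^sub>\<tau>\<close> from \<open>H(\<sigma>,\<tau>)\<close> to \<open>H(\<tau>,\<sigma>)\<close>.
\<close>

definition cocycle_twist ::
    "('k, 'c) ring_scheme \<Rightarrow> ('k, 'h, 'd) hopf_scheme \<Rightarrow> ('h \<Rightarrow> 'h \<Rightarrow> 'k) \<Rightarrow> ('h \<Rightarrow> 'h \<Rightarrow> 'k) \<Rightarrow>
     ('k, 'h) module" where
  "cocycle_twist K H \<sigma> \<tau> = \<lparr>carrier = carrier H,
     mult = (\<lambda>h k. sweedler3 K H H h (\<lambda>h1 h2 h3. sweedler3 K H H k (\<lambda>k1 k2 k3.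
       (\<sigma> h1 k1 \<otimes>\<^bsub>K\<^esub> convolution_inverse K H \<tau> h3 k3) \<odot>\<^bsub>H\<^esub> (h2 \<otimes>\<^bsub>H\<^esub> k2)))),
     one = one H, zero = zero H, add = add H, smult = smult H\<rparr>"

definition right_cleft_object ::
    "('k, 'c) ring_scheme \<Rightarrow> ('k, 'h, 'd) hopf_scheme \<Rightarrow> ('h \<Rightarrow> 'h \<Rightarrow> 'k) \<Rightarrow> ('k, 'h) module" where
  "right_cleft_object K H \<sigma> = cocycle_twist K H \<sigma> (trivial_cocycle K H)"

definition cocycle_antipode ::
    "('k, 'c) ring_scheme \<Rightarrow> ('k, 'h, 'd) hopf_scheme \<Rightarrow> ('h \<Rightarrow> 'h \<Rightarrow> 'k) \<Rightarrow> ('h \<Rightarrow> 'h \<Rightarrow> 'k) \<Rightarrow>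
     'h \<Rightarrow> 'h" where
  "cocycle_antipode K H \<sigma> \<tau> h = sweedler5 K H H h (\<lambda>h1 h2 h3 h4 h5.
     (\<sigma> h1 (antipode H h2) \<otimes>\<^bsub>K\<^esub> convolution_inverse K H \<tau> (antipode H h4) h5)
       \<odot>\<^bsub>H\<^esub> antipode H h3)"

definition cocycle_antipode_inv ::
    "('k, 'c) ring_scheme \<Rightarrow> ('k, 'h, 'd) hopf_scheme \<Rightarrow> ('h \<Rightarrow> 'h \<Rightarrow> 'k) \<Rightarrow> ('h \<Rightarrow> 'h \<Rightarrow> 'k) \<Rightarrow>
     'h \<Rightarrow> 'h" where
  "cocycle_antipode_inv K H \<sigma> \<tau> = inv_into (carrier H) (cocycle_antipode K H \<sigma> \<tau>)"

end

theory Submission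
  imports Defs
begin

text \<open>
 Let A be the cleft object, with \<open>L\<close> for \<open>S\<^sub>1\<^sub>,\<^sub>\<sigma>\<close> and \<open>t\<close> for the inverse of \<open>S\<^sub>\<sigma>\<^sub>,\<^sub>1\<close>.  The translation map
 \<open>v \<mapsto> L(v1) \<otimes> v2\<close> of the Galois object gives an algebra map \<open>\<kappa> : H \<rightarrow> A\<^sup>e\<close>, \<open>\<kappa>(S v) = L(v1) \<otimes> v2\<close>, over
 which \<open>A\<^sup>e\<close> is free on both sides and \<open>A = A\<^sup>e \<otimes>\<^sub>H k\<close>.  A resolution of H over \<open>H\<^sup>e\<close> by finitely generated
 projective modules is given by idempotent matrices.  It splits over one tensor factor of \<open>H\<^sup>e\<close>, and
 so does its dual, whose only cohomology is free over that factor; hence applying the counit to this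
 factor gives a resolution of k over H whose dual is exact outside degree d.  Base change along \<open>\<kappa>\<close>
 carries both facts to \<open>A\<^sup>e\<close>.  If z is a cocycle whose class spans the integral, then \<open>y \<mapsto> [\<kappa>(z) (1 \<otimes> y)]\<close>
 identifies A with the top Ext, and \<open>[\<kappa>(z) \<kappa>(h) s] = \<xi>(S h) [\<kappa>(z) s]\<close> forces \<open>\<mu>(L(v)) = \<xi>(v1) t(v2)\<close>.
\<close>

\<comment> \<open>Two obstacles shape the proof. First, \<open>red\<close>, the counit on the right
  factor of \<open>He\<close>, need not be flat. Exactness survives it only because the complexes
  split over that factor, and they split in spite of one nonzero homology because that homology is
  free of rank one there: H itself for the resolution, H twisted by its Nakayama automorphism for
  the dual. Base change along \<open>kappa\<close> needs no splitting, since \<open>Ae\<close> has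
  dual bases over H on both sides; the right one serves the resolution, the left one its dual.
  Second, Ext is defined by a resolution picked by choice on one fixed type. The comparison theorem
  removes the choice once some resolution is known to live on that type. Therefore the matrices take
  their indices from an arbitrary infinite type, and H is resolved twice at the end, once for each
  carrier type. Matrices are used because base change becomes an entrywise map and duality a
  transposition, so that no tensor product over a noncommutative ring has to be formed.\<close>
syntax (input) "_index" :: "logic => index" ("(00\<^sub>_)" [1000] 1000)

abbreviation "mhom \<equiv> module_hom"
abbreviation "reg \<equiv> regular_module"
abbreviation "opp \<equiv> opposite_algebra"

lemmas (in abelian_group) ag = abelian_group_axioms

abbreviation in_carrier (infix "<:" 50) where "x <: M \<equiv> x \<in> carrier M"

section \<open>Finite sums and additive maps\<close>

definition additive ::
  "('a, 'c) ring_scheme => ('b, 'd) ring_scheme => ('a => 'b) => bool" where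
 "additive M N g \<longleftrightarrow> g \<in> carrier M \<rightarrow> carrier N \<and>
   (\<forall>x\<in>carrier M. \<forall>y\<in>carrier M. g (x \<oplus>\<^sub>M y) = g x \<oplus>\<^sub>N g y)"

lemma additiveI:
 assumes "!!x. x <: M ==> g x <: N"
  and "!!x y. x <: M ==> y <: M ==> g (x \<oplus>\<^sub>M y) = g x \<oplus>\<^sub>N g y"
 shows "additive M N g"
 using assms by (auto simp: additive_def)

lemma additive_closed: "additive M N g ==> x <: M ==> g x <: N"
 by (auto simp: additive_def)

lemma additive_add:
 "additive M N g ==> x <: M ==> y <: M ==> g (x \<oplus>\<^sub>M y) = g x \<oplus>\<^sub>N g y"
 by (auto simp: additive_def)

lemma additive_zero:
 assumes "abelian_group M" "abelian_group N" "additive M N g"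
 shows "g \<zero>\<^sub>M = \<zero>\<^sub>N"
proof -
 interpret M: abelian_group M by fact
 interpret N: abelian_group N by fact
 have "g \<zero>\<^sub>M = g \<zero>\<^sub>M \<oplus>\<^sub>N g \<zero>\<^sub>M"
  using additive_add[OF assms(3), of "\<zero>\<^sub>M" "\<zero>\<^sub>M"] by simp
 moreover have "g \<zero>\<^sub>M <: N" using additive_closed[OF assms(3)] by simp
 ultimately show ?thesis by (metis N.add.r_cancel_one')
qed

lemma additive_neg:
 assumes "abelian_group M" "abelian_group N" "additive M N g" "x <: M"
 shows "g (\<ominus>\<^sub>M x) = \<ominus>\<^sub>N g x"
proof -
 interpret M: abelian_group M by fact
 interpret N: abelian_group N by fact
 have "g (\<ominus>\<^sub>M x) \<oplus>\<^sub>N g x = \<zero>\<^sub>N"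
  using additive_add[OF assms(3), of "\<ominus>\<^sub>M x" x] additive_zero[OF assms(1-3)] assms(4)
  by (simp add: M.l_neg)
 then show ?thesis
  using additive_closed[OF assms(3)] assms(4) by (metis M.a_inv_closed N.minus_equality)
qed

lemma additive_diff:
 assumes "abelian_group M" "abelian_group N" "additive M N g" "x <: M" "y <: M"
 shows "g (x \<ominus>\<^sub>M y) = g x \<ominus>\<^sub>N g y"
proof -
 interpret M: abelian_group M by fact
 show ?thesis
  using additive_neg[OF assms(1-3,5)] additive_add[OF assms(3,4), of "\<ominus>\<^sub>M y"] assms(4,5)
  by (simp add: a_minus_def)
qed

lemma additive_finsum:
 assumes M: "abelian_group M" and N: "abelian_group N" and g: "additive M N g"
  and f: "f \<in> S \<rightarrow> carrier M"
 shows "g (finsum M f S) = finsum N (%i. g (f i)) S"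
proof -
 interpret M: abelian_group M by fact
 interpret N: abelian_group N by fact
 show ?thesis
  using f
 proof (induction S rule: infinite_finite_induct)
  case (insert x F)
  have "(%i. g (f i)) \<in> F \<rightarrow> carrier N" "g (f x) <: N"
   using insert.prems additive_closed[OF g] by (auto simp: Pi_def)
  moreover have "f \<in> F \<rightarrow> carrier M" "f x <: M" using insert.prems by auto
  ultimately show ?case
   using insert additive_add[OF g] by simp
 qed (simp_all add: additive_zero[OF M N g])
qed

lemma additive_comp: "additive M N g ==> additive N L h ==> additive M L (%x. h (g x))"
 by (auto simp: additive_def Pi_def)

context abelian_monoid
begin

lemma finsum_supset:
 assumes "finite B" "A \<subseteq> B" "!!i. i \<in> B - A ==> f i = \<zero>" "!!i. i \<in> A ==> f i <: G"
 shows "finsum G f A = finsum G f B"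
proof (rule add.finprod_mono_neutral_cong_left)
 show "f \<in> B \<rightarrow> carrier G" using assms(3,4) by (metis DiffI Pi_I zero_closed)
qed (use assms in auto)

lemma finsum_eq_zeroI: "(!!i. i \<in> A ==> f i = \<zero>) ==> finsum G f A = \<zero>"
 by (rule add.finprod_one_eqI)

lemma finsum_in: "(!!i. i \<in> A ==> f i <: G) ==> finsum G f A <: G"
 by (rule finsum_closed) auto

lemma finsum_eqI:
 "(!!i. i \<in> A ==> f i = g i) ==> (!!i. i \<in> A ==> g i <: G) ==>
  finsum G f A = finsum G g A"
 by (rule finsum_cong') auto

lemma finsum_plus:
 "(!!i. i \<in> A ==> f i <: G) ==> (!!i. i \<in> A ==> g i <: G) ==>
  finsum G (%i. f i \<oplus> g i) A = finsum G f A \<oplus> finsum G g A"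
 by (rule finsum_addf) auto

lemma finsum_swap:
 assumes "finite A" "finite B" "!!a b. a \<in> A ==> b \<in> B ==> f a b <: G"
 shows "(\<Oplus>a\<in>A. \<Oplus>b\<in>B. f a b) = (\<Oplus>b\<in>B. \<Oplus>a\<in>A. f a b)"
 using assms(1,3)
proof (induction A rule: finite_induct)
 case empty
 then show ?case by simp
next
 case (insert x F)
 have 1: "(%a. \<Oplus>b\<in>B. f a b) \<in> F \<rightarrow> carrier G" using insert by (auto intro!: finsum_in)
 have 2: "(\<Oplus>b\<in>B. f x b) <: G" using insert by (auto intro!: finsum_in)
 have "(\<Oplus>a\<in>insert x F. \<Oplus>b\<in>B. f a b) = (\<Oplus>b\<in>B. f x b) \<oplus> (\<Oplus>b\<in>B. \<Oplus>a\<in>F. f a b)"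
  using insert 1 2 by simp
 also have "... = (\<Oplus>b\<in>B. f x b \<oplus> (\<Oplus>a\<in>F. f a b))"
  using insert by (intro finsum_plus[symmetric]) (auto intro!: finsum_in)
 also have "... = (\<Oplus>b\<in>B. \<Oplus>a\<in>insert x F. f a b)"
  using insert by (intro finsum_eqI) (auto intro!: finsum_in)
 finally show ?case .
qed

lemma finsum_delta:
 assumes "finite A" "i \<in> A" "f i <: G" "!!j. j \<in> A ==> j \<noteq> i ==> f j = \<zero>"
 shows "finsum G f A = f i"
proof -
 have "finsum G f {i} = finsum G f A"
  using assms by (intro finsum_supset) auto
 then show ?thesis using assms(3) by simp
qed

lemma finsum_Times:
 assumes "finite A" "finite B" "!!a b. a \<in> A ==> b \<in> B ==> f a b <: G"
 shows "(\<Oplus>p\<in>A \<times> B. f (fst p) (snd p)) = (\<Oplus>a\<in>A. \<Oplus>b\<in>B. f a b)"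
 using assms(1,3)
proof (induction A rule: finite_induct)
 case empty
 then show ?case by simp
next
 case (insert x F)
 have eq: "insert x F \<times> B = (Pair x) ` B \<union> F \<times> B" by auto
 have "(\<Oplus>p\<in>insert x F \<times> B. f (fst p) (snd p)) =
   (\<Oplus>p\<in>Pair x ` B. f (fst p) (snd p)) \<oplus> (\<Oplus>p\<in>F \<times> B. f (fst p) (snd p))"
  unfolding eq using insert assms(2) by (intro finsum_Un_disjoint) auto
 also have "(\<Oplus>p\<in>Pair x ` B. f (fst p) (snd p)) = (\<Oplus>b\<in>B. f x b)"
  using insert by (subst finsum_reindex) (auto simp: inj_on_def)
 also have "(\<Oplus>p\<in>F \<times> B. f (fst p) (snd p)) = (\<Oplus>a\<in>F. \<Oplus>b\<in>B. f a b)"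
  using insert by simp
 also have "(\<Oplus>b\<in>B. f x b) \<oplus> (\<Oplus>a\<in>F. \<Oplus>b\<in>B. f a b) = (\<Oplus>a\<in>insert x F. \<Oplus>b\<in>B. f a b)"
  using insert by (subst finsum_insert) (auto intro!: finsum_in)
 finally show ?case .
qed

end

context abelian_group
begin

lemma minus_self: "x <: G ==> x \<ominus> x = \<zero>"
 by (simp add: minus_eq r_neg)

lemma minus_eq_zero_iff: "x <: G ==> y <: G ==> x \<ominus> y = \<zero> \<longleftrightarrow> x = y"
 by (metis a_inv_closed add.inv_equality minus_eq minus_minus minus_self)

lemma neg_zero: "\<ominus> \<zero> = \<zero>"
 by (metis add.inv_equality l_zero zero_closed)

lemma minus_cancel_right: "x <: G ==> y <: G ==> x \<ominus> y \<oplus> y = x"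
 by (simp add: minus_eq a_assoc l_neg)

lemma minus_zero_right: "x <: G ==> x \<ominus> \<zero> = x"
 by (simp add: minus_eq neg_zero)

end

section \<open>Modules, homomorphisms and dual bases\<close>

context lmodule
begin

lemma additive_smult: "a <: R ==> additive M M (%x. a \<odot>\<^sub>M x)"
 by (auto simp: additive_def lsmult_closed lsmult_r_distr)

lemma additive_smult_left: "x <: M ==> additive R M (%a. a \<odot>\<^sub>M x)"
 by (auto simp: additive_def lsmult_closed lsmult_l_distr)

lemma lsmult_zero_left: "x <: M ==> \<zero>\<^sub>R \<odot>\<^sub>M x = \<zero>\<^sub>M"
 using additive_zero[OF R.is_abelian_group M.ag additive_smult_left] .

lemma lsmult_zero_right: "a <: R ==> a \<odot>\<^sub>M \<zero>\<^sub>M = \<zero>\<^sub>M"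
 using additive_zero[OF M.ag M.ag additive_smult] .

lemma lsmult_neg_right:
 "a <: R ==> x <: M ==> a \<odot>\<^sub>M (\<ominus>\<^sub>M x) = \<ominus>\<^sub>M (a \<odot>\<^sub>M x)"
 using additive_neg[OF M.ag M.ag additive_smult] .

lemma lsmult_neg_left:
 "a <: R ==> x <: M ==> (\<ominus>\<^sub>R a) \<odot>\<^sub>M x = \<ominus>\<^sub>M (a \<odot>\<^sub>M x)"
 using additive_neg[OF R.is_abelian_group M.ag additive_smult_left] .

lemma finsum_lsmult:
 "a <: R ==> (!!i. i \<in> S ==> f i <: M) ==>
  a \<odot>\<^sub>M finsum M f S = finsum M (%i. a \<odot>\<^sub>M f i) S"
 by (rule additive_finsum[OF M.ag M.ag additive_smult]) auto

lemma finsum_lsmult_left: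
 "x <: M ==> (!!i. i \<in> S ==> f i <: R) ==>
  finsum R f S \<odot>\<^sub>M x = finsum M (%i. f i \<odot>\<^sub>M x) S"
 by (rule additive_finsum[OF R.is_abelian_group M.ag additive_smult_left]) auto

end

lemma (in module) lmodule: "lmodule R M"
 by unfold_locales (auto simp: smult_l_distr smult_r_distr smult_assoc1)

lemma lmodule_regular: "ring R ==> lmodule R (reg R)"
proof -
 assume "ring R"
 then interpret ring R .
 have "abelian_group (reg R)"
 proof (rule abelian_groupI)
  fix x assume "x <: (reg R)"
  then show "\<exists>y\<in>carrier (reg R). y \<oplus>\<^sub>(reg R) x = \<zero>\<^sub>(reg R)"
   by (intro bexI[of _ "\<ominus>\<^sub>R x"]) (auto simp: regular_module_def l_neg)
 qed (auto simp: regular_module_def a_ac)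
 then show ?thesis
  by (intro lmodule.intro lmodule_axioms.intro)
    (auto simp: regular_module_def l_distr r_distr m_assoc \<open>ring R\<close>)
qed

lemma regular_module_simps [simp]:
 "carrier (reg R) = carrier R" "add (reg R) = add R"
 "zero (reg R) = zero R" "smult (reg R) = mult R"
 "mult (reg R) = mult R" "one (reg R) = one R"
 "finsum (reg R) = finsum R" "a_inv (reg R) = a_inv R"
 "a_minus (reg R) = a_minus R"
 by (auto simp: regular_module_def finsum_def finprod_def fun_eq_iff a_inv_def m_inv_def a_minus_def)

lemma mhomI:
 assumes "!!x. x <: M ==> f x <: N"
  and "!!x y. x <: M ==> y <: M ==> f (x \<oplus>\<^sub>M y) = f x \<oplus>\<^sub>N f y"
  and "!!a x. a <: R ==> x <: M ==> f (a \<odot>\<^sub>M x) = a \<odot>\<^sub>N f x"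
 shows "f \<in> mhom R M N"
 using assms by (auto simp: module_hom_def)

lemma mhom_additive: "f \<in> mhom R M N ==> additive M N f"
 by (auto simp: module_hom_def additive_def)

lemma mhom_closed: "f \<in> mhom R M N ==> x <: M ==> f x <: N"
 by (auto simp: module_hom_def)

lemma mhom_add:
 "f \<in> mhom R M N ==> x <: M ==> y <: M ==>
  f (x \<oplus>\<^sub>M y) = f x \<oplus>\<^sub>N f y"
 by (auto simp: module_hom_def)

lemma mhom_smult:
 "f \<in> mhom R M N ==> a <: R ==> x <: M ==>
  f (a \<odot>\<^sub>M x) = a \<odot>\<^sub>N f x"
 by (auto simp: module_hom_def)

lemma mhom_comp:
 "f \<in> mhom R M N ==> g \<in> mhom R N L ==> (%x. g (f x)) \<in> mhom R M L"
 by (auto simp: module_hom_def Pi_def)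

lemma mhom_cong:
 assumes "f \<in> mhom R M N" "abelian_group M" "!!x. x <: M ==> g x = f x"
  "!!a x. a <: R ==> x <: M ==> a \<odot>\<^sub>M x <: M"
 shows "g \<in> mhom R M N"
proof -
 interpret abelian_group M by fact
 show ?thesis using assms by (auto simp: module_hom_def Pi_def)
qed

lemma mhom_zero:
 assumes "lmodule R N"
 shows "(%_. \<zero>\<^sub>N) \<in> mhom R M N"
proof -
 interpret lmodule R N by fact
 show ?thesis by (auto simp: module_hom_def lsmult_zero_right)
qed

lemma mhom_plus:
 assumes "lmodule R N" "f \<in> mhom R M N" "g \<in> mhom R M N"
 shows "(%x. f x \<oplus>\<^sub>N g x) \<in> mhom R M N"
proof -
 interpret lmodule R N by fact
 show ?thesis
 proof (rule mhomI)
  fix x y assume "x <: M" "y <: M"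
  then show "f (x \<oplus>\<^sub>M y) \<oplus>\<^sub>N g (x \<oplus>\<^sub>M y) = f x \<oplus>\<^sub>N g x \<oplus>\<^sub>N (f y \<oplus>\<^sub>N g y)"
   using assms(2,3) mhom_closed[OF assms(2)] mhom_closed[OF assms(3)]
   by (simp add: mhom_add a_ac)
 qed (use assms(2,3) mhom_closed[OF assms(2)] mhom_closed[OF assms(3)]
   in \<open>auto simp: mhom_smult lsmult_r_distr\<close>)
qed

lemma mhom_minus:
 assumes "lmodule R N" "f \<in> mhom R M N" "g \<in> mhom R M N"
 shows "(%x. f x \<ominus>\<^sub>N g x) \<in> mhom R M N"
proof -
 interpret lmodule R N by fact
 have "(%x. \<ominus>\<^sub>N g x) \<in> mhom R M N"
  using mhom_closed[OF assms(3)]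
  by (intro mhomI)
    (auto simp: mhom_smult[OF assms(3)] mhom_add[OF assms(3)] lsmult_neg_right M.minus_add)
 from mhom_plus[OF assms(1,2) this] show ?thesis by (simp add: a_minus_def)
qed

text \<open>A module has a dual basis iff it is projective; the basis may be infinite.\<close>

definition dual_basis ::
  "('r, 'c) ring_scheme => ('r, 'm, 'd) module_scheme => 'b set => ('b => 'm) =>
   ('b => 'm => 'r) => bool" where
 "dual_basis R P B x \<phi> \<longleftrightarrow>
   (\<forall>b\<in>B. x b <: P) \<and> (\<forall>b\<in>B. \<phi> b \<in> mhom R P (reg R)) \<and>
   (\<forall>p\<in>carrier P. finite {b\<in>B. \<phi> b p \<noteq> \<zero>\<^sub>R} \<and>
    p = (\<Oplus>\<^sub>P b\<in>{b\<in>B. \<phi> b p \<noteq> \<zero>\<^sub>R}. \<phi> b p \<odot>\<^sub>P x b))"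

lemma dual_basis_closed: "dual_basis R P B x \<phi> ==> b \<in> B ==> x b <: P"
 and dual_basis_hom: "dual_basis R P B x \<phi> ==> b \<in> B ==> \<phi> b \<in> mhom R P (reg R)"
 and dual_basis_finite: "dual_basis R P B x \<phi> ==> p <: P ==> finite {b\<in>B. \<phi> b p \<noteq> \<zero>\<^sub>R}"
 by (auto simp: dual_basis_def)

lemma dual_basis_coord:
 "dual_basis R P B x \<phi> ==> b \<in> B ==> p <: P ==> \<phi> b p <: R"
 using mhom_closed[OF dual_basis_hom] by fastforce

lemma dual_basis_sum:
 assumes "lmodule R P" "dual_basis R P B x \<phi>" "p <: P"
  and "finite S" "S \<subseteq> B" "{b\<in>B. \<phi> b p \<noteq> \<zero>\<^sub>R} \<subseteq> S"
 shows "(\<Oplus>\<^sub>P b\<in>S. \<phi> b p \<odot>\<^sub>P x b) = p"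
proof -
 interpret lmodule R P by fact
 have cl: "\<phi> b p \<odot>\<^sub>P x b <: P" if "b \<in> B" for b
  using that lsmult_closed dual_basis_coord[OF assms(2)] dual_basis_closed[OF assms(2)] assms(3)
  by auto
 have "(\<Oplus>\<^sub>P b\<in>{b\<in>B. \<phi> b p \<noteq> \<zero>\<^sub>R}. \<phi> b p \<odot>\<^sub>P x b) = (\<Oplus>\<^sub>P b\<in>S. \<phi> b p \<odot>\<^sub>P x b)"
 proof (rule M.finsum_supset)
  fix b assume "b \<in> S - {b\<in>B. \<phi> b p \<noteq> \<zero>\<^sub>R}"
  then show "\<phi> b p \<odot>\<^sub>P x b = \<zero>\<^sub>P"
   using assms(5) dual_basis_closed[OF assms(2)] lsmult_zero_left by auto
 qed (use assms(4-6) cl in auto)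
 moreover have "p = (\<Oplus>\<^sub>P b\<in>{b\<in>B. \<phi> b p \<noteq> \<zero>\<^sub>R}. \<phi> b p \<odot>\<^sub>P x b)"
  using assms(2,3) unfolding dual_basis_def by blast
 ultimately show ?thesis by simp
qed

lemma dual_basisI:
 assumes "lmodule R P" "!!b. b \<in> B ==> x b <: P"
  and "!!b. b \<in> B ==> \<phi> b \<in> mhom R P (reg R)"
  and "!!p. p <: P ==> \<exists>S. finite S \<and> S \<subseteq> B \<and> (\<forall>b\<in>B - S. \<phi> b p = \<zero>\<^sub>R) \<and>
      p = (\<Oplus>\<^sub>P b\<in>S. \<phi> b p \<odot>\<^sub>P x b)"
 shows "dual_basis R P B x \<phi>"
 unfolding dual_basis_def
proof (intro conjI ballI)
 interpret lmodule R P by fact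
 fix p assume p: "p <: P"
 from assms(4)[OF this] obtain S where S: "finite S" "S \<subseteq> B" "\<forall>b\<in>B - S. \<phi> b p = \<zero>\<^sub>R"
  "p = (\<Oplus>\<^sub>P b\<in>S. \<phi> b p \<odot>\<^sub>P x b)" by (elim exE conjE)
 have sub: "{b\<in>B. \<phi> b p \<noteq> \<zero>\<^sub>R} \<subseteq> S" using S by auto
 then show "finite {b\<in>B. \<phi> b p \<noteq> \<zero>\<^sub>R}" using S(1) finite_subset by blast
 have cl: "\<phi> b p <: R" if "b \<in> B" for b
  using mhom_closed[OF assms(3)[OF that] p] by simp
 have "(\<Oplus>\<^sub>P b\<in>{b\<in>B. \<phi> b p \<noteq> \<zero>\<^sub>R}. \<phi> b p \<odot>\<^sub>P x b) = (\<Oplus>\<^sub>P b\<in>S. \<phi> b p \<odot>\<^sub>P x b)"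
 proof (rule M.finsum_supset)
  fix b assume "b \<in> S - {b\<in>B. \<phi> b p \<noteq> \<zero>\<^sub>R}"
  then show "\<phi> b p \<odot>\<^sub>P x b = \<zero>\<^sub>P" using S(2) assms(2) lsmult_zero_left by auto
 qed (use S sub cl assms(2) lsmult_closed in auto)
 then show "p = (\<Oplus>\<^sub>P b\<in>{b\<in>B. \<phi> b p \<noteq> \<zero>\<^sub>R}. \<phi> b p \<odot>\<^sub>P x b)" using S(4) by simp
qed (use assms in auto)

text \<open>The map that sends p to the sum of the \<phi>_b(p) y_b is linear whatever the
  \<open>y b\<close> are. The generators \<open>x b\<close> may satisfy relations, so
  \<open>h (x b)\<close> need not be \<open>y b\<close>; the map is pinned down by its formula
  instead.\<close>

lemma dual_basis_extend:
 assumes P: "lmodule R P" and N: "lmodule R N" and db: "dual_basis R P B x \<phi>"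
  and y: "!!b. b \<in> B ==> y b <: N"
 obtains h where "h \<in> mhom R P N"
  "!!p S. p <: P ==> finite S ==> S \<subseteq> B ==> {b\<in>B. \<phi> b p \<noteq> \<zero>\<^sub>R} \<subseteq> S ==>
   h p = (\<Oplus>\<^sub>N b\<in>S. \<phi> b p \<odot>\<^sub>N y b)"
proof -
 interpret P: lmodule R P by fact
 interpret N: lmodule R N by fact
 define h where "h = (%p. \<Oplus>\<^sub>N b\<in>{b\<in>B. \<phi> b p \<noteq> \<zero>\<^sub>R}. \<phi> b p \<odot>\<^sub>N y b)"
 note coord = dual_basis_coord[OF db]
 have cl: "\<phi> b p \<odot>\<^sub>N y b <: N" if "b \<in> B" "p <: P" for b p
  using that coord y N.lsmult_closed by auto
 have h: "h p = (\<Oplus>\<^sub>N b\<in>S. \<phi> b p \<odot>\<^sub>N y b)"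
  if "p <: P" "finite S" "S \<subseteq> B" "{b\<in>B. \<phi> b p \<noteq> \<zero>\<^sub>R} \<subseteq> S" for p S
  unfolding h_def
 proof (rule N.M.finsum_supset)
  fix b assume "b \<in> S - {b\<in>B. \<phi> b p \<noteq> \<zero>\<^sub>R}"
  then show "\<phi> b p \<odot>\<^sub>N y b = \<zero>\<^sub>N" using that(3) y N.lsmult_zero_left by auto
 qed (use that cl in auto)
 have fin: "finite {b\<in>B. \<phi> b p \<noteq> \<zero>\<^sub>R}" if "p <: P" for p
  using dual_basis_finite[OF db that] .
 have "h \<in> mhom R P N"
 proof (rule mhomI)
  fix p assume "p <: P"
  then show "h p <: N" unfolding h_def using cl by (intro N.M.finsum_in) auto
 next
  fix p q assume pq: "p <: P" "q <: P"
  define S where "S = {b\<in>B. \<phi> b p \<noteq> \<zero>\<^sub>R} \<union> {b\<in>B. \<phi> b q \<noteq> \<zero>\<^sub>R}"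
  have add: "\<phi> b (p \<oplus>\<^sub>P q) = \<phi> b p \<oplus>\<^sub>R \<phi> b q" if "b \<in> B" for b
   using mhom_add[OF dual_basis_hom[OF db that] pq] by simp
  have S: "finite S" "S \<subseteq> B" using fin pq by (auto simp: S_def)
  have sub: "{b\<in>B. \<phi> b (p \<oplus>\<^sub>P q) \<noteq> \<zero>\<^sub>R} \<subseteq> S"
   using add by (auto simp: S_def)
  have "h (p \<oplus>\<^sub>P q) = (\<Oplus>\<^sub>N b\<in>S. \<phi> b (p \<oplus>\<^sub>P q) \<odot>\<^sub>N y b)"
   using h[OF _ S sub] pq by simp
  also have "... = (\<Oplus>\<^sub>N b\<in>S. \<phi> b p \<odot>\<^sub>N y b \<oplus>\<^sub>N \<phi> b q \<odot>\<^sub>N y b)"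
   using S(2) pq cl coord y add by (intro N.M.finsum_eqI) (auto simp: N.lsmult_l_distr subset_iff)
  also have "... = (\<Oplus>\<^sub>N b\<in>S. \<phi> b p \<odot>\<^sub>N y b) \<oplus>\<^sub>N (\<Oplus>\<^sub>N b\<in>S. \<phi> b q \<odot>\<^sub>N y b)"
   using S(2) pq cl by (intro N.M.finsum_plus) auto
  also have "... = h p \<oplus>\<^sub>N h q"
   using h[OF pq(1) S] h[OF pq(2) S] by (simp add: S_def)
  finally show "h (p \<oplus>\<^sub>P q) = h p \<oplus>\<^sub>N h q" .
 next
  fix a p assume ap: "a <: R" "p <: P"
  define S where "S = {b\<in>B. \<phi> b p \<noteq> \<zero>\<^sub>R}"
  have sm: "\<phi> b (a \<odot>\<^sub>P p) = a \<otimes>\<^sub>R \<phi> b p" if "b \<in> B" for b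
   using mhom_smult[OF dual_basis_hom[OF db that] ap] by simp
  have S: "finite S" "S \<subseteq> B" using fin ap by (auto simp: S_def)
  have sub: "{b\<in>B. \<phi> b (a \<odot>\<^sub>P p) \<noteq> \<zero>\<^sub>R} \<subseteq> S"
   using sm ap by (auto simp: S_def)
  have "h (a \<odot>\<^sub>P p) = (\<Oplus>\<^sub>N b\<in>S. \<phi> b (a \<odot>\<^sub>P p) \<odot>\<^sub>N y b)"
   using h[OF _ S sub] ap P.lsmult_closed by simp
  also have "... = (\<Oplus>\<^sub>N b\<in>S. a \<odot>\<^sub>N (\<phi> b p \<odot>\<^sub>N y b))"
   using S(2) ap cl coord y sm N.lsmult_closed
   by (intro N.M.finsum_eqI) (auto simp: N.lsmult_assoc subset_iff)
  also have "... = a \<odot>\<^sub>N (\<Oplus>\<^sub>N b\<in>S. \<phi> b p \<odot>\<^sub>N y b)"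
   using S(2) ap cl by (intro N.finsum_lsmult[symmetric]) auto
  finally show "h (a \<odot>\<^sub>P p) = a \<odot>\<^sub>N h p"
   using h[OF ap(2) S] by (simp add: S_def)
 qed
 then show thesis using h that by blast
qed

text \<open>Choose preimages \<open>m b\<close> of the \<open>f (x b)\<close>. Then
  \<open>g (h p)\<close> is the sum of the \<phi>_b(p) f(x_b), which is \<open>f p\<close>.\<close>

lemma dual_basis_lift:
 assumes P: "lmodule R P" and M: "lmodule R M" and N: "abelian_group N"
  and db: "dual_basis R P B x \<phi>"
  and g: "g \<in> mhom R M N" and f: "f \<in> mhom R P N"
  and im: "!!p. p <: P ==> f p \<in> g ` carrier M"
 obtains h where "h \<in> mhom R P M" "!!p. p <: P ==> g (h p) = f p"
proof -
 interpret P: lmodule R P by fact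
 interpret M: lmodule R M by fact
 interpret N: abelian_group N by fact
 have "\<exists>m. \<forall>b\<in>B. m b <: M \<and> g (m b) = f (x b)"
  using im[OF dual_basis_closed[OF db]] by (intro bchoice) (auto simp: image_iff, metis)
 then obtain m where m: "!!b. b \<in> B ==> m b <: M" "!!b. b \<in> B ==> g (m b) = f (x b)"
  by blast
 obtain h where h: "h \<in> mhom R P M"
  "!!p S. p <: P ==> finite S ==> S \<subseteq> B ==> {b\<in>B. \<phi> b p \<noteq> \<zero>\<^sub>R} \<subseteq> S ==>
   h p = (\<Oplus>\<^sub>M b\<in>S. \<phi> b p \<odot>\<^sub>M m b)"
  using dual_basis_extend[OF P M db, of m] m(1) by blast
 have "g (h p) = f p" if p: "p <: P" for p
 proof -
  define S where "S = {b\<in>B. \<phi> b p \<noteq> \<zero>\<^sub>R}"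
  have S: "finite S" "S \<subseteq> B" using dual_basis_finite[OF db p] by (auto simp: S_def)
  have c: "\<phi> b p <: R" "x b <: P" if "b \<in> S" for b
   using that S dual_basis_coord[OF db _ p] dual_basis_closed[OF db] by auto
  have "g (h p) = (\<Oplus>\<^sub>N b\<in>S. g (\<phi> b p \<odot>\<^sub>M m b))"
   using additive_finsum[OF M.M.ag N mhom_additive[OF g], of _ S] h(2)[OF p S]
    c m(1) S(2) M.lsmult_closed by (simp add: S_def Pi_def)
  also have "... = (\<Oplus>\<^sub>N b\<in>S. f (\<phi> b p \<odot>\<^sub>P x b))"
  proof (rule N.finsum_eqI)
   fix b assume b: "b \<in> S"
   then show "g (\<phi> b p \<odot>\<^sub>M m b) = f (\<phi> b p \<odot>\<^sub>P x b)"
    using mhom_smult[OF g c(1)[OF b] m(1)] mhom_smult[OF f c[OF b]] m(2) S(2) by auto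
   show "f (\<phi> b p \<odot>\<^sub>P x b) <: N"
    using mhom_closed[OF f] c[OF b] P.lsmult_closed by auto
  qed
  also have "... = f (\<Oplus>\<^sub>P b\<in>S. \<phi> b p \<odot>\<^sub>P x b)"
   using additive_finsum[OF P.M.ag N mhom_additive[OF f], of _ S]
    c P.lsmult_closed by (simp add: Pi_def)
  also have "... = f p" using dual_basis_sum[OF P db p S] by (simp add: S_def)
  finally show ?thesis .
 qed
 then show thesis using h(1) that by blast
qed

section \<open>Free modules, and projectivity in terms of dual bases\<close>

lemma lmodule_free:
 fixes R (structure)
 assumes "ring R"
 shows "lmodule R (free_module R X)"
proof -
 interpret ring R by fact
 let ?F = "free_module R X"
 have fin: "finite {x. f x \<oplus> g x \<noteq> \<zero>}"
  if "finite {x. f x \<noteq> \<zero>}" "finite {x. g x \<noteq> \<zero>}" for f g :: "_ => _"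
 proof (rule finite_subset)
  show "{x. f x \<oplus> g x \<noteq> \<zero>} \<subseteq> {x. f x \<noteq> \<zero>} \<union> {x. g x \<noteq> \<zero>}" by auto
 qed (use that in simp)
 have fin2: "finite {x. a \<otimes> f x \<noteq> \<zero>}" if "finite {x. f x \<noteq> \<zero>}" "a <: R" for a f
  using that by (rule_tac finite_subset[of _ "{x. f x \<noteq> \<zero>}"]) auto
 have fin3: "finite {x. \<ominus> f x \<noteq> \<zero>}" if "finite {x. f x \<noteq> \<zero>}" for f
  using that by (rule_tac finite_subset[of _ "{x. f x \<noteq> \<zero>}"]) auto
 have grp: "abelian_group ?F"
 proof (rule abelian_groupI)
  fix f assume f: "f <: ?F"
  then have "(%x. \<ominus> f x) <: ?F" "(%x. \<ominus> f x) \<oplus>\<^sub>?F f = \<zero>\<^sub>?F"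
   using fin3 by (auto simp: free_module_def fun_eq_iff image_subset_iff l_neg)
  then show "\<exists>g\<in>carrier ?F. g \<oplus>\<^sub>?F f = \<zero>\<^sub>?F" by blast
 qed (auto simp: free_module_def fun_eq_iff image_subset_iff fin a_ac)
 show ?thesis
  by (intro lmodule.intro grp assms lmodule_axioms.intro)
    (auto simp: free_module_def fun_eq_iff image_subset_iff fin2 l_distr r_distr m_assoc)
qed

lemma free_module_simps:
 "add (free_module R X) = (%f g x. f x \<oplus>\<^sub>R g x)"
 "zero (free_module R X) = (%x. \<zero>\<^sub>R)"
 "smult (free_module R X) = (%a f x. a \<otimes>\<^sub>R f x)"
 by (auto simp: free_module_def)

lemma free_module_carrier:
 "f <: (free_module R X) \<longleftrightarrow>
   (\<forall>x. f x <: R) \<and> finite {x. f x \<noteq> \<zero>\<^sub>R} \<and> (\<forall>x. x \<notin> X \<longrightarrow> f x = \<zero>\<^sub>R)"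
 by (auto simp: free_module_def)

lemma basis_vector_in_free:
 fixes R (structure)
 assumes "ring R" "x \<in> X"
 shows "basis_vector R x <: (free_module R X)"
proof -
 interpret ring R by fact
 have "{y. basis_vector R x y \<noteq> \<zero>} \<subseteq> {x}" by (auto simp: basis_vector_def)
 then have "finite {y. basis_vector R x y \<noteq> \<zero>}" using finite_subset by blast
 then show ?thesis using assms(2) by (auto simp: free_module_carrier basis_vector_def)
qed

lemma free_module_eval_finsum:
 fixes R (structure)
 assumes "ring R" "!!i. i \<in> S ==> f i <: (free_module R X)"
 shows "finsum (free_module R X) f S y = (\<Oplus>\<^sub>R i\<in>S. f i y)"
proof -
 interpret ring R by fact
 interpret F: lmodule R "free_module R X" by (rule lmodule_free) fact
 have "additive (free_module R X) R (%f. f y)"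
  by (rule additiveI) (auto simp: free_module_carrier free_module_simps)
 from additive_finsum[OF F.M.ag is_abelian_group this, of f S] assms(2)
 show ?thesis by (simp add: Pi_def)
qed

lemma dual_basis_free:
 fixes R (structure)
 assumes "ring R"
 shows "dual_basis R (free_module R X) X (basis_vector R) (%x f. f x)"
proof (rule dual_basisI)
 interpret ring R by fact
 show "lmodule R (free_module R X)" by (rule lmodule_free) fact
 then interpret F: lmodule R "free_module R X" .
 show "(%f. f b) \<in> mhom R (free_module R X) (reg R)" for b
  by (rule mhomI) (auto simp: free_module_simps free_module_carrier)
 fix p assume p: "p <: (free_module R X)"
 define S where "S = {x. p x \<noteq> \<zero>}"
 have S: "finite S" "S \<subseteq> X" using p by (auto simp: S_def free_module_carrier)
 have cl: "p b \<odot>\<^sub>(free_module R X) basis_vector R b <: (free_module R X)" if "b \<in> S" for b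
  using that S p basis_vector_in_free[OF assms, of b X]
  by (intro F.lsmult_closed) (auto simp: free_module_carrier[of p])
 have eq: "p y = (\<Oplus>b\<in>S. (p b \<odot>\<^sub>(free_module R X) basis_vector R b) y)" for y
 proof (cases "y \<in> S")
  case True
  have "(\<Oplus>b\<in>S. (p b \<odot>\<^sub>(free_module R X) basis_vector R b) y) =
    (p y \<odot>\<^sub>(free_module R X) basis_vector R y) y"
   using p S True
   by (intro finsum_delta) (auto simp: free_module_simps free_module_carrier basis_vector_def)
  then show ?thesis using p by (simp add: free_module_simps free_module_carrier basis_vector_def)
 next
  case False
  then have "(\<Oplus>b\<in>S. (p b \<odot>\<^sub>(free_module R X) basis_vector R b) y) = \<zero>"
   using p S
   by (intro finsum_eq_zeroI) (auto simp: free_module_simps free_module_carrier basis_vector_def)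
  then show ?thesis using False by (simp add: S_def)
 qed
 have "p = (\<Oplus>\<^sub>(free_module R X)b\<in>S. p b \<odot>\<^sub>(free_module R X) basis_vector R b)"
  by (intro ext trans[OF eq free_module_eval_finsum[OF assms cl, symmetric]])
 then show "\<exists>S. finite S \<and> S \<subseteq> X \<and> (\<forall>b\<in>X - S. p b = \<zero>) \<and>
   p = (\<Oplus>\<^sub>(free_module R X)b\<in>S. p b \<odot>\<^sub>(free_module R X) basis_vector R b)"
  using S by (intro exI[of _ S] conjI) (auto simp: S_def)
qed (rule basis_vector_in_free[OF assms])

text \<open>The retraction from the free module sends the standard basis to generators of
  \<open>P\<close>; the section followed by the coordinates gives the functionals.\<close>

lemma projective_dual_basis:
 fixes P :: "('r, 'm, 'd) module_scheme"
 assumes "projective_module R P"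
 obtains X :: "'m set" and x \<phi> where "dual_basis R P X x \<phi>"
proof -
 interpret P: lmodule R P using assms by (simp add: projective_module_def)
 obtain X :: "'m set" and s p where s: "s \<in> mhom R P (free_module R X)"
  and p: "p \<in> mhom R (free_module R X) P" and ps: "!!x. x <: P ==> p (s x) = x"
  using assms by (auto simp: projective_module_def)
 interpret F: lmodule R "free_module R X" by (rule lmodule_free) unfold_locales
 have rR: "ring R" by unfold_locales
 have "dual_basis R P X (%b. p (basis_vector R b)) (%b q. s q b)"
 proof (rule dual_basisI)
  show "(%q. s q b) \<in> mhom R P (reg R)" if "b \<in> X" for b
   using mhom_comp[OF s dual_basis_hom[OF dual_basis_free[OF rR] that]] .
  fix q assume q: "q <: P"
  have sq: "s q <: (free_module R X)" using mhom_closed[OF s q] .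
  define S where "S = {b\<in>X. s q b \<noteq> \<zero>\<^sub>R}"
  have S: "finite S" "S \<subseteq> X" using dual_basis_finite[OF dual_basis_free[OF rR] sq] by (auto simp: S_def)
  have cl: "s q b <: R" "basis_vector R b <: (free_module R X)" if "b \<in> S" for b
   using that S sq basis_vector_in_free[OF rR, of b X] by (auto simp: free_module_carrier[of "s q"])
  have "q = p (\<Oplus>\<^sub>(free_module R X)b\<in>S. s q b \<odot>\<^sub>(free_module R X) basis_vector R b)"
   using dual_basis_sum[OF F.lmodule_axioms dual_basis_free[OF rR] sq S] ps[OF q] by (simp add: S_def)
  also have "... = (\<Oplus>\<^sub>P b\<in>S. p (s q b \<odot>\<^sub>(free_module R X) basis_vector R b))"
   using cl F.lsmult_closed
   by (intro additive_finsum[OF F.M.ag P.M.ag mhom_additive[OF p]]) auto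
  also have "... = (\<Oplus>\<^sub>P b\<in>S. s q b \<odot>\<^sub>P p (basis_vector R b))"
   using cl P.lsmult_closed mhom_closed[OF p]
   by (intro P.M.finsum_eqI) (auto simp: mhom_smult[OF p])
  finally show "\<exists>S. finite S \<and> S \<subseteq> X \<and> (\<forall>b\<in>X - S. s q b = \<zero>\<^sub>R) \<and>
    q = (\<Oplus>\<^sub>P b\<in>S. s q b \<odot>\<^sub>P p (basis_vector R b))"
   using S by (intro exI[of _ S] conjI) (auto simp: S_def)
 qed (auto intro: mhom_closed[OF p] basis_vector_in_free[OF rR] P.lmodule_axioms)
 then show thesis using that by blast
qed

text \<open>The definition of projectivity admits only free modules on sets of elements of the type
  of \<open>P\<close>. The injection \<open>j\<close> moves the index set of the dual basis into
  that type, not into the carrier.\<close>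

lemma dual_basis_projective:
 assumes P: "lmodule R (P :: ('r, 'm, 'd) module_scheme)" and db: "dual_basis R P B x \<phi>"
  and j: "inj_on (j :: 'b => 'm) B"
 shows "projective_module R P"
proof -
 interpret P: lmodule R P by fact
 have rR: "ring R" by unfold_locales
 define X where "X = j ` B"
 define i where "i = inv_into B j"
 have i: "i b \<in> B" "j (i b) = b" if "b \<in> X" for b
  using that by (auto simp: X_def i_def inv_into_into f_inv_into_f)
 have ij: "i (j b) = b" "j b \<in> X" if "b \<in> B" for b using that j by (auto simp: i_def X_def)
 interpret F: lmodule R "free_module R X" using lmodule_free[OF rR] .
 obtain p where p: "p \<in> mhom R (free_module R X) P"
  "!!f S. f <: (free_module R X) ==> finite S ==> S \<subseteq> X ==> {b\<in>X. f b \<noteq> \<zero>\<^sub>R} \<subseteq> S ==>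
   p f = (\<Oplus>\<^sub>P b\<in>S. f b \<odot>\<^sub>P x (i b))"
  using dual_basis_extend[OF F.lmodule_axioms P dual_basis_free[OF rR], of "%b. x (i b)"]
   dual_basis_closed[OF db] i by blast
 define s where "s = (%q b. if b \<in> X then \<phi> (i b) q else \<zero>\<^sub>R)"
 have sc: "s q <: (free_module R X)" if q: "q <: P" for q
 proof -
  have "{b. s q b \<noteq> \<zero>\<^sub>R} \<subseteq> j ` {b\<in>B. \<phi> b q \<noteq> \<zero>\<^sub>R}"
   using i by (auto simp: s_def image_iff split: if_splits) (metis)
  then have "finite {b. s q b \<noteq> \<zero>\<^sub>R}"
   using dual_basis_finite[OF db q] by (meson finite_imageI finite_subset)
  then show ?thesis using dual_basis_coord[OF db _ q] i by (auto simp: free_module_carrier s_def)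
 qed
 have s: "s \<in> mhom R P (free_module R X)"
 proof (rule mhomI)
  fix q r assume "q <: P" "r <: P"
  then show "s (q \<oplus>\<^sub>P r) = s q \<oplus>\<^sub>(free_module R X) s r"
   using mhom_add[OF dual_basis_hom[OF db]] i
   by (auto simp: s_def free_module_simps fun_eq_iff)
 next
  fix a q assume "a <: R" "q <: P"
  then show "s (a \<odot>\<^sub>P q) = a \<odot>\<^sub>(free_module R X) s q"
   using mhom_smult[OF dual_basis_hom[OF db]] i
   by (auto simp: s_def free_module_simps fun_eq_iff)
 qed (rule sc)
 have "p (s q) = q" if q: "q <: P" for q
 proof -
  define S where "S = {b\<in>B. \<phi> b q \<noteq> \<zero>\<^sub>R}"
  have S: "finite S" "S \<subseteq> B" using dual_basis_finite[OF db q] by (auto simp: S_def)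
  have sub: "{b\<in>X. s q b \<noteq> \<zero>\<^sub>R} \<subseteq> j ` S" "j ` S \<subseteq> X"
   using i S ij by (auto simp: s_def image_iff S_def split: if_splits) (metis)
  have cl: "\<phi> b q <: R" "x b <: P" if "b \<in> S" for b
   using that S dual_basis_coord[OF db _ q] dual_basis_closed[OF db] by auto
  have "p (s q) = (\<Oplus>\<^sub>P b\<in>j ` S. s q b \<odot>\<^sub>P x (i b))"
   using p(2)[OF sc[OF q] _ sub(2,1)] S by simp
  also have "... = (\<Oplus>\<^sub>P b\<in>S. s q (j b) \<odot>\<^sub>P x (i (j b)))"
   using S ij cl P.lsmult_closed j
   by (intro P.M.finsum_reindex) (auto simp: s_def subset_iff inj_on_def)
  also have "... = (\<Oplus>\<^sub>P b\<in>S. \<phi> b q \<odot>\<^sub>P x b)"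
   using S ij cl P.lsmult_closed by (intro P.M.finsum_eqI) (auto simp: s_def subset_iff)
  also have "... = q" using dual_basis_sum[OF P db q S] by (simp add: S_def)
  finally show ?thesis .
 qed
 then show ?thesis using P s p(1) unfolding projective_module_def by blast
qed

section \<open>Bases of vector spaces\<close>

text \<open>Zorn's lemma gives a maximal independent set \<open>E\<close>. The linear combination
  map \<open>lc\<close> on the free module over \<open>E\<close> is then bijective, and its inverse
  supplies the coordinates.\<close>

lemma vector_space_dual_basis:
 fixes K (structure) and V :: "('k, 'v, 'd) module_scheme"
 assumes "field K" "module K V"
 obtains E :: "'v set" and \<phi> where "dual_basis K V E (%e. e) \<phi>"
proof -
 interpret field K by fact
 interpret V: module K V by fact
 have rK: "ring K" by unfold_locales
 have V: "lmodule K V" by (rule V.lmodule)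
 interpret lmodule K V by fact
 let ?FV = "free_module K (carrier V)"
 interpret F: lmodule K ?FV using lmodule_free[OF rK] .
 obtain lc where lc: "lc \<in> mhom K ?FV V"
  "!!f S. f <: ?FV ==> finite S ==> S \<subseteq> carrier V ==> {b\<in>carrier V. f b \<noteq> \<zero>} \<subseteq> S ==>
   lc f = (\<Oplus>\<^sub>V b\<in>S. f b \<odot>\<^sub>V b)"
  using dual_basis_extend[OF F.lmodule_axioms V dual_basis_free[OF rK], of "%b. b"] by blast
 define indep where "indep = {E. E \<subseteq> carrier V \<and>
  (\<forall>f\<in>carrier (free_module K E). lc f = \<zero>\<^sub>V \<longrightarrow> f = (%_. \<zero>))}"
 have mono: "f <: ?FV" if "f <: (free_module K E)" "E \<subseteq> carrier V" for f E
  using that by (auto simp: free_module_carrier)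
 have "\<exists>E\<in>indep. \<forall>X\<in>indep. E \<subseteq> X \<longrightarrow> X = E"
 proof (rule subset_Zorn_nonempty)
  have "{} \<in> indep" by (auto simp: indep_def free_module_carrier)
  then show "indep \<noteq> {}" by blast
  fix C assume C: "C \<noteq> {}" "subset.chain indep C"
  show "\<Union>C \<in> indep"
   unfolding indep_def
  proof (safe)
   fix e X assume "X \<in> C" "e \<in> X"
   then show "e <: V" using C(2) by (auto simp: subset.chain_def indep_def)
  next
   \<comment> \<open>A relation among elements of the union has finite support, so it already lives
     on one member of the chain.\<close>
   fix f assume f: "f \<in> carrier (free_module K (\<Union>C))" "lc f = \<zero>\<^sub>V"
   have "finite {x. f x \<noteq> \<zero>}" "{x. f x \<noteq> \<zero>} \<subseteq> \<Union>C"
    using f(1) by (auto simp: free_module_carrier)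
   then obtain X where "X \<in> C" "{x. f x \<noteq> \<zero>} \<subseteq> X"
    using finite_subset_Union_chain[OF _ _ C(1)] C(2) by metis
   moreover from this have "f <: (free_module K X)"
    using f(1) by (auto simp: free_module_carrier)
   ultimately show "f = (%_. \<zero>)"
    using f(2) C(2) by (auto simp: subset.chain_def indep_def)
  qed
 qed
 then obtain E where E: "E \<in> indep" "!!X. X \<in> indep ==> E \<subseteq> X ==> X = E" by blast
 let ?FE = "free_module K E"
 interpret FE: lmodule K ?FE using lmodule_free[OF rK] .
 have EV: "E \<subseteq> carrier V" using E(1) by (auto simp: indep_def)
 have FE: "carrier ?FE \<subseteq> carrier ?FV" using mono EV by auto
 have lcE: "lc \<in> mhom K ?FE V"
  using lc(1) FE by (auto simp: module_hom_def free_module_simps Pi_iff subset_iff)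
 have bv: "lc (basis_vector K v) = v" if "v <: V" for v
  using lc(2)[of "basis_vector K v" "{v}"] basis_vector_in_free[OF rK that] that
  by (auto simp: basis_vector_def lsmult_one)
 have surj: "v \<in> lc ` carrier ?FE" if v: "v <: V" for v
 proof (cases "v \<in> E")
  case True
  then show ?thesis using bv[OF v] basis_vector_in_free[OF rK True] by (metis image_eqI)
 next
  case False
  \<comment> \<open>By maximality \<open>insert v E\<close> carries a nontrivial relation
    \<open>f\<close>. Its coefficient at \<open>v\<close> is nonzero, hence invertible, and
    \<open>v\<close> is a combination of the rest.\<close>
  then have "insert v E \<notin> indep" using E(2)[of "insert v E"] by auto
  then obtain f where f: "f \<in> carrier (free_module K (insert v E))" "lc f = \<zero>\<^sub>V" "f \<noteq> (%_. \<zero>)"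
   using EV v by (auto simp: indep_def)
  define g where "g = f(v := \<zero>)"
  have "{x. g x \<noteq> \<zero>} \<subseteq> {x. f x \<noteq> \<zero>}" by (auto simp: g_def)
  then have "finite {x. g x \<noteq> \<zero>}" using f(1) finite_subset by (auto simp: free_module_carrier)
  then have g: "g <: ?FE" using f(1) by (auto simp: free_module_carrier g_def)
  have fv: "f v <: K" using f(1) by (auto simp: free_module_carrier)
  have "f v \<noteq> \<zero>"
  proof
   assume "f v = \<zero>"
   then have "f = g" by (auto simp: g_def)
   then show False using f g E(1) by (auto simp: indep_def)
  qed
  then have u: "inv (f v) <: K" "inv (f v) \<otimes> f v = \<one>" "f v \<otimes> inv (f v) = \<one>"
   using fv field_Units by auto
  have bvF: "basis_vector K v <: ?FV" using basis_vector_in_free[OF rK v] .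
  have "f = f v \<odot>\<^sub>?FV basis_vector K v \<oplus>\<^sub>?FV g"
   using f(1) by (auto simp: fun_eq_iff free_module_simps basis_vector_def g_def free_module_carrier)
  then have "lc f = f v \<odot>\<^sub>V v \<oplus>\<^sub>V lc g"
   using mhom_add[OF lc(1), of "f v \<odot>\<^sub>?FV basis_vector K v" g] mhom_smult[OF lc(1) fv bvF]
    F.lsmult_closed[OF fv bvF] bv[OF v] g FE by auto
  then have "f v \<odot>\<^sub>V v \<oplus>\<^sub>V lc g = \<zero>\<^sub>V" using f(2) by simp
  moreover have lg: "lc g <: V" using mhom_closed[OF lcE g] .
  ultimately have "f v \<odot>\<^sub>V v = \<ominus>\<^sub>V lc g"
   using V.M.minus_equality[of "f v \<odot>\<^sub>V v" "lc g"] v fv by simp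
  then have "inv (f v) \<odot>\<^sub>V (f v \<odot>\<^sub>V v) = inv (f v) \<odot>\<^sub>V (\<ominus>\<^sub>V lc g)" by simp
  then have "v = inv (f v) \<odot>\<^sub>V (\<ominus>\<^sub>V lc g)"
   using u v fv by (simp add: V.smult_assoc1[symmetric])
  also have "... = lc (inv (f v) \<odot>\<^sub>?FE (\<ominus>\<^sub>?FE g))"
   using mhom_smult[OF lcE u(1), of "\<ominus>\<^sub>?FE g"] g
    additive_neg[OF FE.M.ag V.M.ag mhom_additive[OF lcE] g]
   by simp
  finally show ?thesis using FE.lsmult_closed[OF u(1), of "\<ominus>\<^sub>?FE g"] g by blast
 qed
 have inj: "f = g" if "f <: ?FE" "g <: ?FE" "lc f = lc g" for f g
 proof -
  have "lc (f \<ominus>\<^sub>?FE g) = \<zero>\<^sub>V"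
   using additive_diff[OF FE.M.ag V.M.ag
     mhom_additive[OF lcE] that(1,2)] that mhom_closed[OF lcE]
   by (simp add: V.M.r_neg a_minus_def)
  then have "f \<ominus>\<^sub>?FE g = \<zero>\<^sub>?FE"
   using E(1) that by (auto simp: indep_def free_module_simps)
  then show ?thesis using that by (simp add: FE.M.minus_eq_zero_iff)
 qed
 define s where "s = (%v. inv_into (carrier ?FE) lc v)"
 have s: "s v <: ?FE" "lc (s v) = v" if "v <: V" for v
  using surj[OF that] by (auto simp: s_def inv_into_into f_inv_into_f)
 have sh: "s \<in> mhom K V ?FE"
 proof (rule mhomI)
  fix v w assume vw: "v <: V" "w <: V"
  then show "s (v \<oplus>\<^sub>V w) = s v \<oplus>\<^sub>?FE s w"
   using s by (intro inj) (auto simp: mhom_add[OF lcE])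
 next
  fix a v assume "a <: K" "v <: V"
  then show "s (a \<odot>\<^sub>V v) = a \<odot>\<^sub>?FE s v"
   using s by (intro inj) (auto simp: mhom_smult[OF lcE] FE.lsmult_closed)
 qed (rule s)
 have "dual_basis K V E (%e. e) (%e v. s v e)"
 proof (rule dual_basisI[OF V])
  show "(%v. s v b) \<in> mhom K V (reg K)" if "b \<in> E" for b
   using mhom_comp[OF sh dual_basis_hom[OF dual_basis_free[OF rK] that]] .
  fix v assume v: "v <: V"
  define S where "S = {e\<in>carrier V. s v e \<noteq> \<zero>}"
  have S: "finite S" "S \<subseteq> E" "S \<subseteq> carrier V" "\<forall>b\<in>E - S. s v b = \<zero>"
   using s(1)[OF v] EV by (auto simp: S_def free_module_carrier)
  have "(\<Oplus>\<^sub>V b\<in>S. s v b \<odot>\<^sub>V b) = lc (s v)"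
   using lc(2)[of "s v" S] s(1)[OF v] FE S(1,3) by (auto simp: S_def)
  then have "v = (\<Oplus>\<^sub>V b\<in>S. s v b \<odot>\<^sub>V b)" using s(2)[OF v] by simp
  then show "\<exists>S. finite S \<and> S \<subseteq> E \<and> (\<forall>b\<in>E - S. s v b = \<zero>) \<and> v = (\<Oplus>\<^sub>V b\<in>S. s v b \<odot>\<^sub>V b)"
   using S by (intro exI[of _ S] conjI)
 qed (use EV in auto)
 then show thesis using that by blast
qed

section \<open>Quotients and restriction of scalars\<close>

locale module_quotient =
 fixes M :: "('r, 'm, 'd) module_scheme" (structure) and N :: "'m set"
 assumes M: "abelian_group M" and N: "additive_subgroup N M"
begin

sublocale M: abelian_group M by (rule M)
sublocale NM: abelian_subgroup N M by (rule abelian_subgroupI3) (rule N, rule M)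

lemma quotient_carrier: "carrier (quotient_module M N) = (%x. N +> x) ` carrier M"
 by (auto simp: quotient_module_def A_RCOSETS_def')

lemma quotient_zero: "\<zero>\<^sub>(quotient_module M N) = N"
 by (simp add: quotient_module_def)

lemma quotient_add:
 "x <: M ==> y <: M ==>
  (N +> x) \<oplus>\<^sub>(quotient_module M N) (N +> y) = N +> (x \<oplus> y)"
 by (simp add: quotient_module_def NM.a_rcos_sum)

lemma coset_eq_iff:
 assumes "x <: M" "y <: M"
 shows "N +> x = N +> y \<longleftrightarrow> x \<ominus> y \<in> N"
proof
 assume "N +> x = N +> y"
 then have "x \<in> N +> y" using NM.a_rcos_self[OF assms(1)] by simp
 then show "x \<ominus> y \<in> N" using NM.a_rcos_module_imp[OF assms(2)] by (simp add: a_minus_def)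
next
 assume "x \<ominus> y \<in> N"
 then have "x \<in> N +> y" using NM.a_rcos_module_rev[OF assms(2,1)] by (simp add: a_minus_def)
 then show "N +> x = N +> y" using NM.a_repr_independence'[OF _ assms(2)] by simp
qed

lemma coset_eq_N_iff: "x <: M ==> N +> x = N \<longleftrightarrow> x \<in> N"
 using NM.a_rcos_self NM.a_rcos_const by blast

text \<open>The product in the quotient is a union over all representatives of the coset. It
  collapses to a single coset because multiplication by \<open>r\<close> is additive and maps
  \<open>N\<close> into itself.\<close>

lemma quotient_smult:
 assumes f: "additive M M (%x. r \<odot> x)" "!!x. x \<in> N ==> r \<odot> x \<in> N" and x: "x <: M"
 shows "r \<odot>\<^sub>(quotient_module M N) (N +> x) = N +> (r \<odot> x)"
proof -
 have "N +> (r \<odot> y) = N +> (r \<odot> x)" if "y \<in> N +> x" for y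
 proof -
  have y: "y <: M" using that x NM.a_elemrcos_carrier by blast
  have "y \<ominus> x \<in> N" using NM.a_rcos_module_imp[OF x that] by (simp add: a_minus_def)
  then have "r \<odot> y \<ominus> r \<odot> x \<in> N"
   using f(2) additive_diff[OF M M f(1) y x] by metis
  then show ?thesis using coset_eq_iff[of "r \<odot> y" "r \<odot> x"] additive_closed[OF f(1)] x y by blast
 qed
 then have "(\<Union>y\<in>N +> x. N +> (r \<odot> y)) = (\<Union>y\<in>N +> x. N +> (r \<odot> x))" by (rule SUP_cong[OF refl])
 moreover have "N +> x \<noteq> {}" using NM.a_rcos_self[OF x] by blast
 ultimately show ?thesis by (simp add: quotient_module_def)
qed

lemma quotient_group: "abelian_group (quotient_module M N)"
proof (rule abelian_groupI)
 fix X Y Z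
 assume X: "X <: (quotient_module M N)" and Y: "Y <: (quotient_module M N)"
 then show "X \<oplus>\<^sub>(quotient_module M N) Y <: (quotient_module M N)"
  by (auto simp: quotient_carrier quotient_add)
 from X Y show "X \<oplus>\<^sub>(quotient_module M N) Y = Y \<oplus>\<^sub>(quotient_module M N) X"
  by (auto simp: quotient_carrier quotient_add M.a_comm)
 assume "Z <: (quotient_module M N)"
 with X Y show "X \<oplus>\<^sub>(quotient_module M N) Y \<oplus>\<^sub>(quotient_module M N) Z =
   X \<oplus>\<^sub>(quotient_module M N) (Y \<oplus>\<^sub>(quotient_module M N) Z)"
  by (auto simp: quotient_carrier quotient_add M.a_assoc)
next
 have z: "\<zero>\<^sub>(quotient_module M N) = N +> \<zero>" using coset_eq_N_iff[OF M.zero_closed] NM.zero_closed by (simp add: quotient_zero)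
 then show "\<zero>\<^sub>(quotient_module M N) <: (quotient_module M N)"
  by (auto simp: quotient_carrier)
 fix X assume "X <: (quotient_module M N)"
 then obtain x where x: "x <: M" "X = N +> x" by (auto simp: quotient_carrier)
 then show "\<zero>\<^sub>(quotient_module M N) \<oplus>\<^sub>(quotient_module M N) X = X"
  unfolding z by (simp add: quotient_add)
 have "(N +> (\<ominus> x)) \<oplus>\<^sub>(quotient_module M N) X = \<zero>\<^sub>(quotient_module M N)"
  unfolding z using x by (simp add: quotient_add M.l_neg)
 then show "\<exists>Y\<in>carrier (quotient_module M N). Y \<oplus>\<^sub>(quotient_module M N) X = \<zero>\<^sub>(quotient_module M N)"
  using x by (auto simp: quotient_carrier)
qed

end

text \<open>Restriction of scalars. Applied to opposite rings it also encodes right module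
  structures, so that one notion of dual basis serves both sides.\<close>

definition restr :: "('t => 'r) => ('r, 'm, 'd) module_scheme => ('t, 'm) module" where
 "restr \<tau> M = \<lparr>carrier = carrier M, mult = mult M, one = one M,
   zero = zero M, add = add M, smult = (%t x. \<tau> t \<odot>\<^sub>M x)\<rparr>"

lemma restr_simps [simp]:
 "carrier (restr \<tau> M) = carrier M" "add (restr \<tau> M) = add M"
 "zero (restr \<tau> M) = zero M" "smult (restr \<tau> M) = (%t x. \<tau> t \<odot>\<^sub>M x)"
 "finsum (restr \<tau> M) = finsum M"
 by (auto simp: restr_def finsum_def finprod_def fun_eq_iff)

lemma abelian_group_cong:
 assumes "abelian_group M" "carrier N = carrier M" "add N = add M" "zero N = zero M"
 shows "abelian_group N"
proof -
 interpret M: abelian_group M by fact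
 show ?thesis
  by (rule abelian_groupI) (use assms(2-4) M.l_neg M.a_inv_closed in \<open>auto simp: M.a_ac\<close>)
qed

lemma lmodule_restrict:
 assumes "lmodule R M" "ring T" "\<tau> \<in> ring_hom T R"
 shows "lmodule T (restr \<tau> M)"
proof -
 interpret M: lmodule R M by fact
 interpret T: ring T by fact
 have "abelian_group (restr \<tau> M)"
  by (rule abelian_group_cong[OF M.M.ag]) auto
 then show ?thesis
  using assms(3)
  by (intro lmodule.intro lmodule_axioms.intro assms(2))
    (auto simp: ring_hom_def M.lsmult_closed M.lsmult_l_distr M.lsmult_r_distr M.lsmult_assoc
     M.lsmult_one Pi_iff)
qed

lemma module_hom_restrict:
 "f \<in> mhom R M N ==> \<tau> \<in> ring_hom T R ==>
  f \<in> mhom T (restr \<tau> M) (restr \<tau> N)"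
 by (auto simp: module_hom_def ring_hom_def)

text \<open>Transitivity of projectivity: expand over R first, then expand each coefficient over T.
  The generators are the products of the two families.\<close>

lemma dual_basis_restrict:
 assumes M: "lmodule R M" and T: "ring T" and \<tau>: "\<tau> \<in> ring_hom T R"
  and c: "dual_basis T (restr \<tau> (reg R)) B \<beta> c"
  and db: "dual_basis R M J x \<phi>"
 shows "dual_basis T (restr \<tau> M) (B \<times> J)
  (%p. \<beta> (fst p) \<odot>\<^sub>M x (snd p)) (%p q. c (fst p) (\<phi> (snd p) q))"
proof (rule dual_basisI)
 interpret M: lmodule R M by fact
 interpret T: ring T by fact
 let ?R = "restr \<tau> (reg R)"
 have R': "lmodule T ?R" using lmodule_restrict[OF lmodule_regular[OF M.R.ring_axioms] T \<tau>] .
 show "lmodule T (restr \<tau> M)" using lmodule_restrict[OF M T \<tau>] .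
 have \<beta>: "\<beta> b <: R" if "b \<in> B" for b using dual_basis_closed[OF c that] by simp
 note x = dual_basis_closed[OF db]
 note ch = dual_basis_hom[OF c] and \<phi>h = dual_basis_hom[OF db]
 have \<tau>c: "\<tau> t <: R" if "t <: T" for t using \<tau> that by (auto simp: ring_hom_def)
 fix p assume "p \<in> B \<times> J"
 then show "\<beta> (fst p) \<odot>\<^sub>M x (snd p) <: (restr \<tau> M)"
  using \<beta> x M.lsmult_closed by auto
 show "(%q. c (fst p) (\<phi> (snd p) q)) \<in> mhom T (restr \<tau> M) (reg T)"
  using \<open>p \<in> B \<times> J\<close> by (intro mhom_comp[OF module_hom_restrict[OF \<phi>h \<tau>] ch]) auto
next
 interpret M: lmodule R M by fact
 interpret T: ring T by fact
 let ?R = "restr \<tau> (reg R)"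
 have R': "lmodule T ?R" using lmodule_restrict[OF lmodule_regular[OF M.R.ring_axioms] T \<tau>] .
 have \<beta>: "\<beta> b <: R" if "b \<in> B" for b using dual_basis_closed[OF c that] by simp
 note x = dual_basis_closed[OF db]
 note ch = dual_basis_hom[OF c] and \<phi>h = dual_basis_hom[OF db]
 have \<tau>c: "\<tau> t <: R" if "t <: T" for t using \<tau> that by (auto simp: ring_hom_def)
 fix q assume "q <: (restr \<tau> M)"
 then have q: "q <: M" by simp
 have \<phi>c: "\<phi> j q <: R" if "j \<in> J" for j using dual_basis_coord[OF db that q] .
 have cc: "c b r <: T" if "b \<in> B" "r <: R" for b r
  using dual_basis_coord[OF c that(1), of r] that(2) by simp
 define S where "S = {j\<in>J. \<phi> j q \<noteq> \<zero>\<^sub>R}"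
 have S: "finite S" "S \<subseteq> J" using dual_basis_finite[OF db q] by (auto simp: S_def)
 \<comment> \<open>One set \<open>U\<close> serves all j at once, so that the double sum runs over a
   rectangle and the two sums can be exchanged.\<close>
 define U where "U = (\<Union>j\<in>S. {b\<in>B. c b (\<phi> j q) \<noteq> \<zero>\<^sub>T})"
 have U: "finite U" "U \<subseteq> B"
  using S dual_basis_finite[OF c] \<phi>c by (auto simp: U_def)
 have c0: "c b \<zero>\<^sub>R = \<zero>\<^sub>T" if "b \<in> B" for b
  using additive_zero[OF lmodule.axioms(2)[OF R'] lmodule.axioms(2)[OF lmodule_regular[OF T]]
    mhom_additive[OF ch[OF that]]] by simp
 have "q = (\<Oplus>\<^sub>M j\<in>S. \<phi> j q \<odot>\<^sub>M x j)" using dual_basis_sum[OF M db q S] by (simp add: S_def)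
 also have "... = (\<Oplus>\<^sub>M j\<in>S. \<Oplus>\<^sub>M b\<in>U. \<tau> (c b (\<phi> j q)) \<odot>\<^sub>M (\<beta> b \<odot>\<^sub>M x j))"
 proof (rule M.M.finsum_eqI)
  fix j assume j: "j \<in> S"
  then have jJ: "j \<in> J" using S by auto
  have "\<phi> j q = (\<Oplus>\<^sub>R b\<in>U. \<tau> (c b (\<phi> j q)) \<otimes>\<^sub>R \<beta> b)"
   using dual_basis_sum[OF R' c, of "\<phi> j q" U, symmetric] \<phi>c[OF jJ] U j by (auto simp: U_def)
  then have "\<phi> j q \<odot>\<^sub>M x j = (\<Oplus>\<^sub>R b\<in>U. \<tau> (c b (\<phi> j q)) \<otimes>\<^sub>R \<beta> b) \<odot>\<^sub>M x j" by (rule arg_cong)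
  also have "... = (\<Oplus>\<^sub>M b\<in>U. (\<tau> (c b (\<phi> j q)) \<otimes>\<^sub>R \<beta> b) \<odot>\<^sub>M x j)"
   using x[OF jJ] U \<tau>c cc \<phi>c[OF jJ] \<beta> by (intro M.finsum_lsmult_left) auto
  also have "... = (\<Oplus>\<^sub>M b\<in>U. \<tau> (c b (\<phi> j q)) \<odot>\<^sub>M (\<beta> b \<odot>\<^sub>M x j))"
   using x[OF jJ] U \<tau>c cc \<phi>c[OF jJ] \<beta>
   by (intro M.M.finsum_eqI) (auto simp: M.lsmult_assoc M.lsmult_closed subset_iff)
  finally show "\<phi> j q \<odot>\<^sub>M x j = (\<Oplus>\<^sub>M b\<in>U. \<tau> (c b (\<phi> j q)) \<odot>\<^sub>M (\<beta> b \<odot>\<^sub>M x j))" .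
  show "(\<Oplus>\<^sub>M b\<in>U. \<tau> (c b (\<phi> j q)) \<odot>\<^sub>M (\<beta> b \<odot>\<^sub>M x j)) <: M"
   using x[OF jJ] U \<tau>c cc \<phi>c[OF jJ] \<beta> by (intro M.M.finsum_in M.lsmult_closed) auto
 qed
 also have "... = (\<Oplus>\<^sub>M b\<in>U. \<Oplus>\<^sub>M j\<in>S. \<tau> (c b (\<phi> j q)) \<odot>\<^sub>M (\<beta> b \<odot>\<^sub>M x j))"
  using S U by (intro M.M.finsum_swap) (auto intro!: M.lsmult_closed x \<tau>c cc \<phi>c \<beta>)
 also have "... = (\<Oplus>\<^sub>M p\<in>U \<times> S. \<tau> (c (fst p) (\<phi> (snd p) q)) \<odot>\<^sub>M (\<beta> (fst p) \<odot>\<^sub>M x (snd p)))"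
  using S U by (intro M.M.finsum_Times[symmetric]) (auto intro!: M.lsmult_closed x \<tau>c cc \<phi>c \<beta>)
 finally have q_eq: "q = (\<Oplus>\<^sub>M p\<in>U \<times> S. \<tau> (c (fst p) (\<phi> (snd p) q)) \<odot>\<^sub>M (\<beta> (fst p) \<odot>\<^sub>M x (snd p)))" .
 have van: "c (fst p) (\<phi> (snd p) q) = \<zero>\<^sub>T" if "p \<in> B \<times> J - U \<times> S" for p
 proof (cases "snd p \<in> S")
  case True
  then have "fst p \<notin> U" "fst p \<in> B" using that by (auto simp: mem_Times_iff)
  then show ?thesis using True by (auto simp: U_def)
 next
  case False
  then show ?thesis using that c0 by (auto simp: S_def mem_Times_iff)
 qed
 show "\<exists>S. finite S \<and> S \<subseteq> B \<times> J \<and> (\<forall>p\<in>B \<times> J - S. c (fst p) (\<phi> (snd p) q) = \<zero>\<^sub>T) \<and>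
   q = (\<Oplus>\<^bsub>restr \<tau> M\<^esub>p\<in>S. c (fst p) (\<phi> (snd p) q) \<odot>\<^bsub>restr \<tau> M\<^esub>
    (\<beta> (fst p) \<odot>\<^sub>M x (snd p)))"
 proof (intro exI[of _ "U \<times> S"] conjI ballI)
  show "U \<times> S \<subseteq> B \<times> J" using S U by blast
  show "q = (\<Oplus>\<^bsub>restr \<tau> M\<^esub>p\<in>U \<times> S. c (fst p) (\<phi> (snd p) q) \<odot>\<^bsub>restr \<tau> M\<^esub>
    (\<beta> (fst p) \<odot>\<^sub>M x (snd p)))"
   unfolding restr_simps by (rule q_eq)
 qed (use S U van in auto)
qed

section \<open>The comparison theorem for projective resolutions\<close>

lemma resolution_facts:
 assumes "projective_resolution R M P \<delta> \<epsilon>"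
 shows "projective_module R (P n)" "lmodule R (P n)" "\<delta> n \<in> mhom R (P (Suc n)) (P n)"
  "\<epsilon> \<in> mhom R (P 0) M" "\<epsilon> ` carrier (P 0) = carrier M"
  "x \<in> carrier (P (Suc n)) ==> \<delta> n x <: (P n)"
  "x <: (P 1) ==> \<epsilon> (\<delta> 0 x) = \<zero>\<^sub>M"
  "x \<in> carrier (P (Suc (Suc n))) ==> \<delta> n (\<delta> (Suc n) x) = \<zero>\<^sub>(P n)"
  "x <: (P 0) ==> \<epsilon> x = \<zero>\<^sub>M ==> x \<in> \<delta> 0 ` carrier (P 1)"
  "x \<in> carrier (P (Suc n)) ==> \<delta> n x = \<zero>\<^sub>(P n) ==> x \<in> \<delta> (Suc n) ` carrier (P (Suc (Suc n)))"
proof -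
 note P = assms[unfolded projective_resolution_def]
 show 1: "projective_module R (P n)" and 2: "\<delta> n \<in> mhom R (P (Suc n)) (P n)"
  and "\<epsilon> \<in> mhom R (P 0) M" "\<epsilon> ` carrier (P 0) = carrier M" for n
  using P by auto
 show "lmodule R (P n)" using 1 by (simp add: projective_module_def)
 show "x \<in> carrier (P (Suc n)) ==> \<delta> n x <: (P n)" using mhom_closed[OF 2] .
 have 3: "\<delta> 0 ` carrier (P 1) = {x \<in> carrier (P 0). \<epsilon> x = \<zero>\<^sub>M}"
  "\<delta> (Suc n) ` carrier (P (Suc (Suc n))) = {x \<in> carrier (P (Suc n)). \<delta> n x = \<zero>\<^sub>(P n)}"
  using P by blast+
 show "x <: (P 1) ==> \<epsilon> (\<delta> 0 x) = \<zero>\<^sub>M"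
  "x \<in> carrier (P (Suc (Suc n))) ==> \<delta> n (\<delta> (Suc n) x) = \<zero>\<^sub>(P n)"
  using 3 by blast+
 show "x <: (P 0) ==> \<epsilon> x = \<zero>\<^sub>M ==> x \<in> \<delta> 0 ` carrier (P 1)"
  "x \<in> carrier (P (Suc n)) ==> \<delta> n x = \<zero>\<^sub>(P n) ==> x \<in> \<delta> (Suc n) ` carrier (P (Suc (Suc n)))"
  unfolding 3 by auto
qed

lemma projective_lift:
 fixes P :: "('r, 'p, 'd) module_scheme"
 assumes "projective_module R P" "lmodule R M" "abelian_group N"
  and "g \<in> mhom R M N" "f \<in> mhom R P N"
  and "!!p. p <: P ==> f p \<in> g ` carrier M"
 shows "\<exists>h\<in>mhom R P M. \<forall>p\<in>carrier P. g (h p) = f p"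
proof -
 obtain X :: "'p set" and x \<phi> where "dual_basis R P X x \<phi>" by (rule projective_dual_basis[OF assms(1)])
 moreover have "lmodule R P" using assms(1) by (simp add: projective_module_def)
 ultimately obtain h where "h \<in> mhom R P M" "!!p. p <: P ==> g (h p) = f p"
  using dual_basis_lift[OF _ assms(2,3) _ assms(4-6)] by metis
 then show ?thesis by blast
qed

text \<open>Dependent choice along the degrees. The invariant \<open>G\<close> says that
  \<open>f\<close> after the differential lands in the next image, which is exactly what the next
  lift requires.\<close>

lemma chain_map_exists:
 assumes P: "projective_resolution R M P \<delta> \<epsilon>" and Q: "projective_resolution R M Q \<delta>' \<epsilon>'"
  and M: "abelian_group M"
 shows "\<exists>f. (\<forall>n. f n \<in> mhom R (P n) (Q n)) \<and> (\<forall>x\<in>carrier (P 0). \<epsilon>' (f 0 x) = \<epsilon> x) \<and>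
  (\<forall>n. \<forall>x\<in>carrier (P (Suc n)). \<delta>' n (f (Suc n) x) = f n (\<delta> n x))"
proof -
 note P' = resolution_facts[OF P] and Q' = resolution_facts[OF Q]
 define G where "G = (%n f. f \<in> mhom R (P n) (Q n) \<and>
  (n = 0 \<longrightarrow> (\<forall>x\<in>carrier (P 0). \<epsilon>' (f x) = \<epsilon> x)) \<and>
  (\<forall>x\<in>carrier (P (Suc n)). f (\<delta> n x) \<in> \<delta>' n ` carrier (Q (Suc n))))"
 have "\<exists>f. \<forall>n. G n (f n) \<and> (\<forall>x\<in>carrier (P (Suc n)). \<delta>' n (f (Suc n) x) = f n (\<delta> n x))"
 proof (rule dependent_nat_choice)
  have "\<exists>f\<in>mhom R (P 0) (Q 0). \<forall>p\<in>carrier (P 0). \<epsilon>' (f p) = \<epsilon> p"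
   using P' Q' M by (intro projective_lift) (auto intro: mhom_closed[OF P'(4)])
  then obtain f where f: "f \<in> mhom R (P 0) (Q 0)" "!!p. p <: (P 0) ==> \<epsilon>' (f p) = \<epsilon> p"
   by blast
  have "f (\<delta> 0 x) \<in> \<delta>' 0 ` carrier (Q (Suc 0))" if x: "x \<in> carrier (P (Suc 0))" for x
   using Q'(9)[of "f (\<delta> 0 x)"] mhom_closed[OF f(1)] P'(6)[OF x] f(2) P'(7)[of x] x by simp
  then show "\<exists>f. G 0 f" using f unfolding G_def by blast
 next
  fix f n assume G: "G n f"
  then have f: "f \<in> mhom R (P n) (Q n)" by (simp add: G_def)
  interpret Pn: lmodule R "P n" by (rule P')
  interpret Qn: lmodule R "Q n" by (rule Q')
  have "(%x. f (\<delta> n x)) \<in> mhom R (P (Suc n)) (Q n)"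
   using mhom_comp[OF P'(3) f] .
  then have "\<exists>h\<in>mhom R (P (Suc n)) (Q (Suc n)). \<forall>p\<in>carrier (P (Suc n)). \<delta>' n (h p) = f (\<delta> n p)"
   using P'(1) Q'(2,3) G Qn.M.ag by (intro projective_lift) (auto simp: G_def)
  then obtain h where h: "h \<in> mhom R (P (Suc n)) (Q (Suc n))"
   "!!p. p \<in> carrier (P (Suc n)) ==> \<delta>' n (h p) = f (\<delta> n p)" by blast
  have f0: "f \<zero>\<^sub>(P n) = \<zero>\<^sub>(Q n)"
   using additive_zero[OF Pn.M.ag Qn.M.ag mhom_additive[OF f]] .
  have "h (\<delta> (Suc n) x) \<in> \<delta>' (Suc n) ` carrier (Q (Suc (Suc n)))" if x: "x \<in> carrier (P (Suc (Suc n)))" for x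
   using Q'(10)[of "h (\<delta> (Suc n) x)" n] mhom_closed[OF h(1)] P'(6)[OF x] h(2) P'(8)[OF x] f0
   by simp
  then show "\<exists>h. G (Suc n) h \<and> (\<forall>x\<in>carrier (P (Suc n)). \<delta>' n (h x) = f (\<delta> n x))"
   using h unfolding G_def by blast
 qed
 then obtain f where "\<forall>n. G n (f n) \<and> (\<forall>x\<in>carrier (P (Suc n)). \<delta>' n (f (Suc n) x) = f n (\<delta> n x))"
  by (rule exE)
 then show ?thesis by (intro exI[of _ f]) (simp add: G_def)
qed

text \<open>The next lift exists because u - h \<delta> is killed by the differential of
  \<open>Q\<close>; this is what the invariant \<open>G\<close> records. The lemma is applied to the
  difference of a round trip of chain maps and the identity.\<close>

lemma chain_homotopy_exists:
 assumes P: "projective_resolution R M P \<delta> \<epsilon>" and Q: "projective_resolution R M Q \<delta>' \<epsilon>'"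
  and u: "!!n. u n \<in> mhom R (P n) (Q n)" "!!x. x <: (P 0) ==> \<epsilon>' (u 0 x) = \<zero>\<^sub>M"
   "!!n x. x \<in> carrier (P (Suc n)) ==> \<delta>' n (u (Suc n) x) = u n (\<delta> n x)"
 shows "\<exists>h. (\<forall>n. h n \<in> mhom R (P n) (Q (Suc n))) \<and>
  (\<forall>x\<in>carrier (P 0). \<delta>' 0 (h 0 x) = u 0 x) \<and>
  (\<forall>n. \<forall>x\<in>carrier (P (Suc n)). \<delta>' (Suc n) (h (Suc n) x) = u (Suc n) x \<ominus>\<^sub>(Q (Suc n)) h n (\<delta> n x))"
proof -
 note P' = resolution_facts[OF P] and Q' = resolution_facts[OF Q]
 have gr: "abelian_group (Q n)" "abelian_group (P n)" for n
  using Q'(2) P'(2) lmodule.axioms(2) by blast+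
 note ucl = mhom_closed[OF u(1)]
 define G where "G = (%n h. h \<in> mhom R (P n) (Q (Suc n)) \<and>
  (n = 0 \<longrightarrow> (\<forall>x\<in>carrier (P 0). \<delta>' 0 (h x) = u 0 x)) \<and>
  (\<forall>x\<in>carrier (P (Suc n)). u (Suc n) x \<ominus>\<^sub>(Q (Suc n)) h (\<delta> n x) \<in> \<delta>' (Suc n) ` carrier (Q (Suc (Suc n)))))"
 have "\<exists>h. \<forall>n. G n (h n) \<and>
  (\<forall>x\<in>carrier (P (Suc n)). \<delta>' (Suc n) (h (Suc n) x) = u (Suc n) x \<ominus>\<^sub>(Q (Suc n)) h n (\<delta> n x))"
 proof (rule dependent_nat_choice)
  have "\<exists>h\<in>mhom R (P 0) (Q 1). \<forall>p\<in>carrier (P 0). \<delta>' 0 (h p) = u 0 p"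
   using P'(1) Q'(2,3) gr u(1) Q'(9) u(2) ucl by (intro projective_lift) auto
  then obtain h where h: "h \<in> mhom R (P 0) (Q 1)" "!!p. p <: (P 0) ==> \<delta>' 0 (h p) = u 0 p"
   by blast
  have "u 1 x \<ominus>\<^sub>(Q 1) h (\<delta> 0 x) \<in> \<delta>' 1 ` carrier (Q (Suc 1))" if x: "x <: (P 1)" for x
  proof -
   interpret Q1: abelian_group "Q 1" by (rule gr)
   interpret Q0: abelian_group "Q 0" by (rule gr)
   have dx: "\<delta> 0 x <: (P 0)" "h (\<delta> 0 x) <: (Q 1)" "u 1 x <: (Q 1)"
    using P'(6)[of x 0] x mhom_closed[OF h(1)] ucl by auto
   have "\<delta>' 0 (u 1 x \<ominus>\<^sub>(Q 1) h (\<delta> 0 x)) = u 0 (\<delta> 0 x) \<ominus>\<^sub>(Q 0) u 0 (\<delta> 0 x)"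
    using additive_diff[OF gr(1) gr(1) mhom_additive[OF Q'(3)], of _ 0] dx u(3)[of x 0] h(2) x
    by simp
   also have "... = \<zero>\<^sub>(Q 0)" using ucl[OF dx(1)] by (simp add: Q0.r_neg a_minus_def)
   finally show ?thesis
    using Q'(10)[of "u 1 x \<ominus>\<^sub>(Q 1) h (\<delta> 0 x)" 0] Q1.minus_closed[OF dx(3,2)] by simp
  qed
  then show "\<exists>h. G 0 h" using h unfolding G_def by auto
 next
  fix h n assume G: "G n h"
  then have h: "h \<in> mhom R (P n) (Q (Suc n))" by (simp add: G_def)
  interpret Q1: lmodule R "Q (Suc n)" by (rule Q')
  interpret Q2: lmodule R "Q (Suc (Suc n))" by (rule Q')
  have hd: "(%x. h (\<delta> n x)) \<in> mhom R (P (Suc n)) (Q (Suc n))"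
   using mhom_comp[OF P'(3) h] .
  have "(%x. u (Suc n) x \<ominus>\<^sub>(Q (Suc n)) h (\<delta> n x)) \<in> mhom R (P (Suc n)) (Q (Suc n))"
   using mhom_minus[OF Q'(2) u(1) hd] .
  then have "\<exists>k\<in>mhom R (P (Suc n)) (Q (Suc (Suc n))). \<forall>p\<in>carrier (P (Suc n)).
    \<delta>' (Suc n) (k p) = u (Suc n) p \<ominus>\<^sub>(Q (Suc n)) h (\<delta> n p)"
   using P' Q' G gr by (intro projective_lift) (auto simp: G_def)
  then obtain k where k: "k \<in> mhom R (P (Suc n)) (Q (Suc (Suc n)))"
   "!!p. p \<in> carrier (P (Suc n)) ==> \<delta>' (Suc n) (k p) = u (Suc n) p \<ominus>\<^sub>(Q (Suc n)) h (\<delta> n p)" by blast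
  have "u (Suc (Suc n)) x \<ominus>\<^sub>(Q (Suc (Suc n))) k (\<delta> (Suc n) x) \<in>
    \<delta>' (Suc (Suc n)) ` carrier (Q (Suc (Suc (Suc n))))" if x: "x \<in> carrier (P (Suc (Suc n)))" for x
  proof -
   have dx: "\<delta> (Suc n) x \<in> carrier (P (Suc n))" "k (\<delta> (Suc n) x) \<in> carrier (Q (Suc (Suc n)))"
    "u (Suc (Suc n)) x \<in> carrier (Q (Suc (Suc n)))" "u (Suc n) (\<delta> (Suc n) x) \<in> carrier (Q (Suc n))"
    using P'(6)[OF x] x mhom_closed[OF k(1)] ucl by auto
   have h0: "h (\<delta> n (\<delta> (Suc n) x)) = \<zero>\<^sub>(Q (Suc n))"
    using P'(8)[OF x] additive_zero[OF gr(2) gr(1) mhom_additive[OF h]] by simp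
   have "\<delta>' (Suc n) (u (Suc (Suc n)) x \<ominus>\<^sub>(Q (Suc (Suc n))) k (\<delta> (Suc n) x)) =
     u (Suc n) (\<delta> (Suc n) x) \<ominus>\<^sub>(Q (Suc n)) (u (Suc n) (\<delta> (Suc n) x) \<ominus>\<^sub>(Q (Suc n)) \<zero>\<^sub>(Q (Suc n)))"
    using additive_diff[OF gr(1) gr(1) mhom_additive[OF Q'(3)] dx(3,2)] u(3)[OF x] k(2)[OF dx(1)] h0
    by simp
   also have "... = \<zero>\<^sub>(Q (Suc n))" using dx(4) by (simp add: Q1.M.minus_self Q1.M.minus_zero_right)
   finally show ?thesis
    using Q'(10)[of "u (Suc (Suc n)) x \<ominus>\<^sub>(Q (Suc (Suc n))) k (\<delta> (Suc n) x)" "Suc n"]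
     Q2.M.minus_closed[OF dx(3,2)] by simp
  qed
  then show "\<exists>k. G (Suc n) k \<and> (\<forall>x\<in>carrier (P (Suc n)).
    \<delta>' (Suc n) (k x) = u (Suc n) x \<ominus>\<^sub>(Q (Suc n)) h (\<delta> n x))"
   using k unfolding G_def by blast
 qed
 then obtain h where "\<forall>n. G n (h n) \<and>
  (\<forall>x\<in>carrier (P (Suc n)). \<delta>' (Suc n) (h (Suc n) x) = u (Suc n) x \<ominus>\<^sub>(Q (Suc n)) h n (\<delta> n x))"
  by (rule exE)
 then show ?thesis by (intro exI[of _ h]) (simp add: G_def)
qed

section \<open>Ext from an arbitrary projective resolution\<close>

text \<open>Functions matter only on the carriers here, whereas \<open>cocycles\<close> asks for
  extensional functions. The loose form composes with chain maps without a restriction at every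
  step.\<close>

definition cochain_cocycles ::
  "('r, 'c) ring_scheme => (nat => ('r, 'u) module) => (nat => 'u => 'u) => nat => ('u => 'r) set" where
 "cochain_cocycles R Q \<delta> n =
   {c \<in> mhom R (Q n) (reg R). \<forall>x\<in>carrier (Q (Suc n)). c (\<delta> n x) = \<zero>\<^sub>R}"

definition is_coboundary ::
  "('r, 'c) ring_scheme => (nat => ('r, 'u) module) => (nat => 'u => 'u) => nat => ('u => 'r) => bool" where
 "is_coboundary R Q \<delta> n c \<longleftrightarrow>
   (case n of 0 => \<forall>x\<in>carrier (Q 0). c x = \<zero>\<^sub>R
   | Suc m => \<exists>b\<in>mhom R (Q m) (reg R). \<forall>x\<in>carrier (Q n). c x = b (\<delta> m x))"

lemma module_hom_regular_mult:
 assumes "ring R" "f \<in> mhom R M (reg R)" "r <: R"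
 shows "(%x. f x \<otimes>\<^sub>R r) \<in> mhom R M (reg R)"
proof -
 interpret ring R by fact
 show ?thesis
  using mhom_closed[OF assms(2)] mhom_add[OF assms(2)] mhom_smult[OF assms(2)] assms(3)
  by (intro mhomI) (auto simp: l_distr m_assoc)
qed

text \<open>Functions in \<open>Z\<close> represent the elements of \<open>E\<close>, those satisfying \<open>B\<close> represent zero, and only
 the values on \<open>X\<close> matter.\<close>

definition presents ::
  "('r, 'c) ring_scheme => ('r, 'e) module => 'x set => ('x => 'r) set => (('x => 'r) => bool) =>
   (('x => 'r) => 'e) => bool" where
 "presents R E X Z B \<Phi> \<longleftrightarrow> abelian_group E \<and> carrier E = \<Phi> ` Z \<and>
   (\<forall>c\<in>Z. \<forall>c'\<in>Z. \<Phi> (%x. c x \<oplus>\<^sub>R c' x) = \<Phi> c \<oplus>\<^sub>E \<Phi> c') \<and>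
   (\<forall>c\<in>Z. \<forall>r\<in>carrier R. \<Phi> (%x. c x \<otimes>\<^sub>R r) = r \<odot>\<^sub>E \<Phi> c) \<and>
   (\<forall>c\<in>Z. \<Phi> c = \<zero>\<^sub>E \<longleftrightarrow> B c) \<and>
   (\<forall>c c'. (\<forall>x\<in>X. c x = c' x) \<longrightarrow> \<Phi> c = \<Phi> c')"

lemma presentsD:
 assumes "presents R E X Z B \<Phi>"
 shows "abelian_group E" "carrier E = \<Phi> ` Z"
  "!!c c'. c \<in> Z ==> c' \<in> Z ==> \<Phi> (%x. c x \<oplus>\<^sub>R c' x) = \<Phi> c \<oplus>\<^sub>E \<Phi> c'"
  "!!c r. c \<in> Z ==> r <: R ==> \<Phi> (%x. c x \<otimes>\<^sub>R r) = r \<odot>\<^sub>E \<Phi> c"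
  "!!c. c \<in> Z ==> \<Phi> c = \<zero>\<^sub>E \<longleftrightarrow> B c"
  "!!c c'. (!!x. x \<in> X ==> c x = c' x) ==> \<Phi> c = \<Phi> c'"
 using assms by (auto simp: presents_def)

text \<open>Restricting to the carrier of \<open>P n\<close> turns loose cochains into the
  extensional ones of the definition; the map \<Phi> is this restriction followed by the
  coset.\<close>

lemma Ext_regular_chosen:
 fixes R (structure) and M :: "('r, 'm, 'd) module_scheme" and n :: nat
 assumes R: "ring R" and P: "projective_resolution R M P \<delta> \<epsilon>"
  and ch: "chosen_resolution R M = (P, \<delta>)"
 defines "E \<equiv> Ext_regular R M n"
 obtains \<Phi> where "presents R E (carrier (P n)) (cochain_cocycles R P \<delta> n) (is_coboundary R P \<delta> n) \<Phi>"
proof -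
 interpret R: ring R by fact
 note P' = resolution_facts[OF P]
 interpret Pn: lmodule R "P n" by (rule P')
 let ?act = "%s x. x \<otimes> s"
 let ?H = "hom_module R (P n) (reg R) ?act"
 let ?Z = "?H\<lparr>carrier := cocycles R P \<delta> (reg R) ?act n\<rparr>"
 let ?B = "coboundaries R P \<delta> (reg R) ?act n"
 have reg: "lmodule R (reg R)" using lmodule_regular[OF R] .
 have E: "E = quotient_module ?Z ?B" by (simp add: E_def Ext_regular_def Ext_module_def ch)
 let ?C = "cochain_cocycles R P \<delta> n"
 let ?r = "%c. restrict c (carrier (P n))"
 have dcl: "\<delta> n x <: (P n)" if "x \<in> carrier (P (Suc n))" for x using P'(6)[OF that] .
 have cong: "?r c \<in> mhom R (P n) (reg R)" if "c \<in> mhom R (P n) (reg R)" for c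
  using mhom_cong[OF that Pn.M.ag, of "?r c"] Pn.lsmult_closed by auto
 have Z: "carrier ?Z = ?r ` ?C"
 proof
  show "?r ` ?C \<subseteq> carrier ?Z"
   using cong dcl by (auto simp: cochain_cocycles_def cocycles_def hom_module_def)
  show "carrier ?Z \<subseteq> ?r ` ?C"
  proof
   fix f assume f: "f <: ?Z"
   then have "f \<in> ?C" "?r f = f"
    by (auto simp: cochain_cocycles_def cocycles_def hom_module_def extensional_restrict)
   then show "f \<in> ?r ` ?C" by (metis image_eqI)
  qed
 qed
 have ccl: "c x <: R" if "c \<in> ?C" "x <: (P n)" for c x
  using mhom_closed[of c R "P n" "reg R" x] that by (auto simp: cochain_cocycles_def)
 have Cadd: "(%x. c x \<oplus> c' x) \<in> ?C" if "c \<in> ?C" "c' \<in> ?C" for c c'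
  using that mhom_plus[OF reg, of c "P n" c'] by (auto simp: cochain_cocycles_def)
 have Cneg: "(%x. \<ominus> c x) \<in> ?C" if "c \<in> ?C" for c
 proof -
  have "(%x. \<zero> \<ominus> c x) \<in> mhom R (P n) (reg R)"
   using mhom_minus[OF reg mhom_zero[OF reg], of c "P n"] that
   by (simp add: cochain_cocycles_def)
  then have "(%x. \<ominus> c x) \<in> mhom R (P n) (reg R)"
   using ccl[OF that] Pn.lsmult_closed by (elim mhom_cong[OF _ Pn.M.ag]) (auto simp: a_minus_def)
  then show ?thesis using that by (auto simp: cochain_cocycles_def)
 qed
 have Cmult: "(%x. c x \<otimes> r) \<in> ?C" if "c \<in> ?C" "r <: R" for c r
  using that module_hom_regular_mult[OF R _ that(2), of c "P n"] by (auto simp: cochain_cocycles_def)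
 have Czero: "(%x. \<zero>) \<in> ?C"
  using mhom_zero[OF reg, of "P n"] by (auto simp: cochain_cocycles_def)
 have Zadd: "?r c \<oplus>\<^sub>?Z ?r c' = ?r (%x. c x \<oplus> c' x)" for c c'
  by (auto simp: hom_module_def fun_eq_iff)
 have Zzero: "\<zero>\<^sub>?Z = ?r (%x. \<zero>)"
  by (auto simp: hom_module_def)
 have Zsm: "s \<odot>\<^sub>?Z ?r c = ?r (%x. c x \<otimes> s)" for s c
  by (auto simp: hom_module_def fun_eq_iff)
 have grp: "abelian_group ?Z"
 proof (rule abelian_groupI)
  fix f g h assume "f <: ?Z" "g <: ?Z"
  then obtain c c' where c: "c \<in> ?C" "f = ?r c" "c' \<in> ?C" "g = ?r c'" unfolding Z by blast
  show "f \<oplus>\<^sub>?Z g <: ?Z" unfolding c Zadd Z using Cadd c by blast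
  show "f \<oplus>\<^sub>?Z g = g \<oplus>\<^sub>?Z f" unfolding c Zadd using ccl c by (auto simp: fun_eq_iff R.a_comm)
  assume "h <: ?Z"
  then obtain c'' where c'': "c'' \<in> ?C" "h = ?r c''" unfolding Z by blast
  show "f \<oplus>\<^sub>?Z g \<oplus>\<^sub>?Z h = f \<oplus>\<^sub>?Z (g \<oplus>\<^sub>?Z h)"
   unfolding c c'' Zadd using ccl c c'' by (auto simp: fun_eq_iff R.a_assoc)
 next
  show "\<zero>\<^sub>?Z <: ?Z" unfolding Zzero Z using Czero by blast
  fix f assume "f <: ?Z"
  then obtain c where c: "c \<in> ?C" "f = ?r c" unfolding Z by blast
  show "\<zero>\<^sub>?Z \<oplus>\<^sub>?Z f = f" unfolding c Zzero Zadd using ccl c by (auto simp: fun_eq_iff)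
  have "?r (%x. \<ominus> c x) \<oplus>\<^sub>?Z f = \<zero>\<^sub>?Z"
   unfolding c Zzero Zadd using ccl c by (auto simp: fun_eq_iff R.l_neg)
  then show "\<exists>g\<in>carrier ?Z. g \<oplus>\<^sub>?Z f = \<zero>\<^sub>?Z" unfolding Z using Cneg[OF c(1)] by blast
 qed
 have Bin: "?r c \<in> ?B \<longleftrightarrow> is_coboundary R P \<delta> n c" for c
 proof (cases n)
  case 0
  then show ?thesis
   by (auto simp: is_coboundary_def hom_module_def fun_eq_iff restrict_def)
 next
  case (Suc m)
  \<comment> \<open>A loose coboundary comes from an arbitrary linear map, which has to be replaced
    by its restriction to the carrier.\<close>
  have rest: "\<exists>b\<in>carrier (hom_module R (P m) (reg R) ?act).
    \<forall>x\<in>carrier (P n). b (\<delta> m x) = b' (\<delta> m x)"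
   if "b' \<in> mhom R (P m) (reg R)" for b'
  proof (rule bexI)
   have lm: "lmodule R (P m)" by (rule P')
   show "restrict b' (carrier (P m)) \<in> carrier (hom_module R (P m) (reg R) ?act)"
    using mhom_cong[OF that lmodule.axioms(2)[OF lm], of "restrict b' (carrier (P m))"]
     lmodule.lsmult_closed[OF lm] by (auto simp: hom_module_def)
   show "\<forall>x\<in>carrier (P n). restrict b' (carrier (P m)) (\<delta> m x) = b' (\<delta> m x)"
    using P'(6)[of _ m] Suc by auto
  qed
  have "?r c \<in> ?B \<longleftrightarrow> (\<exists>b\<in>carrier (hom_module R (P m) (reg R) ?act).
    \<forall>x\<in>carrier (P n). c x = b (\<delta> m x))"
   using Suc by (auto simp: image_iff fun_eq_iff restrict_def)
  also have "... \<longleftrightarrow> is_coboundary R P \<delta> n c"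
  proof
   assume "is_coboundary R P \<delta> n c"
   then obtain b' where b': "b' \<in> mhom R (P m) (reg R)"
    "\<forall>x\<in>carrier (P n). c x = b' (\<delta> m x)" using Suc by (auto simp: is_coboundary_def)
   then show "\<exists>b\<in>carrier (hom_module R (P m) (reg R) ?act). \<forall>x\<in>carrier (P n). c x = b (\<delta> m x)"
    using rest[OF b'(1)] by metis
  qed (use Suc in \<open>auto simp: is_coboundary_def hom_module_def\<close>)
  finally show ?thesis .
 qed
 have BZ: "f <: ?Z" if fB: "f \<in> ?B" for f
 proof (cases n)
  case 0
  then show ?thesis using that Zzero abelian_groupE(2)[OF grp] by (auto simp: hom_module_def)
 next
  case (Suc m)
  then obtain g where g: "g \<in> mhom R (P m) (reg R)" "f = ?r (%x. g (\<delta> m x))"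
   using fB by (auto simp: hom_module_def)
  have lm: "lmodule R (P m)" by (rule P')
  have "g \<zero>\<^sub>(P m) = \<zero>"
   using additive_zero[OF lmodule.axioms(2)[OF lm] R.is_abelian_group, of g] mhom_additive[OF g(1)]
   by (auto simp: additive_def)
  then have "(%x. g (\<delta> m x)) \<in> ?C"
   using mhom_comp[OF P'(3) g(1)] P'(8) Suc by (auto simp: cochain_cocycles_def)
  then show ?thesis unfolding Z g(2) by blast
 qed
 have cobadd: "is_coboundary R P \<delta> n (%x. c x \<oplus> c' x)"
  if cb: "is_coboundary R P \<delta> n c" "is_coboundary R P \<delta> n c'" for c c'
 proof (cases n)
  case (Suc m)
  then obtain b b' where "b \<in> mhom R (P m) (reg R)" "\<forall>x\<in>carrier (P n). c x = b (\<delta> m x)"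
   "b' \<in> mhom R (P m) (reg R)" "\<forall>x\<in>carrier (P n). c' x = b' (\<delta> m x)"
   using cb by (auto simp: is_coboundary_def)
  then show ?thesis using mhom_plus[OF reg, of b "P m" b'] Suc
   by (auto simp: is_coboundary_def intro!: bexI[of _ "%x. b x \<oplus> b' x"])
 qed (use that in \<open>auto simp: is_coboundary_def\<close>)
 have cobmult: "is_coboundary R P \<delta> n (%x. c x \<otimes> r)"
  if cb: "is_coboundary R P \<delta> n c" "r <: R" for c r
 proof (cases n)
  case (Suc m)
  then obtain b where "b \<in> mhom R (P m) (reg R)" "\<forall>x\<in>carrier (P n). c x = b (\<delta> m x)"
   using cb by (auto simp: is_coboundary_def)
  then show ?thesis using module_hom_regular_mult[OF R _ cb(2), of b "P m"] Suc
   by (auto simp: is_coboundary_def intro!: bexI[of _ "%x. b x \<otimes> r"])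
 qed (use that in \<open>auto simp: is_coboundary_def\<close>)
 have cobcong: "is_coboundary R P \<delta> n c" if "is_coboundary R P \<delta> n c'" "!!x. x <: (P n) ==> c x = c' x" for c c'
  using that by (auto simp: is_coboundary_def split: nat.splits)
 have Bsub: "additive_subgroup ?B ?Z"
 proof (rule additive_subgroupI, rule group.subgroupI)
  interpret Z: abelian_group ?Z by (rule grp)
  show "group (add_monoid ?Z)" using Z.a_group .
  show "?B \<subseteq> carrier (add_monoid ?Z)" using BZ by auto
  have z: "is_coboundary R P \<delta> n (%x. \<zero>)"
   using mhom_zero[OF reg]
   by (cases n) (auto simp: is_coboundary_def intro!: bexI[of _ "%x. \<zero>"])
  then have "?r (%x. \<zero>) \<in> ?B" using Bin by blast
  then show "?B \<noteq> {}" by blast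
  fix f assume f: "f \<in> ?B"
  then obtain c where c: "c \<in> ?C" "f = ?r c" using BZ Z by blast
  have cb: "is_coboundary R P \<delta> n c" using f c Bin by blast
  have "is_coboundary R P \<delta> n (%x. c x \<otimes> \<ominus> \<one>)" using cobmult[OF cb] by simp
  then have "is_coboundary R P \<delta> n (%x. \<ominus> c x)"
   using ccl[OF c(1)] by (elim cobcong) (auto simp: R.r_minus)
  then have "?r (%x. \<ominus> c x) \<in> ?B" using Bin by blast
  moreover have "?r (%x. \<ominus> c x) \<oplus>\<^sub>?Z f = \<zero>\<^sub>?Z"
   unfolding c Zzero Zadd using ccl c by (auto simp: fun_eq_iff R.l_neg)
  then have "\<ominus>\<^sub>?Z f = ?r (%x. \<ominus> c x)"
   using Z.minus_equality BZ[OF f] BZ[OF calculation] by blast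
  ultimately show "inv\<^sub>(add_monoid ?Z) f \<in> ?B" by (simp add: a_inv_def)
  fix g assume g: "g \<in> ?B"
  then obtain c' where c': "c' \<in> ?C" "g = ?r c'" using BZ Z by blast
  have cb': "is_coboundary R P \<delta> n c'" using g c' Bin by blast
  have "f \<oplus>\<^sub>?Z g \<in> ?B" unfolding c c' Zadd using cobadd[OF cb cb'] Bin by blast
  then show "f \<otimes>\<^sub>(add_monoid ?Z) g \<in> ?B" by simp
 qed
 interpret Q: module_quotient ?Z ?B by (rule module_quotient.intro[OF grp Bsub])
 define \<Phi> where "\<Phi> = (%c. ?B +>\<^sub>?Z ?r c)"
 have rZ: "?r c <: ?Z" if "c \<in> ?C" for c using that Z by blast
 have "presents R E (carrier (P n)) ?C (is_coboundary R P \<delta> n) \<Phi>"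
  unfolding presents_def
 proof (intro conjI ballI allI impI)
  show "carrier E = \<Phi> ` ?C" unfolding E Q.quotient_carrier Z \<Phi>_def by auto
  show "\<Phi> (%x. c x \<oplus> c' x) = \<Phi> c \<oplus>\<^sub>E \<Phi> c'" if "c \<in> ?C" "c' \<in> ?C" for c c'
   unfolding E \<Phi>_def Q.quotient_add[OF rZ[OF that(1)] rZ[OF that(2)]] Zadd ..
  show "\<Phi> (%x. c x \<otimes> r) = r \<odot>\<^sub>E \<Phi> c" if c: "c \<in> ?C" "r <: R" for c r
  proof -
   have 1: "additive ?Z ?Z (%x. r \<odot>\<^sub>?Z x)"
   proof (rule additiveI)
    fix f g assume "f <: ?Z" "g <: ?Z"
    then obtain c c' where c': "c \<in> ?C" "f = ?r c" "c' \<in> ?C" "g = ?r c'" unfolding Z by blast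
    show "r \<odot>\<^sub>?Z f <: ?Z" unfolding c' Zsm using rZ[OF Cmult[OF c'(1) c(2)]] .
    show "r \<odot>\<^sub>?Z (f \<oplus>\<^sub>?Z g) = r \<odot>\<^sub>?Z f \<oplus>\<^sub>?Z r \<odot>\<^sub>?Z g"
     unfolding c' Zsm Zadd using ccl c' c(2) by (auto simp: fun_eq_iff R.l_distr)
   qed
   have 2: "r \<odot>\<^sub>?Z f \<in> ?B" if f: "f \<in> ?B" for f
   proof -
    obtain c where c': "c \<in> ?C" "f = ?r c" using BZ[OF f] Z by blast
    then show ?thesis using f Bin cobmult c(2) by (metis Zsm)
   qed
   have "r \<odot>\<^sub>(quotient_module ?Z ?B) (?B +>\<^sub>?Z ?r c) = ?B +>\<^sub>?Z (r \<odot>\<^sub>?Z ?r c)"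
    by (rule Q.quotient_smult[OF 1 _ rZ[OF c(1)]]) (rule 2)
   then show ?thesis unfolding E \<Phi>_def Zsm by (rule sym)
  qed
  show "\<Phi> c = \<zero>\<^sub>E \<longleftrightarrow> is_coboundary R P \<delta> n c" if "c \<in> ?C" for c
   unfolding E \<Phi>_def Q.quotient_zero Q.coset_eq_N_iff[OF rZ[OF that]] Bin ..
  show "\<Phi> c = \<Phi> c'" if "\<forall>x\<in>carrier (P n). c x = c' x" for c c'
  proof -
   have "?r c = ?r c'" using that by (auto simp: restrict_def)
   then show ?thesis by (simp add: \<Phi>_def)
  qed
  show "abelian_group E" unfolding E by (rule Q.quotient_group)
 qed
 then show thesis by (rule that)
qed

lemma coboundary_pullback:
 assumes P: "projective_resolution R M P \<delta> \<epsilon>" and Q: "projective_resolution R M Q \<delta>' \<epsilon>'"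
  and g: "!!n. g n \<in> mhom R (Q n) (P n)"
   "!!n x. x \<in> carrier (Q (Suc n)) ==> \<delta> n (g (Suc n) x) = g n (\<delta>' n x)"
  and c: "is_coboundary R P \<delta> n c"
 shows "is_coboundary R Q \<delta>' n (%x. c (g n x))"
proof (cases n)
 case 0
 then show ?thesis using c mhom_closed[OF g(1)] by (auto simp: is_coboundary_def)
next
 case (Suc m)
 then obtain b where b: "b \<in> mhom R (P m) (reg R)" "\<forall>x\<in>carrier (P n). c x = b (\<delta> m x)"
  using c by (auto simp: is_coboundary_def)
 then have "\<forall>x\<in>carrier (Q n). c (g n x) = b (g m (\<delta>' m x))"
  using mhom_closed[OF g(1)] g(2)[of _ m] Suc by auto
 then show ?thesis
  using mhom_comp[OF g(1) b(1)] Suc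
  by (auto simp: is_coboundary_def intro!: bexI[of _ "%x. b (g m x)"])
qed

text \<open>By the homotopy, c u = c \<delta> h + c h \<delta>. The cocycle c kills the first
  summand and the second is a coboundary; in degree 0 there is no second summand.\<close>

lemma coboundary_nullhomotopic:
 fixes R (structure)
 assumes R: "ring R" and P: "projective_resolution R M P \<delta> \<epsilon>"
  and u: "!!n. u n \<in> mhom R (P n) (P n)" "!!x. x <: (P 0) ==> \<epsilon> (u 0 x) = \<zero>\<^sub>M"
   "!!n x. x \<in> carrier (P (Suc n)) ==> \<delta> n (u (Suc n) x) = u n (\<delta> n x)"
  and c: "c \<in> cochain_cocycles R P \<delta> n"
 shows "is_coboundary R P \<delta> n (%x. c (u n x))"
proof -
 interpret R: ring R by fact
 note P' = resolution_facts[OF P]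
 obtain h where h: "!!n. h n \<in> mhom R (P n) (P (Suc n))"
  "!!x. x <: (P 0) ==> \<delta> 0 (h 0 x) = u 0 x"
  "!!n x. x \<in> carrier (P (Suc n)) ==> \<delta> (Suc n) (h (Suc n) x) = u (Suc n) x \<ominus>\<^sub>(P (Suc n)) h n (\<delta> n x)"
  using chain_homotopy_exists[OF P P, of u] u by metis
 have c': "c \<in> mhom R (P n) (reg R)" "!!x. x \<in> carrier (P (Suc n)) ==> c (\<delta> n x) = \<zero>"
  using c by (auto simp: cochain_cocycles_def)
 show ?thesis
 proof (cases n)
  case 0
  then show ?thesis using c'(2) h(2) mhom_closed[OF h(1)] by (auto simp: is_coboundary_def) metis
 next
  case (Suc m)
  interpret Pn: lmodule R "P n" by (rule P')
  have "c (u n x) = c (h m (\<delta> m x))" if x: "x <: (P n)" for x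
  proof -
   have cl: "h m (\<delta> m x) <: (P n)" "u n x <: (P n)" "h n x \<in> carrier (P (Suc n))"
    using mhom_closed[OF h(1)] P'(6)[of x m] x mhom_closed[OF u(1)] Suc by auto
   have "\<delta> n (h n x) \<oplus>\<^sub>(P n) h m (\<delta> m x) = u n x"
    using h(3)[of x m] x Suc cl Pn.M.minus_cancel_right[OF cl(2,1)] by simp
   then have "c (u n x) = c (\<delta> n (h n x)) \<oplus> c (h m (\<delta> m x))"
    using mhom_add[OF c'(1), of "\<delta> n (h n x)" "h m (\<delta> m x)"] P'(6)[OF cl(3)] cl by simp
   then show ?thesis using c'(2)[OF cl(3)] mhom_closed[OF c'(1) cl(1)] by simp
  qed
  then show ?thesis using mhom_comp[OF h(1)[of m], of c "reg R"] c' Suc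
   by (auto simp: is_coboundary_def intro!: bexI[of _ "%x. c (h m x)"])
 qed
qed

lemma coboundary_diff:
 fixes R (structure)
 assumes R: "ring R" and P: "!!n. abelian_group (P n)"
  and "is_coboundary R P \<delta> n a" "is_coboundary R P \<delta> n b"
  and "!!x. x <: (P n) ==> c x = a x \<ominus> b x"
 shows "is_coboundary R P \<delta> n c"
proof (cases n)
 case 0
 interpret ring R by fact
 show ?thesis using assms(3-5) 0 by (auto simp: is_coboundary_def minus_self)
next
 case (Suc m)
 then obtain a' b' where "a' \<in> mhom R (P m) (reg R)" "\<forall>x\<in>carrier (P n). a x = a' (\<delta> m x)"
  "b' \<in> mhom R (P m) (reg R)" "\<forall>x\<in>carrier (P n). b x = b' (\<delta> m x)"
  using assms by (auto simp: is_coboundary_def)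
 then show ?thesis
  using mhom_minus[OF lmodule_regular[OF R], of a' "P m" b'] Suc assms(5)
  by (auto simp: is_coboundary_def intro!: bexI[of _ "%x. a' x \<ominus> b' x"])
qed

text \<open>\<open>chosen_resolution\<close> is a choice, and only \<open>ex\<close> guarantees that
  it is a resolution. Classes are transported by composition with the chain map \<open>f\<close>
  from the chosen resolution to \<open>Q\<close>; the chain map \<open>g\<close> back shows that
  this is bijective on classes.\<close>

lemma Ext_regular_resolution:
 fixes R (structure) and M :: "('r, 'm, 'd) module_scheme" and n :: nat
 assumes R: "ring R" and M: "abelian_group M" and Q: "projective_resolution R M Q \<delta>' \<epsilon>'"
  and ex: "\<exists>(P :: nat => ('r, ('r, 'm) resolution_carrier) module) \<delta> \<epsilon>. projective_resolution R M P \<delta> \<epsilon>"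
 defines "E \<equiv> Ext_regular R M n"
 obtains \<Phi> where "presents R E (carrier (Q n)) (cochain_cocycles R Q \<delta>' n) (is_coboundary R Q \<delta>' n) \<Phi>"
proof -
 interpret R: ring R by fact
 obtain P :: "nat => ('r, ('r, 'm) resolution_carrier) module" and \<delta> where
  ch: "chosen_resolution R M = (P, \<delta>)" by (cases "chosen_resolution R M")
 have "case chosen_resolution R M of (P, \<delta>) => \<exists>\<epsilon>. projective_resolution R M P \<delta> \<epsilon>"
  unfolding chosen_resolution_def by (rule someI_ex) (use ex in auto)
 then obtain \<epsilon> where P: "projective_resolution R M P \<delta> \<epsilon>" using ch by auto
 note P' = resolution_facts[OF P] and Q' = resolution_facts[OF Q]
 have gr: "abelian_group (Q n)" "abelian_group (P n)" for n
  using Q'(2) P'(2) lmodule.axioms(2) by blast+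
 obtain \<Phi> where \<Phi>: "presents R E (carrier (P n)) (cochain_cocycles R P \<delta> n) (is_coboundary R P \<delta> n) \<Phi>"
  by (rule Ext_regular_chosen[OF R P ch, of n, folded E_def])
 note \<Phi> = presentsD(2-6)[OF this] presentsD(1)[OF this]
 interpret E: abelian_group E by (rule \<Phi>)
 obtain f where f: "!!n. f n \<in> mhom R (P n) (Q n)" "!!x. x <: (P 0) ==> \<epsilon>' (f 0 x) = \<epsilon> x"
  "!!n x. x \<in> carrier (P (Suc n)) ==> \<delta>' n (f (Suc n) x) = f n (\<delta> n x)"
  using chain_map_exists[OF P Q M] by metis
 obtain g where g: "!!n. g n \<in> mhom R (Q n) (P n)" "!!x. x <: (Q 0) ==> \<epsilon> (g 0 x) = \<epsilon>' x"
  "!!n x. x \<in> carrier (Q (Suc n)) ==> \<delta> n (g (Suc n) x) = g n (\<delta>' n x)"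
  using chain_map_exists[OF Q P M] by metis
 note fcl = mhom_closed[OF f(1)] and gcl = mhom_closed[OF g(1)]
 have id: "(%x. x) \<in> mhom R N N" for N :: "('r, 'n, 'e) module_scheme"
  by (auto simp: module_hom_def)
 have cobP: "is_coboundary R P \<delta> n (%x. c (g n (f n x) \<ominus>\<^sub>(P n) x))" if "c \<in> cochain_cocycles R P \<delta> n" for c
 proof (rule coboundary_nullhomotopic[OF R P _ _ _ that, of "%n x. g n (f n x) \<ominus>\<^sub>(P n) x"])
  show "(%x. g n (f n x) \<ominus>\<^sub>(P n) x) \<in> mhom R (P n) (P n)" for n
   by (rule mhom_minus[OF P'(2) mhom_comp[OF f(1) g(1)] id])
  show "\<epsilon> (g 0 (f 0 x) \<ominus>\<^sub>(P 0) x) = \<zero>\<^sub>M" if "x <: (P 0)" for x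
   using additive_diff[OF gr(2) M mhom_additive[OF P'(4)], of "g 0 (f 0 x)" x] that fcl gcl f(2) g(2)
    abelian_group.minus_self[OF M mhom_closed[OF P'(4)]] by simp
  show "\<delta> n (g (Suc n) (f (Suc n) x) \<ominus>\<^sub>(P (Suc n)) x) = g n (f n (\<delta> n x)) \<ominus>\<^sub>(P n) \<delta> n x"
   if "x \<in> carrier (P (Suc n))" for n x
   using additive_diff[OF gr(2) gr(2) mhom_additive[OF P'(3)], of "g (Suc n) (f (Suc n) x)" n x]
    that fcl gcl f(3) g(3) by simp
 qed
 have cobQ: "is_coboundary R Q \<delta>' n (%x. c (f n (g n x) \<ominus>\<^sub>(Q n) x))" if "c \<in> cochain_cocycles R Q \<delta>' n" for c
 proof (rule coboundary_nullhomotopic[OF R Q _ _ _ that, of "%n x. f n (g n x) \<ominus>\<^sub>(Q n) x"])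
  show "(%x. f n (g n x) \<ominus>\<^sub>(Q n) x) \<in> mhom R (Q n) (Q n)" for n
   by (rule mhom_minus[OF Q'(2) mhom_comp[OF g(1) f(1)] id])
  show "\<epsilon>' (f 0 (g 0 x) \<ominus>\<^sub>(Q 0) x) = \<zero>\<^sub>M" if "x <: (Q 0)" for x
   using additive_diff[OF gr(1) M mhom_additive[OF Q'(4)], of "f 0 (g 0 x)" x] that fcl gcl f(2) g(2)
    abelian_group.minus_self[OF M mhom_closed[OF Q'(4)]] by simp
  show "\<delta>' n (f (Suc n) (g (Suc n) x) \<ominus>\<^sub>(Q (Suc n)) x) = f n (g n (\<delta>' n x)) \<ominus>\<^sub>(Q n) \<delta>' n x"
   if "x \<in> carrier (Q (Suc n))" for n x
   using additive_diff[OF gr(1) gr(1) mhom_additive[OF Q'(3)], of "f (Suc n) (g (Suc n) x)" n x]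
    that fcl gcl f(3) g(3) by simp
 qed
 have pb: "(%x. c (f n x)) \<in> cochain_cocycles R P \<delta> n" if "c \<in> cochain_cocycles R Q \<delta>' n" for c
  using that mhom_comp[OF f(1)[of n]] fcl f(3)[symmetric] by (auto simp: cochain_cocycles_def)
 have pb': "(%x. c (g n x)) \<in> cochain_cocycles R Q \<delta>' n" if "c \<in> cochain_cocycles R P \<delta> n" for c
  using that mhom_comp[OF g(1)[of n]] gcl g(3)[symmetric] by (auto simp: cochain_cocycles_def)
 define \<Psi> where "\<Psi> = (%c. \<Phi> (%x. c (f n x)))"
 have "presents R E (carrier (Q n)) (cochain_cocycles R Q \<delta>' n) (is_coboundary R Q \<delta>' n) \<Psi>"
  unfolding presents_def
 proof (intro conjI ballI allI impI)
  show "carrier E = \<Psi> ` cochain_cocycles R Q \<delta>' n"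
  proof
   show "\<Psi> ` cochain_cocycles R Q \<delta>' n \<subseteq> carrier E" using pb unfolding \<Psi>_def \<Phi>(1) by blast
   show "carrier E \<subseteq> \<Psi> ` cochain_cocycles R Q \<delta>' n"
   proof
    fix y assume "y <: E"
    then obtain c where c: "c \<in> cochain_cocycles R P \<delta> n" "y = \<Phi> c" unfolding \<Phi>(1) by blast
    \<comment> \<open>The error of the round trip by \<open>f\<close> and \<open>g\<close> is the
      coboundary \<open>?u\<close>, so y is also represented by c composed with g.\<close>
    let ?u = "%x. c (g n (f n x) \<ominus>\<^sub>(P n) x)"
    have ch: "c \<in> mhom R (P n) (reg R)" using c(1) by (simp add: cochain_cocycles_def)
    have eq: "c (g n (f n x)) = c x \<oplus> ?u x" if x: "x <: (P n)" for x
    proof -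
     interpret Pn: abelian_group "P n" by (rule gr)
     have gf: "g n (f n x) <: (P n)" using x fcl gcl by auto
     have "c (g n (f n x) \<ominus>\<^sub>(P n) x \<oplus>\<^sub>(P n) x) = ?u x \<oplus> c x"
      using mhom_add[OF ch, of "g n (f n x) \<ominus>\<^sub>(P n) x" x] x gf by simp
     then show ?thesis
      using x gf mhom_closed[OF ch] by (simp add: Pn.minus_cancel_right R.a_comm)
    qed
    have uc: "?u \<in> cochain_cocycles R P \<delta> n"
     unfolding cochain_cocycles_def
    proof (intro CollectI conjI ballI)
     show "?u \<in> mhom R (P n) (reg R)"
      by (rule mhom_comp[OF mhom_minus[OF P'(2) mhom_comp[OF f(1) g(1)] id] ch])
     fix x assume x: "x \<in> carrier (P (Suc n))"
     have "g n (f n (\<delta> n x)) \<ominus>\<^sub>(P n) \<delta> n x = \<delta> n (g (Suc n) (f (Suc n) x) \<ominus>\<^sub>(P (Suc n)) x)"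
      using additive_diff[OF gr(2) gr(2) mhom_additive[OF P'(3)], of "g (Suc n) (f (Suc n) x)" n x]
       x fcl gcl f(3) g(3) by simp
     then show "?u (\<delta> n x) = \<zero>"
      using c(1) x fcl gcl abelian_group.minus_closed[OF gr(2)] by (auto simp: cochain_cocycles_def)
    qed
    have "\<Psi> (%x. c (g n x)) = \<Phi> (%x. c x \<oplus> ?u x)"
     unfolding \<Psi>_def using eq by (intro \<Phi>(5)) auto
    also have "... = \<Phi> c \<oplus>\<^sub>E \<Phi> ?u" using \<Phi>(2)[OF c(1) uc] .
    also have "... = y" using \<Phi>(4)[OF uc] cobP[OF c(1)] c \<Phi>(1) by auto
    finally show "y \<in> \<Psi> ` cochain_cocycles R Q \<delta>' n" using pb'[OF c(1)] by blast
   qed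
  qed
  show "\<Psi> (%x. c x \<oplus> c' x) = \<Psi> c \<oplus>\<^sub>E \<Psi> c'"
   if "c \<in> cochain_cocycles R Q \<delta>' n" "c' \<in> cochain_cocycles R Q \<delta>' n" for c c'
   unfolding \<Psi>_def using \<Phi>(2)[OF pb pb, OF that] .
  show "\<Psi> (%x. c x \<otimes> r) = r \<odot>\<^sub>E \<Psi> c" if "c \<in> cochain_cocycles R Q \<delta>' n" "r <: R" for c r
   unfolding \<Psi>_def using \<Phi>(3)[OF pb, OF that] .
  show "\<Psi> c = \<Psi> c'" if "\<forall>x\<in>carrier (Q n). c x = c' x" for c c'
   unfolding \<Psi>_def using that fcl by (intro \<Phi>(5)) auto
  show "\<Psi> c = \<zero>\<^sub>E \<longleftrightarrow> is_coboundary R Q \<delta>' n c" if c: "c \<in> cochain_cocycles R Q \<delta>' n" for c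
  proof -
   have ch: "c \<in> mhom R (Q n) (reg R)" using c by (simp add: cochain_cocycles_def)
   have "is_coboundary R P \<delta> n (%x. c (f n x)) \<longleftrightarrow> is_coboundary R Q \<delta>' n c"
   proof
    assume "is_coboundary R P \<delta> n (%x. c (f n x))"
    then have 1: "is_coboundary R Q \<delta>' n (%x. c (f n (g n x)))"
     using coboundary_pullback[where c = "%x. c (f n x)" and g = g, OF P Q g(1,3)] by blast
    have eq: "c x = c (f n (g n x)) \<ominus> c (f n (g n x) \<ominus>\<^sub>(Q n) x)" if x: "x <: (Q n)" for x
    proof -
     have fg: "f n (g n x) <: (Q n)" using x fcl gcl by auto
     have "c (f n (g n x) \<ominus>\<^sub>(Q n) x) = c (f n (g n x)) \<ominus> c x"
      using additive_diff[OF gr(1) lmodule.axioms(2)[OF lmodule_regular[OF R]] mhom_additive[OF ch] fg x]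
      by simp
     then show ?thesis
      using mhom_closed[OF ch fg] mhom_closed[OF ch x]
      by (simp add: R.minus_eq R.minus_add R.r_neg2)
    qed
    show "is_coboundary R Q \<delta>' n c"
     by (rule coboundary_diff[where P = Q, OF R gr(1) 1 cobQ[OF c] eq])
   next
    assume "is_coboundary R Q \<delta>' n c"
    then show "is_coboundary R P \<delta> n (%x. c (f n x))"
     using coboundary_pullback[where c = c and g = f, OF Q P f(1,3)] by blast
   qed
   then show ?thesis unfolding \<Psi>_def using \<Phi>(4)[OF pb[OF c]] by simp
  qed
 qed (rule \<Phi>)
 then show thesis by (rule that)
qed

lemma mhom_inverse:
 assumes M: "lmodule R M" and f: "f \<in> mhom R M N" and bij: "bij_betw f (carrier M) (carrier N)"
 shows "inv_into (carrier M) f \<in> mhom R N M"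
proof (rule mhomI)
 interpret M: lmodule R M by (rule M)
 let ?g = "inv_into (carrier M) f"
 have i: "?g (f x) = x" if "x <: M" for x using bij that by (rule bij_betw_inv_into_left)
 have s: "\<exists>y\<in>carrier M. x = f y" if "x <: N" for x using bij that by (auto simp: bij_betw_def)
 fix x assume x: "x <: N"
 then obtain x' where x': "x' <: M" "x = f x'" using s by blast
 show "?g x <: M" using x' i by simp
 show "?g (x \<oplus>\<^sub>N y) = ?g x \<oplus>\<^sub>M ?g y" if y: "y <: N" for y
 proof -
  obtain y' where "y' <: M" "y = f y'" using s y by blast
  then show ?thesis using x' i by (simp add: mhom_add[OF f, symmetric])
 qed
 show "?g (a \<odot>\<^sub>N x) = a \<odot>\<^sub>M ?g x" if a: "a <: R" for a
  using x' i a M.lsmult_closed by (simp add: mhom_smult[OF f, symmetric])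
qed

section \<open>Complexes given by matrices\<close>

text \<open>Entries vanish outside the index sets, so that equal matrices are equal functions and
  products need no restriction.\<close>

definition Mat :: "('r, 'c) ring_scheme => 'x set => 'y set => ('x => 'y => 'r) set" where
 "Mat R I J = {A. (\<forall>i j. A i j <: R) \<and> (\<forall>i j. i \<notin> I \<or> j \<notin> J \<longrightarrow> A i j = \<zero>\<^sub>R)}"

abbreviation Vec :: "('r, 'c) ring_scheme => 'x set => ('x => 'r) set" where
 "Vec R I \<equiv> carrier (free_module R I)"

definition vec_mat :: "('r, 'c) ring_scheme => 'x set => ('x => 'r) => ('x => 'y => 'r) => 'y => 'r" where
 "vec_mat R I q A = (%j. \<Oplus>\<^sub>R i\<in>I. q i \<otimes>\<^sub>R A i j)"

definition mat_vec :: "('r, 'c) ring_scheme => 'y set => ('x => 'y => 'r) => ('y => 'r) => 'x => 'r" where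
 "mat_vec R J A c = (%i. \<Oplus>\<^sub>R j\<in>J. A i j \<otimes>\<^sub>R c j)"

definition mat_mul ::
  "('r, 'c) ring_scheme => 'y set => ('x => 'y => 'r) => ('y => 'z => 'r) => 'x => 'z => 'r" where
 "mat_mul R J A B = (%i k. \<Oplus>\<^sub>R j\<in>J. A i j \<otimes>\<^sub>R B j k)"

definition dot :: "('r, 'c) ring_scheme => 'x set => ('x => 'r) => ('x => 'r) => 'r" where
 "dot R I q c = (\<Oplus>\<^sub>R i\<in>I. q i \<otimes>\<^sub>R c i)"

definition lcomb ::
  "('r, 'm, 'd) module_scheme => 'x set => ('x => 'r) => ('x => 'm) => 'm" where
 "lcomb M I q m = (\<Oplus>\<^sub>M i\<in>I. q i \<odot>\<^sub>M m i)"

lemma MatD: "A \<in> Mat R I J ==> A i j <: R" "A \<in> Mat R I J ==> i \<notin> I ==> A i j = \<zero>\<^sub>R"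
 "A \<in> Mat R I J ==> j \<notin> J ==> A i j = \<zero>\<^sub>R"
 by (auto simp: Mat_def)

lemma VecI: "finite I ==> (!!i. q i <: R) ==> (!!i. i \<notin> I ==> q i = \<zero>\<^sub>R) ==> q \<in> Vec R I"
 by (auto simp: free_module_carrier elim!: finite_subset[rotated])

lemma VecD: "q \<in> Vec R I ==> q i <: R" "q \<in> Vec R I ==> i \<notin> I ==> q i = \<zero>\<^sub>R"
 by (auto simp: free_module_carrier)

lemma Mat_row: "finite J ==> A \<in> Mat R I J ==> A i \<in> Vec R J"
 by (intro VecI) (auto simp: Mat_def)

context ring
begin

lemma finsum_distr_right:
 "(!!i. i \<in> S ==> f i <: R) ==> a <: R ==>
  finsum R f S \<otimes> a = (\<Oplus>i\<in>S. f i \<otimes> a)"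
 by (rule additive_finsum[OF is_abelian_group is_abelian_group, where g = "%x. x \<otimes> a"])
  (auto intro!: additiveI simp: l_distr)

lemma finsum_distr_left:
 "(!!i. i \<in> S ==> f i <: R) ==> a <: R ==>
  a \<otimes> finsum R f S = (\<Oplus>i\<in>S. a \<otimes> f i)"
 by (rule additive_finsum[OF is_abelian_group is_abelian_group, where g = "%x. a \<otimes> x"])
  (auto intro!: additiveI simp: r_distr)

lemma vec_mat_closed:
 assumes "finite J" "!!i. i \<in> I ==> q i <: R" "A \<in> Mat R I' J"
 shows "vec_mat R I q A \<in> Vec R J"
proof (rule VecI)
 show "vec_mat R I q A j <: R" for j
  unfolding vec_mat_def using assms by (intro finsum_in) (auto intro: MatD(1)[OF assms(3)])
 show "vec_mat R I q A j = \<zero>" if "j \<notin> J" for j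
  unfolding vec_mat_def using that assms(2) MatD(3)[OF assms(3)] by (intro finsum_eq_zeroI) auto
qed fact

text \<open>Associativity of a row, a matrix and a column; the associativity laws that follow are
  instances of it.\<close>

lemma double_sum_assoc:
 assumes "finite I" "finite J" "!!i. i \<in> I ==> q i <: R" "!!j. j \<in> J ==> c j <: R"
  "!!i j. i \<in> I ==> j \<in> J ==> A i j <: R"
 shows "(\<Oplus>j\<in>J. (\<Oplus>i\<in>I. q i \<otimes> A i j) \<otimes> c j) = (\<Oplus>i\<in>I. q i \<otimes> (\<Oplus>j\<in>J. A i j \<otimes> c j))"
proof -
 have "(\<Oplus>j\<in>J. (\<Oplus>i\<in>I. q i \<otimes> A i j) \<otimes> c j) = (\<Oplus>j\<in>J. \<Oplus>i\<in>I. q i \<otimes> (A i j \<otimes> c j))"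
 proof (rule finsum_eqI)
  fix j assume j: "j \<in> J"
  show "(\<Oplus>i\<in>I. q i \<otimes> A i j) \<otimes> c j = (\<Oplus>i\<in>I. q i \<otimes> (A i j \<otimes> c j))"
   using j assms by (subst finsum_distr_right) (auto intro!: finsum_eqI simp: m_assoc)
  show "(\<Oplus>i\<in>I. q i \<otimes> (A i j \<otimes> c j)) <: R" using j assms by (intro finsum_in) auto
 qed
 also have "... = (\<Oplus>i\<in>I. \<Oplus>j\<in>J. q i \<otimes> (A i j \<otimes> c j))"
  using assms by (intro finsum_swap) auto
 also have "... = (\<Oplus>i\<in>I. q i \<otimes> (\<Oplus>j\<in>J. A i j \<otimes> c j))"
  using assms by (intro finsum_eqI) (auto intro!: finsum_distr_left[symmetric] finsum_in)
 finally show ?thesis .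
qed

lemma vec_mat_assoc:
 assumes "finite I" "finite J" "!!i. i \<in> I ==> q i <: R" "A \<in> Mat R I J" "B \<in> Mat R J L"
 shows "vec_mat R J (vec_mat R I q A) B = vec_mat R I q (mat_mul R J A B)"
 unfolding vec_mat_def mat_mul_def using assms(1-3) MatD(1)[OF assms(4)] MatD(1)[OF assms(5)]
 by (intro ext double_sum_assoc) auto

lemma dot_assoc:
 assumes "finite I" "finite J" "!!i. i \<in> I ==> q i <: R" "A \<in> Mat R I J"
  "!!j. j \<in> J ==> c j <: R"
 shows "dot R J (vec_mat R I q A) c = dot R I q (mat_vec R J A c)"
 unfolding dot_def vec_mat_def mat_vec_def using assms(1-3,5) MatD(1)[OF assms(4)]
 by (intro double_sum_assoc) auto

lemma dot_closed:
 "(!!i. i \<in> I ==> q i <: R) ==> (!!i. i \<in> I ==> c i <: R) ==> dot R I q c <: R"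
 unfolding dot_def by (intro finsum_in) auto

lemma dot_plus:
 assumes "!!i. i \<in> I ==> q i <: R" "!!i. i \<in> I ==> q' i <: R" "!!i. i \<in> I ==> c i <: R"
 shows "dot R I (%i. q i \<oplus> q' i) c = dot R I q c \<oplus> dot R I q' c"
proof -
 have "dot R I (%i. q i \<oplus> q' i) c = (\<Oplus>i\<in>I. q i \<otimes> c i \<oplus> q' i \<otimes> c i)"
  unfolding dot_def using assms by (intro finsum_eqI) (auto simp: l_distr)
 then show ?thesis unfolding dot_def using assms by (simp add: finsum_plus)
qed

lemma dot_plus_right:
 assumes "!!i. i \<in> I ==> q i <: R" "!!i. i \<in> I ==> c' i <: R" "!!i. i \<in> I ==> c i <: R"
 shows "dot R I q (%i. c i \<oplus> c' i) = dot R I q c \<oplus> dot R I q c'"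
proof -
 have "dot R I q (%i. c i \<oplus> c' i) = (\<Oplus>i\<in>I. q i \<otimes> c i \<oplus> q i \<otimes> c' i)"
  unfolding dot_def using assms by (intro finsum_eqI) (auto simp: r_distr)
 then show ?thesis unfolding dot_def using assms by (simp add: finsum_plus)
qed

lemma dot_smult:
 assumes "a <: R" "!!i. i \<in> I ==> q i <: R" "!!i. i \<in> I ==> c i <: R"
 shows "dot R I (%i. a \<otimes> q i) c = a \<otimes> dot R I q c"
 unfolding dot_def using assms by (subst finsum_distr_left) (auto intro!: finsum_eqI simp: m_assoc)

lemma dot_mult_right:
 assumes "a <: R" "!!i. i \<in> I ==> q i <: R" "!!i. i \<in> I ==> c i <: R"
 shows "dot R I q (%i. c i \<otimes> a) = dot R I q c \<otimes> a"
 unfolding dot_def using assms by (subst finsum_distr_right) (auto intro!: finsum_eqI simp: m_assoc)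

lemma vec_mat_dot: "vec_mat R I q A j = dot R I q (%i. A i j)"
 by (simp add: vec_mat_def dot_def)

lemma mat_vec_dot: "mat_vec R J A c i = dot R J (A i) c"
 by (simp add: mat_vec_def dot_def)

lemma mat_mul_row: "mat_mul R J A B i = vec_mat R J (A i) B"
 by (auto simp: mat_mul_def vec_mat_def)

lemma vec_mat_add:
 assumes "!!i. i \<in> I ==> q i <: R" "!!i. i \<in> I ==> q' i <: R" "A \<in> Mat R I J"
 shows "vec_mat R I (%i. q i \<oplus> q' i) A = (%j. vec_mat R I q A j \<oplus> vec_mat R I q' A j)"
 unfolding vec_mat_dot[abs_def] using assms by (intro ext dot_plus) (auto intro: MatD(1)[OF assms(3)])

lemma vec_mat_smult:
 assumes "a <: R" "!!i. i \<in> I ==> q i <: R" "A \<in> Mat R I J"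
 shows "vec_mat R I (%i. a \<otimes> q i) A = (%j. a \<otimes> vec_mat R I q A j)"
 unfolding vec_mat_dot[abs_def] using assms by (intro ext dot_smult) (auto intro: MatD(1)[OF assms(3)])

lemma vec_mat_hom:
 assumes "finite J" "A \<in> Mat R I J"
 shows "(%q. vec_mat R I q A) \<in> mhom R (free_module R I) (free_module R J)"
proof (rule mhomI)
 fix x y assume "x \<in> Vec R I" "y \<in> Vec R I"
 then show "vec_mat R I (x \<oplus>\<^sub>(free_module R I) y) A =
   vec_mat R I x A \<oplus>\<^sub>(free_module R J) vec_mat R I y A"
  unfolding free_module_simps by (intro vec_mat_add[OF _ _ assms(2)]) (auto dest: VecD(1))
next
 fix a x assume "a <: R" "x \<in> Vec R I"
 then show "vec_mat R I (a \<odot>\<^sub>(free_module R I) x) A = a \<odot>\<^sub>(free_module R J) vec_mat R I x A"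
  unfolding free_module_simps by (intro vec_mat_smult[OF _ _ assms(2)]) (auto dest: VecD(1))
qed (use assms in \<open>auto intro!: vec_mat_closed dest: VecD(1)\<close>)

lemma dot_zero_right: "(!!i. i \<in> I ==> c i <: R) ==> dot R I c (%_. \<zero>) = \<zero>"
 unfolding dot_def by (rule finsum_eq_zeroI) auto

end

lemma Vec_all: "q \<in> Vec R I ==> \<forall>i. q i <: R"
 by (auto dest: VecD(1))

section \<open>Projective modules as images of idempotent matrices\<close>

definition row_module :: "('r, 'c) ring_scheme => 'x set => ('x => 'x => 'r) => ('r, 'x => 'r) module" where
 "row_module R I e = (free_module R I)\<lparr>carrier := {q \<in> Vec R I. vec_mat R I q e = q}\<rparr>"

lemma row_module_simps:
 "carrier (row_module R I e) = {q \<in> Vec R I. vec_mat R I q e = q}"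
 "add (row_module R I e) = (%f g x. f x \<oplus>\<^sub>R g x)"
 "zero (row_module R I e) = (%x. \<zero>\<^sub>R)"
 "smult (row_module R I e) = (%a f x. a \<otimes>\<^sub>R f x)"
 by (auto simp: row_module_def free_module_simps)

context ring
begin

lemma vec_mat_zero: "A \<in> Mat R I J ==> vec_mat R I (%_. \<zero>) A = (%_. \<zero>)"
 using MatD(1)[of A R I J] by (auto simp: vec_mat_def intro!: finsum_eq_zeroI)

lemma lmodule_row:
 assumes I: "finite I" and e: "e \<in> Mat R I I"
 shows "lmodule R (row_module R I e)"
proof -
 let ?P = "row_module R I e"
 interpret F: lmodule R "free_module R I" by (rule lmodule_free[OF ring_axioms])
 note h = vec_mat_hom[OF I e]
 have zero: "(%_. \<zero>) <: ?P"
  using F.M.zero_closed vec_mat_zero[OF e] by (simp add: row_module_simps free_module_simps)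
 have add: "(%x. f x \<oplus> g x) <: ?P" if "f <: ?P" "g <: ?P" for f g
  using that F.M.a_closed[of f g] mhom_add[OF h, of f g]
  by (simp add: row_module_simps free_module_simps)
 have sm: "(%x. a \<otimes> f x) <: ?P" if "a <: R" "f <: ?P" for a f
  using that F.lsmult_closed[of a f] mhom_smult[OF h, of a f]
  by (simp add: row_module_simps free_module_simps)
 have cl: "f x <: R" if "f <: ?P" for f x
  using that VecD(1) by (auto simp: row_module_simps)
 have "abelian_group ?P"
 proof (rule abelian_groupI)
  fix f assume f: "f <: ?P"
  have "(%x. \<ominus> \<one> \<otimes> f x) \<oplus>\<^sub>?P f = \<zero>\<^sub>?P"
   using cl[OF f] by (simp add: row_module_simps l_minus l_neg)
  then show "\<exists>g\<in>carrier ?P. g \<oplus>\<^sub>?P f = \<zero>\<^sub>?P"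
   using sm[OF _ f, of "\<ominus> \<one>"] by blast
 qed (use zero add cl in \<open>simp_all add: row_module_simps(2,3) a_ac\<close>)
 then show ?thesis
  by (intro lmodule.intro lmodule_axioms.intro ring_axioms)
   (use sm cl in \<open>simp_all add: row_module_simps(2,4) l_distr r_distr m_assoc\<close>)
qed

lemma row_module_eval_finsum:
 assumes "finite I" "e \<in> Mat R I I" "!!i. i \<in> S ==> f i <: (row_module R I e)"
 shows "finsum (row_module R I e) f S y = (\<Oplus>i\<in>S. f i y)"
proof -
 interpret P: lmodule R "row_module R I e" using lmodule_row[OF assms(1,2)] .
 have "additive (row_module R I e) R (%f. f y)"
  by (rule additiveI) (auto simp: row_module_simps dest: VecD(1))
 from additive_finsum[OF P.M.ag is_abelian_group this, of f S] assms(3)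
 show ?thesis by (simp add: Pi_def)
qed

lemma idempotent_row:
 assumes "finite I" "e \<in> Mat R I I" "mat_mul R I e e = e"
 shows "e i <: (row_module R I e)"
 using assms Mat_row[OF assms(1,2)] by (simp add: row_module_simps mat_mul_row[symmetric])

lemma vec_mat_in_row:
 assumes "finite I" "finite J" "A \<in> Mat R I J" "e \<in> Mat R J J" "mat_mul R J A e = A" "q \<in> Vec R I"
 shows "vec_mat R I q A <: (row_module R J e)"
 using assms vec_mat_assoc[OF assms(1,2) _ assms(3,4), of q] vec_mat_closed[OF assms(2) _ assms(3), of I q]
  VecD(1)[OF assms(6)] by (simp add: row_module_simps)

text \<open>Read row by row, q e = q expresses q through the rows of e with the entries of q as
  coefficients.\<close>

lemma row_module_dual_basis:
 assumes I: "finite I" and e: "e \<in> Mat R I I" "mat_mul R I e e = e"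
 shows "dual_basis R (row_module R I e) I e (%i q. q i)"
proof (rule dual_basisI[OF lmodule_row[OF I e(1)]])
 fix i assume "i \<in> I"
 show "e i <: (row_module R I e)" using idempotent_row[OF I e] .
 show "(%q. q i) \<in> mhom R (row_module R I e) (reg R)"
  by (rule mhomI) (auto simp: row_module_simps dest: VecD(1))
next
 interpret P: lmodule R "row_module R I e" using lmodule_row[OF I e(1)] .
 fix q assume q: "q <: (row_module R I e)"
 have qc: "q i <: R" for i using q by (auto simp: row_module_simps dest: VecD(1))
 have "q j = (\<Oplus>\<^sub>(row_module R I e)i\<in>I. q i \<odot>\<^sub>(row_module R I e) e i) j" for j
 proof -
  have "(\<Oplus>\<^sub>(row_module R I e)i\<in>I. q i \<odot>\<^sub>(row_module R I e) e i) j = (\<Oplus>i\<in>I. (q i \<odot>\<^sub>(row_module R I e) e i) j)"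
   using P.lsmult_closed[OF qc idempotent_row[OF I e]] by (intro row_module_eval_finsum[OF I e(1)])
  also have "... = vec_mat R I q e j" by (simp add: row_module_simps vec_mat_def)
  finally show ?thesis using q by (simp add: row_module_simps)
 qed
 then have "q = (\<Oplus>\<^sub>(row_module R I e)i\<in>I. q i \<odot>\<^sub>(row_module R I e) e i)" by (rule ext)
 then show "\<exists>S. finite S \<and> S \<subseteq> I \<and> (\<forall>b\<in>I - S. q b = \<zero>) \<and>
   q = (\<Oplus>\<^sub>(row_module R I e)b\<in>S. q b \<odot>\<^sub>(row_module R I e) e b)"
  using I by (intro exI[of _ I] conjI) auto
qed

text \<open>\<open>dual_basis_projective\<close> needs an injection of the index set into the type
  of rows. The functions with value \<open>a\<close> at one index and \<open>b\<close> elsewhere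
  provide it, so \<open>a\<close> and \<open>b\<close> are just two distinct values of the type of
  scalars.\<close>

lemma row_module_projective:
 assumes I: "finite (I :: 'x set)" and e: "e \<in> Mat R I I" "mat_mul R I e e = e"
  and ab: "a \<noteq> (b :: 'a)"
 shows "projective_module R (row_module R I e)"
proof (rule dual_basis_projective[OF lmodule_row[OF I e(1)] row_module_dual_basis[OF I e]])
 show "inj_on (%i x. if x = i then a else b) I"
  using ab by (auto simp: inj_on_def fun_eq_iff)
qed

lemma row_module_fg:
 assumes I: "finite I" and e: "e \<in> Mat R I I" "mat_mul R I e e = e"
 shows "finitely_generated_module R (row_module R I e)"
proof -
 let ?P = "row_module R I e"
 interpret P: lmodule R ?P using lmodule_row[OF I e(1)] .
 have sub: "e ` I \<subseteq> carrier ?P" using idempotent_row[OF I e] by auto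
 have "carrier ?P \<subseteq> N" if N: "submodule N R ?P" "e ` I \<subseteq> N" for N
 proof
  fix q assume q: "q <: ?P"
  interpret N: submodule N R ?P by (rule N)
  have qc: "q i <: R" for i using q by (auto simp: row_module_simps dest: VecD(1))
  have "finsum ?P (%i. q i \<odot>\<^sub>?P e i) S \<in> N" if "finite S" "S \<subseteq> I" for S
   using that
  proof (induction S rule: finite_induct)
   case empty
   then show ?case using N.one_closed by simp
  next
   case (insert x F)
   have "q x \<odot>\<^sub>?P e x \<in> N" using insert.prems N(2) qc by (intro N.smult_closed) auto
   moreover have "finsum ?P (%i. q i \<odot>\<^sub>?P e i) F \<in> N" using insert by auto
   moreover have "finsum ?P (%i. q i \<odot>\<^sub>?P e i) (insert x F) =
     q x \<odot>\<^sub>?P e x \<oplus>\<^sub>?P finsum ?P (%i. q i \<odot>\<^sub>?P e i) F"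
    using insert P.lsmult_closed[OF qc idempotent_row[OF I e]] by (intro P.M.finsum_insert) auto
   ultimately show ?case using N.m_closed by simp
  qed
  moreover have "finsum ?P (%i. q i \<odot>\<^sub>?P e i) I = q"
   by (rule dual_basis_sum[OF P.lmodule_axioms row_module_dual_basis[OF I e] q]) (use I in auto)
  ultimately show "q \<in> N" using I by force
 qed
 moreover have "submodule (carrier ?P) R ?P"
  by (intro submodule.intro submodule_axioms.intro P.M.add.group_incl_imp_subgroup P.lsmult_closed)
   (auto intro!: P.M.a_group)
 ultimately have "submodule_generated R ?P (e ` I) = carrier ?P"
  using sub unfolding submodule_generated_def by blast
 then show ?thesis unfolding finitely_generated_module_def using I sub by blast
qed

end

text \<open>
 The idempotent matrix \<open>e i\<close> describes the projective module of all rows \<open>q\<close> with \<open>q e = q\<close>, the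
 matrix \<open>D i\<close> the differential in degree \<open>i + 1\<close>, and \<open>m\<close> the augmentation.
\<close>

definition mcomplex ::
  "('r, 'c) ring_scheme => (nat => 'x set) => (nat => 'x => 'x => 'r) => (nat => 'x => 'x => 'r) => bool" where
 "mcomplex R I e D \<longleftrightarrow> (\<forall>i. finite (I i)) \<and> (\<forall>i. e i \<in> Mat R (I i) (I i)) \<and>
   (\<forall>i. D i \<in> Mat R (I (Suc i)) (I i)) \<and> (\<forall>i. mat_mul R (I i) (e i) (e i) = e i) \<and>
   (\<forall>i. mat_mul R (I (Suc i)) (e (Suc i)) (D i) = D i) \<and> (\<forall>i. mat_mul R (I i) (D i) (e i) = D i) \<and>
   (\<forall>i. mat_mul R (I (Suc i)) (D (Suc i)) (D i) = (%_ _. \<zero>\<^sub>R))"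

lemma mcomplexD:
 assumes "mcomplex R I e D"
 shows "finite (I i)" "e i \<in> Mat R (I i) (I i)" "D i \<in> Mat R (I (Suc i)) (I i)"
  "mat_mul R (I i) (e i) (e i) = e i" "mat_mul R (I (Suc i)) (e (Suc i)) (D i) = D i"
  "mat_mul R (I i) (D i) (e i) = D i" "mat_mul R (I (Suc i)) (D (Suc i)) (D i) = (%_ _. \<zero>\<^sub>R)"
 using assms by (auto simp: mcomplex_def)

definition row_exact ::
  "('r, 'c) ring_scheme => (nat => 'x set) => (nat => 'x => 'x => 'r) => (nat => 'x => 'x => 'r) => nat => bool" where
 "row_exact R I e D i \<longleftrightarrow>
   (\<forall>q\<in>Vec R (I (Suc i)). vec_mat R (I (Suc i)) q (e (Suc i)) = q \<longrightarrow>
    vec_mat R (I (Suc i)) q (D i) = (%_. \<zero>\<^sub>R) \<longrightarrow>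
    (\<exists>p\<in>Vec R (I (Suc (Suc i))). q = vec_mat R (I (Suc (Suc i))) p (D (Suc i))))"

text \<open>Matrix form of a projective resolution of \<open>M\<close>. Preimages are sought among
  all rows p and not only those with p e = p; this is the same because p D = (p e) D.\<close>

definition mres ::
  "('r, 'c) ring_scheme => ('r, 'm, 'd) module_scheme => (nat => 'x set) => (nat => 'x => 'x => 'r) =>
   (nat => 'x => 'x => 'r) => ('x => 'm) => bool" where
 "mres R M I e D m \<longleftrightarrow> mcomplex R I e D \<and> (\<forall>j\<in>I 0. m j <: M) \<and>
   (\<forall>j\<in>I 0. lcomb M (I 0) (e 0 j) m = m j) \<and>
   (\<forall>j\<in>I (Suc 0). lcomb M (I 0) (D 0 j) m = \<zero>\<^sub>M) \<and>
   (\<forall>x\<in>carrier M. \<exists>q\<in>Vec R (I 0). x = lcomb M (I 0) q m) \<and>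
   (\<forall>q\<in>Vec R (I 0). vec_mat R (I 0) q (e 0) = q \<longrightarrow> lcomb M (I 0) q m = \<zero>\<^sub>M \<longrightarrow>
    (\<exists>p\<in>Vec R (I (Suc 0)). q = vec_mat R (I (Suc 0)) p (D 0))) \<and>
   (\<forall>i. row_exact R I e D i)"

lemma mresD:
 assumes "mres R M I e D m"
 shows "mcomplex R I e D" "!!j. j \<in> I 0 ==> m j <: M"
  "!!j. j \<in> I 0 ==> lcomb M (I 0) (e 0 j) m = m j"
  "!!j. j \<in> I (Suc 0) ==> lcomb M (I 0) (D 0 j) m = \<zero>\<^sub>M"
  "!!x. x <: M ==> \<exists>q\<in>Vec R (I 0). x = lcomb M (I 0) q m"
  "!!q. q \<in> Vec R (I 0) ==> vec_mat R (I 0) q (e 0) = q ==> lcomb M (I 0) q m = \<zero>\<^sub>M ==>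
    \<exists>p\<in>Vec R (I (Suc 0)). q = vec_mat R (I (Suc 0)) p (D 0)"
  "!!i. row_exact R I e D i"
 using assms by (auto simp: mres_def)

context lmodule
begin

lemma lcomb_closed:
 "(!!i. i \<in> I ==> q i <: R) ==> (!!i. i \<in> I ==> m i <: M) ==>
  lcomb M I q m <: M"
 unfolding lcomb_def by (intro M.finsum_in lsmult_closed) auto

lemma lcomb_hom:
 assumes m: "!!i. i \<in> I ==> m i <: M"
 shows "(%q. lcomb M I q m) \<in> mhom R (free_module R I) M"
proof (rule mhomI)
 fix q assume "q \<in> Vec R I"
 then show "lcomb M I q m <: M" using m by (intro lcomb_closed) (auto dest: VecD(1))
next
 fix q q' assume q: "q \<in> Vec R I" "q' \<in> Vec R I"
 note c = VecD(1)[OF q(1)] VecD(1)[OF q(2)]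
 have "lcomb M I (q \<oplus>\<^sub>(free_module R I) q') m = (\<Oplus>\<^sub>M i\<in>I. q i \<odot>\<^sub>M m i \<oplus>\<^sub>M q' i \<odot>\<^sub>M m i)"
  unfolding lcomb_def free_module_simps using c m
  by (intro M.finsum_eqI) (auto simp: lsmult_l_distr lsmult_closed)
 also have "... = lcomb M I q m \<oplus>\<^sub>M lcomb M I q' m"
  unfolding lcomb_def using c m by (intro M.finsum_plus lsmult_closed)
 finally show "lcomb M I (q \<oplus>\<^sub>(free_module R I) q') m = lcomb M I q m \<oplus>\<^sub>M lcomb M I q' m" .
next
 fix a q assume a: "a <: R" and q: "q \<in> Vec R I"
 note c = VecD(1)[OF q]
 show "lcomb M I (a \<odot>\<^sub>(free_module R I) q) m = a \<odot>\<^sub>M lcomb M I q m"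
  unfolding lcomb_def free_module_simps using c m a
  by (subst finsum_lsmult) (auto intro!: M.finsum_eqI simp: lsmult_assoc lsmult_closed)
qed

lemma lcomb_vec_mat:
 assumes "finite I" "finite J" "!!i. i \<in> I ==> q i <: R" "A \<in> Mat R I J"
  "!!j. j \<in> J ==> m j <: M"
 shows "lcomb M J (vec_mat R I q A) m = lcomb M I q (%i. lcomb M J (A i) m)"
proof -
 note A = MatD(1)[OF assms(4)]
 have "lcomb M J (vec_mat R I q A) m = (\<Oplus>\<^sub>M j\<in>J. \<Oplus>\<^sub>M i\<in>I. q i \<odot>\<^sub>M (A i j \<odot>\<^sub>M m j))"
  unfolding lcomb_def vec_mat_def
 proof (rule M.finsum_eqI)
  fix j assume j: "j \<in> J"
  have "(\<Oplus>\<^sub>R i\<in>I. q i \<otimes>\<^sub>R A i j) \<odot>\<^sub>M m j = (\<Oplus>\<^sub>M i\<in>I. (q i \<otimes>\<^sub>R A i j) \<odot>\<^sub>M m j)"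
   using assms(3,5) A j by (intro finsum_lsmult_left) auto
  also have "... = (\<Oplus>\<^sub>M i\<in>I. q i \<odot>\<^sub>M (A i j \<odot>\<^sub>M m j))"
   using assms(3,5) A j by (intro M.finsum_eqI) (auto simp: lsmult_assoc lsmult_closed)
  finally show "(\<Oplus>\<^sub>R i\<in>I. q i \<otimes>\<^sub>R A i j) \<odot>\<^sub>M m j = (\<Oplus>\<^sub>M i\<in>I. q i \<odot>\<^sub>M (A i j \<odot>\<^sub>M m j))" .
  show "(\<Oplus>\<^sub>M i\<in>I. q i \<odot>\<^sub>M (A i j \<odot>\<^sub>M m j)) <: M"
   using assms(3,5) A j by (intro M.finsum_in lsmult_closed) auto
 qed
 also have "... = (\<Oplus>\<^sub>M i\<in>I. \<Oplus>\<^sub>M j\<in>J. q i \<odot>\<^sub>M (A i j \<odot>\<^sub>M m j))"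
  using assms A by (intro M.finsum_swap lsmult_closed) auto
 also have "... = lcomb M I q (%i. lcomb M J (A i) m)"
  unfolding lcomb_def using assms A
  by (intro M.finsum_eqI) (auto intro!: finsum_lsmult[symmetric] M.finsum_in lsmult_closed)
 finally show ?thesis .
qed

lemma lcomb_cong:
 "(!!i. i \<in> I ==> m i = m' i) ==> (!!i. i \<in> I ==> q i <: R) ==> (!!i. i \<in> I ==> m' i <: M) ==>
  lcomb M I q m = lcomb M I q m'"
 unfolding lcomb_def by (intro M.finsum_eqI lsmult_closed) auto

lemma lcomb_zero:
 "(!!i. i \<in> I ==> m i = \<zero>\<^sub>M) ==> (!!i. i \<in> I ==> q i <: R) ==> lcomb M I q m = \<zero>\<^sub>M"
 unfolding lcomb_def by (intro M.finsum_eq_zeroI) (auto simp: lsmult_zero_right)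

lemma mres_projective_resolution:
 assumes res: "mres R M (I :: nat => 'x set) e D m" and ab: "x \<noteq> (y :: 'a)"
 shows "projective_resolution R M (%i. row_module R (I i) (e i))
  (%i q. vec_mat R (I (Suc i)) q (D i)) (%q. lcomb M (I 0) q m)"
proof -
 note r = mresD[OF res]
 note c = mcomplexD[OF r(1)]
 let ?P = "%i. row_module R (I i) (e i)" and ?d = "%i q. vec_mat R (I (Suc i)) q (D i)"
  and ?eps = "%q. lcomb M (I 0) q m"
 have sub: "carrier (?P i) \<subseteq> Vec R (I i)" for i by (auto simp: row_module_simps)
 have ops: "add (?P i) = add (free_module R (I i))" "smult (?P i) = smult (free_module R (I i))"
  "zero (?P i) = zero (free_module R (I i))" for i
  by (simp_all add: row_module_def)
 have dP: "?d i q <: (?P i)" if "q \<in> Vec R (I (Suc i))" for i q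
  using R.vec_mat_in_row[OF c(1) c(1) c(3) c(2) c(6) that] .
 have dh: "?d i \<in> mhom R (?P (Suc i)) (?P i)" for i
  using R.vec_mat_hom[OF c(1) c(3)[of i]] sub dP unfolding module_hom_def ops
  by (auto simp: subset_iff)
 have eh: "?eps \<in> mhom R (?P 0) M"
  using lcomb_hom[of "I 0" m, OF r(2)] sub[of 0] unfolding module_hom_def ops by (auto simp: subset_iff)
 have proj: "projective_module R (?P i)" for i
  using R.row_module_projective[OF c(1,2,4) ab] .
 have dd: "?d i (?d (Suc i) q) = (%_. \<zero>\<^sub>R)" if "q \<in> Vec R (I (Suc (Suc i)))" for i q
  using R.vec_mat_assoc[of "I (Suc (Suc i))" "I (Suc i)" q "D (Suc i)" "D i", OF c(1) c(1) _ c(3) c(3)] VecD(1)[OF that] c(7)[of i]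
  by (auto simp: vec_mat_def intro!: R.finsum_eq_zeroI)
 have ed: "?eps (?d 0 q) = \<zero>\<^sub>M" if "q \<in> Vec R (I (Suc 0))" for q
  using lcomb_vec_mat[of "I (Suc 0)" "I 0" q "D 0" m, OF c(1) c(1) _ c(3)] VecD(1)[OF that] r(2,4)
  by (simp add: lcomb_zero)
 \<comment> \<open>Replacing p by p e keeps p D, since e D = D, and puts p into the projective
   module.\<close>
 have pe: "?d i p = ?d i (vec_mat R (I (Suc i)) p (e (Suc i)))" "vec_mat R (I (Suc i)) p (e (Suc i)) \<in> carrier (?P (Suc i))"
  if "p \<in> Vec R (I (Suc i))" for p i
  using R.vec_mat_assoc[of "I (Suc i)" "I (Suc i)" p "e (Suc i)" "D i", OF c(1) c(1) _ c(2) c(3)] VecD(1)[OF that] c(5)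
   R.vec_mat_in_row[OF c(1) c(1) c(2) c(2) c(4) that] by simp_all
 have surj: "?eps ` carrier (?P 0) = carrier M"
 proof
  show "?eps ` carrier (?P 0) \<subseteq> carrier M" using mhom_closed[OF eh] by auto
  show "carrier M \<subseteq> ?eps ` carrier (?P 0)"
  proof
   fix z assume "z <: M"
   then obtain q where q: "q \<in> Vec R (I 0)" "z = ?eps q" using r(5) by blast
   have "?eps (vec_mat R (I 0) q (e 0)) = ?eps q"
    using lcomb_vec_mat[of "I 0" "I 0" q "e 0" m, OF c(1) c(1) _ c(2)] VecD(1)[OF q(1)] r(2,3)
    by (auto intro: lcomb_cong)
   then show "z \<in> ?eps ` carrier (?P 0)"
    using q R.vec_mat_in_row[OF c(1) c(1) c(2) c(2) c(4) q(1)] by (metis image_eqI)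
  qed
 qed
 show ?thesis
  unfolding projective_resolution_def
 proof (intro conjI allI proj dh eh surj)
  show "?d 0 ` carrier (?P 1) = {q \<in> carrier (?P 0). ?eps q = \<zero>\<^sub>M}"
  proof
   show "?d 0 ` carrier (?P 1) \<subseteq> {q \<in> carrier (?P 0). ?eps q = \<zero>\<^sub>M}"
    using dP[of _ 0] ed sub[of 1] by auto
   show "{q \<in> carrier (?P 0). ?eps q = \<zero>\<^sub>M} \<subseteq> ?d 0 ` carrier (?P 1)"
   proof
    fix q assume "q \<in> {q \<in> carrier (?P 0). ?eps q = \<zero>\<^sub>M}"
    then obtain p where p: "p \<in> Vec R (I (Suc 0))" "q = ?d 0 p"
     using r(6)[of q] by (auto simp: row_module_simps)
    then show "q \<in> ?d 0 ` carrier (?P 1)" using pe[OF p(1)] by (metis One_nat_def image_eqI)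
   qed
  qed
  show "?d (Suc i) ` carrier (?P (Suc (Suc i))) = {q \<in> carrier (?P (Suc i)). ?d i q = \<zero>\<^sub>(?P i)}" for i
  proof
   show "?d (Suc i) ` carrier (?P (Suc (Suc i))) \<subseteq> {q \<in> carrier (?P (Suc i)). ?d i q = \<zero>\<^sub>(?P i)}"
    using dP[of _ "Suc i"] dd sub[of "Suc (Suc i)"] by (auto simp: row_module_simps(3))
   show "{q \<in> carrier (?P (Suc i)). ?d i q = \<zero>\<^sub>(?P i)} \<subseteq> ?d (Suc i) ` carrier (?P (Suc (Suc i)))"
   proof
    fix q assume "q \<in> {q \<in> carrier (?P (Suc i)). ?d i q = \<zero>\<^sub>(?P i)}"
    then obtain p where p: "p \<in> Vec R (I (Suc (Suc i)))" "q = ?d (Suc i) p"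
     using r(7)[of i] unfolding row_exact_def by (auto simp: row_module_simps)
    then show "q \<in> ?d (Suc i) ` carrier (?P (Suc (Suc i)))" using pe[OF p(1)] by (metis image_eqI)
   qed
  qed
 qed
qed

end

text \<open>A functional f on the rows with q e = q is the same as a column c with e c = c: the
  entries are c_j = f(e_j), and f sends q to q c. Composing f with the differential turns c into D
  c.\<close>

definition mat_cocycles ::
  "('r, 'c) ring_scheme => (nat => 'x set) => (nat => 'x => 'x => 'r) => (nat => 'x => 'x => 'r) => nat => ('x => 'r) set" where
 "mat_cocycles R I e D n =
   {c \<in> Vec R (I n). mat_vec R (I n) (e n) c = c \<and> mat_vec R (I n) (D n) c = (%_. \<zero>\<^sub>R)}"

definition mat_coboundary ::
  "('r, 'c) ring_scheme => (nat => 'x set) => (nat => 'x => 'x => 'r) => nat => ('x => 'r) => bool" where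
 "mat_coboundary R I D n c \<longleftrightarrow>
   (case n of 0 => c = (%_. \<zero>\<^sub>R) | Suc k => \<exists>b\<in>Vec R (I k). c = mat_vec R (I k) (D k) b)"

lemma Ext_mres:
 fixes R (structure) and M :: "('r, 'm, 'd) module_scheme" and n :: nat and I :: "nat => 'x set"
 assumes M: "lmodule R M" and res: "mres R M I e D m" and ab: "a \<noteq> (b :: 'r)"
  and ex: "\<exists>(P :: nat => ('r, ('r, 'm) resolution_carrier) module) \<delta> \<epsilon>. projective_resolution R M P \<delta> \<epsilon>"
 obtains \<Theta> where "presents R (Ext_regular R M n) (I n) (mat_cocycles R I e D n) (mat_coboundary R I D n) \<Theta>"
proof -
 interpret M: lmodule R M by fact
 note r = mresD[OF res]
 note c = mcomplexD[OF r(1)]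
 let ?Q = "%i. row_module R (I i) (e i)" and ?d = "%i q. vec_mat R (I (Suc i)) q (D i)"
 let ?E = "Ext_regular R M n"
 note Q = M.mres_projective_resolution[OF res ab]
 note Q' = resolution_facts[OF Q]
 obtain \<Phi> where \<Phi>: "presents R ?E (carrier (?Q n)) (cochain_cocycles R ?Q ?d n) (is_coboundary R ?Q ?d n) \<Phi>"
  by (rule Ext_regular_resolution[OF M.R.ring_axioms M.M.ag Q ex])
 note P = presentsD[OF \<Phi>]
 define \<phi> where "\<phi> = (%i c q. dot R (I i) q c)"
 have rowV: "q \<in> Vec R (I i)" "vec_mat R (I i) q (e i) = q" if "q <: (?Q i)" for q i
  using that by (auto simp: row_module_simps)
 have hom: "\<phi> i x \<in> mhom R (?Q i) (reg R)" if "x \<in> Vec R (I i)" for i x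
  unfolding \<phi>_def using VecD(1)[OF that]
  by (intro mhomI) (auto simp: row_module_simps(2,4) intro!: M.R.dot_closed M.R.dot_plus M.R.dot_smult dest!: rowV(1) Vec_all)
 have row_e: "e i j <: (?Q i)" for i j using M.R.idempotent_row[OF c(1,2,4)] .
 have row_D: "D i j <: (?Q i)" for i j
  using Mat_row[OF c(1) c(3)[of i], of j] c(6)[of i]
  by (simp add: row_module_simps M.R.mat_mul_row[symmetric])
 have coc: "\<phi> n x \<in> cochain_cocycles R ?Q ?d n" if x: "x \<in> mat_cocycles R I e D n" for x
 proof -
  have xV: "x \<in> Vec R (I n)" using x by (simp add: mat_cocycles_def)
  have "\<phi> n x (?d n q) = \<zero>" if q: "q \<in> carrier (?Q (Suc n))" for q
   using M.R.dot_assoc[of "I (Suc n)" "I n" q "D n" x, OF c(1) c(1) _ c(3)] VecD(1)[OF xV] VecD(1)[OF rowV(1)[OF q]] x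
   by (auto simp: \<phi>_def mat_cocycles_def intro!: M.R.dot_zero_right)
  then show ?thesis using hom[OF xV] by (simp add: cochain_cocycles_def)
 qed
 \<comment> \<open>The column of the values of \<open>f\<close> on the rows of the idempotent
   represents \<open>f\<close>, because these rows form a dual basis.\<close>
 have repr: "\<exists>x\<in>Vec R (I i). (\<forall>j. x j = f (e i j)) \<and> (\<forall>q\<in>carrier (?Q i). f q = \<phi> i x q) \<and> mat_vec R (I i) (e i) x = x"
  if f: "f \<in> mhom R (?Q i) (reg R)" for f i
 proof -
  interpret Qi: lmodule R "?Q i" by (rule Q')
  define x where "x = (%j. f (e i j))"
  have f0: "f (%_. \<zero>) = \<zero>"
   using additive_zero[OF Qi.M.ag lmodule.axioms(2)[OF lmodule_regular[OF M.R.ring_axioms]] mhom_additive[OF f]]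
   by (simp add: row_module_simps)
  have fcl: "f q <: R" if "q <: (?Q i)" for q using mhom_closed[OF f that] by simp
  have "x j = \<zero>" if "j \<notin> I i" for j
  proof -
   have "e i j = (%_. \<zero>)" using MatD(2)[OF c(2) that] by blast
   then show ?thesis using f0 by (simp add: x_def)
  qed
  then have xV: "x \<in> Vec R (I i)" using fcl[OF row_e] by (intro VecI c(1)) (auto simp: x_def)
  have fq: "f q = \<phi> i x q" if q: "q <: (?Q i)" for q
  proof -
   have qc: "q j <: R" for j using VecD(1)[OF rowV(1)[OF q]] .
   have "(\<Oplus>\<^sub>(?Q i)j\<in>I i. q j \<odot>\<^sub>(?Q i) e i j) = q"
    by (rule dual_basis_sum[OF Q'(2) M.R.row_module_dual_basis[OF c(1,2,4)] q]) (use c(1) in auto)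
   note this[symmetric]
   then have "f q = f (\<Oplus>\<^sub>(?Q i)j\<in>I i. q j \<odot>\<^sub>(?Q i) e i j)" by (rule arg_cong)
   also have "... = (\<Oplus>j\<in>I i. f (q j \<odot>\<^sub>(?Q i) e i j))"
    using additive_finsum[OF Qi.M.ag lmodule.axioms(2)[OF lmodule_regular[OF M.R.ring_axioms]] mhom_additive[OF f], of "%j. q j \<odot>\<^sub>(?Q i) e i j" "I i"]
     Qi.lsmult_closed[OF qc row_e] by simp
   also have "... = \<phi> i x q"
    unfolding \<phi>_def dot_def x_def
    by (intro M.R.finsum_eqI) (use mhom_smult[OF f qc row_e] fcl[OF row_e] qc in auto)
   finally show ?thesis .
  qed
  have "mat_vec R (I i) (e i) x = x"
  proof
   fix j
   have "mat_vec R (I i) (e i) x j = \<phi> i x (e i j)" by (simp add: M.R.mat_vec_dot \<phi>_def)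
   also have "... = f (e i j)" by (rule fq[OF row_e, symmetric])
   also have "... = x j" by (simp only: x_def)
   finally show "mat_vec R (I i) (e i) x j = x j" .
  qed
  then show ?thesis using xV fq by (intro bexI[of _ x]) (auto simp: x_def)
 qed
 \<comment> \<open>Padding by zero makes the value depend only on the entries inside
   \<open>I n\<close>, as \<open>presents\<close> demands.\<close>
 define \<Theta> where "\<Theta> = (%x. \<Phi> (\<phi> n (%j. if j \<in> I n then x j else \<zero>)))"
 have \<Theta>: "\<Theta> x = \<Phi> (\<phi> n x)" if "!!j. j \<notin> I n ==> x j = \<zero>" for x
 proof -
  have "(%j. if j \<in> I n then x j else \<zero>) = x" using that by auto
  then show ?thesis by (simp add: \<Theta>_def)
 qed
 have ZV: "x \<in> Vec R (I n)" "x j <: R" "j \<notin> I n ==> x j = \<zero>" if "x \<in> mat_cocycles R I e D n" for x j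
  using that VecD by (auto simp: mat_cocycles_def)
 have \<Theta>Z: "\<Theta> x = \<Phi> (\<phi> n x)" if "x \<in> mat_cocycles R I e D n" for x
  by (rule \<Theta>) (rule ZV(3)[OF that])
 have "presents R ?E (I n) (mat_cocycles R I e D n) (mat_coboundary R I D n) \<Theta>"
  unfolding presents_def
 proof (intro conjI ballI allI impI)
  show "abelian_group ?E" by (rule P)
  show "carrier ?E = \<Theta> ` mat_cocycles R I e D n"
  proof
   show "\<Theta> ` mat_cocycles R I e D n \<subseteq> carrier ?E" using coc unfolding P(2) by (auto simp: \<Theta>Z)
   show "carrier ?E \<subseteq> \<Theta> ` mat_cocycles R I e D n"
   proof
    fix y assume "y <: ?E"
    then obtain f where f: "f \<in> cochain_cocycles R ?Q ?d n" "y = \<Phi> f" unfolding P(2) by blast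
    then have fh: "f \<in> mhom R (?Q n) (reg R)" by (simp add: cochain_cocycles_def)
    obtain x where x: "x \<in> Vec R (I n)" "!!j. x j = f (e n j)" "!!q. q <: (?Q n) ==> f q = \<phi> n x q"
     "mat_vec R (I n) (e n) x = x" using repr[OF fh] by blast
    have "mat_vec R (I n) (D n) x i = \<zero>" for i
    proof -
     have "mat_vec R (I n) (D n) x i = f (D n i)" using x(3)[OF row_D] by (simp add: M.R.mat_vec_dot \<phi>_def)
     also have "D n i = ?d n (e (Suc n) i)"
      using c(5)[of n] by (metis M.R.mat_mul_row)
     also have "f ... = \<zero>" using f(1) row_e by (auto simp: cochain_cocycles_def)
     finally show ?thesis .
    qed
    then have xZ: "x \<in> mat_cocycles R I e D n" using x(1,4) by (simp add: mat_cocycles_def fun_eq_iff)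
    have "\<Theta> x = y" unfolding \<Theta>Z[OF xZ] f(2) by (rule P(6)) (rule x(3)[symmetric])
    with xZ show "y \<in> \<Theta> ` mat_cocycles R I e D n" by blast
   qed
  qed
  fix x assume x: "x \<in> mat_cocycles R I e D n"
  show "\<Theta> (%i. x i \<oplus> y i) = \<Theta> x \<oplus>\<^sub>?E \<Theta> y" if y: "y \<in> mat_cocycles R I e D n" for y
  proof -
   have "\<Theta> (%i. x i \<oplus> y i) = \<Phi> (%q. \<phi> n x q \<oplus> \<phi> n y q)"
    using ZV(3)[OF x] ZV(3)[OF y] ZV(2)[OF x] ZV(2)[OF y]
    by (subst \<Theta>) (auto intro!: P(6) M.R.dot_plus_right dest!: rowV(1) Vec_all simp: \<phi>_def)
   then show ?thesis using P(3)[OF coc[OF x] coc[OF y]] x y by (simp add: \<Theta>Z)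
  qed
  show "\<Theta> (%i. x i \<otimes> s) = s \<odot>\<^sub>?E \<Theta> x" if s: "s <: R" for s
  proof -
   have "\<Theta> (%i. x i \<otimes> s) = \<Phi> (%q. \<phi> n x q \<otimes> s)"
    using ZV(3)[OF x] ZV(2)[OF x] s
    by (subst \<Theta>) (auto intro!: P(6) M.R.dot_mult_right dest!: rowV(1) Vec_all simp: \<phi>_def)
   then show ?thesis using P(4)[OF coc[OF x] s] x by (simp add: \<Theta>Z)
  qed
  have xe: "x j = \<phi> n x (e n j)" for j
   using x by (simp add: mat_cocycles_def \<phi>_def M.R.mat_vec_dot[symmetric])
  have "is_coboundary R ?Q ?d n (\<phi> n x) \<longleftrightarrow> mat_coboundary R I D n x"
  proof (cases n)
   case 0
   have "is_coboundary R ?Q ?d n (\<phi> n x) \<longleftrightarrow> x = (%_. \<zero>)"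
   proof
    assume "is_coboundary R ?Q ?d n (\<phi> n x)"
    then show "x = (%_. \<zero>)" using xe row_e[of n] 0 by (auto simp: is_coboundary_def fun_eq_iff)
   next
    assume "x = (%_. \<zero>)"
    then show "is_coboundary R ?Q ?d n (\<phi> n x)"
     using 0 by (auto simp: is_coboundary_def \<phi>_def intro!: M.R.dot_zero_right dest!: rowV(1) Vec_all)
   qed
   then show ?thesis using 0 by (simp add: mat_coboundary_def)
  next
   case (Suc k)
   have de: "?d k (e n j) = D k j" for j
    using c(5)[of k] Suc by (metis M.R.mat_mul_row)
   show ?thesis
   proof
    assume "is_coboundary R ?Q ?d n (\<phi> n x)"
    then obtain f where f: "f \<in> mhom R (?Q k) (reg R)"
     "!!q. q <: (?Q n) ==> \<phi> n x q = f (?d k q)" using Suc by (auto simp: is_coboundary_def)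
    obtain y where y: "y \<in> Vec R (I k)" "!!q. q <: (?Q k) ==> f q = \<phi> k y q"
     using repr[OF f(1)] by blast
    have "x j = mat_vec R (I k) (D k) y j" for j
     using xe[of j] f(2)[OF row_e, of j] de[of j] y(2)[OF row_D, of j]
     by (simp add: M.R.mat_vec_dot \<phi>_def)
    then show "mat_coboundary R I D n x" using y(1) Suc by (auto simp: mat_coboundary_def)
   next
    assume "mat_coboundary R I D n x"
    then obtain y where y: "y \<in> Vec R (I k)" "x = mat_vec R (I k) (D k) y"
     using Suc by (auto simp: mat_coboundary_def)
    have "\<phi> n x q = \<phi> k y (?d k q)" if q: "q <: (?Q n)" for q
     unfolding \<phi>_def y(2) using M.R.dot_assoc[of "I (Suc k)" "I k" q "D k" y, OF c(1) c(1) _ c(3)] VecD(1)[OF rowV(1)[OF q]]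
      VecD(1)[OF y(1)] Suc by simp
    then show "is_coboundary R ?Q ?d n (\<phi> n x)"
     using hom[OF y(1)] Suc by (auto simp: is_coboundary_def intro!: bexI[of _ "\<phi> k y"])
   qed
  qed
  then show "\<Theta> x = \<zero>\<^sub>?E \<longleftrightarrow> mat_coboundary R I D n x" unfolding \<Theta>Z[OF x] using P(5)[OF coc[OF x]] by simp
 next
  fix x y :: "'x => 'r" assume "\<forall>i\<in>I n. x i = y i"
  then have "(%j. if j \<in> I n then x j else \<zero>) = (%j. if j \<in> I n then y j else \<zero>)" by auto
  then show "\<Theta> x = \<Theta> y" by (simp add: \<Theta>_def)
 qed
 then show thesis by (rule that)
qed

section \<open>Matrices of a finitely generated projective resolution\<close>

text \<open>The identity lifts through the surjection from the free module on the generators; the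
  resulting dual basis is reindexed by a finite subset of the given infinite type. The zero module
  gets the empty index set, so that a bounded resolution yields a bounded matrix complex.\<close>

lemma finite_dual_basis:
 fixes P :: "('r, 'u, 'd) module_scheme"
 assumes proj: "projective_module R P" and fg: "finitely_generated_module R P"
  and inf: "infinite (UNIV :: 'x set)"
 obtains J :: "'x set" and x \<phi> where "finite J" "dual_basis R P J x \<phi>" "carrier P = {\<zero>\<^sub>P} ==> J = {}"
proof -
 interpret P: lmodule R P using proj by (simp add: projective_module_def)
 have rR: "ring R" by unfold_locales
 show thesis
 proof (cases "carrier P = {\<zero>\<^sub>P}")
  case True
  have "dual_basis R P ({} :: 'x set) (%_. \<zero>\<^sub>P) (%_ _. \<zero>\<^sub>R)"
   using True by (intro dual_basisI P.lmodule_axioms) (auto intro!: exI[of _ "{}"])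
  then show ?thesis by (rule that[rotated]) auto
 next
  case False
  obtain G where G: "finite G" "G \<subseteq> carrier P" "submodule_generated R P G = carrier P"
   using fg by (auto simp: finitely_generated_module_def)
  let ?F = "free_module R G"
  interpret F: lmodule R ?F using lmodule_free[OF rR] .
  obtain h where h: "h \<in> mhom R ?F P"
   "!!f S. f <: ?F ==> finite S ==> S \<subseteq> G ==> {g\<in>G. f g \<noteq> \<zero>\<^sub>R} \<subseteq> S ==>
    h f = (\<Oplus>\<^sub>P g\<in>S. f g \<odot>\<^sub>P g)"
   using dual_basis_extend[OF F.lmodule_axioms P.lmodule_axioms dual_basis_free[OF rR], of "%g. g"] G(2)
   by blast
  have hadd: "additive ?F P h" by (rule mhom_additive[OF h(1)])
  have "submodule (h ` carrier ?F) R P"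
  proof (intro submodule.intro submodule_axioms.intro)
   show "subgroup (h ` carrier ?F) (add_monoid P)"
   proof (rule group.subgroupI[OF P.M.a_group])
    show "h ` carrier ?F \<subseteq> carrier (add_monoid P)" using mhom_closed[OF h(1)] by auto
    show "h ` carrier ?F \<noteq> {}" using F.M.zero_closed by blast
    fix y assume "y \<in> h ` carrier ?F"
    then obtain f where f: "f <: ?F" "y = h f" by blast
    have "\<ominus>\<^sub>P y = h (\<ominus>\<^sub>?F f)"
     using additive_neg[OF F.M.ag P.M.ag hadd f(1)] f(2) by simp
    then show "inv\<^sub>(add_monoid P) y \<in> h ` carrier ?F" using f(1) by (simp add: a_inv_def[symmetric])
    fix z assume "z \<in> h ` carrier ?F"
    then obtain g where g: "g <: ?F" "z = h g" by blast
    have "y \<oplus>\<^sub>P z = h (f \<oplus>\<^sub>?F g)" using f g mhom_add[OF h(1) f(1) g(1)] by simp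
    then show "y \<otimes>\<^sub>(add_monoid P) z \<in> h ` carrier ?F" using F.M.a_closed[OF f(1) g(1)] by simp
   qed
   fix a y assume a: "a <: R" and "y \<in> h ` carrier ?F"
   then obtain f where f: "f <: ?F" "y = h f" by blast
   have "a \<odot>\<^sub>P y = h (a \<odot>\<^sub>?F f)" unfolding f(2) using mhom_smult[OF h(1) a f(1)] by simp
   then show "a \<odot>\<^sub>P y \<in> h ` carrier ?F" using F.lsmult_closed[OF a f(1)] by blast
  qed
  moreover have "G \<subseteq> h ` carrier ?F"
  proof
   fix g assume g: "g \<in> G"
   have "h (basis_vector R g) = (\<Oplus>\<^sub>P g'\<in>{g}. basis_vector R g g' \<odot>\<^sub>P g')"
    using g basis_vector_in_free[OF rR g] by (intro h(2)) (auto simp: basis_vector_def)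
   then have "h (basis_vector R g) = g" using g G(2) by (auto simp: basis_vector_def P.lsmult_one)
   then show "g \<in> h ` carrier ?F" using basis_vector_in_free[OF rR g] by (metis image_eqI)
  qed
  ultimately have surj: "carrier P \<subseteq> h ` carrier ?F"
   using G(3) unfolding submodule_generated_def by blast
  have id: "(%x. x) \<in> mhom R P P" by (auto simp: module_hom_def)
  obtain s where s: "s \<in> mhom R P ?F" "!!p. p <: P ==> h (s p) = p"
   using projective_lift[OF proj F.lmodule_axioms P.M.ag h(1) id] surj by blast
  obtain J :: "'x set" where J: "finite J" "card J = card G"
   using infinite_arbitrarily_large[OF inf] by metis
  then obtain f where f: "bij_betw f J G" using finite_same_card_bij[OF J(1) G(1)] by blast
  have fJ: "f j \<in> G" if "j \<in> J" for j using f that by (auto simp: bij_betw_def)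
  have "dual_basis R P J f (%j p. s p (f j))"
  proof (rule dual_basisI[OF P.lmodule_axioms])
   show "f j <: P" if "j \<in> J" for j using fJ[OF that] G(2) by auto
   show "(%p. s p (f j)) \<in> mhom R P (reg R)" if "j \<in> J" for j
    using mhom_comp[OF s(1) dual_basis_hom[OF dual_basis_free[OF rR] fJ[OF that]]] .
   fix p assume p: "p <: P"
   have sp: "s p <: ?F" using mhom_closed[OF s(1) p] .
   have cl: "s p g \<odot>\<^sub>P g <: P" if "g \<in> G" for g
    using that VecD(1)[OF sp] G(2) by (intro P.lsmult_closed) auto
   have "h (s p) = (\<Oplus>\<^sub>P g\<in>f ` J. s p g \<odot>\<^sub>P g)"
    using h(2)[OF sp G(1)] f by (auto simp: bij_betw_def)
   also have "... = (\<Oplus>\<^sub>P j\<in>J. s p (f j) \<odot>\<^sub>P f j)"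
    using f cl fJ by (intro P.M.finsum_reindex) (auto simp: bij_betw_def)
   finally have "p = (\<Oplus>\<^sub>P j\<in>J. s p (f j) \<odot>\<^sub>P f j)" using s(2)[OF p] by simp
   then show "\<exists>S. finite S \<and> S \<subseteq> J \<and> (\<forall>j\<in>J - S. s p (f j) = \<zero>\<^sub>R) \<and> p = (\<Oplus>\<^sub>P j\<in>S. s p (f j) \<odot>\<^sub>P f j)"
    using J by (intro exI[of _ J] conjI) auto
  qed
  then show ?thesis using that J(1) False by blast
 qed
qed

text \<open>Coordinates \<open>coo\<close> embed \<open>P n\<close> into rows, and combinations
  \<open>comb\<close> retract rows onto it. The idempotent is \<open>coo\<close> after
  \<open>comb\<close>; the rows of \<open>D n\<close> are the coordinates of the images of the
  generators under the differential.\<close>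

lemma mres_exists:
 fixes M :: "('r, 'm, 'd) module_scheme"
 assumes M: "lmodule R M" and P: "projective_resolution R M P \<delta> \<epsilon>"
  and fg: "!!n. finitely_generated_module R (P n)" and inf: "infinite (UNIV :: 'x set)"
 obtains I :: "nat => 'x set" and e D m where "mres R M I e D m"
  "!!n. carrier (P n) = {\<zero>\<^sub>(P n)} ==> I n = {}"
proof -
 interpret M: lmodule R M by fact
 note P' = resolution_facts[OF P]
 have lm: "lmodule R (P n)" for n by (rule P')
 have ex: "\<exists>t. finite (fst t :: 'x set) \<and> dual_basis R (P n) (fst t) (fst (snd t)) (snd (snd t)) \<and>
   (carrier (P n) = {\<zero>\<^sub>(P n)} \<longrightarrow> fst t = {})" for n
 proof -
  obtain J :: "'x set" and x \<phi> where "finite J" "dual_basis R (P n) J x \<phi>" "carrier (P n) = {\<zero>\<^sub>(P n)} ==> J = {}"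
   using finite_dual_basis[OF P'(1) fg inf, of n] by blast
  then show ?thesis by (intro exI[of _ "(J, x, \<phi>)"]) auto
 qed
 from choice[OF allI[OF ex]] obtain t where
  t: "\<forall>n. finite (fst (t n) :: 'x set) \<and> dual_basis R (P n) (fst (t n)) (fst (snd (t n))) (snd (snd (t n))) \<and>
   (carrier (P n) = {\<zero>\<^sub>(P n)} \<longrightarrow> fst (t n) = {})" by (rule exE)
 define J where "J = (%n. fst (t n))"
 define x where "x = (%n. fst (snd (t n)))"
 define \<phi> where "\<phi> = (%n. snd (snd (t n)))"
 have J: "finite (J n)" and db: "dual_basis R (P n) (J n) (x n) (\<phi> n)"
  and J0: "carrier (P n) = {\<zero>\<^sub>(P n)} ==> J n = {}" for n
  using t by (auto simp: J_def x_def \<phi>_def)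
 note xc = dual_basis_closed[OF db] and \<phi>c = dual_basis_coord[OF db] and \<phi>h = dual_basis_hom[OF db]
 define coo where "coo = (%n p k. if k \<in> J n then \<phi> n k p else \<zero>\<^sub>R)"
 define comb where "comb = (%n q. lcomb (P n) (J n) q (x n))"
 have coo: "coo n p \<in> Vec R (J n)" if "p <: (P n)" for n p
  using that \<phi>c J by (intro VecI) (auto simp: coo_def)
 have comb: "comb n q <: (P n)" if "q \<in> Vec R (J n)" for n q
  unfolding comb_def using VecD(1)[OF that] xc by (intro lmodule.lcomb_closed[OF lm]) auto
 have cc: "comb n (coo n p) = p" if p: "p <: (P n)" for n p
 proof -
  interpret Pn: lmodule R "P n" by (rule lm)
  have "comb n (coo n p) = (\<Oplus>\<^sub>(P n)j\<in>J n. \<phi> n j p \<odot>\<^sub>(P n) x n j)"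
   unfolding comb_def lcomb_def using p \<phi>c xc Pn.lsmult_closed
   by (intro Pn.M.finsum_eqI) (auto simp: coo_def)
  also have "... = p" using dual_basis_sum[OF lm db p J] by auto
  finally show ?thesis .
 qed
 have comb_map: "f (comb n q) = lcomb N (J n) q (%j. f (x n j))"
  if f: "f \<in> mhom R (P n) N" and N: "abelian_group N" and q: "q \<in> Vec R (J n)"
  for f n q and N :: "('r, 'n, 'e) module_scheme"
 proof -
  interpret Pn: lmodule R "P n" by (rule lm)
  interpret N: abelian_group N by fact
  have "f (comb n q) = (\<Oplus>\<^sub>N j\<in>J n. f (q j \<odot>\<^sub>(P n) x n j))"
   unfolding comb_def lcomb_def using VecD(1)[OF q] xc Pn.lsmult_closed
   by (intro additive_finsum[OF Pn.M.ag N mhom_additive[OF f]]) auto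
  also have "... = lcomb N (J n) q (%j. f (x n j))"
   unfolding lcomb_def
  proof (rule N.finsum_eqI)
   fix j assume j: "j \<in> J n"
   show "f (q j \<odot>\<^sub>(P n) x n j) = q j \<odot>\<^sub>N f (x n j)" using mhom_smult[OF f VecD(1)[OF q] xc[OF j]] .
   then show "q j \<odot>\<^sub>N f (x n j) <: N"
    using mhom_closed[OF f Pn.lsmult_closed[OF VecD(1)[OF q] xc[OF j]]] by metis
  qed
  finally show ?thesis .
 qed
 define e where "e = (%n j. if j \<in> J n then coo n (x n j) else (%_. \<zero>\<^sub>R))"
 define D where "D = (%n j. if j \<in> J (Suc n) then coo n (\<delta> n (x (Suc n) j)) else (%_. \<zero>\<^sub>R))"
 define m where "m = (%j. \<epsilon> (x 0 j))"
 have \<delta>x: "\<delta> n (x (Suc n) j) <: (P n)" if "j \<in> J (Suc n)" for n j using P'(6)[OF xc[OF that]] .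
 have eM: "e n \<in> Mat R (J n) (J n)" for n
  using VecD[OF coo[OF xc]] M.R.zero_closed by (auto simp: Mat_def e_def)
 have DM: "D n \<in> Mat R (J (Suc n)) (J n)" for n
  using VecD[OF coo[OF \<delta>x]] M.R.zero_closed by (auto simp: Mat_def D_def)
 \<comment> \<open>A linear map conjugated by \<open>comb\<close> and \<open>coo\<close> is
   multiplication by its matrix; this is used for the identity and for the differential.\<close>
 have coohom: "coo n (f (comb k q)) = vec_mat R (J k) q A"
  if f: "f \<in> mhom R (P k) (P n)" and q: "q \<in> Vec R (J k)" and A: "A \<in> Mat R (J k) (J n)"
   "!!j. j \<in> J k ==> A j = coo n (f (x k j))" for n k f q A
 proof
  fix i
  show "coo n (f (comb k q)) i = vec_mat R (J k) q A i"
  proof (cases "i \<in> J n")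
   case True
   have fh: "(%p. \<phi> n i (f p)) \<in> mhom R (P k) (reg R)"
    using mhom_comp[OF f \<phi>h[OF True]] .
   have "\<phi> n i (f (comb k q)) = lcomb (reg R) (J k) q (%j. \<phi> n i (f (x k j)))"
    by (rule comb_map[OF fh _ q]) (rule lmodule.axioms(2)[OF lmodule_regular[OF M.R.ring_axioms]])
   also have "... = vec_mat R (J k) q A i"
    unfolding lcomb_def vec_mat_def regular_module_simps
    using True A(2) VecD(1)[OF q] MatD(1)[OF A(1)] mhom_closed[OF fh xc]
    by (intro M.R.finsum_eqI) (auto simp: coo_def)
   finally show ?thesis using True by (simp add: coo_def)
  next
   case False
   have "vec_mat R (J k) q A \<in> Vec R (J n)"
    using VecD(1)[OF q] by (intro M.R.vec_mat_closed[OF J _ A(1)])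
   then show ?thesis using VecD(2)[OF _ False, of "vec_mat R (J k) q A" R] False by (simp add: coo_def)
  qed
 qed
 have id: "(%p. p) \<in> mhom R (P n) (P n)" for n by (auto simp: module_hom_def)
 have ve: "vec_mat R (J n) q (e n) = coo n (comb n q)" if "q \<in> Vec R (J n)" for n q
  using coohom[OF id that eM] by (simp add: e_def)
 have vD: "vec_mat R (J (Suc n)) q (D n) = coo n (\<delta> n (comb (Suc n) q))" if "q \<in> Vec R (J (Suc n))" for n q
  using coohom[OF P'(3) that DM] by (simp add: D_def)
 have coo0: "coo n \<zero>\<^sub>(P n) = (%_. \<zero>\<^sub>R)" for n
  using additive_zero[OF lmodule.axioms(2)[OF lm] lmodule.axioms(2)[OF lmodule_regular[OF M.R.ring_axioms]] mhom_additive[OF \<phi>h]]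
  by (auto simp: coo_def)
 have comb0: "comb n (%_. \<zero>\<^sub>R) = \<zero>\<^sub>(P n)" for n
  unfolding comb_def lcomb_def using xc
  by (intro abelian_monoid.finsum_eq_zeroI) (auto simp: lmodule.lsmult_zero_left[OF lm] abelian_group.axioms(1)[OF lmodule.axioms(2)[OF lm]])
 have row: "vec_mat R S (%_. \<zero>\<^sub>R) A = (%_. \<zero>\<^sub>R)" if "A \<in> Mat R S S'" for S S' A
  using M.R.vec_mat_zero[OF that] .
 have comb_m: "lcomb M (J 0) q m = \<epsilon> (comb 0 q)" if "q \<in> Vec R (J 0)" for q
  unfolding m_def using comb_map[OF P'(4) M.M.ag that] by simp
 have "mres R M J e D m"
  unfolding mres_def mcomplex_def
 proof (intro conjI allI ballI impI J eM DM)
  show "mat_mul R (J n) (e n) (e n) = e n" for n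
  proof
   fix j show "mat_mul R (J n) (e n) (e n) j = e n j"
    unfolding M.R.mat_mul_row using ve[OF coo[OF xc]] cc[OF xc] row[OF eM] by (auto simp: e_def)
  qed
  show "mat_mul R (J (Suc n)) (e (Suc n)) (D n) = D n" for n
  proof
   fix j
   show "mat_mul R (J (Suc n)) (e (Suc n)) (D n) j = D n j"
    unfolding M.R.mat_mul_row using vD[OF coo[OF xc]] cc[OF xc] row[OF DM]
    by (cases "j \<in> J (Suc n)") (simp_all add: e_def D_def)
  qed
  show "mat_mul R (J n) (D n) (e n) = D n" for n
  proof
   fix j
   show "mat_mul R (J n) (D n) (e n) j = D n j"
    unfolding M.R.mat_mul_row using ve[OF coo[OF \<delta>x]] cc[OF \<delta>x] row[OF eM]
    by (cases "j \<in> J (Suc n)") (simp_all add: D_def)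
  qed
  show "mat_mul R (J (Suc n)) (D (Suc n)) (D n) = (%_ _. \<zero>\<^sub>R)" for n
  proof
   fix j
   show "mat_mul R (J (Suc n)) (D (Suc n)) (D n) j = (%_. \<zero>\<^sub>R)"
    unfolding M.R.mat_mul_row using vD[OF coo[OF \<delta>x]] cc[OF \<delta>x] row[OF DM] P'(8)[OF xc] coo0
    by (cases "j \<in> J (Suc (Suc n))") (simp_all add: D_def)
  qed
  show "m j <: M" if "j \<in> J 0" for j unfolding m_def using mhom_closed[OF P'(4) xc[OF that]] .
  show "lcomb M (J 0) (e 0 j) m = m j" if "j \<in> J 0" for j
   using comb_m[OF coo[OF xc[OF that]]] cc[OF xc[OF that]] that by (simp add: e_def m_def)
  show "lcomb M (J 0) (D 0 j) m = \<zero>\<^sub>M" if "j \<in> J (Suc 0)" for j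
   using comb_m[OF coo[OF \<delta>x[OF that]]] cc[OF \<delta>x[OF that]] that P'(7)[of "x (Suc 0) j"] xc[OF that]
   by (simp add: D_def)
  show "\<exists>q\<in>Vec R (J 0). z = lcomb M (J 0) q m" if z: "z <: M" for z
  proof -
   obtain p where p: "p <: (P 0)" "z = \<epsilon> p" using z P'(5) by blast
   then show ?thesis using comb_m[OF coo] coo cc by (intro bexI[of _ "coo 0 p"]) auto
  qed
  show "\<exists>p\<in>Vec R (J (Suc 0)). q = vec_mat R (J (Suc 0)) p (D 0)"
   if q: "q \<in> Vec R (J 0)" "vec_mat R (J 0) q (e 0) = q" "lcomb M (J 0) q m = \<zero>\<^sub>M" for q
  proof -
   have "comb 0 q \<in> \<delta> 0 ` carrier (P 1)"
    using q(3) comb_m[OF q(1)] comb[OF q(1)] by (intro P'(9)) auto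
   then obtain p where p: "p \<in> carrier (P (Suc 0))" "comb 0 q = \<delta> 0 p" by auto
   have "q = coo 0 (\<delta> 0 p)" using ve[OF q(1)] q(2) p(2) by simp
   then have "q = vec_mat R (J (Suc 0)) (coo (Suc 0) p) (D 0)" using vD[OF coo[OF p(1)]] cc[OF p(1)] by simp
   then show ?thesis using coo[OF p(1)] by blast
  qed
  show "row_exact R J e D n" for n
   unfolding row_exact_def
  proof (intro ballI impI)
   fix q assume q: "q \<in> Vec R (J (Suc n))" "vec_mat R (J (Suc n)) q (e (Suc n)) = q"
    "vec_mat R (J (Suc n)) q (D n) = (%_. \<zero>\<^sub>R)"
   have "\<delta> n (comb (Suc n) q) = comb n (coo n (\<delta> n (comb (Suc n) q)))"
    using cc[OF P'(6)[OF comb[OF q(1)]]] by simp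
   also have "... = \<zero>\<^sub>(P n)" using vD[OF q(1)] q(3) comb0 by simp
   finally have "comb (Suc n) q \<in> \<delta> (Suc n) ` carrier (P (Suc (Suc n)))"
    using comb[OF q(1)] by (intro P'(10)) auto
   then obtain p where p: "p \<in> carrier (P (Suc (Suc n)))" "comb (Suc n) q = \<delta> (Suc n) p" by auto
   have "q = coo (Suc n) (\<delta> (Suc n) p)" using ve[OF q(1)] q(2) p(2) by simp
   then have "q = vec_mat R (J (Suc (Suc n))) (coo (Suc (Suc n)) p) (D (Suc n))"
    using vD[OF coo[OF p(1)]] cc[OF p(1)] by simp
   then show "\<exists>p\<in>Vec R (J (Suc (Suc n))). q = vec_mat R (J (Suc (Suc n))) p (D (Suc n))"
    using coo[OF p(1)] by blast
  qed
 qed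
 then show thesis using that J0 by blast
qed

section \<open>Splitting complexes with free homology in one spot\<close>

text \<open>The maps s are built upwards with d s = \<theta>, where \<theta> = id - s d takes values
  in cycles. In degree w cycles need not be boundaries; subtracting l(\<theta> y) z makes them so,
  because l vanishes exactly on boundaries and l z = 1. Thus d s + s d = id is lost in degree w
  only.\<close>

lemma split_complex:
 fixes T (structure)
 assumes C: "!!j. lmodule T (C j)" and db: "!!j. dual_basis T (C j) (B j) (x j) (\<phi> j)"
  and d: "!!j. d j \<in> mhom T (C (Suc j)) (C j)"
  and dd: "!!j y. y \<in> carrier (C (Suc (Suc j))) ==> d j (d (Suc j) y) = \<zero>\<^sub>(C j)"
  and exact: "!!j y. j \<noteq> w ==> y <: (C j) ==> (!!k. j = Suc k ==> d k y = \<zero>\<^sub>(C k)) ==>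
   y \<in> d j ` carrier (C (Suc j))"
 defines "Z \<equiv> {y \<in> carrier (C w). \<forall>k. w = Suc k \<longrightarrow> d k y = \<zero>\<^sub>(C k)}"
 assumes lam: "!!y. y \<in> Z ==> l y <: T"
   "!!y y'. y \<in> Z ==> y' \<in> Z ==> l (y \<oplus>\<^sub>(C w) y') = l y \<oplus> l y'"
   "!!t y. t <: T ==> y \<in> Z ==> l (t \<odot>\<^sub>(C w) y) = t \<otimes> l y"
   "!!y. y \<in> Z ==> l y = \<zero> \<longleftrightarrow> y \<in> d w ` carrier (C (Suc w))"
  and z: "z \<in> Z" "l z = \<one>"
 shows "\<exists>s. (\<forall>j. s j \<in> mhom T (C j) (C (Suc j))) \<and>
  (w \<noteq> 0 \<longrightarrow> (\<forall>y\<in>carrier (C 0). d 0 (s 0 y) = y)) \<and>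
  (\<forall>j. Suc j \<noteq> w \<longrightarrow> (\<forall>y\<in>carrier (C (Suc j)). d (Suc j) (s (Suc j) y) = y \<ominus>\<^sub>(C (Suc j)) s j (d j y)))"
proof -
 interpret T: ring T using lmodule.axioms(1)[OF C] .
 note cl = mhom_closed[OF d]
 have gr: "abelian_group (C j)" for j using lmodule.axioms(2)[OF C] .
 \<comment> \<open>The identity d s d = d keeps \<theta> a map into cycles one degree higher. The
   correction in degree w respects it because l is zero on boundaries.\<close>
 have step: "\<exists>s\<in>mhom T (C j) (C (Suc j)). (\<forall>y\<in>carrier (C (Suc j)). d j (s (d j y)) = d j y) \<and>
   (j \<noteq> w \<longrightarrow> (\<forall>y\<in>carrier (C j). d j (s y) = \<theta> y))"
  if \<theta>: "\<theta> \<in> mhom T (C j) (C j)" and ker: "!!y k. y <: (C j) ==> j = Suc k ==> d k (\<theta> y) = \<zero>\<^sub>(C k)"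
   and fx: "!!y. y \<in> carrier (C (Suc j)) ==> \<theta> (d j y) = d j y" for \<theta> j
 proof (cases "j = w")
  case False
  have "\<theta> y \<in> d j ` carrier (C (Suc j))" if "y <: (C j)" for y
   using exact[OF False mhom_closed[OF \<theta> that]] ker[OF that] by blast
  then obtain s where "s \<in> mhom T (C j) (C (Suc j))" "!!y. y <: (C j) ==> d j (s y) = \<theta> y"
   using dual_basis_lift[OF C C gr db d \<theta>] by blast
  then show ?thesis using fx cl by (intro bexI[of _ s]) auto
 next
  case True
  interpret Cw: lmodule T "C w" by (rule C)
  have \<theta>Z: "\<theta> y \<in> Z" if "y <: (C w)" for y
   using mhom_closed[OF \<theta>] ker True that by (auto simp: Z_def)
  have zc: "z <: (C w)" using z by (simp add: Z_def)
  define \<rho> where "\<rho> = (%y. \<theta> y \<ominus>\<^sub>(C w) l (\<theta> y) \<odot>\<^sub>(C w) z)"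
  have lh: "(%y. l (\<theta> y) \<odot>\<^sub>(C w) z) \<in> mhom T (C w) (C w)"
  proof (rule mhomI)
   fix y assume "y <: (C w)"
   then show "l (\<theta> y) \<odot>\<^sub>(C w) z <: (C w)" using lam(1) \<theta>Z zc Cw.lsmult_closed by auto
  next
   fix y y' assume y: "y <: (C w)" "y' <: (C w)"
   show "l (\<theta> (y \<oplus>\<^sub>(C w) y')) \<odot>\<^sub>(C w) z = l (\<theta> y) \<odot>\<^sub>(C w) z \<oplus>\<^sub>(C w) l (\<theta> y') \<odot>\<^sub>(C w) z"
    using mhom_add[OF \<theta>, of y y'] y True lam(1,2) \<theta>Z zc by (simp add: Cw.lsmult_l_distr)
  next
   fix a y assume y: "a <: T" "y <: (C w)"
   show "l (\<theta> (a \<odot>\<^sub>(C w) y)) \<odot>\<^sub>(C w) z = a \<odot>\<^sub>(C w) (l (\<theta> y) \<odot>\<^sub>(C w) z)"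
    using mhom_smult[OF \<theta>, of a y] y True lam(1,3) \<theta>Z zc by (simp add: Cw.lsmult_assoc)
  qed
  have \<rho>h: "\<rho> \<in> mhom T (C w) (C w)"
   unfolding \<rho>_def using mhom_minus[OF C _ lh] \<theta> True by auto
  have ZZ: "t \<odot>\<^sub>(C w) y \<in> Z" "y \<oplus>\<^sub>(C w) y' \<in> Z" if "t <: T" "y \<in> Z" "y' \<in> Z" for t y y'
   using that mhom_smult[OF d] mhom_add[OF d] Cw.lsmult_closed
    lmodule.lsmult_zero_right[OF C] abelian_group.axioms(1)[OF gr, THEN abelian_monoid.l_zero]
   by (auto simp: Z_def abelian_monoid.zero_closed[OF abelian_group.axioms(1)[OF gr]])
  have \<rho>im: "\<rho> y \<in> d w ` carrier (C (Suc w))" if y: "y <: (C w)" for y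
  proof -
   have ty: "\<theta> y \<in> Z" "\<theta> y <: (C w)" using \<theta>Z[OF y] by (auto simp: Z_def)
   have ly: "l (\<theta> y) <: T" using lam(1)[OF ty(1)] .
   have e: "\<rho> y = \<theta> y \<oplus>\<^sub>(C w) (\<ominus> l (\<theta> y)) \<odot>\<^sub>(C w) z"
    unfolding \<rho>_def using ly zc by (simp add: a_minus_def Cw.lsmult_neg_left)
   have "\<rho> y \<in> Z" unfolding e using ZZ ty ly z(1) by simp
   moreover have "l (\<rho> y) = \<zero>" unfolding e using lam(2)[OF ty(1), of "(\<ominus> l (\<theta> y)) \<odot>\<^sub>(C w) z"]
     ZZ(1)[OF _ z(1) z(1), of "\<ominus> l (\<theta> y)"] lam(3)[OF _ z(1), of "\<ominus> l (\<theta> y)"] z(2) ly by (simp add: T.r_neg)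
   ultimately show ?thesis using lam(4) by blast
  qed
  obtain s where s: "s \<in> mhom T (C w) (C (Suc w))" "!!y. y <: (C w) ==> d w (s y) = \<rho> y"
   using dual_basis_lift[OF C C gr db d \<rho>h] \<rho>im by blast
  have "d w (s (d w y)) = d w y" if y: "y \<in> carrier (C (Suc w))" for y
  proof -
   have "d w y \<in> Z" using \<theta>Z[OF cl[OF y]] fx y True by auto
   then have "l (d w y) = \<zero>" using lam(4) y by blast
   then show ?thesis
    using s(2)[OF cl[OF y]] fx[of y] y True zc cl[OF y]
    by (simp add: \<rho>_def Cw.lsmult_zero_left Cw.M.minus_zero_right)
  qed
  then show ?thesis using s(1) True by blast
 qed
 define G where "G = (%j s. s \<in> mhom T (C j) (C (Suc j)) \<and>
  (j = 0 \<longrightarrow> w \<noteq> 0 \<longrightarrow> (\<forall>y\<in>carrier (C 0). d 0 (s y) = y)) \<and>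
  (\<forall>y\<in>carrier (C (Suc j)). d j (s (d j y)) = d j y))"
 have "\<exists>s. \<forall>j. G j (s j) \<and> (Suc j \<noteq> w \<longrightarrow>
  (\<forall>y\<in>carrier (C (Suc j)). d (Suc j) (s (Suc j) y) = y \<ominus>\<^sub>(C (Suc j)) s j (d j y)))"
 proof (rule dependent_nat_choice)
  have id: "(%y. y) \<in> mhom T (C 0) (C 0)" by (auto simp: module_hom_def)
  show "\<exists>s. G 0 s" using step[OF id] unfolding G_def by auto
 next
  fix s j assume G: "G j s"
  interpret C1: lmodule T "C (Suc j)" by (rule C)
  interpret C0: lmodule T "C j" by (rule C)
  have sh: "s \<in> mhom T (C j) (C (Suc j))" using G by (simp add: G_def)
  define \<theta> where "\<theta> = (%y. y \<ominus>\<^sub>(C (Suc j)) s (d j y))"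
  have id: "(%y. y) \<in> mhom T (C (Suc j)) (C (Suc j))" by (auto simp: module_hom_def)
  have \<theta>h: "\<theta> \<in> mhom T (C (Suc j)) (C (Suc j))"
   unfolding \<theta>_def using mhom_minus[OF C id mhom_comp[OF d sh]] .
  have "d k (\<theta> y) = \<zero>\<^sub>(C k)" if y: "y \<in> carrier (C (Suc j))" "Suc j = Suc k" for y k
  proof -
   have "d j (\<theta> y) = d j y \<ominus>\<^sub>(C j) d j (s (d j y))"
    unfolding \<theta>_def using y(1) mhom_closed[OF sh] cl
    by (intro additive_diff[OF gr gr mhom_additive[OF d]]) auto
   then show ?thesis using G y cl by (simp add: G_def abelian_group.minus_self[OF gr])
  qed
  moreover have "\<theta> (d (Suc j) y) = d (Suc j) y" if y: "y \<in> carrier (C (Suc (Suc j)))" for y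
  proof -
   have "s \<zero>\<^sub>(C j) = \<zero>\<^sub>(C (Suc j))" using additive_zero[OF gr gr mhom_additive[OF sh]] .
   then show ?thesis using dd[OF y] cl[OF y] by (simp add: \<theta>_def C1.M.minus_zero_right)
  qed
  ultimately obtain s' where s': "s' \<in> mhom T (C (Suc j)) (C (Suc (Suc j)))"
   "!!y. y \<in> carrier (C (Suc (Suc j))) ==> d (Suc j) (s' (d (Suc j) y)) = d (Suc j) y"
   "Suc j \<noteq> w ==> (\<forall>y\<in>carrier (C (Suc j)). d (Suc j) (s' y) = \<theta> y)"
   using step[OF \<theta>h] by blast
  then show "\<exists>s'. G (Suc j) s' \<and> (Suc j \<noteq> w \<longrightarrow>
   (\<forall>y\<in>carrier (C (Suc j)). d (Suc j) (s' y) = y \<ominus>\<^sub>(C (Suc j)) s (d j y)))"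
   unfolding G_def \<theta>_def by (intro exI[of _ s']) simp
 qed
 then obtain s where "\<forall>j. G j (s j) \<and> (Suc j \<noteq> w \<longrightarrow>
  (\<forall>y\<in>carrier (C (Suc j)). d (Suc j) (s (Suc j) y) = y \<ominus>\<^sub>(C (Suc j)) s j (d j y)))" by (rule exE)
 then show ?thesis by (intro exI[of _ s]) (simp add: G_def)
qed

section \<open>Base change of matrix complexes\<close>

lemma ring_hom_additive: "h \<in> ring_hom R S ==> additive R S h"
 by (auto simp: ring_hom_def additive_def)

lemma ring_hom_null: "ring R ==> ring S ==> h \<in> ring_hom R S ==> h \<zero>\<^sub>R = \<zero>\<^sub>S"
 using additive_zero[OF _ _ ring_hom_additive] ring.is_abelian_group by metis

lemma ring_hom_finsum:
 assumes "ring R" "ring S" "h \<in> ring_hom R S" "!!i. i \<in> A ==> f i <: R"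
 shows "h (finsum R f A) = (\<Oplus>\<^sub>S i\<in>A. h (f i))"
 using additive_finsum[OF ring.is_abelian_group[OF assms(1)] ring.is_abelian_group[OF assms(2)] ring_hom_additive[OF assms(3)], of f A]
  assms(4) by (simp add: Pi_def)

lemma ring_hom_Mat:
 assumes "ring R" "ring S" "h \<in> ring_hom R S" "A \<in> Mat R I J"
 shows "(%i j. h (A i j)) \<in> Mat S I J"
 using assms(4) ring_hom_null[OF assms(1-3)] ring_hom_closed[OF assms(3)] by (auto simp: Mat_def)

lemma ring_hom_Vec:
 assumes "ring R" "ring S" "h \<in> ring_hom R S" "finite I" "q \<in> Vec R I"
 shows "(%i. h (q i)) \<in> Vec S I"
 using VecD[OF assms(5)] ring_hom_null[OF assms(1-3)] ring_hom_closed[OF assms(3)]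
 by (intro VecI assms(4)) auto

lemma ring_hom_dot:
 assumes "ring R" "ring S" "h \<in> ring_hom R S" "!!i. i \<in> I ==> q i <: R" "!!i. i \<in> I ==> c i <: R"
 shows "h (dot R I q c) = dot S I (%i. h (q i)) (%i. h (c i))"
proof -
 interpret R: ring R by fact
 interpret S: ring S by fact
 have "h (dot R I q c) = (\<Oplus>\<^sub>S i\<in>I. h (q i \<otimes>\<^sub>R c i))"
  unfolding dot_def using assms by (intro ring_hom_finsum) auto
 also have "... = dot S I (%i. h (q i)) (%i. h (c i))"
  unfolding dot_def using assms(4,5) ring_hom_mult[OF assms(3)] ring_hom_closed[OF assms(3)]
  by (intro S.finsum_eqI) auto
 finally show ?thesis .
qed

lemma ring_hom_vec_mat:
 assumes "ring R" "ring S" "h \<in> ring_hom R S" "!!i. i \<in> I ==> q i <: R" "A \<in> Mat R I' J"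
 shows "h (vec_mat R I q A j) = vec_mat S I (%i. h (q i)) (%i j. h (A i j)) j"
 using ring_hom_dot[OF assms(1-3), of I q "%i. A i j"] assms(4) MatD(1)[OF assms(5)]
 by (simp add: vec_mat_def dot_def)

lemma mcomplex_map:
 assumes R: "ring R" and S: "ring S" and h: "h \<in> ring_hom R S" and c: "mcomplex R I e D"
 shows "mcomplex S I (%n i j. h (e n i j)) (%n i j. h (D n i j))"
proof -
 note c' = mcomplexD[OF c]
 have mul: "mat_mul S J (%i j. h (A i j)) (%i j. h (B i j)) = (%i k. h (mat_mul R J A B i k))"
  if "A \<in> Mat R I' J" "B \<in> Mat R J L" for A B I' J L
  using ring_hom_vec_mat[OF R S h, of J "A _" B J L] MatD(1)[OF that(1)] that(2)
  by (auto simp: fun_eq_iff mat_mul_def vec_mat_def)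
 show ?thesis
  unfolding mcomplex_def
  using c' mul[OF c'(2) c'(2)] mul[OF c'(2) c'(3)] mul[OF c'(3) c'(2)] mul[OF c'(3) c'(3)]
   ring_hom_Mat[OF R S h c'(2)] ring_hom_Mat[OF R S h c'(3)] ring_hom_null[OF R S h]
  by (simp add: fun_eq_iff)
qed

definition exact_at ::
  "('r, 'c) ring_scheme => (nat => 'x set) => (nat => 'x => 'x => 'r) => (nat => 'x => 'x => 'r) => nat => bool" where
 "exact_at R I e D j \<longleftrightarrow>
   (\<forall>q\<in>Vec R (I j). vec_mat R (I j) q (e j) = q \<longrightarrow>
    (\<forall>k. j = Suc k \<longrightarrow> vec_mat R (I j) q (D k) = (%_. \<zero>\<^sub>R)) \<longrightarrow>
    (\<exists>p\<in>Vec R (I (Suc j)). q = vec_mat R (I (Suc j)) p (D j)))"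

lemma row_exact_iff: "row_exact R I e D i \<longleftrightarrow> exact_at R I e D (Suc i)"
 by (auto simp: row_exact_def exact_at_def)

text \<open>The coordinates \<open>c i\<close> split a row over S into rows over R, almost all of
  them zero. Solutions over R for the separate coordinates, weighted by the \<open>b i\<close>, add
  up to a solution over S.\<close>

lemma flat_lift:
 assumes R: "ring R" and S: "ring S" and h: "h \<in> ring_hom R S"
  and b: "!!i. i \<in> B ==> b i <: S"
  and sum: "!!s U. s <: S ==> finite U ==> U \<subseteq> B ==> {i\<in>B. c i s \<noteq> \<zero>\<^sub>R} \<subseteq> U ==>
    s = (\<Oplus>\<^sub>S i\<in>U. b i \<otimes>\<^sub>S h (c i s))"
  and fin: "!!s. s <: S ==> finite {i\<in>B. c i s \<noteq> \<zero>\<^sub>R}"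
  and J: "finite J" and K: "finite L" and q: "q \<in> Vec S J" and A: "A \<in> Mat R L J"
  and p: "!!i. i \<in> B ==> \<exists>p\<in>Vec R L. (%j. c i (q j)) = vec_mat R L p A"
 shows "\<exists>p\<in>Vec S L. q = vec_mat S L p (%i j. h (A i j))"
proof -
 interpret R: ring R by fact
 interpret S: ring S by fact
 note hc = ring_hom_closed[OF h] and Ac = MatD(1)[OF A]
 have "\<forall>i\<in>B. \<exists>p. p \<in> Vec R L \<and> (%j. c i (q j)) = vec_mat R L p A" using p by blast
 from bchoice[OF this] obtain P where
  P': "\<forall>i\<in>B. P i \<in> Vec R L \<and> (%j. c i (q j)) = vec_mat R L (P i) A" by (rule exE)
 then have P: "!!i. i \<in> B ==> P i \<in> Vec R L" by blast
 have P2: "c i (q j) = vec_mat R L (P i) A j" if "i \<in> B" for i j using fun_cong[OF conjunct2[OF bspec[OF P' that]], of j] .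
 note Pc = VecD(1)[OF P]
 define U where "U = (\<Union>j\<in>J. {i\<in>B. c i (q j) \<noteq> \<zero>\<^sub>R})"
 have U: "finite U" "U \<subseteq> B" using J fin VecD(1)[OF q] by (auto simp: U_def)
 define r where "r = (%k. \<Oplus>\<^sub>S i\<in>U. b i \<otimes>\<^sub>S h (P i k))"
 have cl: "b i \<otimes>\<^sub>S h (P i k) <: S" if "i \<in> U" for i k using that U b hc Pc by auto
 have r: "r \<in> Vec S L"
 proof (rule VecI[OF K])
  show "r k <: S" for k unfolding r_def using cl by (intro S.finsum_in)
  show "r k = \<zero>\<^sub>S" if "k \<notin> L" for k
  proof -
   have "P i k = \<zero>\<^sub>R" if "i \<in> U" for i using VecD(2)[OF P \<open>k \<notin> L\<close>] that U by auto
   then show ?thesis unfolding r_def using ring_hom_null[OF R S h] b U by (intro S.finsum_eq_zeroI) auto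
  qed
 qed
 have "q j = vec_mat S L r (%i j. h (A i j)) j" for j
 proof (cases "j \<in> J")
  case True
  have "q j = (\<Oplus>\<^sub>S i\<in>U. b i \<otimes>\<^sub>S h (c i (q j)))"
   using True by (intro sum VecD(1)[OF q] U) (auto simp: U_def)
  also have "... = (\<Oplus>\<^sub>S i\<in>U. b i \<otimes>\<^sub>S (\<Oplus>\<^sub>S k\<in>L. h (P i k) \<otimes>\<^sub>S h (A k j)))"
  proof (rule S.finsum_eqI)
   fix i assume i: "i \<in> U"
   then have "h (c i (q j)) = (\<Oplus>\<^sub>S k\<in>L. h (P i k) \<otimes>\<^sub>S h (A k j))"
    using P2[of i j] ring_hom_vec_mat[OF R S h _ A, of L "P i" j] Pc U by (auto simp: vec_mat_def)
   then show "b i \<otimes>\<^sub>S h (c i (q j)) = b i \<otimes>\<^sub>S (\<Oplus>\<^sub>S k\<in>L. h (P i k) \<otimes>\<^sub>S h (A k j))" by simp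
   show "b i \<otimes>\<^sub>S (\<Oplus>\<^sub>S k\<in>L. h (P i k) \<otimes>\<^sub>S h (A k j)) <: S"
    using i U b Pc Ac hc by (intro S.m_closed S.finsum_in) auto
  qed
  also have "... = (\<Oplus>\<^sub>S k\<in>L. r k \<otimes>\<^sub>S h (A k j))"
   unfolding r_def using U b Pc Ac hc K by (intro S.double_sum_assoc[symmetric]) auto
  finally show ?thesis by (simp add: vec_mat_def)
 next
  case False
  then show ?thesis
   using VecD(2)[OF q False] MatD(3)[OF A False] ring_hom_null[OF R S h] VecD(1)[OF r]
   by (simp add: vec_mat_def S.finsum_eq_zeroI)
 qed
 then show ?thesis using r by blast
qed

text \<open>The coordinates \<open>c i\<close> are linear for right multiplication by R, so they
  commute with matrices coming from R. Hence the coordinate rows of a cycle are cycles over R, and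
  \<open>flat_lift\<close> reassembles their preimages.\<close>

lemma exact_at_base_change:
 assumes R: "ring R" and S: "ring S" and h: "h \<in> ring_hom R S"
  and b: "!!i. i \<in> B ==> b i <: S"
  and sum: "!!s U. s <: S ==> finite U ==> U \<subseteq> B ==> {i\<in>B. c i s \<noteq> \<zero>\<^sub>R} \<subseteq> U ==>
    s = (\<Oplus>\<^sub>S i\<in>U. b i \<otimes>\<^sub>S h (c i s))"
  and fin: "!!s. s <: S ==> finite {i\<in>B. c i s \<noteq> \<zero>\<^sub>R}"
  and add: "!!i. i \<in> B ==> additive S R (c i)"
  and mult: "!!i s r. i \<in> B ==> s <: S ==> r <: R ==> c i (s \<otimes>\<^sub>S h r) = c i s \<otimes>\<^sub>R r"
  and cx: "mcomplex R I e D" and ex: "exact_at R I e D j"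
 shows "exact_at S I (%n i j. h (e n i j)) (%n i j. h (D n i j)) j"
 unfolding exact_at_def
proof (intro ballI impI)
 interpret R: ring R by fact
 interpret S: ring S by fact
 note cx' = mcomplexD[OF cx]
 note hc = ring_hom_closed[OF h]
 fix q assume q: "q \<in> Vec S (I j)" "vec_mat S (I j) q (%i k. h (e j i k)) = q"
  "\<forall>k. j = Suc k \<longrightarrow> vec_mat S (I j) q (%i l. h (D k i l)) = (%_. \<zero>\<^sub>S)"
 note qc = VecD(1)[OF q(1)]
 have c0: "c i \<zero>\<^sub>S = \<zero>\<^sub>R" if "i \<in> B" for i
  using additive_zero[OF S.is_abelian_group R.is_abelian_group add[OF that]] .
 have cv: "c i (vec_mat S (I j) q (%i l. h (A i l)) l) = vec_mat R (I j) (%k. c i (q k)) A l"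
  if i: "i \<in> B" and A: "A \<in> Mat R (I j) J" for i A l J
 proof -
  note Ac = MatD(1)[OF A]
  have "c i (vec_mat S (I j) q (%i l. h (A i l)) l) = (\<Oplus>\<^sub>R k\<in>I j. c i (q k \<otimes>\<^sub>S h (A k l)))"
   unfolding vec_mat_def using qc hc Ac
   by (intro additive_finsum[OF S.is_abelian_group R.is_abelian_group add[OF i]]) auto
  also have "... = vec_mat R (I j) (%k. c i (q k)) A l"
   unfolding vec_mat_def using mult[OF i] qc Ac additive_closed[OF add[OF i]] by (intro R.finsum_eqI) auto
  finally show ?thesis .
 qed
 show "\<exists>p\<in>Vec S (I (Suc j)). q = vec_mat S (I (Suc j)) p (%i l. h (D j i l))"
 proof (rule flat_lift[OF R S h b sum fin cx'(1) cx'(1) q(1) cx'(3)])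
  fix i assume i: "i \<in> B"
  let ?r = "%k. c i (q k)"
  have "?r \<in> Vec R (I j)"
   by (rule VecI[OF cx'(1)]) (use additive_closed[OF add[OF i] qc] VecD(2)[OF q(1)] c0[OF i] in auto)
  moreover have "vec_mat R (I j) ?r (e j) = ?r" 
  proof
   fix l
   show "vec_mat R (I j) ?r (e j) l = ?r l"
    unfolding cv[OF i cx'(2), symmetric] by (simp only: q(2))
  qed
  moreover have "vec_mat R (I j) ?r (D k) = (%_. \<zero>\<^sub>R)" if "j = Suc k" for k
   using cv[OF i, of "D k" "I k"] cx'(3)[of k] that q(3) c0[OF i] by (auto simp: fun_eq_iff)
  ultimately show "\<exists>p\<in>Vec R (I (Suc j)). ?r = vec_mat R (I (Suc j)) p (D j)"
   using ex unfolding exact_at_def by blast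
 qed auto
qed

text \<open>
 A ring homomorphism \<open>\<pi>\<close> out of \<open>R\<close> whose kernel is generated by elements of \<open>T\<close>, such that \<open>R\<close> is
 projective over \<open>T\<close>: base change along \<open>\<pi>\<close> is tensoring over \<open>T\<close>, so that it preserves the
 exactness of complexes that split over \<open>T\<close>.
\<close>

locale reduction =
 fixes R :: "('r, 'c1) ring_scheme" and T :: "('t, 'c2) ring_scheme" and S :: "('s, 'c3) ring_scheme"
  and \<tau> \<pi> and B :: "'b set" and \<beta> c
 assumes R: "ring R" and T: "ring T" and S: "ring S"
  and \<tau>: "\<tau> \<in> ring_hom T R" and \<pi>: "\<pi> \<in> ring_hom R S"
  and db: "dual_basis T (restr \<tau> (reg R)) B \<beta> c"
  and kernel: "!!r b. r <: R ==> \<pi> r = \<zero>\<^sub>S ==> b \<in> B ==> \<pi> (\<tau> (c b r)) = \<zero>\<^sub>S"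
  and surj: "carrier S \<subseteq> \<pi> ` carrier R"
begin

sublocale R: ring R by (rule R)
sublocale S: ring S by (rule S)

abbreviation "row I f \<equiv> restr \<tau> (row_module R I f)"

lemma row_lmodule: "finite I ==> f \<in> Mat R I I ==> lmodule T (row I f)"
 by (rule lmodule_restrict[OF R.lmodule_row T \<tau>])

lemma row_dual_basis:
 assumes "finite I" "f \<in> Mat R I I" "mat_mul R I f f = f"
 shows "dual_basis T (row I f) (B \<times> I) (%p. \<beta> (fst p) \<odot>\<^sub>(row_module R I f) f (snd p))
  (%p q. c (fst p) (q (snd p)))"
 by (rule dual_basis_restrict[OF R.lmodule_row[OF assms(1,2)] T \<tau> db R.row_module_dual_basis[OF assms]])

text \<open>Maps linear over T descend along \<pi>: the expansion of y over T moves all of y into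
  the coefficients \<tau>(c ...), which \<pi> kills by \<open>kernel\<close>.\<close>

lemma reduce_zero:
 assumes I: "finite I" "f \<in> Mat R I I" "mat_mul R I f f = f" and J: "finite J" "g \<in> Mat R J J"
  and h: "h \<in> mhom T (row I f) (row J g)"
  and y: "y <: (row_module R I f)" "!!i. \<pi> (y i) = \<zero>\<^sub>S"
 shows "\<pi> (h y k) = \<zero>\<^sub>S"
proof -
 note rdb = row_dual_basis[OF I]
 interpret P: lmodule T "row I f" by (rule row_lmodule[OF I(1,2)])
 interpret Q: lmodule T "row J g" by (rule row_lmodule[OF J])
 define X where "X = (%p. \<beta> (fst p) \<odot>\<^sub>(row_module R I f) f (snd p))"
 define C where "C = (%p. c (fst p) (y (snd p)))"
 define U where "U = {p\<in>B \<times> I. C p \<noteq> \<zero>\<^sub>T}"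
 have y': "y <: (row I f)" using y by simp
 have U: "finite U" "U \<subseteq> B \<times> I" using dual_basis_finite[OF rdb y'] by (auto simp: U_def C_def)
 have X: "X p <: (row I f)" if "p \<in> U" for p
  using dual_basis_closed[OF rdb, of p] that U by (auto simp: X_def)
 have C: "C p <: T" if "p \<in> U" for p
  using dual_basis_coord[OF rdb _ y', of p] that U by (auto simp: C_def)
 have hX: "h (X p) <: (row J g)" if "p \<in> U" for p using mhom_closed[OF h X[OF that]] .
 have yc: "y i <: R" for i using y(1) by (auto simp: row_module_simps dest: VecD(1))
 have "(\<Oplus>\<^sub>(row I f)p\<in>U. C p \<odot>\<^sub>(row I f) X p) = y"
  using dual_basis_sum[OF P.lmodule_axioms rdb y' U] by (simp add: U_def C_def X_def)
 then have "h y = h (\<Oplus>\<^sub>(row I f)p\<in>U. C p \<odot>\<^sub>(row I f) X p)" by simp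
 also have "... = (\<Oplus>\<^sub>(row J g)p\<in>U. h (C p \<odot>\<^sub>(row I f) X p))"
  using P.lsmult_closed[OF C X]
  by (intro additive_finsum[OF P.M.ag Q.M.ag mhom_additive[OF h]]) auto
 also have "... = (\<Oplus>\<^sub>(row J g)p\<in>U. C p \<odot>\<^sub>(row J g) h (X p))"
  using mhom_smult[OF h C X] Q.lsmult_closed[OF C hX] by (intro Q.M.finsum_eqI) auto
 finally have "h y k = (\<Oplus>\<^sub>(row_module R J g)p\<in>U. C p \<odot>\<^sub>(row J g) h (X p)) k"
  by (simp only: restr_simps)
 also have "... = (\<Oplus>\<^sub>R p\<in>U. (C p \<odot>\<^sub>(row J g) h (X p)) k)"
  using Q.lsmult_closed[OF C hX] by (intro R.row_module_eval_finsum[OF J]) simp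
 finally have hy: "h y k = (\<Oplus>\<^sub>R p\<in>U. \<tau> (C p) \<otimes>\<^sub>R h (X p) k)" by (simp add: row_module_simps)
 have \<tau>C: "\<tau> (C p) <: R" if "p \<in> U" for p using ring_hom_closed[OF \<tau> C[OF that]] .
 have hXk: "h (X p) k <: R" if "p \<in> U" for p
  using hX[OF that] by (auto simp: row_module_simps dest: VecD(1))
 have "\<pi> (h y k) = (\<Oplus>\<^sub>S p\<in>U. \<pi> (\<tau> (C p) \<otimes>\<^sub>R h (X p) k))"
  unfolding hy using \<tau>C hXk by (intro ring_hom_finsum[OF R S \<pi>]) auto
 also have "... = \<zero>\<^sub>S"
 proof (rule S.finsum_eq_zeroI)
  fix p assume p: "p \<in> U"
  have "\<pi> (\<tau> (C p)) = \<zero>\<^sub>S" unfolding C_def using p U y(2) yc by (intro kernel) auto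
  then show "\<pi> (\<tau> (C p) \<otimes>\<^sub>R h (X p) k) = \<zero>\<^sub>S"
   using ring_hom_mult[OF \<pi> \<tau>C[OF p] hXk[OF p]] ring_hom_closed[OF \<pi> hXk[OF p]] by simp
 qed
 finally show ?thesis .
qed

text \<open>Lift the entries one by one and multiply by the idempotent; under \<pi> this changes
  nothing, since q is fixed by the image of f.\<close>

lemma lift_row:
 assumes I: "finite I" "f \<in> Mat R I I" "mat_mul R I f f = f"
  and q: "q \<in> Vec S I" "vec_mat S I q (%i j. \<pi> (f i j)) = q"
 shows "\<exists>y\<in>carrier (row_module R I f). \<forall>i. \<pi> (y i) = q i"
proof -
 have "\<exists>r\<in>carrier R. \<pi> r = q i" for i using VecD(1)[OF q(1), of i] surj by (force simp: image_iff)
 then obtain r where r: "!!i. r i <: R" "!!i. \<pi> (r i) = q i" by metis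
 define r' where "r' = (%i. if i \<in> I then r i else \<zero>\<^sub>R)"
 have r': "r' \<in> Vec R I" using r(1) by (intro VecI[OF I(1)]) (auto simp: r'_def)
 have "\<pi> (r' i) = q i" for i
  using r(2) VecD(2)[OF q(1)] ring_hom_null[OF R S \<pi>] by (auto simp: r'_def)
 then have "\<pi> (vec_mat R I r' f i) = q i" for i
  using ring_hom_vec_mat[OF R S \<pi> _ I(2), of I r' i] VecD(1)[OF r'] q(2) by simp
 then show ?thesis using R.vec_mat_in_row[OF I(1) I(1) I(2) I(2) I(3) r'] by blast
qed

text \<open>The contraction s is linear over T only, so it has no matrix over R that could be mapped
  by \<pi>. It is applied to a lift y of q instead: y = d s y + s d y, and the last term dies under
  \<pi> by \<open>reduce_zero\<close>, because d y does.\<close>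

lemma reduce_exact:
 assumes cx: "mcomplex R J f D"
  and ex: "!!j. j \<noteq> w ==> exact_at R J f D j"
 defines "Z \<equiv> {y \<in> carrier (row_module R (J w) (f w)). \<forall>k. w = Suc k \<longrightarrow> vec_mat R (J w) y (D k) = (%_. \<zero>\<^sub>R)}"
 assumes l: "!!y. y \<in> Z ==> l y <: T"
   "!!y y'. y \<in> Z ==> y' \<in> Z ==> l (%i. y i \<oplus>\<^sub>R y' i) = l y \<oplus>\<^sub>T l y'"
   "!!t y. t <: T ==> y \<in> Z ==> l (%i. \<tau> t \<otimes>\<^sub>R y i) = t \<otimes>\<^sub>T l y"
   "!!y. y \<in> Z ==> l y = \<zero>\<^sub>T \<longleftrightarrow> (\<exists>p\<in>Vec R (J (Suc w)). y = vec_mat R (J (Suc w)) p (D w))"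
  and z: "z \<in> Z" "l z = \<one>\<^sub>T"
  and j: "j \<noteq> w"
 shows "exact_at S J (%n i k. \<pi> (f n i k)) (%n i k. \<pi> (D n i k)) j"
proof -
 note c = mcomplexD[OF cx]
 let ?C = "%j. row (J j) (f j)" and ?d = "%j q. vec_mat R (J (Suc j)) q (D j)"
 have dP: "?d i q <: (?C i)" if "q \<in> Vec R (J (Suc i))" for i q
  using R.vec_mat_in_row[OF c(1) c(1) c(3) c(2) c(6) that] by simp
 have lm: "lmodule T (?C j)" for j by (rule row_lmodule[OF c(1,2)])
 have rV: "q \<in> Vec R (J i)" if "q <: (?C i)" for i q using that by (simp add: row_module_simps)
 have dh: "?d i \<in> mhom R (row_module R (J (Suc i)) (f (Suc i))) (row_module R (J i) (f i))" for i
  using R.vec_mat_hom[OF c(1) c(3)[of i]] dP unfolding module_hom_def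
  by (auto simp: row_module_simps free_module_simps)
 have dd: "?d i (?d (Suc i) q) = (%_. \<zero>\<^sub>R)" if "q \<in> Vec R (J (Suc (Suc i)))" for i q
  using R.vec_mat_assoc[of "J (Suc (Suc i))" "J (Suc i)" q "D (Suc i)" "D i", OF c(1) c(1) _ c(3) c(3)]
   VecD(1)[OF that] c(7)[of i] by (auto simp: vec_mat_def intro!: R.finsum_eq_zeroI)
 have pe: "?d i p = ?d i (vec_mat R (J (Suc i)) p (f (Suc i)))" "vec_mat R (J (Suc i)) p (f (Suc i)) \<in> carrier (?C (Suc i))"
  if "p \<in> Vec R (J (Suc i))" for p i
  using R.vec_mat_assoc[of "J (Suc i)" "J (Suc i)" p "f (Suc i)" "D i", OF c(1) c(1) _ c(2) c(3)] VecD(1)[OF that] c(5)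
   R.vec_mat_in_row[OF c(1) c(1) c(2) c(2) c(4) that] by simp_all
 have im: "y \<in> ?d i ` carrier (?C (Suc i)) \<longleftrightarrow> (\<exists>p\<in>Vec R (J (Suc i)). y = ?d i p)" for i y
 proof
  assume "\<exists>p\<in>Vec R (J (Suc i)). y = ?d i p"
  then obtain p where p: "p \<in> Vec R (J (Suc i))" "y = ?d i p" by blast
  then have "y = ?d i (vec_mat R (J (Suc i)) p (f (Suc i)))" using pe(1) by simp
  then show "y \<in> ?d i ` carrier (?C (Suc i))" using pe(2)[OF p(1)] by blast
 qed (use rV in blast)
 have Z': "Z = {y \<in> carrier (?C w). \<forall>k. w = Suc k \<longrightarrow> ?d k y = \<zero>\<^sub>(?C k)}"
  by (auto simp: Z_def row_module_simps)
 have "\<exists>s. (\<forall>j. s j \<in> mhom T (?C j) (?C (Suc j))) \<and>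
  (w \<noteq> 0 \<longrightarrow> (\<forall>y\<in>carrier (?C 0). ?d 0 (s 0 y) = y)) \<and>
  (\<forall>j. Suc j \<noteq> w \<longrightarrow> (\<forall>y\<in>carrier (?C (Suc j)). ?d (Suc j) (s (Suc j) y) = y \<ominus>\<^sub>(?C (Suc j)) s j (?d j y)))"
 proof (rule split_complex[where l = l and z = z and w = w and C = ?C and d = ?d and T = T and B = "%j. B \<times> J j" and
    x = "%j p. \<beta> (fst p) \<odot>\<^sub>(row_module R (J j) (f j)) f j (snd p)" and \<phi> = "%j p q. c (fst p) (q (snd p))"])
  show "lmodule T (?C j)" for j by (rule lm)
  show "dual_basis T (?C j) (B \<times> J j) (%p. \<beta> (fst p) \<odot>\<^sub>(row_module R (J j) (f j)) f j (snd p))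
    (%p q. c (fst p) (q (snd p)))" for j by (rule row_dual_basis[OF c(1,2,4)])
  show "?d j \<in> mhom T (?C (Suc j)) (?C j)" for j by (rule module_hom_restrict[OF dh \<tau>])
  show "?d i (?d (Suc i) y) = \<zero>\<^sub>(?C i)" if "y \<in> carrier (?C (Suc (Suc i)))" for i y
   using dd[OF rV[OF that]] by (simp add: row_module_simps)
  show "y \<in> ?d j ` carrier (?C (Suc j))"
   if "j \<noteq> w" "y <: (?C j)" "!!k. j = Suc k ==> ?d k y = \<zero>\<^sub>(?C k)" for j y
   unfolding im using ex[OF that(1)] that(2,3) by (auto simp: exact_at_def row_module_simps)
 qed (unfold Z'[symmetric] im, use l z in \<open>auto simp: row_module_simps\<close>)
 then obtain s where s: "!!j. s j \<in> mhom T (?C j) (?C (Suc j))"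
  "!!y. w \<noteq> 0 ==> y <: (?C 0) ==> ?d 0 (s 0 y) = y"
  "!!j y. Suc j \<noteq> w ==> y \<in> carrier (?C (Suc j)) ==> ?d (Suc j) (s (Suc j) y) = y \<ominus>\<^sub>(?C (Suc j)) s j (?d j y)"
  by blast
 show ?thesis
  unfolding exact_at_def
 proof (intro ballI impI)
  fix q assume q: "q \<in> Vec S (J j)" "vec_mat S (J j) q (%i k. \<pi> (f j i k)) = q"
   "\<forall>k. j = Suc k \<longrightarrow> vec_mat S (J j) q (%i l. \<pi> (D k i l)) = (%_. \<zero>\<^sub>S)"
  obtain y where y: "y \<in> carrier (row_module R (J j) (f j))" "!!i. \<pi> (y i) = q i"
   using lift_row[OF c(1,2,4) q(1,2)] by blast
  have sy: "s j y \<in> carrier (?C (Suc j))" using mhom_closed[OF s(1)] y(1) by simp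
  define p where "p = (%i. \<pi> (s j y i))"
  have p: "p \<in> Vec S (J (Suc j))" unfolding p_def using ring_hom_Vec[OF R S \<pi> c(1) rV[OF sy]] .
  have "\<pi> (?d j (s j y) i) = q i" for i
  proof (cases j)
   case 0
   then show ?thesis using s(2)[of y] y j by simp
  next
   case (Suc k)
   have yV: "y \<in> Vec R (J (Suc k))" using y(1) Suc by (simp add: row_module_simps)
   have dy: "?d k y <: (?C k)" using dP[OF yV] .
   have "\<pi> (?d k y i) = \<zero>\<^sub>S" for i
    using ring_hom_vec_mat[OF R S \<pi> _ c(3)[of k], of "J (Suc k)" y i] VecD(1)[OF yV] y(2) q(3) Suc
    by (simp add: fun_eq_iff)
   then have z: "\<pi> (s k (?d k y) i) = \<zero>\<^sub>S"
    using dy by (intro reduce_zero[OF c(1,2,4) c(1,2) s(1)]) auto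
   interpret Cj: lmodule T "?C (Suc k)" by (rule lm)
   have sdy: "s k (?d k y) \<in> carrier (?C (Suc k))" using mhom_closed[OF s(1) dy] .
   have "?d j (s j y) \<oplus>\<^sub>(?C (Suc k)) s k (?d k y) = y"
    using s(3)[of k y] y(1) Suc j Cj.M.minus_cancel_right[OF _ sdy, of y] by simp
   then have "?d j (s j y) i \<oplus>\<^sub>R s k (?d k y) i = y i" by (simp add: row_module_simps fun_eq_iff)
   moreover have "?d j (s j y) i <: R" "s k (?d k y) i <: R"
    using VecD(1)[OF rV[OF dP[OF rV[OF sy]]]] VecD(1)[OF rV[OF sdy]] by auto
   ultimately have "\<pi> (?d j (s j y) i) \<oplus>\<^sub>S \<zero>\<^sub>S = q i"
    using ring_hom_add[OF \<pi>, of "?d j (s j y) i" "s k (?d k y) i"] y(2)[of i] z by simp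
   then show ?thesis using ring_hom_closed[OF \<pi> \<open>?d j (s j y) i <: R\<close>] by simp
  qed
  then have "q = vec_mat S (J (Suc j)) p (%i k. \<pi> (D j i k))"
   using ring_hom_vec_mat[OF R S \<pi> _ c(3), of "J (Suc j)" "s j y" j] VecD(1)[OF rV[OF sy]]
   by (auto simp: p_def fun_eq_iff)
  then show "\<exists>p\<in>Vec S (J (Suc j)). q = vec_mat S (J (Suc j)) p (%i k. \<pi> (D j i k))" using p by blast
 qed
qed

end

section \<open>Opposite rings and dual complexes\<close>

lemma opposite_simps [simp]:
 "carrier (opp R) = carrier R" "add (opp R) = add R"
 "zero (opp R) = zero R" "one (opp R) = one R"
 "mult (opp R) = (%x y. y \<otimes>\<^sub>R x)" "smult (opp R) = smult R"
 "finsum (opp R) = finsum R" "opp (opp R) = R"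
 by (auto simp: opposite_algebra_def finsum_def finprod_def fun_eq_iff)

lemma ring_opposite: "ring R ==> ring (opp R)"
proof -
 assume "ring R"
 then interpret ring R .
 have "abelian_group (opp R)" by (rule abelian_group_cong[OF is_abelian_group]) auto
 then show ?thesis
  by (intro ringI) (auto intro!: monoidI simp: m_assoc l_distr r_distr)
qed

lemma ring_hom_opposite:
 "h \<in> ring_hom R S ==> h \<in> ring_hom (opp R) (opp S)"
 by (auto simp: ring_hom_def)

lemma Vec_opposite [simp]: "Vec (opp R) I = Vec R I"
 by (auto simp: free_module_carrier)

lemma Mat_opposite [simp]: "Mat (opp R) I J = Mat R I J"
 by (auto simp: Mat_def)

definition transposed :: "('x => 'y => 'r) => 'y => 'x => 'r" where
 "transposed A = (%i j. A j i)"

lemma vec_mat_opposite: "vec_mat (opp R) J c (transposed A) = mat_vec R J A c"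
 by (simp add: vec_mat_def mat_vec_def transposed_def)

lemma mat_mul_opposite:
 "mat_mul (opp R) J (transposed B) (transposed A) = transposed (mat_mul R J A B)"
 by (simp add: mat_mul_def transposed_def)

text \<open>The dual complex runs in the other direction. Reflecting the degrees at N makes it a
  chain complex over the opposite ring, to which the exactness lemmas apply; the degrees above N are
  filled with zeros.\<close>

definition rev_I :: "nat => (nat => 'x set) => nat => 'x set" where
 "rev_I N I j = (if j \<le> N then I (N - j) else {})"

definition rev_e ::
  "('r, 'c) ring_scheme => nat => (nat => 'x => 'x => 'r) => nat => 'x => 'x => 'r" where
 "rev_e R N e j = (if j \<le> N then transposed (e (N - j)) else (%_ _. \<zero>\<^sub>R))"

definition rev_D ::
  "('r, 'c) ring_scheme => nat => (nat => 'x => 'x => 'r) => nat => 'x => 'x => 'r" where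
 "rev_D R N D j = (if Suc j \<le> N then transposed (D (N - Suc j)) else (%_ _. \<zero>\<^sub>R))"

text \<open>Transposition reverses products over the opposite ring, so the two identities e D = D
  and D e = D exchange their roles.\<close>

lemma mcomplex_rev:
 fixes R :: "('k, 'r, 'c) module_scheme"
 assumes R: "ring R" and cx: "mcomplex R I e D"
 shows "mcomplex (opp R) (rev_I N I) (rev_e R N e) (rev_D R N D)"
proof -
 interpret R: ring R by fact
 interpret O: ring "opp R" by (rule ring_opposite[OF R])
 note c = mcomplexD[OF cx]
 have tM: "transposed A \<in> Mat R J I" if "A \<in> Mat R I J" for A I J
  using that by (auto simp: Mat_def transposed_def)
 have z: "mat_mul (opp R) J A (%_ _. \<zero>\<^sub>R) = (%_ _. \<zero>\<^sub>R)"
  "mat_mul (opp R) J (%_ _. \<zero>\<^sub>R) A = (%_ _. \<zero>\<^sub>R)" if "!!i j. A i j <: R" for A J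
  using that by (auto simp: mat_mul_def fun_eq_iff intro!: R.finsum_eq_zeroI)
 have z': "mat_mul (opp R) J (%_ _. \<zero>\<^sub>R) (%_ _. \<zero>\<^sub>R) = (%_ _. \<zero>\<^sub>R)" for J
  by (auto simp: mat_mul_def fun_eq_iff intro!: R.finsum_eq_zeroI)
 have N: "N - j = Suc (N - Suc j)" if "Suc j \<le> N" for j using that by auto
 have eM: "rev_e R N e j \<in> Mat R (rev_I N I j) (rev_I N I j)" for j
  using tM[OF c(2)] by (auto simp: rev_e_def rev_I_def Mat_def)
 have DM: "rev_D R N D j \<in> Mat R (rev_I N I (Suc j)) (rev_I N I j)" for j
  using tM[OF c(3)[of "N - Suc j"]] N[of j] by (auto simp: rev_D_def rev_I_def Mat_def)
 show ?thesis
  unfolding mcomplex_def Mat_opposite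
 proof (intro conjI allI eM DM)
  fix j
  show "finite (rev_I N I j)" using c(1) by (auto simp: rev_I_def)
  show "mat_mul (opp R) (rev_I N I j) (rev_e R N e j) (rev_e R N e j) = rev_e R N e j"
   using c(4)[of "N - j"] z' by (auto simp: rev_I_def rev_e_def mat_mul_opposite)
  show "mat_mul (opp R) (rev_I N I (Suc j)) (rev_e R N e (Suc j)) (rev_D R N D j) = rev_D R N D j"
   using c(6)[of "N - Suc j"] z' by (auto simp: rev_I_def rev_e_def rev_D_def mat_mul_opposite)
  show "mat_mul (opp R) (rev_I N I j) (rev_D R N D j) (rev_e R N e j) = rev_D R N D j"
  proof (cases "Suc j \<le> N")
   case True
   then show ?thesis using c(5)[of "N - Suc j"] N[OF True]
    by (simp add: rev_I_def rev_e_def rev_D_def mat_mul_opposite)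
  next
   case False
   then show ?thesis using z(2)[of "rev_e R N e j"] MatD(1)[OF eM] by (simp add: rev_D_def)
  qed
  show "mat_mul (opp R) (rev_I N I (Suc j)) (rev_D R N D (Suc j)) (rev_D R N D j) =
    (%_ _. \<zero>\<^sub>(opp R))"
  proof (cases "Suc (Suc j) \<le> N")
   case True
   then have "N - Suc j = Suc (N - Suc (Suc j))" by auto
   then show ?thesis using c(7)[of "N - Suc (Suc j)"] True
    by (simp add: rev_I_def rev_D_def mat_mul_opposite) (simp add: transposed_def)
  next
   case False
   then have "rev_D R N D (Suc j) = (%_ _. \<zero>\<^sub>R)" by (simp add: rev_D_def)
   then show ?thesis using z(2)[of "rev_D R N D j"] MatD(1)[OF DM] by simp
  qed
 qed
qed

lemma rev_facts:
 fixes R :: "('k, 'r, 'c) module_scheme"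
 assumes R: "ring R" and cx: "mcomplex R I e D" and N: "n \<le> N" "I (Suc N) = {}"
 shows "{y \<in> carrier (row_module (opp R) (rev_I N I (N - n)) (rev_e R N e (N - n))).
   \<forall>k. N - n = Suc k \<longrightarrow> vec_mat (opp R) (rev_I N I (N - n)) y (rev_D R N D k) = (%_. \<zero>\<^sub>R)} =
  mat_cocycles R I e D n" (is ?A)
  and "(\<exists>p\<in>Vec R (rev_I N I (Suc (N - n))). c = vec_mat (opp R) (rev_I N I (Suc (N - n))) p (rev_D R N D (N - n)))
   \<longleftrightarrow> mat_coboundary R I D n c" (is ?B)
proof -
 interpret R: ring R by fact
 note c = mcomplexD[OF cx]
 have ie: "rev_I N I (N - n) = I n" "rev_e R N e (N - n) = transposed (e n)"
  using N by (auto simp: rev_I_def rev_e_def)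
 show ?A
 proof (cases "n = N")
  case True
  \<comment> \<open>In degree 0 of the reflected complex there is no cycle condition.
    Correspondingly \<open>D n\<close> has no rows, as \<open>I (Suc N)\<close> is empty.\<close>
  have "mat_vec R (I n) (D n) x = (%_. \<zero>\<^sub>R)" if "x \<in> Vec R (I n)" for x
   using MatD(2)[OF c(3)[of n]] N True VecD(1)[OF that]
   by (auto simp: mat_vec_def fun_eq_iff intro!: R.finsum_eq_zeroI)
  then show ?thesis
   unfolding ie using True by (auto simp: row_module_simps mat_cocycles_def vec_mat_opposite)
 next
  case False
  then have 1: "Suc (N - Suc n) = N - n" "Suc (N - Suc n) \<le> N" "N - Suc (N - Suc n) = n" using N by auto
  then have "rev_D R N D (N - Suc n) = transposed (D n)" by (simp add: rev_D_def)
  then show ?thesis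
   unfolding ie using 1(1)[symmetric] by (auto simp: row_module_simps mat_cocycles_def vec_mat_opposite)
 qed
 show ?B
 proof (cases n)
  case 0
  have "vec_mat (opp R) {} p A = (%_. \<zero>\<^sub>R)" for p :: "'b => 'r" and A :: "'b => 'b => 'r"
   by (simp add: vec_mat_def)
  moreover have "(%_. \<zero>\<^sub>R) \<in> Vec R {}" by (rule VecI) auto
  ultimately show ?thesis using 0 by (auto simp: rev_I_def mat_coboundary_def)
 next
  case (Suc m)
  then have 1: "Suc (N - n) \<le> N" "N - Suc (N - n) = m" using N by auto
  then have "rev_D R N D (N - n) = transposed (D m)" "rev_I N I (Suc (N - n)) = I m"
   by (simp_all add: rev_D_def rev_I_def)
  then show ?thesis using Suc by (simp add: mat_coboundary_def vec_mat_opposite)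
 qed
qed

definition coexact_at ::
  "('r, 'c) ring_scheme => (nat => 'x set) => (nat => 'x => 'x => 'r) => (nat => 'x => 'x => 'r) => nat => bool" where
 "coexact_at R I e D n \<longleftrightarrow> (\<forall>c\<in>mat_cocycles R I e D n. mat_coboundary R I D n c)"

lemma exact_at_rev:
 fixes R :: "('k, 'r, 'c) module_scheme"
 assumes "ring R" "mcomplex R I e D" "n \<le> N" "I (Suc N) = {}"
 shows "exact_at (opp R) (rev_I N I) (rev_e R N e) (rev_D R N D) (N - n) \<longleftrightarrow> coexact_at R I e D n"
 unfolding coexact_at_def rev_facts(1)[OF assms, symmetric] rev_facts(2)[OF assms, symmetric]
  exact_at_def row_module_simps Vec_opposite opposite_simps by auto

lemma exact_at_rev_trivial:
 fixes R :: "('k, 'r, 'c) module_scheme" and I :: "nat => 'x set"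
 assumes "ring R" "N < j"
 shows "exact_at (opp R) (rev_I N I) (rev_e R N e) (rev_D R N D) j"
proof -
 interpret R: ring R by fact
 have "q = (%_. \<zero>\<^sub>R)" if "q \<in> Vec R {}" for q using VecD(2)[OF that] by auto
 moreover have "vec_mat (opp R) {} p A = (%_. \<zero>\<^sub>R)" for p :: "'x => 'r" and A :: "'x => 'x => 'r"
  by (simp add: vec_mat_def)
 moreover have "(%_. \<zero>\<^sub>R) \<in> Vec R {}" by (rule VecI) auto
 ultimately show ?thesis using assms by (auto simp: exact_at_def rev_I_def)
qed

text \<open>The reflection fills up with zeros, which h has to preserve.\<close>

lemma transposed_map:
 assumes "h \<zero>\<^sub>R = \<zero>\<^sub>S"
 shows "(%n i j. h (rev_e R N e n i j)) = rev_e S N (%n i j. h (e n i j))"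
  "(%n i j. h (rev_D R N D n i j)) = rev_D S N (%n i j. h (D n i j))"
 using assms by (auto simp: rev_e_def rev_D_def transposed_def fun_eq_iff)

text \<open>This is \<open>reduce_exact\<close> for the reflected dual complex. Its only homology is
  the cohomology in degree d, which l identifies with T.\<close>

lemma coexact_reduce:
 fixes R :: "('k1, 'r, 'c1) module_scheme" and S :: "('k2, 's, 'c2) module_scheme"
 assumes red: "reduction (opp R) T (opp S) \<tau> \<pi> B \<beta> c"
  and Rr: "ring R" and Sr: "ring S" and \<pi>h: "\<pi> \<in> ring_hom R S"
  and cx: "mcomplex R I e D" and ex: "!!n. n \<noteq> d ==> coexact_at R I e D n"
  and bd: "!!n. n > N ==> I n = {}"
  and l: "!!y. y \<in> mat_cocycles R I e D d ==> l y <: T"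
   "!!y y'. y \<in> mat_cocycles R I e D d ==> y' \<in> mat_cocycles R I e D d ==>
    l (%i. y i \<oplus>\<^sub>R y' i) = l y \<oplus>\<^sub>T l y'"
   "!!t y. t <: T ==> y \<in> mat_cocycles R I e D d ==> l (%i. y i \<otimes>\<^sub>R \<tau> t) = t \<otimes>\<^sub>T l y"
   "!!y. y \<in> mat_cocycles R I e D d ==> l y = \<zero>\<^sub>T \<longleftrightarrow> mat_coboundary R I D d y"
  and z: "z \<in> mat_cocycles R I e D d" "l z = \<one>\<^sub>T"
  and n: "n \<noteq> d"
 shows "coexact_at S I (%n i j. \<pi> (e n i j)) (%n i j. \<pi> (D n i j)) n"
proof -
 interpret reduction "opp R" T "opp S" \<tau> \<pi> B \<beta> c by (rule red)
 \<comment> \<open>Reflecting at a degree above N, d and n keeps both d and n within range.\<close>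
 define M where "M = Max {N, d, n}"
 have M: "d \<le> M" "n \<le> M" "I (Suc M) = {}" using bd by (auto simp: M_def)
 have ex': "exact_at (opp R) (rev_I M I) (rev_e R M e) (rev_D R M D) j" if "j \<noteq> M - d" for j
 proof (cases "j \<le> M")
  case True
  then have "M - (M - j) = j" "M - j \<le> M" "M - j \<noteq> d" using that by auto
  then show ?thesis using exact_at_rev[OF Rr cx \<open>M - j \<le> M\<close> M(3)] ex by metis
 next
  case False
  then show ?thesis by (intro exact_at_rev_trivial Rr) simp
 qed
 note rf = rev_facts[OF Rr cx M(1,3)]
 have "exact_at (opp S) (rev_I M I) (%n i k. \<pi> (rev_e R M e n i k)) (%n i k. \<pi> (rev_D R M D n i k)) (M - n)"
 proof (rule reduce_exact[where w = "M - d" and l = l and z = z, OF mcomplex_rev[OF Rr cx] ex'])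
  show "M - n \<noteq> M - d" using M n by auto
 qed (unfold opposite_simps Vec_opposite rf, use l z in auto)
 then show ?thesis
  unfolding transposed_map[where h = \<pi>, OF ring_hom_null[OF Rr Sr \<pi>h]]
  using exact_at_rev[OF Sr mcomplex_map[OF Rr Sr \<pi>h cx] M(2,3)] by simp
qed

section \<open>Tensor products\<close>

definition bilinear ::
  "('k, 'c) ring_scheme => ('k, 'v, 'd) module_scheme => ('k, 'w, 'e) module_scheme =>
   ('k, 'u, 'f) module_scheme => ('v => 'w => 'u) => bool" where
 "bilinear K V W U f \<longleftrightarrow> (\<forall>v\<in>carrier V. f v \<in> mhom K W U) \<and>
   (\<forall>w\<in>carrier W. (%v. f v w) \<in> mhom K V U)"

lemma bilinearI:
 "(!!v. v <: V ==> (%w. f v w) \<in> mhom K W U) ==>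
  (!!w. w <: W ==> (%v. f v w) \<in> mhom K V U) ==> bilinear K V W U f"
 by (simp add: bilinear_def)

lemma bilinear_right: "bilinear K V W U f ==> v <: V ==> (%w. f v w) \<in> mhom K W U"
 and bilinear_left: "bilinear K V W U f ==> w <: W ==> (%v. f v w) \<in> mhom K V U"
 by (simp_all add: bilinear_def)

lemma bilinear_closed:
 "bilinear K V W U f ==> v <: V ==> w <: W ==> f v w <: U"
 using mhom_closed[OF bilinear_right] by metis

lemma moduleI_lmodule:
 assumes "cring K" "lmodule K M"
 shows "module K M"
proof -
 interpret lmodule K M by fact
 show ?thesis
  by (rule moduleI[OF assms(1) M.ag])
   (auto simp: lsmult_closed lsmult_l_distr lsmult_r_distr lsmult_assoc lsmult_one)
qed

lemma submodule_generated_facts: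
 assumes "lmodule R M" "X \<subseteq> carrier M"
 shows "submodule (submodule_generated R M X) R M" "X \<subseteq> submodule_generated R M X"
  "submodule N R M ==> X \<subseteq> N ==> submodule_generated R M X \<subseteq> N"
proof -
 interpret lmodule R M by fact
 let ?S = "{N. submodule N R M \<and> X \<subseteq> N}"
 have "submodule (carrier M) R M"
  by (intro submodule.intro submodule_axioms.intro M.add.group_incl_imp_subgroup lsmult_closed)
   (auto intro!: M.a_group)
 then have ne: "?S \<noteq> {}" using assms(2) by blast
 have "subgroup (\<Inter>?S) (add_monoid M)"
  using ne by (intro group.subgroups_Inter[OF M.a_group]) (auto simp: submodule_def)
 then show "submodule (submodule_generated R M X) R M"
  unfolding submodule_generated_def
  by (intro submodule.intro submodule_axioms.intro) (auto simp: submodule_def submodule_axioms_def)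
 show "X \<subseteq> submodule_generated R M X"
  "submodule N R M ==> X \<subseteq> N ==> submodule_generated R M X \<subseteq> N"
  by (auto simp: submodule_generated_def)
qed

lemma kernel_submodule:
 assumes "lmodule R M" "lmodule R N" "f \<in> mhom R M N"
 shows "submodule {x \<in> carrier M. f x = \<zero>\<^sub>N} R M"
proof -
 interpret M: lmodule R M by fact
 interpret N: lmodule R N by fact
 note ad = mhom_additive[OF assms(3)]
 show ?thesis
 proof (intro submodule.intro submodule_axioms.intro group.subgroupI)
  show "group (add_monoid M)" by (rule M.M.a_group)
  show "{x \<in> carrier M. f x = \<zero>\<^sub>N} \<noteq> {}"
   using additive_zero[OF M.M.ag N.M.ag ad] M.M.zero_closed by blast
  fix x assume "x \<in> {x \<in> carrier M. f x = \<zero>\<^sub>N}"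
  then show "inv\<^sub>(add_monoid M) x \<in> {x \<in> carrier M. f x = \<zero>\<^sub>N}"
   using additive_neg[OF M.M.ag N.M.ag ad, of x]
   by (auto simp: a_inv_def[symmetric] N.M.neg_zero)
 qed (auto simp: mhom_add[OF assms(3)] mhom_smult[OF assms(3)] N.lsmult_zero_right M.lsmult_closed)
qed

locale tensor =
 fixes K (structure) and V :: "('k, 'v, 'd) module_scheme" and W :: "('k, 'w, 'e) module_scheme"
 assumes V: "module K V" and W: "module K W"
begin

sublocale V: module K V by (rule V)
sublocale W: module K W by (rule W)

abbreviation "F \<equiv> free_module K (carrier V \<times> carrier W)"
abbreviation "N \<equiv> tensor_null K V W"
abbreviation "T \<equiv> tensor_module K V W"
abbreviation "pt \<equiv> pure_tensor K V W"
abbreviation "bv v w \<equiv> basis_vector K (v, w)"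

lemma K_ring: "ring K" by unfold_locales

lemma F_lmodule: "lmodule K F" by (rule lmodule_free[OF K_ring])

sublocale F: lmodule K F by (rule F_lmodule)

lemma bv_closed: "v <: V ==> w <: W ==> bv v w <: F"
 by (rule basis_vector_in_free[OF K_ring]) simp

lemma relations_closed: "tensor_relations K V W \<subseteq> carrier F"
 unfolding tensor_relations_def Let_def
 by (auto intro!: F.M.minus_closed F.M.a_closed F.lsmult_closed bv_closed)

lemma N_submodule: "submodule N K F"
 and N_relations: "tensor_relations K V W \<subseteq> N"
 and N_least: "submodule X K F ==> tensor_relations K V W \<subseteq> X ==> N \<subseteq> X"
 unfolding tensor_null_def using submodule_generated_facts[OF F_lmodule relations_closed] by auto

sublocale Q: module_quotient F N
 by (rule module_quotient.intro[OF F.M.ag])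
  (rule additive_subgroupI, rule submodule.axioms(1)[OF N_submodule])

lemma T_def: "T = quotient_module F N" by (simp add: tensor_module_def)

lemma T_carrier: "carrier T = (%c. N +>\<^sub>F c) ` carrier F"
 by (simp add: T_def Q.quotient_carrier)

lemma T_add: "x <: F ==> y <: F ==>
  (N +>\<^sub>F x) \<oplus>\<^sub>T (N +>\<^sub>F y) = N +>\<^sub>F (x \<oplus>\<^sub>F y)"
 by (simp add: T_def Q.quotient_add)

lemma T_smult: "a <: K ==> x <: F ==> a \<odot>\<^sub>T (N +>\<^sub>F x) = N +>\<^sub>F (a \<odot>\<^sub>F x)"
 unfolding T_def
 by (rule Q.quotient_smult[OF F.additive_smult]) (auto intro: submodule.smult_closed[OF N_submodule])

lemma T_group: "abelian_group T" unfolding T_def by (rule Q.quotient_group)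

lemma T_module: "module K T"
proof (rule moduleI)
 show "cring K" by (rule V.R.cring_axioms)
 show "abelian_group T" by (rule T_group)
qed (auto simp: T_carrier T_add T_smult F.lsmult_closed F.lsmult_l_distr F.lsmult_r_distr
  F.lsmult_assoc F.lsmult_one)

sublocale T: module K T by (rule T_module)

lemma proj_hom: "(%c. N +>\<^sub>F c) \<in> mhom K F T"
 by (rule mhomI) (auto simp: T_carrier T_add T_smult)

lemma rep: "t <: T ==> (SOME c. c \<in> t) <: F"
 "t <: T ==> N +>\<^sub>F (SOME c. c \<in> t) = t"
proof -
 assume "t <: T"
 then obtain c where c: "c <: F" "t = N +>\<^sub>F c" by (auto simp: T_carrier)
 then have "c \<in> t" using Q.NM.a_rcos_self by simp
 then have s: "(SOME c. c \<in> t) \<in> t" by (rule someI[of "%c. c \<in> t"])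
 then show "(SOME c. c \<in> t) <: F" using c Q.NM.a_elemrcos_carrier by metis
 show "N +>\<^sub>F (SOME c. c \<in> t) = t" using Q.NM.a_repr_independence'[OF _ c(1)] s c(2) by metis
qed

definition eval :: "('k, 'u, 'f) module_scheme => ('v => 'w => 'u) => ('v \<times> 'w => 'k) => 'u" where
 "eval U f c = (\<Oplus>\<^sub>U p\<in>{p. c p \<noteq> \<zero>}. c p \<odot>\<^sub>U f (fst p) (snd p))"

lemma tensor_lift_eval: "tensor_lift K U f t = eval U f (SOME c. c \<in> t)"
 by (simp add: tensor_lift_def eval_def Let_def)

lemma eval_hom:
 assumes U: "module K U" and f: "!!v w. v <: V ==> w <: W ==> f v w <: U"
 shows "eval U f \<in> mhom K F U"
  and "v <: V ==> w <: W ==> eval U f (bv v w) = f v w"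
proof -
 interpret U: module K U by fact
 have y: "f (fst p) (snd p) <: U" if "p \<in> carrier V \<times> carrier W" for p using f that by auto
 obtain h where h: "h \<in> mhom K F U"
  "!!c S. c <: F ==> finite S ==> S \<subseteq> carrier V \<times> carrier W ==>
   {p\<in>carrier V \<times> carrier W. c p \<noteq> \<zero>} \<subseteq> S ==> h c = (\<Oplus>\<^sub>U p\<in>S. c p \<odot>\<^sub>U f (fst p) (snd p))"
  using dual_basis_extend[OF F_lmodule U.lmodule dual_basis_free[OF K_ring], of "%p. f (fst p) (snd p)"] y
  by blast
 have eq: "eval U f c = h c" if c: "c <: F" for c
  unfolding eval_def using c by (intro h(2)[symmetric]) (auto simp: free_module_carrier)
 show "eval U f \<in> mhom K F U"
  using mhom_cong[OF h(1) F.M.ag] eq F.lsmult_closed by blast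
 assume vw: "v <: V" "w <: W"
 have "h (bv v w) = (\<Oplus>\<^sub>U p\<in>{(v, w)}. bv v w p \<odot>\<^sub>U f (fst p) (snd p))"
  using vw by (intro h(2) bv_closed) (auto simp: basis_vector_def)
 then show "eval U f (bv v w) = f v w"
  using eq[OF bv_closed[OF vw]] f[OF vw] by (simp add: basis_vector_def)
qed

text \<open>The kernel of \<open>eval\<close> is a submodule that contains the defining relations,
  hence everything they generate.\<close>

lemma eval_null:
 assumes U: "module K U" and f: "bilinear K V W U f"
 shows "N \<subseteq> {c \<in> carrier F. eval U f c = \<zero>\<^sub>U}"
proof (rule N_least)
 interpret U: module K U by fact
 note fc = bilinear_closed[OF f]
 note eh = eval_hom[OF U fc]
 show "submodule {c \<in> carrier F. eval U f c = \<zero>\<^sub>U} K F"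
  by (rule kernel_submodule[OF F_lmodule U.lmodule eh(1)])
 have d: "eval U f (x \<ominus>\<^sub>F y) = eval U f x \<ominus>\<^sub>U eval U f y" if "x <: F" "y <: F" for x y
  using additive_diff[OF F.M.ag U.M.ag mhom_additive[OF eh(1)] that] .
 note add = mhom_add[OF eh(1)] and sm = mhom_smult[OF eh(1)]
 show "tensor_relations K V W \<subseteq> {c \<in> carrier F. eval U f c = \<zero>\<^sub>U}"
 proof
  fix c assume c: "c \<in> tensor_relations K V W"
  then have cF: "c <: F" using relations_closed by auto
  have "eval U f c = \<zero>\<^sub>U"
   using c unfolding tensor_relations_def Let_def
   by (auto simp: d add sm eh(2) bv_closed F.lsmult_closed fc mhom_add[OF bilinear_left[OF f]]
     mhom_add[OF bilinear_right[OF f]] mhom_smult[OF bilinear_left[OF f]]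
     mhom_smult[OF bilinear_right[OF f]] U.M.minus_self)
  then show "c \<in> {c \<in> carrier F. eval U f c = \<zero>\<^sub>U}" using cF by simp
 qed
qed

text \<open>\<open>tensor_lift\<close> uses one chosen representative. Two representatives differ by
  an element of \<open>N\<close>, where \<open>eval\<close> vanishes for bilinear f.\<close>

lemma lift_coset:
 assumes U: "module K U" and f: "bilinear K V W U f" and c: "c <: F"
 shows "tensor_lift K U f (N +>\<^sub>F c) = eval U f c"
proof -
 interpret U: module K U by fact
 note eh = eval_hom[OF U bilinear_closed[OF f]]
 let ?t = "N +>\<^sub>F c"
 have t: "?t <: T" using c by (auto simp: T_carrier)
 let ?c = "SOME c. c \<in> ?t"
 have "?c \<ominus>\<^sub>F c \<in> N" using Q.coset_eq_iff[OF rep(1)[OF t] c] rep(2)[OF t] by simp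
 then have "eval U f (?c \<ominus>\<^sub>F c) = \<zero>\<^sub>U" using eval_null[OF U f] by auto
 then have "eval U f ?c \<ominus>\<^sub>U eval U f c = \<zero>\<^sub>U"
  using additive_diff[OF F.M.ag U.M.ag mhom_additive[OF eh(1)] rep(1)[OF t] c]
  by simp
 then show ?thesis
  using mhom_closed[OF eh(1)] rep(1)[OF t] c by (simp add: tensor_lift_eval U.M.minus_eq_zero_iff)
qed

lemma pure_closed: "v <: V ==> w <: W ==> pt v w <: T"
 using bv_closed by (auto simp: pure_tensor_def T_carrier)

lemma lift_pure:
 assumes "module K U" "bilinear K V W U f" "v <: V" "w <: W"
 shows "tensor_lift K U f (pt v w) = f v w"
 unfolding pure_tensor_def lift_coset[OF assms(1,2) bv_closed[OF assms(3,4)]]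
 by (rule eval_hom(2)[OF assms(1) bilinear_closed[OF assms(2)] assms(3,4)])

lemma lift_hom:
 assumes U: "module K U" and f: "bilinear K V W U f"
 shows "tensor_lift K U f \<in> mhom K T U"
proof -
 note eh = eval_hom(1)[OF U bilinear_closed[OF f]]
 note lc = lift_coset[OF U f]
 show ?thesis
  by (rule mhomI)
   (auto simp: T_carrier T_add T_smult lc F.lsmult_closed mhom_add[OF eh] mhom_smult[OF eh]
    mhom_closed[OF eh])
qed

lemma coset_eqI: "x <: F ==> y <: F ==> x \<ominus>\<^sub>F y \<in> tensor_relations K V W ==>
  N +>\<^sub>F x = N +>\<^sub>F y"
 using Q.coset_eq_iff N_relations by blast

lemma pure_bilinear: "bilinear K V W T pt"
proof (rule bilinearI)
 fix v assume v: "v <: V"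
 show "(%w. pt v w) \<in> mhom K W T"
 proof (rule mhomI)
  fix w w' assume w: "w <: W" "w' <: W"
  have "N +>\<^sub>F bv v (w \<oplus>\<^sub>W w') = N +>\<^sub>F (bv v w \<oplus>\<^sub>F bv v w')"
   using v w by (intro coset_eqI F.M.a_closed bv_closed) (auto simp: tensor_relations_def Let_def)
  then show "pt v (w \<oplus>\<^sub>W w') = pt v w \<oplus>\<^sub>T pt v w'"
   using v w by (simp add: pure_tensor_def T_add bv_closed)
 next
  fix a w assume a: "a <: K" "w <: W"
  have "N +>\<^sub>F bv v (a \<odot>\<^sub>W w) = N +>\<^sub>F (a \<odot>\<^sub>F bv v w)"
   using v a by (intro coset_eqI F.lsmult_closed bv_closed) (auto simp: tensor_relations_def Let_def)
  then show "pt v (a \<odot>\<^sub>W w) = a \<odot>\<^sub>T pt v w"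
   using v a by (simp add: pure_tensor_def T_smult bv_closed)
 qed (use v pure_closed in auto)
next
 fix w assume w: "w <: W"
 show "(%v. pt v w) \<in> mhom K V T"
 proof (rule mhomI)
  fix v v' assume v: "v <: V" "v' <: V"
  have "N +>\<^sub>F bv (v \<oplus>\<^sub>V v') w = N +>\<^sub>F (bv v w \<oplus>\<^sub>F bv v' w)"
   using v w by (intro coset_eqI F.M.a_closed bv_closed) (auto simp: tensor_relations_def Let_def)
  then show "pt (v \<oplus>\<^sub>V v') w = pt v w \<oplus>\<^sub>T pt v' w"
   using v w by (simp add: pure_tensor_def T_add bv_closed)
 next
  fix a v assume a: "a <: K" "v <: V"
  have "N +>\<^sub>F bv (a \<odot>\<^sub>V v) w = N +>\<^sub>F (a \<odot>\<^sub>F bv v w)"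
   using w a by (intro coset_eqI F.lsmult_closed bv_closed) (auto simp: tensor_relations_def Let_def)
  then show "pt (a \<odot>\<^sub>V v) w = a \<odot>\<^sub>T pt v w"
   using w a by (simp add: pure_tensor_def T_smult bv_closed)
 qed (use w pure_closed in auto)
qed

text \<open>Scalars are absorbed into the first factor, so every tensor is a plain sum of pure
  tensors and two cases suffice.\<close>

lemma tensor_induct [consumes 1, case_names pure add]:
 assumes t: "t <: T"
  and pure: "!!v w. v <: V ==> w <: W ==> P (pt v w)"
  and add: "!!s t. s <: T ==> t <: T ==> P s ==> P t ==> P (s \<oplus>\<^sub>T t)"
 shows "P t"
proof -
 obtain c where c: "c <: F" "t = N +>\<^sub>F c" using t by (auto simp: T_carrier)
 define S where "S = {p\<in>carrier V \<times> carrier W. c p \<noteq> \<zero>}"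
 have S: "finite S" "S \<subseteq> carrier V \<times> carrier W"
  using dual_basis_finite[OF dual_basis_free[OF K_ring] c(1)] by (auto simp: S_def)
 have ck: "c p <: K" for p using VecD(1)[OF c(1)] .
 have "(\<Oplus>\<^sub>F p\<in>S. c p \<odot>\<^sub>F basis_vector K p) = c"
  by (rule dual_basis_sum[OF F_lmodule dual_basis_free[OF K_ring] c(1) S]) (simp add: S_def)
 then have "t = N +>\<^sub>F (\<Oplus>\<^sub>F p\<in>S. c p \<odot>\<^sub>F basis_vector K p)" using c(2) by simp
 also have "... = (\<Oplus>\<^sub>T p\<in>S. N +>\<^sub>F (c p \<odot>\<^sub>F basis_vector K p))"
  using S(2) F.lsmult_closed[OF ck basis_vector_in_free[OF K_ring]]
  by (intro additive_finsum[OF F.M.ag T_group mhom_additive[OF proj_hom]]) blast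
 also have "... = (\<Oplus>\<^sub>T p\<in>S. pt (c p \<odot>\<^sub>V fst p) (snd p))"
 proof (rule T.M.finsum_eqI)
  fix p assume "p \<in> S"
  then have p: "fst p <: V" "snd p <: W" using S by auto
  have "N +>\<^sub>F (c p \<odot>\<^sub>F basis_vector K p) = c p \<odot>\<^sub>T pt (fst p) (snd p)"
   using T_smult[OF ck bv_closed[OF p]] by (simp add: pure_tensor_def)
  also have "... = pt (c p \<odot>\<^sub>V fst p) (snd p)"
   using mhom_smult[OF bilinear_left[OF pure_bilinear p(2)] ck p(1)] by simp
  finally show "N +>\<^sub>F (c p \<odot>\<^sub>F basis_vector K p) = pt (c p \<odot>\<^sub>V fst p) (snd p)" .
  show "pt (c p \<odot>\<^sub>V fst p) (snd p) <: T" using p ck by (intro pure_closed) auto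
 qed
 finally have t_eq: "t = (\<Oplus>\<^sub>T p\<in>S. pt (c p \<odot>\<^sub>V fst p) (snd p))" .
 have "P (\<Oplus>\<^sub>T p\<in>S'. pt (c p \<odot>\<^sub>V fst p) (snd p))" if "finite S'" "S' \<subseteq> S" for S'
  using that
 proof (induction S' rule: finite_induct)
  case empty
  have "pt \<zero>\<^sub>V \<zero>\<^sub>W = \<zero>\<^sub>T"
   using additive_zero[OF W.M.ag T_group
     mhom_additive[OF bilinear_right[OF pure_bilinear V.M.zero_closed]]] .
  then show ?case using pure[of "\<zero>\<^sub>V" "\<zero>\<^sub>W"] by simp
 next
  case (insert p S')
  have cl: "pt (c p \<odot>\<^sub>V fst p) (snd p) <: T" if "p \<in> S" for p
   using that S ck by (intro pure_closed) auto
  have "P (pt (c p \<odot>\<^sub>V fst p) (snd p))" using insert.prems S ck by (intro pure) auto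
  moreover have "(\<Oplus>\<^sub>T p\<in>S'. pt (c p \<odot>\<^sub>V fst p) (snd p)) <: T"
   using insert.prems cl by (intro T.M.finsum_in) auto
  moreover have "(\<Oplus>\<^sub>T p\<in>insert p S'. pt (c p \<odot>\<^sub>V fst p) (snd p)) =
    pt (c p \<odot>\<^sub>V fst p) (snd p) \<oplus>\<^sub>T (\<Oplus>\<^sub>T p\<in>S'. pt (c p \<odot>\<^sub>V fst p) (snd p))"
   using insert.hyps insert.prems cl by (intro T.M.finsum_insert) blast+
  ultimately show ?case
   using insert cl[of p] by (simp add: add)
 qed
 then show ?thesis using t_eq S(1) by simp
qed

lemma tensor_ext:
 assumes "f \<in> mhom K T U" "g \<in> mhom K T U"
  and "!!v w. v <: V ==> w <: W ==> f (pt v w) = g (pt v w)" and "t <: T"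
 shows "f t = g t"
 using assms(4)
 by (induction rule: tensor_induct) (auto simp: assms(3) mhom_add[OF assms(1)] mhom_add[OF assms(2)])

text \<open>The following rules hold for every function \<open>f\<close> with values in \<open>U\<close>, bilinear or not, since
 \<^const>\<open>tensor_lift\<close> is computed on a fixed representative.\<close>

definition supp :: "('k, 'v, 'w) tensor => ('v \<times> 'w) set" where
 "supp t = {p. (SOME c. c \<in> t) p \<noteq> \<zero>}"

definition wt :: "('k, 'v, 'w) tensor => 'v \<times> 'w => 'k" where
 "wt t = (SOME c. c \<in> t)"

lemma lift_sum: "tensor_lift K U f t = (\<Oplus>\<^sub>U p\<in>supp t. wt t p \<odot>\<^sub>U f (fst p) (snd p))"
 by (simp add: tensor_lift_eval eval_def supp_def wt_def)

lemma supp: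
 assumes "t <: T"
 shows "finite (supp t)" "p \<in> supp t ==> fst p <: V" "p \<in> supp t ==> snd p <: W"
  "wt t p <: K"
 using rep(1)[OF assms] by (auto simp: supp_def wt_def free_module_carrier, (cases p; auto)+)

lemma lift_closed:
 assumes "module K U" "t <: T"
  "!!v w. v <: V ==> w <: W ==> f v w <: U"
 shows "tensor_lift K U f t <: U"
proof -
 interpret U: module K U by fact
 show ?thesis unfolding lift_sum using supp[OF assms(2)] assms(3) by (intro U.M.finsum_in) auto
qed

lemma lift_comp:
 assumes "module K U" "module K U'" "h \<in> mhom K U U'" "t <: T"
  "!!v w. v <: V ==> w <: W ==> f v w <: U"
 shows "h (tensor_lift K U f t) = tensor_lift K U' (%v w. h (f v w)) t"
proof -
 interpret U: module K U by fact
 interpret U': module K U' by fact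
 note s = supp[OF assms(4)]
 have "h (tensor_lift K U f t) = (\<Oplus>\<^sub>U' p\<in>supp t. h (wt t p \<odot>\<^sub>U f (fst p) (snd p)))"
  unfolding lift_sum using s assms(5)
  by (intro additive_finsum[OF U.M.ag U'.M.ag mhom_additive[OF assms(3)]]) auto
 also have "... = tensor_lift K U' (%v w. h (f v w)) t"
  unfolding lift_sum using s assms(5) mhom_closed[OF assms(3)]
  by (intro U'.M.finsum_eqI) (auto simp: mhom_smult[OF assms(3)])
 finally show ?thesis .
qed

lemma lift_linear:
 assumes "module K U" "module K X" "t <: T"
  "!!v w. v <: V ==> w <: W ==> (%x. f x v w) \<in> mhom K X U"
 shows "(%x. tensor_lift K U (f x) t) \<in> mhom K X U"
proof -
 interpret U: module K U by fact
 interpret X: module K X by fact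
 note s = supp[OF assms(3)]
 note l = assms(4)
 show ?thesis
 proof (rule mhomI)
  fix x assume x: "x <: X"
  then show "tensor_lift K U (f x) t <: U"
   using mhom_closed[OF l] by (intro lift_closed[OF assms(1,3)])
 next
  fix x y assume x: "x <: X" "y <: X"
  have "tensor_lift K U (f (x \<oplus>\<^sub>X y)) t =
    (\<Oplus>\<^sub>U p\<in>supp t. wt t p \<odot>\<^sub>U f x (fst p) (snd p) \<oplus>\<^sub>U wt t p \<odot>\<^sub>U f y (fst p) (snd p))"
   unfolding lift_sum using s x mhom_closed[OF l]
   by (intro U.M.finsum_eqI) (auto simp: mhom_add[OF l] U.smult_r_distr)
  then show "tensor_lift K U (f (x \<oplus>\<^sub>X y)) t = tensor_lift K U (f x) t \<oplus>\<^sub>U tensor_lift K U (f y) t"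
   unfolding lift_sum using s x mhom_closed[OF l] by (subst (asm) U.M.finsum_plus) auto
 next
  fix a x assume a: "a <: K" "x <: X"
  have "a \<odot>\<^sub>U tensor_lift K U (f x) t = (\<Oplus>\<^sub>U p\<in>supp t. a \<odot>\<^sub>U (wt t p \<odot>\<^sub>U f x (fst p) (snd p)))"
   unfolding lift_sum using s a mhom_closed[OF l]
   by (intro lmodule.finsum_lsmult[OF U.lmodule]) auto
  also have "... = tensor_lift K U (f (a \<odot>\<^sub>X x)) t"
   unfolding lift_sum using s a mhom_closed[OF l]
   by (intro U.M.finsum_eqI) (auto simp: mhom_smult[OF l] U.smult_assoc1[symmetric] V.R.m_comm)
  finally show "tensor_lift K U (f (a \<odot>\<^sub>X x)) t = a \<odot>\<^sub>U tensor_lift K U (f x) t" by simp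
 qed
qed

end

lemma lift_swap:
 assumes t: "tensor K V W" "t <: (tensor_module K V W)" and s: "tensor K X Y" "s <: (tensor_module K X Y)"
  and U: "module K U"
  and f: "!!v w x y. v <: V ==> w <: W ==> x <: X ==> y <: Y ==> f v w x y <: U"
 shows "tensor_lift K U (%v w. tensor_lift K U (%x y. f v w x y) s) t =
  tensor_lift K U (%x y. tensor_lift K U (%v w. f v w x y) t) s"
proof -
 interpret t: tensor K V W by fact
 interpret s: tensor K X Y by fact
 interpret U: module K U by fact
 note st = t.supp[OF t(2)] and ss = s.supp[OF s(2)]
 have "tensor_lift K U (%v w. tensor_lift K U (%x y. f v w x y) s) t =
   (\<Oplus>\<^sub>U p\<in>t.supp t. \<Oplus>\<^sub>U q\<in>s.supp s. t.wt t p \<odot>\<^sub>U (s.wt s q \<odot>\<^sub>U f (fst p) (snd p) (fst q) (snd q)))"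
  unfolding t.lift_sum[of _ _ t] s.lift_sum[of _ _ s] using st ss f
  by (intro U.M.finsum_eqI) (auto intro!: lmodule.finsum_lsmult[OF U.lmodule] U.M.finsum_in)
 also have "... = (\<Oplus>\<^sub>U q\<in>s.supp s. \<Oplus>\<^sub>U p\<in>t.supp t. t.wt t p \<odot>\<^sub>U (s.wt s q \<odot>\<^sub>U f (fst p) (snd p) (fst q) (snd q)))"
  using st ss f by (intro U.M.finsum_swap) auto
 also have "... = tensor_lift K U (%x y. tensor_lift K U (%v w. f v w x y) t) s"
  unfolding t.lift_sum[of _ _ t] s.lift_sum[of _ _ s]
 proof (rule U.M.finsum_eqI)
  fix q assume q: "q \<in> s.supp s"
  have "s.wt s q \<odot>\<^sub>U (\<Oplus>\<^sub>U p\<in>t.supp t. t.wt t p \<odot>\<^sub>U f (fst p) (snd p) (fst q) (snd q)) =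
    (\<Oplus>\<^sub>U p\<in>t.supp t. s.wt s q \<odot>\<^sub>U (t.wt t p \<odot>\<^sub>U f (fst p) (snd p) (fst q) (snd q)))"
   using st ss f q by (intro lmodule.finsum_lsmult[OF U.lmodule]) auto
  also have "... = (\<Oplus>\<^sub>U p\<in>t.supp t. t.wt t p \<odot>\<^sub>U (s.wt s q \<odot>\<^sub>U f (fst p) (snd p) (fst q) (snd q)))"
   using st ss f q by (intro U.M.finsum_eqI) (auto simp: U.smult_assoc1[symmetric] t.V.R.m_comm)
  finally show "(\<Oplus>\<^sub>U p\<in>t.supp t. t.wt t p \<odot>\<^sub>U (s.wt s q \<odot>\<^sub>U f (fst p) (snd p) (fst q) (snd q))) =
   s.wt s q \<odot>\<^sub>U (\<Oplus>\<^sub>U p\<in>t.supp t. t.wt t p \<odot>\<^sub>U f (fst p) (snd p) (fst q) (snd q))" by simp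
  show "s.wt s q \<odot>\<^sub>U (\<Oplus>\<^sub>U p\<in>t.supp t. t.wt t p \<odot>\<^sub>U f (fst p) (snd p) (fst q) (snd q)) <: U"
   using st ss f q by (intro U.smult_closed U.M.finsum_in) auto
 qed
 finally show ?thesis .
qed

section \<open>Tensor products of algebras\<close>

locale tensor_alg = A?: assoc_algebra K A + B?: assoc_algebra K B
 for K (structure) and A :: "('k, 'a, 'd) module_scheme" and B :: "('k, 'b, 'e) module_scheme"
begin

lemma tensor_axioms': "tensor K A B" by unfold_locales

end

sublocale tensor_alg \<subseteq> t: tensor K A B by (rule tensor_axioms')

context tensor_alg
begin

abbreviation "TA \<equiv> tensor_algebra K A B"

lemma TA_simps [simp]: "carrier TA = carrier t.T" "add TA = add t.T" "zero TA = zero t.T" "smult TA = smult t.T"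
 "one TA = t.pt \<one>\<^sub>A \<one>\<^sub>B" "finsum TA = finsum t.T"
 by (auto simp: tensor_algebra_def finsum_def finprod_def fun_eq_iff)

lemma mult_left_lin: "a <: A ==> (%x. a \<otimes>\<^sub>A x) \<in> mhom K A A"
 "a <: A ==> (%x. x \<otimes>\<^sub>A a) \<in> mhom K A A"
 "b <: B ==> (%x. b \<otimes>\<^sub>B x) \<in> mhom K B B"
 "b <: B ==> (%x. x \<otimes>\<^sub>B b) \<in> mhom K B B"
 by (auto intro!: mhomI simp: A.r_distr A.l_distr A.smult_mult_right A.smult_mult_left
   B.r_distr B.l_distr B.smult_mult_right B.smult_mult_left)

definition rmul where "rmul t a b = tensor_lift K t.T (%a' b'. t.pt (a \<otimes>\<^sub>A a') (b \<otimes>\<^sub>B b')) t"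

lemma pt_lin: "v <: A ==> f \<in> mhom K X B ==> (%x. t.pt v (f x)) \<in> mhom K X t.T"
 "w <: B ==> g \<in> mhom K X A ==> (%x. t.pt (g x) w) \<in> mhom K X t.T"
 using mhom_comp[OF _ bilinear_right[OF t.pure_bilinear]] mhom_comp[OF _ bilinear_left[OF t.pure_bilinear]]
 by blast+

lemma rmul_bil: "a <: A ==> b <: B ==>
  bilinear K A B t.T (%a' b'. t.pt (a \<otimes>\<^sub>A a') (b \<otimes>\<^sub>B b'))"
 by (intro bilinearI pt_lin mult_left_lin) auto

lemma rmul_bilinear: "t <: t.T ==> bilinear K A B t.T (rmul t)"
 unfolding rmul_def
 by (intro bilinearI t.lift_linear[OF t.T_module] pt_lin mult_left_lin) (auto intro: t.V t.W)

lemma mult_def': "s \<otimes>\<^sub>TA t = tensor_lift K t.T (%a b. rmul t a b) s"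
 by (simp add: tensor_algebra_def rmul_def)

lemma mult_bilinear: "bilinear K t.T t.T t.T (mult TA)"
proof (rule bilinearI)
 fix s assume s: "s <: t.T"
 show "(%t. s \<otimes>\<^sub>TA t) \<in> mhom K t.T t.T"
  unfolding mult_def'
 proof (rule t.lift_linear[OF t.T_module t.T_module s])
  fix v w assume "v <: A" "w <: B"
  then show "(%x. rmul x v w) \<in> mhom K t.T t.T"
   unfolding rmul_def using t.lift_hom[OF t.T_module rmul_bil] by simp
 qed
next
 fix t assume t: "t <: t.T"
 show "(%s. s \<otimes>\<^sub>TA t) \<in> mhom K t.T t.T"
  unfolding mult_def' using t.lift_hom[OF t.T_module rmul_bilinear[OF t]] by simp
qed

lemma mult_pure:
 assumes "a <: A" "b <: B" "a' <: A" "b' <: B"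
 shows "t.pt a b \<otimes>\<^sub>TA t.pt a' b' = t.pt (a \<otimes>\<^sub>A a') (b \<otimes>\<^sub>B b')"
proof -
 have "t.pt a b \<otimes>\<^sub>TA t.pt a' b' = rmul (t.pt a' b') a b"
  unfolding mult_def' using assms t.pure_closed by (intro t.lift_pure[OF t.T_module] rmul_bilinear) auto
 also have "... = t.pt (a \<otimes>\<^sub>A a') (b \<otimes>\<^sub>B b')"
  unfolding rmul_def using assms by (intro t.lift_pure[OF t.T_module] rmul_bil) auto
 finally show ?thesis .
qed

lemma mult_closed: "s <: t.T ==> t <: t.T ==> s \<otimes>\<^sub>TA t <: t.T"
 by (rule bilinear_closed[OF mult_bilinear])

lemma TA_assoc_algebra: "assoc_algebra K TA"
proof -
 note mr = bilinear_right[OF mult_bilinear] and ml = bilinear_left[OF mult_bilinear]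
 note madd = mhom_add[OF mr] mhom_add[OF ml]
 have one: "t.pt \<one>\<^sub>A \<one>\<^sub>B <: t.T" by (rule t.pure_closed) auto
 have grp: "abelian_group TA" by (rule abelian_group_cong[OF t.T_group]) auto
 have mon: "Group.monoid TA"
 proof (rule monoidI)
  fix x y z assume x: "x <: TA" and y: "y <: TA" and z: "z <: TA"
  then have x': "x <: t.T" and y': "y <: t.T" and z': "z <: t.T" by auto
  show "x \<otimes>\<^sub>TA y \<otimes>\<^sub>TA z = x \<otimes>\<^sub>TA (y \<otimes>\<^sub>TA z)"
   using x'
  proof (induction rule: t.tensor_induct)
   case (pure a b)
   note ab = pure
   show ?case
    using y'
   proof (induction rule: t.tensor_induct)
    case (pure a' b')
    note ab' = pure
    show ?case
     using z'
    proof (induction rule: t.tensor_induct)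
     case (pure a'' b'')
     then show ?case using ab ab' by (simp add: mult_pure A.m_assoc B.m_assoc)
    next
     case (add s t)
     then show ?case using ab ab' by (simp add: madd t.pure_closed mult_closed)
    qed
   next
    case (add s t)
    then show ?case using ab z' by (simp add: madd t.pure_closed mult_closed)
   qed
  next
   case (add s t)
   then show ?case using y' z' by (simp add: madd mult_closed)
  qed
 next
  fix x assume "x <: TA"
  then have x: "x <: t.T" by simp
  show "\<one>\<^sub>TA \<otimes>\<^sub>TA x = x"
   using x by (induction rule: t.tensor_induct) (use one in \<open>auto simp: mult_pure madd\<close>)
  show "x \<otimes>\<^sub>TA \<one>\<^sub>TA = x"
   using x by (induction rule: t.tensor_induct) (use one in \<open>auto simp: mult_pure madd\<close>)
 qed (auto simp: mult_closed one)
 have ring: "ring TA"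
  by (rule ringI[OF grp mon]) (auto simp: madd)
 have modu: "module K TA"
  by (rule moduleI[OF module.axioms(1)[OF t.V] grp])
   (auto simp: t.T.smult_l_distr t.T.smult_r_distr t.T.smult_assoc1)
 show ?thesis
  by (intro assoc_algebra.intro modu ring assoc_algebra_axioms.intro A.K.field_axioms)
   (auto simp: mhom_smult[OF mr] mhom_smult[OF ml])
qed

sublocale TA: assoc_algebra K TA by (rule TA_assoc_algebra)

end

section \<open>Sweedler calculus\<close>

text \<open>The product is defined by an inductive fold that sees the function only on
  \<open>A\<close>, so values outside the carrier do no harm. Terms under a Sweedler sum can thus be
  rewritten without first proving that they lie in the target.\<close>

lemma finprod_cong_all:
 assumes "!!i. i \<in> A ==> f i = g i"
 shows "finprod G f A = finprod G g A"
proof -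
 have *: "(B, z) \<in> foldSetD D (mult G \<circ> g) e" if "(B, z) \<in> foldSetD D (mult G \<circ> f) e" "!!i. i \<in> B ==> f i = g i"
  for B z D e f g
  using that
 proof (induction rule: foldSetD.induct)
  case (insertI x A y)
  have "((\<otimes>\<^sub>G) \<circ> g) x y \<in> D" using insertI by (metis comp_apply insertI1)
  then have "(insert x A, ((\<otimes>\<^sub>G) \<circ> g) x y) \<in> foldSetD D ((\<otimes>\<^sub>G) \<circ> g) e"
   using insertI by (intro foldSetD.insertI) auto
  then show ?case using insertI by (metis comp_apply insertI1)
 qed (auto intro: foldSetD.intros)
 have "(A, z) \<in> foldSetD D (mult G \<circ> f) e \<longleftrightarrow> (A, z) \<in> foldSetD D (mult G \<circ> g) e" for z D e
  using *[of A z D f e g] *[of A z D g e f] assms by metis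
 then show ?thesis by (simp add: finprod_def foldD_def)
qed

context tensor
begin

lemma lift_cong_all:
 assumes "t <: T" "!!v w. v <: V ==> w <: W ==> f v w = g v w"
 shows "tensor_lift K U f t = tensor_lift K U g t"
 unfolding lift_sum finsum_def using supp[OF assms(1)] assms(2) by (intro finprod_cong_all) auto

lemma lift_pt: "t <: T ==> tensor_lift K T pt t = t"
 by (rule tensor_ext[OF lift_hom[OF T_module pure_bilinear], of "%t. t"])
  (auto simp: lift_pure[OF T_module pure_bilinear] module_hom_def)

end

lemma (in field) regular_assoc_algebra: "assoc_algebra R (reg R)"
proof -
 have r: "lmodule R (reg R)" by (rule lmodule_regular[OF ring_axioms])
 have g: "abelian_group (reg R)" using lmodule.axioms(2)[OF r] .
 have m: "Group.monoid (reg R)" by (rule monoidI) (auto simp: m_assoc)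
 have ri: "ring (reg R)" by (rule ringI[OF g m]) (auto simp: l_distr r_distr)
 show ?thesis
  by (intro assoc_algebra.intro field_axioms moduleI_lmodule[OF cring_axioms r] ri assoc_algebra_axioms.intro)
   (auto simp: m_ac)
qed

lemma assoc_algebra_module: "assoc_algebra K A ==> module K A"
 and assoc_algebra_ring: "assoc_algebra K A ==> ring A"
 by (auto simp: assoc_algebra_def)

sublocale hopf_algebra \<subseteq> HH: tensor_alg K H H by unfold_locales

context hopf_algebra
begin

abbreviation Hmult (infixl "**" 70) where "x ** y \<equiv> x \<otimes>\<^sub>H y"
abbreviation Hsmult (infixl "*s" 70) where "a *s x \<equiv> a \<odot>\<^sub>H x"
abbreviation oneH where "oneH \<equiv> \<one>\<^sub>H"
abbreviation KK where "KK \<equiv> reg K"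
abbreviation lin where "lin U \<equiv> mhom K H U"
abbreviation bil where "bil U \<equiv> bilinear K H H U"
abbreviation sw where "sw \<equiv> sweedler2 K H"
abbreviation eps where "eps \<equiv> counit H"
abbreviation S where "S \<equiv> antipode H"
abbreviation HT where "HT \<equiv> tensor_module K H H"
abbreviation pt where "pt \<equiv> pure_tensor K H H"

text \<open>The condition under which coassociativity may be applied to a term in three Sweedler
  legs.\<close>

definition tril where
 "tril U f \<longleftrightarrow> (\<forall>a\<in>carrier H. \<forall>b\<in>carrier H. (%c. f a b c) \<in> lin U) \<and>
   (\<forall>a\<in>carrier H. \<forall>c\<in>carrier H. (%b. f a b c) \<in> lin U) \<and>
   (\<forall>b\<in>carrier H. \<forall>c\<in>carrier H. (%a. f a b c) \<in> lin U)"

lemma trilI: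
 "(!!a b. a <: H ==> b <: H ==> (%c. f a b c) \<in> lin U) ==>
  (!!a c. a <: H ==> c <: H ==> (%b. f a b c) \<in> lin U) ==>
  (!!b c. b <: H ==> c <: H ==> (%a. f a b c) \<in> lin U) ==> tril U f"
 by (simp add: tril_def)

lemmas pt_bil = HH.t.pure_bilinear
lemma H_module: "module K H" by unfold_locales
lemma KK_algebra: "assoc_algebra K KK" by (rule K.regular_assoc_algebra)
lemma KK_module: "module K KK" by (rule assoc_algebra_module[OF KK_algebra])
lemma HT_module: "module K HT" by (rule HH.t.T_module)
lemma H_algebra: "assoc_algebra K H" by unfold_locales
lemmas modules = H_module KK_module HT_module

lemma comult_closed [simp]: "h <: H ==> comult H h <: HT"
 using comult_hom HH.TA_simps(1) by (auto simp: algebra_hom_def ring_hom_def)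

lemma comult_lin: "comult H \<in> lin HT"
 using comult_hom by (auto simp: algebra_hom_def module_hom_def)

lemma comult_mult:
 "x <: H ==> y <: H ==> comult H (x ** y) = comult H x \<otimes>\<^sub>(tensor_algebra K H H) comult H y"
 using comult_hom by (auto simp: algebra_hom_def ring_hom_def)

lemma comult_one: "comult H oneH = pt oneH oneH"
 using comult_hom HH.TA_simps(5) by (auto simp: algebra_hom_def ring_hom_def)

lemma eps_closed [simp]: "h <: H ==> eps h <: K"
 using counit_hom by (auto simp: algebra_hom_def ring_hom_def)

lemma eps_lin: "eps \<in> lin KK"
 using counit_hom by (auto simp: algebra_hom_def)

lemma eps_mult [simp]: "x <: H ==> y <: H ==> eps (x ** y) = eps x \<otimes> eps y"
 using counit_hom by (auto simp: algebra_hom_def ring_hom_def)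

lemma eps_one [simp]: "eps oneH = \<one>"
 using counit_hom by (auto simp: algebra_hom_def ring_hom_def)

lemma S_closed [simp]: "h <: H ==> S h <: H"
 by (rule mhom_closed[OF antipode_linear])

lemma sw_closed:
 "module K U ==> h <: H ==> (!!a b. a <: H ==> b <: H ==> f a b <: U) ==>
  sw U h f <: U"
 unfolding sweedler2_def by (rule HH.t.lift_closed) auto

lemma sw_cong:
 "h <: H ==> (!!a b. a <: H ==> b <: H ==> f a b = g a b) ==> sw U h f = sw U h g"
 unfolding sweedler2_def by (rule HH.t.lift_cong_all) auto

lemma sw_comp:
 "module K U ==> module K U' ==> g \<in> mhom K U U' ==> h <: H ==>
  (!!a b. a <: H ==> b <: H ==> f a b <: U) ==>
  g (sw U h f) = sw U' h (%a b. g (f a b))"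
 unfolding sweedler2_def by (rule HH.t.lift_comp) auto

lemma sw_lin_arg: "module K U ==> bil U f ==> (%h. sw U h f) \<in> lin U"
 unfolding sweedler2_def by (rule mhom_comp[OF comult_lin HH.t.lift_hom])

lemma sw_lin_body:
 "module K U ==> module K X ==> h <: H ==>
  (!!a b. a <: H ==> b <: H ==> (%x. f x a b) \<in> mhom K X U) ==>
  (%x. sw U h (f x)) \<in> mhom K X U"
 unfolding sweedler2_def by (rule HH.t.lift_linear) auto

lemma sw_swap:
 "module K U ==> h <: H ==> k <: H ==>
  (!!a b c d. a <: H ==> b <: H ==> c <: H ==> d <: H ==> f a b c d <: U) ==>
  sw U h (%a b. sw U k (%c d. f a b c d)) = sw U k (%c d. sw U h (%a b. f a b c d))"
 unfolding sweedler2_def by (rule lift_swap[OF HH.tensor_axioms' _ HH.tensor_axioms']) auto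

lemma sw_one: "module K U ==> bil U f ==> sw U oneH f = f oneH oneH"
 unfolding sweedler2_def comult_one by (rule HH.t.lift_pure) auto

lemma sw_pt: "h <: H ==> sw HT h pt = comult H h"
 unfolding sweedler2_def by (rule HH.t.lift_pt) simp

lemma lin_id: "(%x. x) \<in> lin H" by (auto simp: module_hom_def)
lemma lin_mulL: "f \<in> lin H ==> c <: H ==> (%x. f x ** c) \<in> lin H"
 by (rule mhom_comp[OF _ HH.mult_left_lin(2)])
lemma lin_mulR: "f \<in> lin H ==> c <: H ==> (%x. c ** f x) \<in> lin H"
 by (rule mhom_comp[OF _ HH.mult_left_lin(1)])
lemma lin_S: "f \<in> lin H ==> (%x. S (f x)) \<in> lin H"
 by (rule mhom_comp[OF _ antipode_linear])
lemma lin_eps: "f \<in> lin H ==> (%x. eps (f x)) \<in> lin KK"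
 by (rule mhom_comp[OF _ eps_lin])
lemma lin_comult: "f \<in> lin H ==> (%x. comult H (f x)) \<in> lin HT"
 by (rule mhom_comp[OF _ comult_lin])
lemma lin_ptL: "f \<in> lin H ==> c <: H ==> (%x. pt (f x) c) \<in> lin HT"
 by (rule mhom_comp[OF _ bilinear_left[OF pt_bil]])
lemma lin_ptR: "f \<in> lin H ==> c <: H ==> (%x. pt c (f x)) \<in> lin HT"
 by (rule mhom_comp[OF _ bilinear_right[OF pt_bil]])

lemma lin_bilL: "bil U g ==> f \<in> lin H ==> c <: H ==> (%x. g (f x) c) \<in> lin U"
 by (rule mhom_comp[OF _ bilinear_left])
lemma lin_bilR: "bil U g ==> f \<in> lin H ==> c <: H ==> (%x. g c (f x)) \<in> lin U"
 by (rule mhom_comp[OF _ bilinear_right])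

lemma lin_smultR:
 "module K U ==> a <: K ==> f \<in> lin U ==> (%x. a \<odot>\<^sub>U f x) \<in> lin U"
proof -
 assume "module K U" and a: "a <: K" and f: "f \<in> lin U"
 then interpret U: module K U by simp
 show ?thesis
  using mhom_closed[OF f] a
  by (intro mhomI)
   (auto simp: mhom_add[OF f] mhom_smult[OF f] U.smult_r_distr U.smult_assoc1[symmetric] K.m_comm)
qed

lemma lin_smultL:
 "module K U ==> u <: U ==> f \<in> lin KK ==> (%x. f x \<odot>\<^sub>U u) \<in> lin U"
proof -
 assume "module K U" and a: "u <: U" and f: "f \<in> lin KK"
 then interpret U: module K U by simp
 show ?thesis
  using mhom_closed[OF f] a
  by (intro mhomI)
   (auto simp: mhom_add[OF f] mhom_smult[OF f] U.smult_l_distr U.smult_assoc1)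
qed

lemma lin_kmulL: "f \<in> lin KK ==> u <: K ==> (%x. f x \<otimes> u) \<in> lin KK"
 using lin_smultL[OF KK_module, of u f] by simp
lemma lin_kmulR: "f \<in> lin KK ==> u <: K ==> (%x. u \<otimes> f x) \<in> lin KK"
 using lin_smultR[OF KK_module, of u f] by simp

lemma lin_sw_arg: "module K U ==> bil U g ==> f \<in> lin H ==> (%x. sw U (f x) g) \<in> lin U"
 by (rule mhom_comp[OF _ sw_lin_arg])

lemma lin_sw_body:
 "module K U ==> h <: H ==>
  (!!a b. a <: H ==> b <: H ==> (%x. f x a b) \<in> lin U) ==>
  (%x. sw U h (%a b. f x a b)) \<in> lin U"
 by (rule sw_lin_body[OF _ H_module])

lemma lin_algL: "assoc_algebra K A ==> f \<in> lin A ==> c <: A ==> (%x. f x \<otimes>\<^sub>A c) \<in> lin A"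
 and lin_algR: "assoc_algebra K A ==> f \<in> lin A ==> c <: A ==> (%x. c \<otimes>\<^sub>A f x) \<in> lin A"
proof -
 assume A: "assoc_algebra K A" and f: "f \<in> lin A" and c: "c <: A"
 interpret A: assoc_algebra K A by (rule A)
 show "(%x. f x \<otimes>\<^sub>A c) \<in> lin A" "(%x. c \<otimes>\<^sub>A f x) \<in> lin A"
  using mhom_closed[OF f] c
  by (intro mhomI; auto simp: mhom_add[OF f] mhom_smult[OF f] A.l_distr A.r_distr
   A.smult_mult_left A.smult_mult_right)+
qed

text \<open>Rules that establish (multi)linearity of a Sweedler term by descending through it. Most
  side conditions of the calculus are of this kind.\<close>

lemmas lins = lin_id lin_mulL lin_mulR lin_S lin_eps lin_comult lin_ptL lin_ptR lin_smultR lin_smultL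
 lin_kmulL lin_kmulR lin_sw_arg lin_sw_body bilinearI trilI modules

text \<open>The axiom concerns one universal term in the triple tensor product. Every trilinear f
  factors through it by the linear map \<Phi>, which carries the axiom over to f.\<close>

lemma sw_coassoc:
 assumes U: "module K U" and f: "tril U f" and h: "h <: H"
 shows "sw U h (%x c. sw U x (%a b. f a b c)) = sw U h (%a x. sw U x (%b c. f a b c))"
proof -
 let ?T3 = "tensor_module K H HT"
 let ?t3 = "%a b c. pure_tensor K H HT a (pt b c)"
 interpret T3: tensor K H HT by (rule tensor.intro[OF H_module HT_module])
 have fb: "bil U (%b c. f a b c)" if "a <: H" for a
  using f that by (auto simp: tril_def intro!: bilinearI)
 have bl: "bilinear K H HT U (%a t. tensor_lift K U (f a) t)"
 proof (rule bilinearI)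
  show "(%t. tensor_lift K U (f a) t) \<in> mhom K HT U" if "a <: H" for a
   using HH.t.lift_hom[OF U fb[OF that]] by simp
  show "(%a. tensor_lift K U (f a) t) \<in> lin U" if "t <: HT" for t
   by (rule HH.t.lift_linear[OF U H_module that]) (use f in \<open>auto simp: tril_def\<close>)
 qed
 define \<Phi> where "\<Phi> = tensor_lift K U (%a t. tensor_lift K U (f a) t)"
 have \<Phi>: "\<Phi> \<in> mhom K ?T3 U" unfolding \<Phi>_def by (rule T3.lift_hom[OF U bl])
 have t3c: "?t3 a b c <: ?T3" if "a <: H" "b <: H" "c <: H" for a b c
  using that T3.pure_closed HH.t.pure_closed by auto
 have \<Phi>t: "\<Phi> (?t3 a b c) = f a b c" if "a <: H" "b <: H" "c <: H" for a b c
  unfolding \<Phi>_def using that HH.t.pure_closed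
  by (subst T3.lift_pure[OF U bl]) (auto simp: HH.t.lift_pure[OF U fb])
 have 1: "\<Phi> (sw ?T3 h (%x c. sw ?T3 x (%a b. ?t3 a b c))) = sw U h (%x c. sw U x (%a b. f a b c))"
  using h t3c \<Phi>t
  by (subst sw_comp[OF T3.T_module U \<Phi> h])
   (auto intro!: sw_cong sw_closed[OF T3.T_module] simp: sw_comp[OF T3.T_module U \<Phi>])
 have 2: "\<Phi> (sw ?T3 h (%a x. sw ?T3 x (%b c. ?t3 a b c))) = sw U h (%a x. sw U x (%b c. f a b c))"
  using h t3c \<Phi>t
  by (subst sw_comp[OF T3.T_module U \<Phi> h])
   (auto intro!: sw_cong sw_closed[OF T3.T_module] simp: sw_comp[OF T3.T_module U \<Phi>])
 show ?thesis using coassoc[OF h] 1 2 by (simp add: Let_def)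
qed

lemma counitL: "module K U ==> h <: H ==> g \<in> lin U ==> sw U h (%a b. eps a \<odot>\<^sub>U g b) = g h"
proof -
 assume U: "module K U" and h: "h <: H" and g: "g \<in> lin U"
 have "g h = g (sw H h (%a b. eps a *s b))" using counit_left[OF h] by simp
 also have "... = sw U h (%a b. g (eps a *s b))" by (rule sw_comp[OF H_module U g h]) auto
 also have "... = sw U h (%a b. eps a \<odot>\<^sub>U g b)" using h by (intro sw_cong) (auto simp: mhom_smult[OF g])
 finally show ?thesis by simp
qed

lemma counitR: "module K U ==> h <: H ==> g \<in> lin U ==> sw U h (%a b. eps b \<odot>\<^sub>U g a) = g h"
proof -
 assume U: "module K U" and h: "h <: H" and g: "g \<in> lin U"
 have "g h = g (sw H h (%a b. eps b *s a))" using counit_right[OF h] by simp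
 also have "... = sw U h (%a b. g (eps b *s a))" by (rule sw_comp[OF H_module U g h]) auto
 also have "... = sw U h (%a b. eps b \<odot>\<^sub>U g a)" using h by (intro sw_cong) (auto simp: mhom_smult[OF g])
 finally show ?thesis by simp
qed

lemma antiL: "module K U ==> h <: H ==> g \<in> lin U ==> sw U h (%a b. g (S a ** b)) = eps h \<odot>\<^sub>U g oneH"
 using sw_comp[OF H_module, of U g h "%a b. S a ** b"] antipode_left[of h] mhom_smult[of g K H U "eps h" "oneH"] by simp

lemma antiR: "module K U ==> h <: H ==> g \<in> lin U ==> sw U h (%a b. g (a ** S b)) = eps h \<odot>\<^sub>U g oneH"
 using sw_comp[OF H_module, of U g h "%a b. a ** S b"] antipode_right[of h] mhom_smult[of g K H U "eps h" "oneH"] by simp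

text \<open>Comultiplication is multiplicative, so the claim becomes an identity of bilinear
  expressions in two tensors, which is checked on pure ones.\<close>

lemma sw_mult:
 assumes U: "module K U" and f: "bil U f" and x: "x <: H" and y: "y <: H"
 shows "sw U (x ** y) f = sw U x (%a b. sw U y (%c d. f (a ** c) (b ** d)))"
proof -
 let ?\<Phi> = "tensor_lift K U f" and ?TA = "tensor_algebra K H H"
 note \<Phi> = HH.t.lift_hom[OF U f]
 have "?\<Phi> (s \<otimes>\<^sub>?TA t) = tensor_lift K U (%a b. tensor_lift K U (%c d. f (a ** c) (b ** d)) t) s"
  if s: "s <: HT" and t: "t <: HT" for s t
 proof -
  have bl: "bil U (%c d. f (a ** c) (b ** d))" if "a <: H" "b <: H" for a b
   using that by (intro bilinearI lin_bilL[OF f] lin_bilR[OF f] lins) auto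
  have bl': "bil U (%a b. tensor_lift K U (%c d. f (a ** c) (b ** d)) t)"
   using t by (intro bilinearI HH.t.lift_linear[OF U H_module] lin_bilL[OF f] lin_bilR[OF f] lins) auto
  show ?thesis
  proof (rule HH.t.tensor_ext[OF _ _ _ s, where U = U])
   show "(%s. ?\<Phi> (s \<otimes>\<^sub>?TA t)) \<in> mhom K HT U"
    by (rule mhom_comp[OF bilinear_left[OF HH.mult_bilinear t] \<Phi>])
   show "tensor_lift K U (%a b. tensor_lift K U (%c d. f (a ** c) (b ** d)) t) \<in> mhom K HT U"
    by (rule HH.t.lift_hom[OF U bl'])
   fix a b assume ab: "a <: H" "b <: H"
   show "?\<Phi> (pt a b \<otimes>\<^sub>?TA t) =
     tensor_lift K U (%a b. tensor_lift K U (%c d. f (a ** c) (b ** d)) t) (pt a b)"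
    unfolding HH.t.lift_pure[OF U bl' ab]
   proof (rule HH.t.tensor_ext[OF _ _ _ t, where U = U])
    show "(%t. ?\<Phi> (pt a b \<otimes>\<^sub>?TA t)) \<in> mhom K HT U"
     using ab HH.t.pure_closed by (intro mhom_comp[OF bilinear_right[OF HH.mult_bilinear] \<Phi>])
    show "tensor_lift K U (%c d. f (a ** c) (b ** d)) \<in> mhom K HT U"
     by (rule HH.t.lift_hom[OF U bl[OF ab]])
    fix c d assume cd: "c <: H" "d <: H"
    show "?\<Phi> (pt a b \<otimes>\<^sub>?TA pt c d) = tensor_lift K U (%c d. f (a ** c) (b ** d)) (pt c d)"
     using ab cd by (simp add: HH.mult_pure HH.t.lift_pure[OF U f] HH.t.lift_pure[OF U bl[OF ab]])
   qed
  qed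
 qed
 then show ?thesis unfolding sweedler2_def using x y by (simp add: comult_mult)
qed

text \<open>In the convolution algebra of maps from H to A, f is a left inverse and k a right
  inverse of g, hence f = f g k = k. Several identities below are proved by exhibiting two such
  inverses.\<close>

lemma conv_unique:
 assumes A: "assoc_algebra K A" and f: "f \<in> lin A" and g: "g \<in> lin A" and k: "k \<in> lin A"
  and fg: "!!h. h <: H ==> sw A h (%a b. f a \<otimes>\<^sub>A g b) = eps h \<odot>\<^sub>A \<one>\<^sub>A"
  and gk: "!!h. h <: H ==> sw A h (%a b. g a \<otimes>\<^sub>A k b) = eps h \<odot>\<^sub>A \<one>\<^sub>A"
  and h: "h <: H"
 shows "f h = k h"
proof -
 interpret A: assoc_algebra K A by (rule A)
 note AM = assoc_algebra_module[OF A]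
 note fc = mhom_closed[OF f] and gc = mhom_closed[OF g] and kc = mhom_closed[OF k]
 have "f h = sw A h (%a b. eps b \<odot>\<^sub>A f a)" using counitR[OF AM h f] by simp
 also have "... = sw A h (%a b. sw A b (%c d. f a \<otimes>\<^sub>A (g c \<otimes>\<^sub>A k d)))"
 proof (rule sw_cong[OF h])
  fix a b assume ab: "a <: H" "b <: H"
  have "eps b \<odot>\<^sub>A f a = f a \<otimes>\<^sub>A sw A b (%c d. g c \<otimes>\<^sub>A k d)"
   using ab fc by (simp add: gk A.smult_mult_right)
  also have "... = sw A b (%c d. f a \<otimes>\<^sub>A (g c \<otimes>\<^sub>A k d))"
   using ab fc gc kc
   by (intro sw_comp[OF AM AM]) (auto intro!: mhomI simp: A.r_distr A.smult_mult_right)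
  finally show "eps b \<odot>\<^sub>A f a = sw A b (%c d. f a \<otimes>\<^sub>A (g c \<otimes>\<^sub>A k d))" .
 qed
 also have "... = sw A h (%x d. sw A x (%a c. f a \<otimes>\<^sub>A (g c \<otimes>\<^sub>A k d)))"
  using fc gc kc f g k by (intro sw_coassoc[OF AM _ h, symmetric] trilI lin_algL[OF A] lin_algR[OF A]) auto
 also have "... = sw A h (%x d. eps x \<odot>\<^sub>A k d)"
 proof (rule sw_cong[OF h])
  fix x d assume xd: "x <: H" "d <: H"
  have "sw A x (%a c. f a \<otimes>\<^sub>A (g c \<otimes>\<^sub>A k d)) = sw A x (%a c. (f a \<otimes>\<^sub>A g c) \<otimes>\<^sub>A k d)"
   using xd fc gc kc by (intro sw_cong) (auto simp: A.m_assoc)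
  also have "... = sw A x (%a c. f a \<otimes>\<^sub>A g c) \<otimes>\<^sub>A k d"
   using xd fc gc kc
   by (intro sw_comp[OF AM AM, where g = "%y. y \<otimes>\<^sub>A k d", symmetric])
    (auto intro!: mhomI simp: A.l_distr A.smult_mult_left)
  also have "... = eps x \<odot>\<^sub>A k d" using xd kc by (simp add: fg A.smult_mult_left)
  finally show "sw A x (%a c. f a \<otimes>\<^sub>A (g c \<otimes>\<^sub>A k d)) = eps x \<odot>\<^sub>A k d" .
 qed
 also have "... = k h" by (rule counitL[OF AM h k])
 finally show ?thesis .
qed

end

section \<open>Convolution on the tensor square, and the antipode as an anti-homomorphism\<close>

context hopf_algebra
begin

text \<open>The Sweedler sum of the coalgebra H \<otimes> H: the pair (a, c) is the first leg of (x,
  y), and (b, d) is the second.\<close>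

definition sww where
 "sww U x y F = sw U x (%a b. sw U y (%c d. F a c b d))"

lemma tril_lins:
 assumes "tril U f"
 shows "a <: H ==> b <: H ==> (%c. f a b c) \<in> lin U"
  "a <: H ==> c <: H ==> (%b. f a b c) \<in> lin U"
  "b <: H ==> c <: H ==> (%a. f a b c) \<in> lin U"
 using assms by (auto simp: tril_def)

lemma tril_closed: "tril U f ==> a <: H ==> b <: H ==> c <: H ==> f a b c <: U"
 using mhom_closed[OF tril_lins(1)] by metis

lemma sww_closed:
 "module K U ==> x <: H ==> y <: H ==>
  (!!a c b d. a <: H ==> c <: H ==> b <: H ==> d <: H ==> F a c b d <: U) ==>
  sww U x y F <: U"
 unfolding sww_def by (intro sw_closed) auto

lemma sww_cong:
 "x <: H ==> y <: H ==>
  (!!a c b d. a <: H ==> c <: H ==> b <: H ==> d <: H ==> F a c b d = G a c b d) ==>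
  sww U x y F = sww U x y G"
 unfolding sww_def by (intro sw_cong) auto

lemma sww_comp:
 "module K U ==> module K U' ==> g \<in> mhom K U U' ==> x <: H ==> y <: H ==>
  (!!a c b d. a <: H ==> c <: H ==> b <: H ==> d <: H ==> F a c b d <: U) ==>
  g (sww U x y F) = sww U' x y (%a c b d. g (F a c b d))"
 unfolding sww_def by (subst sw_comp) (auto intro!: sw_closed sw_cong sw_comp)

text \<open>Coassociativity of H \<otimes> H: exchange sums until the legs of x stand together and
  likewise those of y, apply coassociativity to each, and exchange back.\<close>

lemma sww_coassoc:
 assumes U: "module K U" and x: "x <: H" and y: "y <: H"
  and t1: "!!r s d. r <: H ==> s <: H ==> d <: H ==> tril U (%p q b. F p r q s b d)"
  and t2: "!!p q b. p <: H ==> q <: H ==> b <: H ==> tril U (%r s d. F p r q s b d)"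
 shows "sww U x y (%X Y b d. sww U X Y (%p r q s. F p r q s b d)) =
  sww U x y (%p r X Y. sww U X Y (%q s b d. F p r q s b d))"
proof -
 have Fc: "F p r q s b d <: U"
  if "p <: H" "r <: H" "q <: H" "s <: H" "b <: H" "d <: H" for p r q s b d
  using tril_closed[OF t1] that by metis
 note lt = tril_lins[OF t1] tril_lins[OF t2]
 have "sww U x y (%X Y b d. sww U X Y (%p r q s. F p r q s b d)) =
   sw U x (%X b. sw U X (%p q. sw U y (%Y d. sw U Y (%r s. F p r q s b d))))"
  unfolding sww_def using y Fc by (intro sw_cong x sw_swap U sw_closed) auto
 also have "... = sw U x (%p X. sw U X (%q b. sw U y (%Y d. sw U Y (%r s. F p r q s b d))))"
  using y lt by (intro sw_coassoc U x trilI lin_sw_body) auto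
 also have "... = sw U x (%p X. sw U X (%q b. sw U y (%r Y. sw U Y (%s d. F p r q s b d))))"
  using t2 y by (intro sw_cong x sw_coassoc U) auto
 also have "... = sww U x y (%p r X Y. sww U X Y (%q s b d. F p r q s b d))"
  unfolding sww_def using y Fc by (intro sw_cong x sw_swap U sw_closed) auto
 finally show ?thesis .
qed

lemma counit2L:
 assumes U: "module K U" and x: "x <: H" and y: "y <: H" and f: "bil U f"
 shows "sww U x y (%a c b d. (eps a \<otimes> eps c) \<odot>\<^sub>U f b d) = f x y"
proof -
 interpret U: module K U by (rule U)
 note fc = bilinear_closed[OF f]
 have "sww U x y (%a c b d. (eps a \<otimes> eps c) \<odot>\<^sub>U f b d) = sw U x (%a b. eps a \<odot>\<^sub>U f b y)"
  unfolding sww_def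
 proof (rule sw_cong[OF x])
  fix a b assume ab: "a <: H" "b <: H"
  have "sw U y (%c d. (eps a \<otimes> eps c) \<odot>\<^sub>U f b d) = sw U y (%c d. eps c \<odot>\<^sub>U (eps a \<odot>\<^sub>U f b d))"
   using ab y fc by (intro sw_cong) (auto simp: U.smult_assoc1[symmetric] K.m_comm)
  also have "... = eps a \<odot>\<^sub>U f b y"
   using ab by (intro counitL U y lins bilinear_right[OF f]) auto
  finally show "sw U y (%c d. (eps a \<otimes> eps c) \<odot>\<^sub>U f b d) = eps a \<odot>\<^sub>U f b y" .
 qed
 also have "... = f x y" by (rule counitL[OF U x bilinear_left[OF f y]])
 finally show ?thesis .
qed

lemma counit2R:
 assumes U: "module K U" and x: "x <: H" and y: "y <: H" and f: "bil U f"
 shows "sww U x y (%a c b d. (eps b \<otimes> eps d) \<odot>\<^sub>U f a c) = f x y"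
proof -
 interpret U: module K U by (rule U)
 note fc = bilinear_closed[OF f]
 have "sww U x y (%a c b d. (eps b \<otimes> eps d) \<odot>\<^sub>U f a c) = sw U x (%a b. eps b \<odot>\<^sub>U f a y)"
  unfolding sww_def
 proof (rule sw_cong[OF x])
  fix a b assume ab: "a <: H" "b <: H"
  have "sw U y (%c d. (eps b \<otimes> eps d) \<odot>\<^sub>U f a c) = sw U y (%c d. eps d \<odot>\<^sub>U (eps b \<odot>\<^sub>U f a c))"
   using ab y fc by (intro sw_cong) (auto simp: U.smult_assoc1[symmetric] K.m_comm)
  also have "... = eps b \<odot>\<^sub>U f a y"
   using ab by (intro counitR U y lins bilinear_right[OF f]) auto
  finally show "sw U y (%c d. (eps b \<otimes> eps d) \<odot>\<^sub>U f a c) = eps b \<odot>\<^sub>U f a y" .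
 qed
 also have "... = f x y" by (rule counitR[OF U x bilinear_left[OF f y]])
 finally show ?thesis .
qed

text \<open>The argument of \<open>conv_unique\<close> for the coalgebra H \<otimes> H.\<close>

lemma conv2_unique:
 assumes A: "assoc_algebra K A" and f: "bil A f" and g: "bil A g" and k: "bil A k"
  and fg: "!!x y. x <: H ==> y <: H ==>
   sww A x y (%a c b d. f a c \<otimes>\<^sub>A g b d) = (eps x \<otimes> eps y) \<odot>\<^sub>A \<one>\<^sub>A"
  and gk: "!!x y. x <: H ==> y <: H ==>
   sww A x y (%a c b d. g a c \<otimes>\<^sub>A k b d) = (eps x \<otimes> eps y) \<odot>\<^sub>A \<one>\<^sub>A"
  and x: "x <: H" and y: "y <: H"
 shows "f x y = k x y"
proof -
 interpret A: assoc_algebra K A by (rule A)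
 note AM = assoc_algebra_module[OF A]
 note fc = bilinear_closed[OF f] and gc = bilinear_closed[OF g] and kc = bilinear_closed[OF k]
 have "f x y = sww A x y (%a c b d. (eps b \<otimes> eps d) \<odot>\<^sub>A f a c)" using counit2R[OF AM x y f] by simp
 also have "... = sww A x y (%a c X Y. sww A X Y (%p r b d. f a c \<otimes>\<^sub>A (g p r \<otimes>\<^sub>A k b d)))"
 proof (rule sww_cong[OF x y])
  fix a c X Y assume ab: "a <: H" "c <: H" "X <: H" "Y <: H"
  have "(eps X \<otimes> eps Y) \<odot>\<^sub>A f a c = f a c \<otimes>\<^sub>A sww A X Y (%p r b d. g p r \<otimes>\<^sub>A k b d)"
   using ab fc by (simp add: gk A.smult_mult_right)
  also have "... = sww A X Y (%p r b d. f a c \<otimes>\<^sub>A (g p r \<otimes>\<^sub>A k b d))"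
   using ab fc gc kc
   by (intro sww_comp[OF AM AM]) (auto intro!: mhomI simp: A.r_distr A.smult_mult_right)
  finally show "(eps X \<otimes> eps Y) \<odot>\<^sub>A f a c = sww A X Y (%p r b d. f a c \<otimes>\<^sub>A (g p r \<otimes>\<^sub>A k b d))" .
 qed
 also have "... = sww A x y (%X Y b d. sww A X Y (%a c p r. f a c \<otimes>\<^sub>A (g p r \<otimes>\<^sub>A k b d)))"
  using fc gc kc
  by (intro sww_coassoc[OF AM x y, symmetric] trilI lin_algL[OF A] lin_algR[OF A] bilinear_left[OF f] bilinear_left[OF g]
    bilinear_left[OF k] bilinear_right[OF f] bilinear_right[OF g] bilinear_right[OF k]) auto
 also have "... = sww A x y (%X Y b d. (eps X \<otimes> eps Y) \<odot>\<^sub>A k b d)"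
 proof (rule sww_cong[OF x y])
  fix X Y b d assume ab: "X <: H" "Y <: H" "b <: H" "d <: H"
  have "sww A X Y (%a c p r. f a c \<otimes>\<^sub>A (g p r \<otimes>\<^sub>A k b d)) = sww A X Y (%a c p r. (f a c \<otimes>\<^sub>A g p r) \<otimes>\<^sub>A k b d)"
   using ab fc gc kc by (intro sww_cong) (auto simp: A.m_assoc)
  also have "... = sww A X Y (%a c p r. f a c \<otimes>\<^sub>A g p r) \<otimes>\<^sub>A k b d"
   using ab fc gc kc
   by (intro sww_comp[OF AM AM, where g = "%y. y \<otimes>\<^sub>A k b d", symmetric])
    (auto intro!: mhomI simp: A.l_distr A.smult_mult_left)
  also have "... = (eps X \<otimes> eps Y) \<odot>\<^sub>A k b d" using ab kc by (simp add: fg A.smult_mult_left)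
  finally show "sww A X Y (%a c p r. f a c \<otimes>\<^sub>A (g p r \<otimes>\<^sub>A k b d)) = (eps X \<otimes> eps Y) \<odot>\<^sub>A k b d" .
 qed
 also have "... = k x y" by (rule counit2L[OF AM x y k])
 finally show ?thesis .
qed

lemma S_one [simp]: "S oneH = oneH"
proof -
 have "sw H oneH (%a b. S a ** b) = S oneH ** oneH"
  by (intro sw_one lins) auto
 then show ?thesis using antipode_left[of "oneH"] by simp
qed

text \<open>Both sides are convolution inverses of the multiplication on H \<otimes> H.\<close>

lemma S_mult: "x <: H ==> y <: H ==> S (x ** y) = S y ** S x"
proof (rule conv2_unique[OF H_algebra, where f = "%x y. S (x ** y)" and g = "%x y. x ** y" and
   k = "%x y. S y ** S x"])
 show "bil H (%x y. S (x ** y))" by (intro lins)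
 show "bil H (%x y. x ** y)" by (intro lins)
 show "bil H (%x y. S y ** S x)" by (intro lins) auto
 fix x y assume xy: "x <: H" "y <: H"
 have "sww H x y (%a c b d. S (a ** c) ** (b ** d)) = sw H (x ** y) (%a b. S a ** b)"
  unfolding sww_def using xy by (intro sw_mult[symmetric] lins) auto
 then show "sww H x y (%a c b d. S (a ** c) ** (b ** d)) = (eps x \<otimes> eps y) *s oneH"
  using antipode_left[of "x ** y"] xy by simp
 have "sww H x y (%a c b d. a ** c ** (S d ** S b)) = sw H x (%a b. eps y *s (a ** S b))"
  unfolding sww_def
 proof (rule sw_cong[OF xy(1)])
  fix a b assume ab: "a <: H" "b <: H"
  have "sw H y (%c d. a ** c ** (S d ** S b)) = sw H y (%c d. a ** (c ** S d) ** S b)"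
   using ab xy by (intro sw_cong) (auto simp: m_assoc)
  also have "... = eps y *s (a ** oneH ** S b)"
   using ab xy by (intro antiR[where g = "%u. a ** u ** S b"] lins) auto
  finally show "sw H y (%c d. a ** c ** (S d ** S b)) = eps y *s (a ** S b)" using ab by simp
 qed
 also have "... = eps x *s (eps y *s oneH)"
  using xy by (intro antiR[where g = "%u. eps y *s u"] lins) auto
 finally show "sww H x y (%a c b d. a ** c ** (S d ** S b)) = (eps x \<otimes> eps y) *s oneH"
  using xy by (simp add: smult_assoc1)
qed

lemma eps_S [simp]: "h <: H ==> eps (S h) = eps h"
proof -
 assume h: "h <: H"
 have "eps (S h) = sw KK h (%a b. eps b \<odot>\<^sub>KK eps (S a))"
  by (rule counitR[symmetric, OF KK_module h]) (intro lins)
 also have "... = sw KK h (%a b. eps (S a ** b))" using h by (intro sw_cong) (auto simp: K.m_comm)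
 also have "... = eps h" using antiL[OF KK_module h eps_lin] h by simp
 finally show ?thesis .
qed

text \<open>The maps sending h to the coproduct of S h and to S(h2) \<otimes> S(h1) are both
  convolution inverses of \<open>comult\<close>, hence equal; then the linear map induced by f is
  applied.\<close>

lemma sw_S:
 assumes U: "module K U" and f: "bil U f" and h: "h <: H"
 shows "sw U (S h) f = sw U h (%a b. f (S b) (S a))"
proof -
 let ?TA = "tensor_algebra K H H"
 interpret TA: assoc_algebra K ?TA by (rule HH.TA_assoc_algebra)
 have sTA: "sweedler2 K H ?TA = sw HT"
  by (auto simp: fun_eq_iff sweedler2_def tensor_lift_def)
 have lTA: "mhom K H ?TA = lin HT" by (auto simp: module_hom_def)
 note pc = HH.t.pure_closed
 have "comult H (S h) = sw HT h (%a b. pt (S b) (S a))"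
 proof (rule conv_unique[OF HH.TA_assoc_algebra, where f = "%h. comult H (S h)" and g = "comult H" and
    k = "%h. sw HT h (%a b. pt (S b) (S a))", unfolded sTA lTA])
  show "(%h. comult H (S h)) \<in> lin HT" by (intro lins)
  show "comult H \<in> lin HT" by (rule comult_lin)
  show "(%h. sw HT h (%a b. pt (S b) (S a))) \<in> lin HT" by (intro lins) auto
  show "h <: H" by (rule h)
 next
  fix h assume h: "h <: H"
  have "sw HT h (%a b. comult H (S a) \<otimes>\<^sub>?TA comult H b) = sw HT h (%a b. comult H (S a ** b))"
   using h by (intro sw_cong) (auto simp: comult_mult)
  then show "sw HT h (%a b. comult H (S a) \<otimes>\<^sub>?TA comult H b) = eps h \<odot>\<^sub>?TA \<one>\<^sub>?TA"
   using antiL[OF HT_module h comult_lin] by (simp add: comult_one)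
 next
  fix h assume h: "h <: H"
  have "sw HT h (%a b. comult H a \<otimes>\<^sub>?TA sw HT b (%a b. pt (S b) (S a))) =
   sw HT h (%x y. sw HT x (%a b. sw HT y (%c d. pt (a ** S d) (b ** S c))))"
  proof (rule sw_cong[OF h])
   fix x y assume xy: "x <: H" "y <: H"
   have 1: "(%u. u \<otimes>\<^sub>?TA v) \<in> mhom K HT HT" "(%u. v \<otimes>\<^sub>?TA u) \<in> mhom K HT HT"
    if "v <: HT" for v
    using bilinear_left[OF HH.mult_bilinear that] bilinear_right[OF HH.mult_bilinear that] .
   have c: "sw HT y (%a b. pt (S b) (S a)) <: HT" using xy pc by (intro sw_closed modules) auto
   have "comult H x \<otimes>\<^sub>?TA sw HT y (%a b. pt (S b) (S a)) = sw HT x pt \<otimes>\<^sub>?TA sw HT y (%a b. pt (S b) (S a))"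
    using xy by (simp add: sw_pt)
   also have "... = sw HT x (%a b. pt a b \<otimes>\<^sub>?TA sw HT y (%a b. pt (S b) (S a)))"
    using xy pc by (intro sw_comp[OF HT_module HT_module 1(1)[OF c]]) auto
   also have "... = sw HT x (%a b. sw HT y (%c d. pt a b \<otimes>\<^sub>?TA pt (S d) (S c)))"
    using xy pc by (intro sw_cong sw_comp[OF HT_module HT_module 1(2)]) auto
   also have "... = sw HT x (%a b. sw HT y (%c d. pt (a ** S d) (b ** S c)))"
    using xy by (intro sw_cong) (auto simp: HH.mult_pure)
   finally show "comult H x \<otimes>\<^sub>?TA sw HT y (%a b. pt (S b) (S a)) =
    sw HT x (%a b. sw HT y (%c d. pt (a ** S d) (b ** S c)))" .
  qed
  also have "... = sw HT h (%a x. sw HT x (%b y. sw HT y (%c d. pt (a ** S d) (b ** S c))))"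
   by (intro sw_coassoc h lins) auto
  \<comment> \<open>The two middle legs are brought together, so that b S(c) collapses to a counit;
    the outer pair follows.\<close>
  also have "... = sw HT h (%a x. sw HT x (%y d. sw HT y (%b c. pt (a ** S d) (b ** S c))))"
   by (intro sw_cong h sw_coassoc[symmetric] lins) auto
  also have "... = sw HT h (%a x. sw HT x (%y d. eps y \<odot>\<^sub>HT pt (a ** S d) oneH))"
   by (intro sw_cong h antiR[where g = "%u. pt _ u"] lins) auto
  also have "... = sw HT h (%a x. pt (a ** S x) oneH)"
   by (intro sw_cong h counitL lins) auto
  also have "... = eps h \<odot>\<^sub>HT pt oneH oneH"
   by (intro antiR[where g = "%u. pt u oneH"] h lins) auto
  finally show "sw HT h (%a b. comult H a \<otimes>\<^sub>?TA sw HT b (%a b. pt (S b) (S a))) = eps h \<odot>\<^sub>?TA \<one>\<^sub>?TA"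
   by simp
 qed
 moreover have "tensor_lift K U f (sw HT h (%a b. pt (S b) (S a))) = sw U h (%a b. tensor_lift K U f (pt (S b) (S a)))"
  using h pc by (intro sw_comp[OF HT_module U HH.t.lift_hom[OF U f]]) auto
 moreover have "... = sw U h (%a b. f (S b) (S a))"
  using h by (intro sw_cong) (auto simp: HH.t.lift_pure[OF U f])
 ultimately show ?thesis by (simp add: sweedler2_def[of K H U "S h"])
qed

text \<open>\<xi> S is a convolution inverse of \<xi>. Since S reverses legs and the values commute,
  \<xi> S S is in turn an inverse of \<xi> S.\<close>

lemma character_S2:
 assumes \<xi>: "\<xi> \<in> algebra_hom K H KK" and h: "h <: H"
 shows "\<xi> (S (S h)) = \<xi> h"
proof -
 have l: "\<xi> \<in> lin KK" and m: "!!x y. x <: H ==> y <: H ==> \<xi> (x ** y) = \<xi> x \<otimes> \<xi> y"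
  and o: "\<xi> oneH = \<one>" and c: "!!x. x <: H ==> \<xi> x <: K"
  using \<xi> by (auto simp: algebra_hom_def ring_hom_def)
 have lS: "(%h. \<xi> (S h)) \<in> lin KK" "(%h. \<xi> (S (S h))) \<in> lin KK"
  by (intro mhom_comp[OF _ l] lins)+
 have 1: "sw KK h (%a b. \<xi> a \<otimes> \<xi> (S b)) = eps h" if h: "h <: H" for h
 proof -
  have "sw KK h (%a b. \<xi> a \<otimes> \<xi> (S b)) = sw KK h (%a b. \<xi> (a ** S b))"
   using h by (intro sw_cong) (auto simp: m)
  then show ?thesis using antiR[OF KK_module h l] h by (simp add: o)
 qed
 show ?thesis
 proof (rule conv_unique[OF KK_algebra lS(2) lS(1) l _ _ h])
  fix h assume h: "h <: H"
  have "sw KK h (%a b. \<xi> (S (S a)) \<otimes>\<^sub>KK \<xi> (S b)) = sw KK h (%a b. \<xi> (S b) \<otimes> \<xi> (S (S a)))"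
   using h by (intro sw_cong) (auto simp: K.m_comm c)
  also have "... = sw KK (S h) (%a b. \<xi> a \<otimes> \<xi> (S b))"
   using h c by (intro sw_S[symmetric] lins lS(1) l) auto
  finally show "sw KK h (%a b. \<xi> (S (S a)) \<otimes>\<^sub>KK \<xi> (S b)) = eps h \<odot>\<^sub>KK \<one>\<^sub>KK"
   using 1[of "S h"] h by simp
  have "sw KK h (%a b. \<xi> (S a) \<otimes>\<^sub>KK \<xi> b) = sw KK h (%a b. \<xi> (S a ** b))"
   using h by (intro sw_cong) (auto simp: m)
  then show "sw KK h (%a b. \<xi> (S a) \<otimes>\<^sub>KK \<xi> b) = eps h \<odot>\<^sub>KK \<one>\<^sub>KK"
   using antiL[OF KK_module h l] h by (simp add: o)
 qed
qed

end

section \<open>The cleft object of a cocycle\<close>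

context hopf_algebra
begin

lemma sw_smult:
 "h <: H ==> c <: K ==> (!!a b. a <: H ==> b <: H ==> f a b <: H) ==>
  c *s sw H h f = sw H h (%a b. c *s f a b)"
 by (intro sw_comp[OF H_module H_module] lins) auto

lemma sw_scalar:
 "h <: H ==> u <: H ==> (!!a b. a <: H ==> b <: H ==> f a b <: K) ==>
  sw KK h f *s u = sw H h (%a b. f a b *s u)"
 by (rule sw_comp[OF KK_module H_module, where g = "%k. k *s u"])
  (auto intro!: mhomI simp: smult_l_distr smult_assoc1)

text \<open>A functional acting on H through the first leg. Functionals that are convolution
  inverses act by inverse maps (\<open>lact_lact\<close>), and the counit recovers the functional
  from its action (\<open>eps_sw_smult\<close>).\<close>

definition lact where "lact \<phi> h = sw H h (%a b. \<phi> a *s b)"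

context
 fixes \<phi> assumes \<phi>: "\<phi> \<in> lin KK"
begin

lemma \<phi>_closed: "h <: H ==> \<phi> h <: K"
 using mhom_closed[OF \<phi>] by simp

lemma lin_\<phi>: "f \<in> lin H ==> (%x. \<phi> (f x)) \<in> lin KK"
 by (rule mhom_comp[OF _ \<phi>])

lemma lact_closed: "h <: H ==> lact \<phi> h <: H"
 unfolding lact_def using \<phi>_closed by (auto intro!: sw_closed H_module)

lemma lact_lin: "lact \<phi> \<in> lin H"
 unfolding lact_def using \<phi>_closed by (intro sw_lin_arg lin_\<phi> lins) simp_all

lemma sw_lact:
 assumes U: "module K U" and f: "bil U f" and h: "h <: H"
 shows "sw U (lact \<phi> h) f = sw U h (%a b. \<phi> a \<odot>\<^sub>U sw U b f)"
proof -
 have "sw U (lact \<phi> h) f = sw U h (%a b. sw U (\<phi> a *s b) f)"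
  unfolding lact_def using h \<phi>_closed by (intro sw_comp[OF H_module U sw_lin_arg[OF U f]]) auto
 also have "... = sw U h (%a b. \<phi> a \<odot>\<^sub>U sw U b f)"
  using h \<phi>_closed by (intro sw_cong) (auto simp: mhom_smult[OF sw_lin_arg[OF U f]])
 finally show ?thesis .
qed

end

lemma lact_lact:
 assumes \<phi>: "\<phi> \<in> lin KK" and \<psi>: "\<psi> \<in> lin KK"
  and inv: "!!h. h <: H ==> sw KK h (%a b. \<phi> a \<otimes> \<psi> b) = eps h" and h: "h <: H"
 shows "lact \<psi> (lact \<phi> h) = h"
proof -
 note c = \<phi>_closed[OF \<phi>] \<phi>_closed[OF \<psi>]
 have "lact \<psi> (lact \<phi> h) = sw H h (%a b. \<phi> a *s sw H b (%b d. \<psi> b *s d))"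
  unfolding lact_def[of \<psi>] using c by (intro sw_lact \<phi> h lin_\<phi>[OF \<psi>] lins) auto
 also have "... = sw H h (%a b. sw H b (%b d. (\<phi> a \<otimes> \<psi> b) *s d))"
  using h c by (intro sw_cong) (auto simp: sw_smult smult_assoc1 intro!: sw_cong)
 also have "... = sw H h (%x d. sw H x (%a b. (\<phi> a \<otimes> \<psi> b) *s d))"
  using c by (intro sw_coassoc[symmetric] h lin_\<phi>[OF \<phi>] lin_\<phi>[OF \<psi>] lins) auto
 also have "... = sw H h (%x d. eps x *s d)"
  using h c inv by (intro sw_cong) (auto simp: sw_scalar[symmetric])
 also have "... = h" by (rule counit_left[OF h])
 finally show ?thesis .
qed

lemma eps_sw_smult:
 assumes "\<phi> \<in> lin KK" "h <: H"
 shows "eps (lact \<phi> h) = \<phi> h" "eps (sw H h (%a b. \<phi> b *s S a)) = \<phi> h"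
proof -
 note c = \<phi>_closed[OF assms(1)] and em = mhom_smult[OF eps_lin]
 have "eps (lact \<phi> h) = sw KK h (%a b. eps (\<phi> a *s b))"
  unfolding lact_def using c assms(2) by (intro sw_comp[OF H_module KK_module eps_lin]) auto
 also have "... = sw KK h (%a b. eps b \<odot>\<^sub>KK \<phi> a)"
  using c assms(2) by (intro sw_cong) (auto simp: em K.m_comm)
 finally show "eps (lact \<phi> h) = \<phi> h" using counitR[OF KK_module assms(2,1)] by simp
 have "eps (sw H h (%a b. \<phi> b *s S a)) = sw KK h (%a b. eps (\<phi> b *s S a))"
  using c assms(2) by (intro sw_comp[OF H_module KK_module eps_lin]) auto
 also have "... = sw KK h (%a b. eps a \<odot>\<^sub>KK \<phi> b)"
  using c assms(2) by (intro sw_cong) (auto simp: em K.m_comm)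
 finally show "eps (sw H h (%a b. \<phi> b *s S a)) = \<phi> h" using counitL[OF KK_module assms(2,1)] by simp
qed

lemma bilinear_form_bil: "bilinear_form K H \<tau> \<longleftrightarrow> bil KK \<tau>"
 by (auto simp: bilinear_form_def bilinear_def)

lemma trivial_bil: "bil KK (trivial_cocycle K H)"
 unfolding trivial_cocycle_def by (intro lins) auto

lemma convolution_sww: "convolution K H \<rho> \<tau> h k = sww KK h k (%a c b d. \<rho> a c \<otimes> \<tau> b d)"
 by (simp add: convolution_def sww_def)

lemma convolution_inverse_facts:
 assumes "is_convolution_inverse K H \<rho> \<tau>"
 shows "bil KK (convolution_inverse K H \<rho>)"
  "x <: H ==> y <: H ==>
   sww KK x y (%a c b d. \<rho> a c \<otimes> convolution_inverse K H \<rho> b d) = eps x \<otimes> eps y"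
  "x <: H ==> y <: H ==>
   sww KK x y (%a c b d. convolution_inverse K H \<rho> a c \<otimes> \<rho> b d) = eps x \<otimes> eps y"
proof -
 have "is_convolution_inverse K H \<rho> (convolution_inverse K H \<rho>)"
  unfolding convolution_inverse_def by (rule someI[of "is_convolution_inverse K H \<rho>", OF assms])
 then show "bil KK (convolution_inverse K H \<rho>)"
  "x <: H ==> y <: H ==>
   sww KK x y (%a c b d. \<rho> a c \<otimes> convolution_inverse K H \<rho> b d) = eps x \<otimes> eps y"
  "x <: H ==> y <: H ==>
   sww KK x y (%a c b d. convolution_inverse K H \<rho> a c \<otimes> \<rho> b d) = eps x \<otimes> eps y"
  by (auto simp: is_convolution_inverse_def bilinear_form_bil convolution_sww trivial_cocycle_def)
qed

text \<open>\<open>convolution_inverse\<close> is a choice. Uniqueness of inverses identifies it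
  here, the trivial cocycle being its own inverse.\<close>

lemma trivial_inverse:
 assumes "x <: H" "y <: H"
 shows "convolution_inverse K H (trivial_cocycle K H) x y = eps x \<otimes> eps y"
proof -
 let ?t = "trivial_cocycle K H"
 have t: "sww KK x y (%a c b d. ?t a c \<otimes> ?t b d) = ?t x y" if "x <: H" "y <: H" for x y
  using counit2L[OF KK_module that trivial_bil] by (simp add: trivial_cocycle_def)
 then have "is_convolution_inverse K H ?t ?t"
  by (simp add: is_convolution_inverse_def bilinear_form_bil trivial_bil convolution_sww)
 note ci = convolution_inverse_facts[OF this]
 have "convolution_inverse K H ?t x y = ?t x y"
  using assms t ci
  by (intro conv2_unique[OF KK_algebra ci(1) trivial_bil trivial_bil]) (auto simp: trivial_cocycle_def)
 then show ?thesis by (simp add: trivial_cocycle_def)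
qed

end

locale hopf_cocycle = hopf_algebra K H for K (structure) and H (structure) +
 fixes \<sigma>
 assumes cocycle: "two_cocycle K H \<sigma>"
  and S_bij: "bij_betw (antipode H) (carrier H) (carrier H)"
begin

lemma \<sigma>_bil: "bil KK \<sigma>"
 using cocycle by (simp add: two_cocycle_def bilinear_form_bil)

lemma \<sigma>_closed [simp]: "a <: H ==> b <: H ==> \<sigma> a b <: K"
 using bilinear_closed[OF \<sigma>_bil] by simp

lemma \<sigma>_one: "h <: H ==> \<sigma> h oneH = eps h" "h <: H ==> \<sigma> oneH h = eps h"
 using cocycle by (simp_all add: two_cocycle_def)

abbreviation \<sigma>' where "\<sigma>' \<equiv> convolution_inverse K H \<sigma>"

lemma \<sigma>'_bil: "bil KK \<sigma>'"
 and \<sigma>'_right: "x <: H ==> y <: H ==> sww KK x y (%a c b d. \<sigma> a c \<otimes> \<sigma>' b d) = eps x \<otimes> eps y"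
 and \<sigma>'_left: "x <: H ==> y <: H ==> sww KK x y (%a c b d. \<sigma>' a c \<otimes> \<sigma> b d) = eps x \<otimes> eps y"
 using cocycle convolution_inverse_facts by (auto simp: two_cocycle_def)

lemma \<sigma>'_closed [simp]: "a <: H ==> b <: H ==> \<sigma>' a b <: K"
 using bilinear_closed[OF \<sigma>'_bil] by simp

lemmas lin\<sigma> = lin_bilL[OF \<sigma>_bil] lin_bilR[OF \<sigma>_bil] lin_bilL[OF \<sigma>'_bil] lin_bilR[OF \<sigma>'_bil]

definition amul where "amul x y = sww H x y (%a c b d. \<sigma> a c *s (b ** d))"

lemma amul_closed [simp]: "x <: H ==> y <: H ==> amul x y <: H"
 unfolding amul_def by (intro sww_closed H_module) auto

lemma amul_bil: "bil H amul"
 unfolding amul_def sww_def by (intro lin\<sigma> lins) auto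

lemmas lin_amul = lin_bilL[OF amul_bil] lin_bilR[OF amul_bil]

text \<open>The comodule algebra property: the coproduct of x.y is x1.y1 \<otimes> x2 y2, with the
  twisted product on the left only. Coassociativity leaves the cocycle with the first legs.\<close>

lemma sww_amul:
 assumes U: "module K U" and f: "bil U f" and x: "x <: H" and y: "y <: H"
 shows "sw U (amul x y) f = sww U x y (%a c b d. f (amul a c) (b ** d))"
proof -
 interpret U: module K U by (rule U)
 note fc = bilinear_closed[OF f] and sf = sw_lin_arg[OF U f]
 note lf = lin_bilL[OF f] lin_bilR[OF f]
 have "sw U (amul x y) f = sww U x y (%a c b d. sw U (\<sigma> a c *s (b ** d)) f)"
  unfolding amul_def using x y by (intro sww_comp[OF H_module U sf]) auto
 also have "... = sww U x y (%p r X Y. sww U X Y (%q s b d. \<sigma> p r \<odot>\<^sub>U f (q ** s) (b ** d)))"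
 proof (rule sww_cong[OF x y])
  fix p r X Y assume ab: "p <: H" "r <: H" "X <: H" "Y <: H"
  have "sw U (\<sigma> p r *s (X ** Y)) f = \<sigma> p r \<odot>\<^sub>U sw U (X ** Y) f"
   using ab by (intro mhom_smult[OF sf]) auto
  also have "sw U (X ** Y) f = sww U X Y (%q s b d. f (q ** s) (b ** d))"
   unfolding sww_def using ab by (intro sw_mult[OF U f])
  also have "\<sigma> p r \<odot>\<^sub>U ... = sww U X Y (%q s b d. \<sigma> p r \<odot>\<^sub>U f (q ** s) (b ** d))"
   using ab fc by (intro sww_comp[OF U U])
    (auto intro!: mhomI simp: U.smult_r_distr U.smult_assoc1[symmetric] K.m_comm)
  finally show "sw U (\<sigma> p r *s (X ** Y)) f = sww U X Y (%q s b d. \<sigma> p r \<odot>\<^sub>U f (q ** s) (b ** d))" .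
 qed
 also have "... = sww U x y (%X Y b d. sww U X Y (%p r q s. \<sigma> p r \<odot>\<^sub>U f (q ** s) (b ** d)))"
  using fc by (intro sww_coassoc[OF U x y, symmetric] lf lin\<sigma> lins U) auto
 also have "... = sww U x y (%X Y b d. f (amul X Y) (b ** d))"
 proof (rule sww_cong[OF x y])
  fix X Y b d assume ab: "X <: H" "Y <: H" "b <: H" "d <: H"
  then have bd: "b ** d <: H" by simp
  have "f (amul X Y) (b ** d) = sww U X Y (%p r q s. f (\<sigma> p r *s (q ** s)) (b ** d))"
   unfolding amul_def using ab
   by (intro sww_comp[OF H_module U bilinear_left[OF f bd]]) auto
  also have "... = sww U X Y (%p r q s. \<sigma> p r \<odot>\<^sub>U f (q ** s) (b ** d))"
   using ab by (intro sww_cong) (auto simp: mhom_smult[OF bilinear_left[OF f bd]])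
  finally show "sww U X Y (%p r q s. \<sigma> p r \<odot>\<^sub>U f (q ** s) (b ** d)) = f (amul X Y) (b ** d)" by simp
 qed
 finally show ?thesis .
qed

text \<open>The 2-cocycle identity in terms of the twisted product. With \<open>sww_amul\<close> it
  yields associativity.\<close>

lemma \<sigma>_amul:
 assumes h: "h <: H" and k: "k <: H" and l: "l <: H"
 shows "\<sigma> (amul h k) l = \<sigma> h (amul k l)"
proof -
 have "\<sigma> (amul h k) l = sww KK h k (%a c b d. \<sigma> (\<sigma> a c *s (b ** d)) l)"
  unfolding amul_def using assms by (intro sww_comp[OF H_module KK_module bilinear_left[OF \<sigma>_bil]]) auto
 also have "... = sww KK h k (%a c b d. \<sigma> a c \<otimes> \<sigma> (b ** d) l)"
  using assms by (intro sww_cong) (auto simp: mhom_smult[OF bilinear_left[OF \<sigma>_bil]])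
 also have "... = sww KK k l (%a c b d. \<sigma> a c \<otimes> \<sigma> h (b ** d))"
  using cocycle assms by (simp add: two_cocycle_def sww_def)
 also have "... = sww KK k l (%a c b d. \<sigma> h (\<sigma> a c *s (b ** d)))"
  using assms by (intro sww_cong) (auto simp: mhom_smult[OF bilinear_right[OF \<sigma>_bil]])
 also have "... = \<sigma> h (amul k l)"
  unfolding amul_def using assms
  by (intro sww_comp[OF H_module KK_module bilinear_right[OF \<sigma>_bil], symmetric]) auto
 finally show ?thesis .
qed

lemma amul_assoc:
 assumes x: "x <: H" and y: "y <: H" and z: "z <: H"
 shows "amul (amul x y) z = amul x (amul y z)"
proof -
 have "amul (amul x y) z = sw H (amul x y) (%a b. sw H z (%c e. \<sigma> a c *s (b ** e)))"
  by (simp add: amul_def[of "amul x y"] sww_def)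
 also have "... = sww H x y (%X Y b d. sw H z (%c e. \<sigma> (amul X Y) c *s ((b ** d) ** e)))"
  using x y z by (intro sww_amul lin\<sigma> lins) auto
 also have "... = sw H x (%X b. sww H y z (%Y c d e. \<sigma> X (amul Y c) *s (b ** (d ** e))))"
  unfolding sww_def using x y z by (intro sw_cong) (auto simp: \<sigma>_amul m_assoc)
 also have "... = sw H x (%X b. sw H (amul y z) (%c e. \<sigma> X c *s (b ** e)))"
  using x y z by (intro sw_cong sww_amul[symmetric] lin\<sigma> lins) auto
 also have "... = amul x (amul y z)" by (simp add: amul_def[of x] sww_def)
 finally show ?thesis .
qed

lemma amul_one:
 assumes x: "x <: H"
 shows "amul x oneH = x" "amul oneH x = x"
proof -
 have "amul x oneH = sw H x (%a b. eps a *s b)"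
  unfolding amul_def sww_def
 proof (rule sw_cong[OF x])
  fix a b assume ab: "a <: H" "b <: H"
  have "sw H oneH (%c d. \<sigma> a c *s (b ** d)) = \<sigma> a oneH *s (b ** oneH)"
   using ab by (intro sw_one lin\<sigma> lins) auto
  then show "sw H oneH (%c d. \<sigma> a c *s (b ** d)) = eps a *s b" using ab by (simp add: \<sigma>_one)
 qed
 then show "amul x oneH = x" by (simp add: counit_left x)
 have "amul oneH x = sw H x (%c d. \<sigma> oneH c *s (oneH ** d))"
  unfolding amul_def sww_def using x by (intro sw_one lin\<sigma> lins) auto
 also have "... = sw H x (%a b. eps a *s b)" using x by (intro sw_cong) (auto simp: \<sigma>_one)
 finally show "amul oneH x = x" by (simp add: counit_left x)
qed

abbreviation A where "A \<equiv> right_cleft_object K H \<sigma>"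

lemma A_simps [simp]: "carrier A = carrier H" "one A = one H" "zero A = zero H" "add A = add H" "smult A = smult H"
 by (simp_all add: right_cleft_object_def cocycle_twist_def)

lemma A_finsum [simp]: "finsum A = finsum H"
 by (auto simp: finsum_def finprod_def fun_eq_iff)

text \<open>The third legs carry the inverse of the trivial cocycle. It is a product of counits,
  which are absorbed one after the other.\<close>

lemma A_mult [simp]:
 assumes h: "h <: H" and k: "k <: H"
 shows "h \<otimes>\<^sub>A k = amul h k"
proof -
 let ?t = "convolution_inverse K H (trivial_cocycle K H)"
 have "h \<otimes>\<^sub>A k = sw H h (%a x. sw H x (%b p. sw H k (%c y. sw H y (%d q. (\<sigma> a c \<otimes> ?t p q) *s (b ** d)))))"
  by (simp add: right_cleft_object_def cocycle_twist_def sweedler3_def)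
 also have "... = sw H h (%a x. sw H x (%b p. sw H k (%c y. eps p *s (\<sigma> a c *s (b ** y)))))"
 proof (intro sw_cong h k)
  fix a x b p c y assume ab: "a <: H" "x <: H" "b <: H" "p <: H" "c <: H" "y <: H"
  have "sw H y (%d q. (\<sigma> a c \<otimes> ?t p q) *s (b ** d)) = sw H y (%d q. eps q *s (eps p *s (\<sigma> a c *s (b ** d))))"
   using ab by (intro sw_cong) (auto simp: trivial_inverse smult_assoc1[symmetric] K.m_ac)
  also have "... = eps p *s (\<sigma> a c *s (b ** y))"
   using ab by (intro counitR lins) auto
  finally show "sw H y (%d q. (\<sigma> a c \<otimes> ?t p q) *s (b ** d)) = eps p *s (\<sigma> a c *s (b ** y))" .
 qed
 also have "... = sw H h (%a x. sw H k (%c y. \<sigma> a c *s (x ** y)))"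
 proof (intro sw_cong h)
  fix a x assume ab: "a <: H" "x <: H"
  have "sw H x (%b p. sw H k (%c y. eps p *s (\<sigma> a c *s (b ** y)))) =
   sw H x (%b p. eps p *s sw H k (%c y. \<sigma> a c *s (b ** y)))"
   using ab k by (intro sw_cong sw_comp[OF H_module H_module, symmetric] lins) auto
  also have "... = sw H k (%c y. \<sigma> a c *s (x ** y))"
   using ab k by (intro counitR lins) auto
  finally show "sw H x (%b p. sw H k (%c y. eps p *s (\<sigma> a c *s (b ** y)))) =
   sw H k (%c y. \<sigma> a c *s (x ** y))" .
 qed
 finally show ?thesis by (simp add: amul_def sww_def)
qed

lemma amul_linear:
 "x <: H ==> y <: H ==> z <: H ==> amul x (y \<oplus>\<^sub>H z) = amul x y \<oplus>\<^sub>H amul x z"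
 "x <: H ==> y <: H ==> z <: H ==> amul (x \<oplus>\<^sub>H y) z = amul x z \<oplus>\<^sub>H amul y z"
 "c <: K ==> x <: H ==> y <: H ==> amul (c *s x) y = c *s amul x y"
 "c <: K ==> x <: H ==> y <: H ==> amul x (c *s y) = c *s amul x y"
 using mhom_add[OF bilinear_right[OF amul_bil]] mhom_add[OF bilinear_left[OF amul_bil]]
  mhom_smult[OF bilinear_right[OF amul_bil]] mhom_smult[OF bilinear_left[OF amul_bil]] by auto

lemma A_algebra: "assoc_algebra K A"
proof -
 have grp: "abelian_group A" by (rule abelian_group_cong[OF ag]) auto
 have mon: "Group.monoid A" by (rule monoidI) (auto simp: amul_assoc amul_one)
 have ring: "ring A" by (rule ringI[OF grp mon]) (auto simp: amul_linear)
 have "module K A"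
  by (rule moduleI[OF K.cring_axioms grp]) (auto simp: smult_l_distr smult_r_distr smult_assoc1)
 then show ?thesis
  by (intro assoc_algebra.intro ring assoc_algebra_axioms.intro K.field_axioms) (auto simp: amul_linear)
qed

end

section \<open>Convolution inverses of the identity map into the cleft object\<close>

context hopf_cocycle
begin

text \<open>\<open>alpha\<close> and \<open>beta\<close> are convolution inverses of each other
  (\<open>alpha_beta\<close>, \<open>beta_alpha\<close>). They measure how far S is from inverting
  the identity map for the twisted product.\<close>

definition alpha where "alpha h = sw KK h (%a b. \<sigma> a (S b))"
definition beta where "beta h = sw KK h (%a b. \<sigma>' (S a) b)"

lemma alpha_lin: "alpha \<in> lin KK" and beta_lin: "beta \<in> lin KK"
 unfolding alpha_def beta_def by (intro lin\<sigma> lins; simp)+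

lemmas lin_ab = lin_\<phi>[OF alpha_lin] lin_\<phi>[OF beta_lin]

lemma ab_closed [simp]: "h <: H ==> alpha h <: K" "h <: H ==> beta h <: K"
 using \<phi>_closed[OF alpha_lin] \<phi>_closed[OF beta_lin] by auto

text \<open>The convolution inverse of the identity map from H to the cleft object
  (\<open>L_left\<close>, \<open>L_right\<close>); it is the map \<open>S_{1,\<sigma>}\<close> of
  the cocycle antipodes.\<close>

definition L where "L h = sw H h (%a b. beta b *s S a)"

lemma L_closed [simp]: "h <: H ==> L h <: H"
 unfolding L_def by (intro sw_closed H_module) auto

lemma L_lin: "L \<in> lin H"
 unfolding L_def by (intro lin_ab lins) auto

lemma lin_L: "f \<in> lin H ==> (%x. L (f x)) \<in> lin H"
 by (rule mhom_comp[OF _ L_lin])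

text \<open>After rebracketing, the inverse cocycle meets the cocycle inside the twisted product,
  and the product of H is what remains.\<close>

lemma amul_\<sigma>':
 assumes x: "x <: H" and y: "y <: H"
 shows "sww H x y (%a c b d. \<sigma>' a c *s amul b d) = x ** y"
proof -
 have "sww H x y (%a c b d. \<sigma>' a c *s amul b d) =
  sww H x y (%p r X Y. sww H X Y (%q s b d. (\<sigma>' p r \<otimes> \<sigma> q s) *s (b ** d)))"
 proof (rule sww_cong[OF x y])
  fix p r X Y assume ab: "p <: H" "r <: H" "X <: H" "Y <: H"
  have "\<sigma>' p r *s amul X Y = sww H X Y (%q s b d. \<sigma>' p r *s (\<sigma> q s *s (b ** d)))"
   unfolding amul_def using ab by (intro sww_comp[OF H_module H_module] lins) auto
  also have "... = sww H X Y (%q s b d. (\<sigma>' p r \<otimes> \<sigma> q s) *s (b ** d))"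
   using ab by (intro sww_cong) (auto simp: smult_assoc1)
  finally show "\<sigma>' p r *s amul X Y = sww H X Y (%q s b d. (\<sigma>' p r \<otimes> \<sigma> q s) *s (b ** d))" .
 qed
 also have "... = sww H x y (%X Y b d. sww H X Y (%p r q s. (\<sigma>' p r \<otimes> \<sigma> q s) *s (b ** d)))"
  by (intro sww_coassoc[OF H_module x y, symmetric] lin\<sigma> lins) auto
 also have "... = sww H x y (%X Y b d. (eps X \<otimes> eps Y) *s (b ** d))"
 proof (rule sww_cong[OF x y])
  fix X Y b d assume ab: "X <: H" "Y <: H" "b <: H" "d <: H"
  have "sww H X Y (%p r q s. (\<sigma>' p r \<otimes> \<sigma> q s) *s (b ** d)) =
   sww KK X Y (%p r q s. \<sigma>' p r \<otimes> \<sigma> q s) *s (b ** d)"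
   using ab by (intro sww_comp[OF KK_module H_module, where g = "%k. k *s (b ** d)", symmetric])
    (auto intro!: mhomI simp: smult_l_distr smult_assoc1)
  then show "sww H X Y (%p r q s. (\<sigma>' p r \<otimes> \<sigma> q s) *s (b ** d)) = (eps X \<otimes> eps Y) *s (b ** d)"
   using ab by (simp add: \<sigma>'_left)
 qed
 also have "... = x ** y" by (intro counit2L H_module x y lins) auto
 finally show ?thesis .
qed

lemma sw_amulL:
 "h <: H ==> c <: H ==> (!!a b. a <: H ==> b <: H ==> f a b <: H) ==>
  amul (sw H h f) c = sw H h (%a b. amul (f a b) c)"
 by (rule sw_comp[OF H_module H_module bilinear_left[OF amul_bil]])

lemma sw_amulR:
 "h <: H ==> c <: H ==> (!!a b. a <: H ==> b <: H ==> f a b <: H) ==>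
  amul c (sw H h f) = sw H h (%a b. amul c (f a b))"
 by (rule sw_comp[OF H_module H_module bilinear_right[OF amul_bil]])

text \<open>The legs are rearranged until \<open>amul_\<sigma>'\<close> applies to S(h1) and h2,
  which leaves the antipode axiom of H.\<close>

lemma L_left:
 assumes h: "h <: H"
 shows "sw H h (%a b. amul (L a) b) = eps h *s oneH"
proof -
 have "sw H h (%a b. amul (L a) b) = sw H h (%x d. sw H x (%a y. amul (beta y *s S a) d))"
  using h by (intro sw_cong) (auto simp: L_def sw_amulL)
 also have "... = sw H h (%x d. sw H x (%a y. sw H y (%b c. \<sigma>' (S b) c *s amul (S a) d)))"
 proof (intro sw_cong h)
  fix x d a y assume ab: "x <: H" "d <: H" "a <: H" "y <: H"
  have "amul (beta y *s S a) d = beta y *s amul (S a) d" using ab by (simp add: amul_linear)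
  also have "... = sw H y (%b c. \<sigma>' (S b) c *s amul (S a) d)"
   unfolding beta_def using ab by (intro sw_scalar) auto
  finally show "amul (beta y *s S a) d = sw H y (%b c. \<sigma>' (S b) c *s amul (S a) d)" .
 qed
 also have "... = sw H h (%a x. sw H x (%y d. sw H y (%b c. \<sigma>' (S b) c *s amul (S a) d)))"
  by (intro sw_coassoc h lin\<sigma> lin_amul lins) auto
 also have "... = sw H h (%a x. sw H x (%b y. sw H y (%c d. \<sigma>' (S b) c *s amul (S a) d)))"
  by (intro sw_cong h sw_coassoc lin\<sigma> lin_amul lins) auto
 also have "... = sw H h (%x y. sw H x (%a b. sw H y (%c d. \<sigma>' (S b) c *s amul (S a) d)))"
  by (intro sw_coassoc[symmetric] h lin\<sigma> lin_amul lins) auto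
 also have "... = sw H h (%x y. S x ** y)"
 proof (rule sw_cong[OF h])
  fix x y assume xy: "x <: H" "y <: H"
  have "sw H x (%a b. sw H y (%c d. \<sigma>' (S b) c *s amul (S a) d)) =
   sw H (S x) (%a b. sw H y (%c d. \<sigma>' a c *s amul b d))"
   using xy by (intro sw_S[symmetric] lin\<sigma> lin_amul lins) auto
  then show "sw H x (%a b. sw H y (%c d. \<sigma>' (S b) c *s amul (S a) d)) = S x ** y"
   using amul_\<sigma>'[of "S x" y] xy by (simp add: sww_def)
 qed
 also have "... = eps h *s oneH" by (rule antipode_left[OF h])
 finally show ?thesis .
qed

lemma amul_S:
 assumes h: "h <: H"
 shows "sw H h (%a b. amul a (S b)) = alpha h *s oneH"
proof -
 have "sw H h (%a b. amul a (S b)) =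
  sw H h (%x y. sw H x (%a b. sw H y (%c d. \<sigma> a (S d) *s (b ** S c))))"
  unfolding amul_def sww_def using h by (intro sw_cong sw_S lin\<sigma> lins) auto
 also have "... = sw H h (%a x. sw H x (%b y. sw H y (%c d. \<sigma> a (S d) *s (b ** S c))))"
  by (intro sw_coassoc h lin\<sigma> lins) auto
 also have "... = sw H h (%a x. sw H x (%y d. sw H y (%b c. \<sigma> a (S d) *s (b ** S c))))"
  by (intro sw_cong h sw_coassoc[symmetric] lin\<sigma> lins) auto
 also have "... = sw H h (%a x. sw H x (%y d. eps y *s (\<sigma> a (S d) *s oneH)))"
  by (intro sw_cong h antiR[where g = "%u. \<sigma> _ (S _) *s u"] lins) auto
 also have "... = sw H h (%a x. \<sigma> a (S x) *s oneH)"
  by (intro sw_cong h counitL lin\<sigma> lins) auto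
 also have "... = alpha h *s oneH"
  unfolding alpha_def using h by (intro sw_scalar[symmetric]) auto
 finally show ?thesis .
qed

definition conv where "conv \<phi> \<psi> h = sw KK h (%a b. \<phi> a \<otimes> \<psi> b)"

lemma conv_lin: "\<phi> \<in> lin KK ==> \<psi> \<in> lin KK ==> conv \<phi> \<psi> \<in> lin KK"
proof -
 assume l: "\<phi> \<in> lin KK" "\<psi> \<in> lin KK"
 show "conv \<phi> \<psi> \<in> lin KK"
  unfolding conv_def using l[THEN \<phi>_closed] by (intro l[THEN lin_\<phi>] lins) auto
qed

lemma amul_L:
 assumes h: "h <: H"
 shows "sw H h (%a b. amul a (L b)) = conv alpha beta h *s oneH"
proof -
 have "sw H h (%a b. amul a (L b)) = sw H h (%a x. sw H x (%b c. beta c *s amul a (S b)))"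
  using h by (intro sw_cong) (auto simp: L_def sw_amulR amul_linear intro!: sw_cong)
 also have "... = sw H h (%x c. sw H x (%a b. beta c *s amul a (S b)))"
  by (intro sw_coassoc[symmetric] h lin_ab lin_amul lins) auto
 also have "... = sw H h (%x c. (alpha x \<otimes> beta c) *s oneH)"
  using h by (intro sw_cong) (auto simp: sw_smult[symmetric] amul_S smult_assoc1[symmetric] K.m_comm)
 also have "... = conv alpha beta h *s oneH"
  unfolding conv_def using h by (intro sw_scalar[symmetric]) auto
 finally show ?thesis .
qed

text \<open>By \<open>amul_L\<close>, the convolution id * L is \<alpha> * \<beta> times the unit.
  Associativity gives (id * L) * id = id * (L * id) = id by \<open>L_left\<close>, so \<alpha> *
  \<beta> acts as the identity; the counit extracts its values.\<close>

lemma alpha_beta: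
 assumes h: "h <: H"
 shows "conv alpha beta h = eps h"
proof -
 note cl = conv_lin[OF alpha_lin beta_lin] and c = \<phi>_closed[OF conv_lin[OF alpha_lin beta_lin]]
 have "lact (conv alpha beta) h = sw H h (%x c. amul (sw H x (%a b. amul a (L b))) c)"
  unfolding lact_def using h c by (intro sw_cong) (auto simp: amul_L amul_linear amul_one)
 also have "... = sw H h (%x c. sw H x (%a b. amul a (amul (L b) c)))"
  using h by (intro sw_cong) (auto simp: sw_amulL amul_assoc intro!: sw_cong)
 also have "... = sw H h (%a x. sw H x (%b c. amul a (amul (L b) c)))"
  by (intro sw_coassoc h lin_L lin_amul lins) auto
 also have "... = sw H h (%a x. eps x *s a)"
  using h by (intro sw_cong) (auto simp: sw_amulR[symmetric] L_left amul_linear amul_one)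
 finally have "lact (conv alpha beta) h = h" by (simp add: counit_right h)
 then show ?thesis using eps_sw_smult(1)[OF cl h] by simp
qed

text \<open>The computation from the other side: L * (id * S) = (L * id) * S = S, where id * S is
  \<alpha> times the unit by \<open>amul_S\<close> and L already carries \<beta>. The counit
  extracts \<beta> * \<alpha>.\<close>

lemma beta_alpha:
 assumes h: "h <: H"
 shows "conv beta alpha h = eps h"
proof -
 note cl = conv_lin[OF beta_lin alpha_lin] and c = \<phi>_closed[OF conv_lin[OF beta_lin alpha_lin]]
 have "sw H h (%a b. conv beta alpha b *s S a) = sw H h (%a x. sw H x (%b c. (beta b \<otimes> alpha c) *s S a))"
  unfolding conv_def using h by (intro sw_cong sw_scalar) auto
 also have "... = sw H h (%x c. sw H x (%a b. (beta b \<otimes> alpha c) *s S a))"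
  by (intro sw_coassoc[symmetric] h lin_ab lins) auto
 also have "... = sw H h (%x c. amul (L x) (alpha c *s oneH))"
 proof (rule sw_cong[OF h])
  fix x c assume xc: "x <: H" "c <: H"
  have "amul (L x) (alpha c *s oneH) = alpha c *s L x" using xc by (simp add: amul_linear amul_one)
  also have "... = sw H x (%a b. alpha c *s (beta b *s S a))"
   unfolding L_def using xc by (intro sw_smult) auto
  also have "... = sw H x (%a b. (beta b \<otimes> alpha c) *s S a)"
   using xc by (intro sw_cong) (auto simp: smult_assoc1[symmetric] K.m_comm)
  finally show "sw H x (%a b. (beta b \<otimes> alpha c) *s S a) = amul (L x) (alpha c *s oneH)" by simp
 qed
 also have "... = sw H h (%x c. sw H c (%a b. amul (amul (L x) a) (S b)))"
  using h by (intro sw_cong) (auto simp: amul_S[symmetric] sw_amulR amul_assoc intro!: sw_cong)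
 also have "... = sw H h (%y b. sw H y (%x a. amul (amul (L x) a) (S b)))"
  by (intro sw_coassoc[symmetric] h lin_L lin_amul lins) auto
 also have "... = sw H h (%y b. eps y *s S b)"
  using h by (intro sw_cong) (auto simp: sw_amulL[symmetric] L_left amul_linear amul_one)
 also have "... = S h" by (intro counitL h lins)
 finally have "eps (S h) = conv beta alpha h" using eps_sw_smult(2)[OF cl h] by simp
 then show ?thesis using h by simp
qed

lemma L_right: "h <: H ==> sw H h (%a b. amul a (L b)) = eps h *s oneH"
 by (simp add: amul_L alpha_beta)

abbreviation Si where "Si \<equiv> inv_into (carrier H) S"

lemmas inverse_lin = mhom_inverse[OF module.lmodule[OF H_module]]

lemma Si_S [simp]: "h <: H ==> Si (S h) = h"
 by (rule bij_betw_inv_into_left[OF S_bij])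

lemma lin_Si: "f \<in> lin H ==> (%x. Si (f x)) \<in> lin H"
 by (rule mhom_comp[OF _ inverse_lin[OF antipode_linear S_bij]])

lemma S_surj:
 assumes "h <: H"
 obtains w where "w <: H" "h = S w"
 using assms S_bij by (auto simp: bij_betw_def)

text \<open>L is S followed by the action of \<beta> S^-1. This action is invertible because
  \<alpha> S^-1 is a convolution inverse of \<beta> S^-1; as S^-1 reverses legs,
  \<open>alpha_beta\<close> and \<open>beta_alpha\<close> change places.\<close>

lemma L_bij: "bij_betw L (carrier H) (carrier H)"
proof -
 have l: "(%h. alpha (Si h)) \<in> lin KK" "(%h. beta (Si h)) \<in> lin KK" by (intro lin_ab lin_Si lins)+
 have c: "sw KK h (%a b. alpha (Si a) \<otimes> beta (Si b)) = eps h" "sw KK h (%a b. beta (Si a) \<otimes> alpha (Si b)) = eps h"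
  if h: "h <: H" for h
 proof -
  obtain w where w: "w <: H" "h = S w" using S_surj[OF h] .
  have "sw KK h (%a b. alpha (Si a) \<otimes> beta (Si b)) = sw KK w (%a b. alpha (Si (S b)) \<otimes> beta (Si (S a)))"
   "sw KK h (%a b. beta (Si a) \<otimes> alpha (Si b)) = sw KK w (%a b. beta (Si (S b)) \<otimes> alpha (Si (S a)))"
   unfolding w(2) using mhom_closed[OF l(1)] mhom_closed[OF l(2)]
   by (intro sw_S w lin_ab lin_Si lins; simp)+
  moreover have "sw KK w (%a b. alpha (Si (S b)) \<otimes> beta (Si (S a))) = conv beta alpha w"
   "sw KK w (%a b. beta (Si (S b)) \<otimes> alpha (Si (S a))) = conv alpha beta w"
   unfolding conv_def using w by (intro sw_cong; simp add: K.m_comm)+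
  ultimately show "sw KK h (%a b. alpha (Si a) \<otimes> beta (Si b)) = eps h" "sw KK h (%a b. beta (Si a) \<otimes> alpha (Si b)) = eps h"
   using w by (simp_all add: alpha_beta beta_alpha)
 qed
 have "bij_betw (lact (%h. beta (Si h))) (carrier H) (carrier H)"
  by (rule bij_betw_byWitness[where f' = "lact (%h. alpha (Si h))"]) (auto simp: lact_lact l c lact_closed)
 then have "bij_betw (lact (%h. beta (Si h)) \<circ> S) (carrier H) (carrier H)" by (rule bij_betw_trans[OF S_bij])
 moreover have "(lact (%h. beta (Si h)) \<circ> S) h = L h" if h: "h <: H" for h
 proof -
  have "lact (%h. beta (Si h)) (S h) = sw H h (%a b. beta (Si (S b)) *s S a)"
   unfolding lact_def using mhom_closed[OF l(2)] by (intro sw_S h lin_ab lin_Si lins) simp_all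
  also have "... = L h" unfolding L_def using h by (intro sw_cong) simp_all
  finally show ?thesis by simp
 qed
 ultimately show ?thesis by (rule bij_betw_cong[THEN iffD1, rotated])
qed

text \<open>The inverse of \<open>S_{\<sigma>,1}\<close> (\<open>antipode_inv_t\<close>). It inverts
  the identity map for the reversed order of legs (\<open>t_left\<close>, \<open>t_right\<close>),
  as L does for the usual order.\<close>

definition t where "t h = lact beta (Si h)"

lemma t_S: "h <: H ==> t (S h) = lact beta h"
 unfolding t_def by simp

lemma t_closed [simp]: "h <: H ==> t h <: H"
 by (metis S_surj t_S lact_closed beta_lin)

lemma t_lin: "t \<in> lin H"
 unfolding t_def by (rule mhom_comp[OF lin_Si[OF lin_id] lact_lin[OF beta_lin]])

lemma lin_t: "f \<in> lin H ==> (%x. t (f x)) \<in> lin H"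
 by (rule mhom_comp[OF _ t_lin])

text \<open>Writing h = S w reverses the legs, and t(S a) becomes the action of \<beta> on a. What
  is left is \<beta> * \<alpha>.\<close>

lemma t_left:
 assumes h: "h <: H"
 shows "sw H h (%a b. amul (t b) a) = eps h *s oneH"
proof -
 obtain w where w: "w <: H" "h = S w" using h S_surj by metis
 have "sw H h (%a b. amul (t b) a) = sw H w (%a b. amul (t (S a)) (S b))"
  unfolding w(2) by (intro sw_S w lin_t lin_amul lins) auto
 also have "... = sw H w (%x c. sw H x (%a b. beta a *s amul b (S c)))"
  using w by (intro sw_cong) (auto simp: t_S lact_def sw_amulL amul_linear intro!: sw_cong)
 also have "... = sw H w (%a x. sw H x (%b c. beta a *s amul b (S c)))"
  by (intro sw_coassoc w lin_ab lin_amul lins) auto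
 also have "... = sw H w (%a x. (beta a \<otimes> alpha x) *s oneH)"
  using w by (intro sw_cong) (auto simp: sw_smult[symmetric] amul_S smult_assoc1)
 also have "... = conv beta alpha w *s oneH"
  unfolding conv_def using w by (intro sw_scalar[symmetric]) auto
 finally show ?thesis using w by (simp add: beta_alpha)
qed

text \<open>The substitution h = S w turns the sum into that of \<open>L_left\<close>.\<close>

lemma t_right:
 assumes h: "h <: H"
 shows "sw H h (%a b. amul b (t a)) = eps h *s oneH"
proof -
 obtain w where w: "w <: H" "h = S w" using h S_surj by metis
 have "sw H h (%a b. amul b (t a)) = sw H w (%a b. amul (S a) (t (S b)))"
  unfolding w(2) by (intro sw_S w lin_t lin_amul lins) auto
 also have "... = sw H w (%a x. sw H x (%b c. beta b *s amul (S a) c))"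
  using w by (intro sw_cong) (auto simp: t_S lact_def sw_amulR amul_linear intro!: sw_cong)
 also have "... = sw H w (%x c. sw H x (%a b. beta b *s amul (S a) c))"
  by (intro sw_coassoc[symmetric] w lin_ab lin_amul lins) auto
 also have "... = sw H w (%x c. amul (L x) c)"
  using w by (intro sw_cong) (auto simp: L_def sw_amulL amul_linear intro!: sw_cong)
 finally show ?thesis using w by (simp add: L_left)
qed

lemma t_bij: "bij_betw t (carrier H) (carrier H)"
proof -
 have "bij_betw (lact beta) (carrier H) (carrier H)"
  by (rule bij_betw_byWitness[where f' = "lact alpha"])
   (auto simp: lact_lact alpha_beta[unfolded conv_def] beta_alpha[unfolded conv_def] alpha_lin beta_lin
    lact_closed)
 then have "bij_betw (lact beta \<circ> inv_into (carrier H) S) (carrier H) (carrier H)"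
  by (rule bij_betw_trans[OF bij_betw_inv_into[OF S_bij]])
 moreover have "t = lact beta \<circ> inv_into (carrier H) S" by (simp add: fun_eq_iff t_def)
 ultimately show ?thesis by simp
qed

text \<open>L reverses legs as S does. The functional \<beta> sits on the last leg of h, next to the
  leg that becomes the first one, and so it is swallowed by L there.\<close>

lemma sw_L:
 assumes U: "module K U" and f: "bil U f" and h: "h <: H"
 shows "sw U (L h) f = sw U h (%a b. f (L b) (S a))"
proof -
 interpret U: module K U by (rule U)
 note fc = bilinear_closed[OF f] and lf = lin_bilL[OF f] lin_bilR[OF f]
 have "sw U (L h) f = sw U h (%a b. beta b \<odot>\<^sub>U sw U (S a) f)"
  unfolding L_def using h
  by (subst sw_comp[OF H_module U sw_lin_arg[OF U f]]) (auto intro!: sw_cong simp: mhom_smult[OF sw_lin_arg[OF U f]])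
 also have "... = sw U h (%x c. sw U x (%a b. beta c \<odot>\<^sub>U f (S b) (S a)))"
 proof (rule sw_cong[OF h])
  fix x c assume xc: "x <: H" "c <: H"
  have "beta c \<odot>\<^sub>U sw U (S x) f = beta c \<odot>\<^sub>U sw U x (%a b. f (S b) (S a))"
   using xc by (simp add: sw_S[OF U f])
  also have "... = sw U x (%a b. beta c \<odot>\<^sub>U f (S b) (S a))"
   using xc fc by (intro sw_comp[OF U U])
    (auto intro!: mhomI simp: U.smult_r_distr U.smult_assoc1[symmetric] K.m_comm)
  finally show "beta c \<odot>\<^sub>U sw U (S x) f = sw U x (%a b. beta c \<odot>\<^sub>U f (S b) (S a))" .
 qed
 also have "... = sw U h (%a x. sw U x (%b c. beta c \<odot>\<^sub>U f (S b) (S a)))"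
  using fc by (intro sw_coassoc U h lf lin_ab lins) auto
 also have "... = sw U h (%a x. f (L x) (S a))"
 proof (rule sw_cong[OF h])
  fix a x assume ax: "a <: H" "x <: H"
  note l = bilinear_left[OF f S_closed[OF ax(1)]]
  have "f (L x) (S a) = sw U x (%b c. f (beta c *s S b) (S a))"
   unfolding L_def using ax by (intro sw_comp[OF H_module U l]) auto
  then show "sw U x (%b c. beta c \<odot>\<^sub>U f (S b) (S a)) = f (L x) (S a)"
   using ax by (auto intro!: sw_cong simp: mhom_smult[OF l])
 qed
 finally show ?thesis .
qed

text \<open>The trivial cocycle consumes the first two of the five legs, and the last two form
  \<beta>; thus \<open>S_{1,\<sigma>}\<close> is L.\<close>

lemma antipode_inv_L:
 assumes h: "h <: H"
 shows "cocycle_antipode_inv K H (trivial_cocycle K H) \<sigma> (L h) = h"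
proof -
 have eq: "cocycle_antipode K H (trivial_cocycle K H) \<sigma> h = L h" if h: "h <: H" for h
 proof -
  have "cocycle_antipode K H (trivial_cocycle K H) \<sigma> h =
   sw H h (%a x. sw H x (%b x. sw H x (%c x. sw H x (%d e. ((eps a \<otimes> eps (S b)) \<otimes> \<sigma>' (S d) e) *s S c))))"
   by (simp add: cocycle_antipode_def sweedler5_def sweedler4_def sweedler3_def trivial_cocycle_def)
  also have "... = sw H h (%a x. sw H x (%b x. eps b *s (eps a *s L x)))"
  proof (intro sw_cong h)
   fix a x b y assume ab: "a <: H" "x <: H" "b <: H" "y <: H"
   have "sw H y (%c x. sw H x (%d e. ((eps a \<otimes> eps (S b)) \<otimes> \<sigma>' (S d) e) *s S c)) =
    sw H y (%c x. (eps b \<otimes> eps a) *s (beta x *s S c))"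
    using ab by (intro sw_cong)
     (auto simp: beta_def sw_scalar sw_smult smult_assoc1[symmetric] K.m_ac intro!: sw_cong)
   then show "sw H y (%c x. sw H x (%d e. ((eps a \<otimes> eps (S b)) \<otimes> \<sigma>' (S d) e) *s S c)) =
    eps b *s (eps a *s L y)"
    using ab sw_smult[of y "eps b \<otimes> eps a" "%c x. beta x *s S c"] by (simp add: L_def smult_assoc1[symmetric] sw_closed[OF H_module])
  qed
  also have "... = sw H h (%a x. eps a *s L x)"
   by (intro sw_cong h counitL lin_L lins) auto
  also have "... = L h" by (intro counitL h lin_L lins)
  finally show ?thesis .
 qed
 have "inj_on (cocycle_antipode K H (trivial_cocycle K H) \<sigma>) (carrier H)"
  using L_bij by (simp add: bij_betw_def inj_on_def eq)
 then show ?thesis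
  unfolding cocycle_antipode_inv_def using h by (intro inv_into_f_eq) (auto simp: eq)
qed

text \<open>Here the trivial cocycle consumes the last two legs, so \<open>S_{\<sigma>,1}\<close> is
  the action of \<alpha> followed by S; the action of \<beta> undoes that of \<alpha>.\<close>

lemma antipode_inv_t:
 assumes u: "u <: H"
 shows "cocycle_antipode_inv K H \<sigma> (trivial_cocycle K H) u = t u"
proof -
 let ?i = "convolution_inverse K H (trivial_cocycle K H)"
 have eq: "cocycle_antipode K H \<sigma> (trivial_cocycle K H) h = S (lact alpha h)" if h: "h <: H" for h
 proof -
  have "cocycle_antipode K H \<sigma> (trivial_cocycle K H) h =
   sw H h (%a x. sw H x (%b x. sw H x (%c x. sw H x (%d e. (\<sigma> a (S b) \<otimes> ?i (S d) e) *s S c))))"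
   by (simp add: cocycle_antipode_def sweedler5_def sweedler4_def sweedler3_def)
  also have "... = sw H h (%a x. sw H x (%b x. sw H x (%c x. eps x *s (\<sigma> a (S b) *s S c))))"
  proof (intro sw_cong h)
   fix a x b y c z assume ab: "a <: H" "x <: H" "b <: H" "y <: H" "c <: H" "z <: H"
   have "sw H z (%d e. (\<sigma> a (S b) \<otimes> ?i (S d) e) *s S c) =
    sw H z (%d e. eps d *s (eps e *s (\<sigma> a (S b) *s S c)))"
    using ab by (intro sw_cong) (auto simp: trivial_inverse smult_assoc1[symmetric] K.m_ac)
   also have "... = eps z *s (\<sigma> a (S b) *s S c)"
    using ab by (intro counitL lins) auto
   finally show "sw H z (%d e. (\<sigma> a (S b) \<otimes> ?i (S d) e) *s S c) = eps z *s (\<sigma> a (S b) *s S c)" .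
  qed
  also have "... = sw H h (%a x. sw H x (%b y. \<sigma> a (S b) *s S y))"
   by (intro sw_cong h counitR lins) auto
  also have "... = sw H h (%x y. sw H x (%a b. \<sigma> a (S b) *s S y))"
   by (intro sw_coassoc[symmetric] h lin\<sigma> lins) auto
  also have "... = sw H h (%x y. S (alpha x *s y))"
  proof (rule sw_cong[OF h])
   fix x y assume xy: "x <: H" "y <: H"
   have "S (alpha x *s y) = alpha x *s S y" using xy by (simp add: mhom_smult[OF antipode_linear])
   also have "... = sw H x (%a b. \<sigma> a (S b) *s S y)"
    unfolding alpha_def using xy by (intro sw_scalar) auto
   finally show "sw H x (%a b. \<sigma> a (S b) *s S y) = S (alpha x *s y)" by simp
  qed
  also have "... = S (lact alpha h)"
   unfolding lact_def using h by (intro sw_comp[OF H_module H_module antipode_linear, symmetric]) auto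
  finally show ?thesis .
 qed
 have tS: "t (S (lact alpha h)) = h" if "h <: H" for h
  using that by (simp add: t_S lact_closed alpha_lin beta_lin lact_lact alpha_beta[unfolded conv_def])
 have inj: "inj_on (cocycle_antipode K H \<sigma> (trivial_cocycle K H)) (carrier H)"
  by (rule inj_onI) (metis eq tS)
 obtain w where w: "w <: H" "u = S w" using u S_surj by metis
 have "cocycle_antipode K H \<sigma> (trivial_cocycle K H) (t u) = u"
  using w by (simp add: eq t_S lact_closed alpha_lin beta_lin lact_lact beta_alpha[unfolded conv_def])
 then show ?thesis
  unfolding cocycle_antipode_inv_def using u inj by (intro inv_into_f_eq) auto
qed

end

section \<open>Enveloping algebras\<close>

text \<open>Tensor products depend on the linear structure only. Hence A \<otimes> A, A \<otimes>
  opp A and H \<otimes> H are literally the same space, and no identification maps are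
  needed.\<close>

lemma tensor_cong:
 assumes "carrier V = carrier V'" "add V = add V'" "smult V = smult V'"
  and "carrier W = carrier W'" "add W = add W'" "smult W = smult W'"
 shows "tensor_module K V W = tensor_module K V' W'" "pure_tensor K V W = pure_tensor K V' W'"
 using assms by (simp_all add: tensor_module_def pure_tensor_def tensor_null_def tensor_relations_def fun_eq_iff)

lemma tensor_lift_cong:
 assumes "carrier U = carrier U'" "add U = add U'" "zero U = zero U'" "smult U = smult U'"
 shows "tensor_lift K U = tensor_lift K U'"
 using assms by (intro ext) (simp add: tensor_lift_def Let_def finsum_def finprod_def)

lemma opposite_assoc_algebra:
 assumes "assoc_algebra K A" shows "assoc_algebra K (opp A)"
proof -
 interpret assoc_algebra K A by fact
 have "abelian_group (opp A)" by (rule abelian_group_cong[OF is_abelian_group]) auto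
 then have "module K (opp A)"
  by (rule moduleI[OF K.cring_axioms]) (auto simp: smult_l_distr smult_r_distr smult_assoc1)
 then show ?thesis
  by (intro assoc_algebra.intro K.field_axioms ring_opposite ring_axioms assoc_algebra_axioms.intro)
   (auto simp: smult_mult_left smult_mult_right)
qed

locale enveloping =
 fixes K (structure) and B :: "('k, 'b, 'c) module_scheme"
 assumes B: "assoc_algebra K B"
begin

sublocale B: assoc_algebra K B by (rule B)

lemma tensor_alg: "tensor_alg K B (opp B)"
 by (intro tensor_alg.intro B opposite_assoc_algebra)

interpretation O: tensor_alg K B "opp B" by (rule tensor_alg)

sublocale T: tensor K B B by (intro tensor.intro assoc_algebra_module B)

abbreviation "Be \<equiv> enveloping_algebra K B"

lemma opposite_tensor: "tensor_module K B (opp B) = T.T" "pure_tensor K B (opp B) = T.pt"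
 by (rule tensor_cong; simp)+

lemma env_algebra: "assoc_algebra K Be"
 unfolding enveloping_algebra_def by (rule O.TA_assoc_algebra)

lemma env_simps [simp]: "carrier Be = carrier T.T" "add Be = add T.T" "zero Be = zero T.T" "smult Be = smult T.T"
 "one Be = T.pt \<one>\<^sub>B \<one>\<^sub>B" "finsum Be = finsum T.T"
 unfolding enveloping_algebra_def using O.TA_simps by (simp_all only: opposite_tensor opposite_simps)

lemma env_pure:
 assumes "a <: B" "b <: B" "a' <: B" "b' <: B"
 shows "T.pt a b \<otimes>\<^sub>Be T.pt a' b' = T.pt (a \<otimes>\<^sub>B a') (b' \<otimes>\<^sub>B b)"
 using O.mult_pure[of a b a' b'] assms by (simp add: opposite_tensor enveloping_algebra_def)

sublocale E: assoc_algebra K Be by (rule env_algebra)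

lemma env_bilinear: "bilinear K T.T T.T T.T (mult Be)"
 using O.mult_bilinear by (simp add: opposite_tensor enveloping_algebra_def)

lemmas env_lin = bilinear_left[OF env_bilinear] bilinear_right[OF env_bilinear]
lemmas env_add = mhom_add[OF env_lin(1)] mhom_add[OF env_lin(2)]

lemma env_closed: "s <: T.T ==> t <: T.T ==> s \<otimes>\<^sub>Be t <: T.T"
 using E.m_closed by simp

lemma env_lift: "tensor_lift K Be = tensor_lift K T.T"
 by (rule tensor_lift_cong) auto

lemma flip_bilinear: "bilinear K B B T.T (%a b. T.pt b a)"
 using bilinear_left[OF T.pure_bilinear] bilinear_right[OF T.pure_bilinear] by (intro bilinearI)

lemma flip_lin: "tensor_flip K B \<in> mhom K T.T T.T"
 unfolding tensor_flip_def opposite_tensor env_lift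
 using T.lift_hom[OF T.T_module flip_bilinear] by simp

lemma flip_pure: "a <: B ==> b <: B ==> tensor_flip K B (T.pt a b) = T.pt b a"
 unfolding tensor_flip_def opposite_tensor env_lift
 by (rule T.lift_pure[OF T.T_module flip_bilinear])

lemma flip_closed: "s <: T.T ==> tensor_flip K B s <: T.T"
 by (rule mhom_closed[OF flip_lin])

lemma mult_left_lin: "f \<in> mhom K X B ==> c <: B ==> (%x. f x \<otimes>\<^sub>B c) \<in> mhom K X B"
 and mult_right_lin: "f \<in> mhom K X B ==> c <: B ==> (%x. c \<otimes>\<^sub>B f x) \<in> mhom K X B"
 using mhom_comp[OF _ O.mult_left_lin(1)] mhom_comp[OF _ O.mult_left_lin(2)] by blast+

lemma ident_lin: "(%x. x) \<in> mhom K B B"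
 by (auto simp: module_hom_def)

context
 fixes \<mu> assumes \<mu>: "\<mu> \<in> algebra_hom K B B"
begin

lemma \<mu>_facts: "\<mu> \<in> mhom K B B" "x <: B ==> \<mu> x <: B"
 "x <: B ==> y <: B ==> \<mu> (x \<otimes>\<^sub>B y) = \<mu> x \<otimes>\<^sub>B \<mu> y" "\<mu> \<one>\<^sub>B = \<one>\<^sub>B"
 using \<mu> by (auto simp: algebra_hom_def ring_hom_def)

lemma twisted_bilinear: "m <: B ==> bilinear K B B B (%a b. a \<otimes>\<^sub>B m \<otimes>\<^sub>B \<mu> b)"
 using \<mu>_facts(1,2) by (intro bilinearI mult_left_lin mult_right_lin ident_lin) auto

lemma twisted_simps [simp]: "carrier (twisted_bimodule K B \<mu>) = carrier B"
 "zero (twisted_bimodule K B \<mu>) = zero B" "add (twisted_bimodule K B \<mu>) = add B"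
 "finsum (twisted_bimodule K B \<mu>) = finsum B"
 by (auto simp: twisted_bimodule_def finsum_def finprod_def fun_eq_iff)

lemma twisted_pure: "a <: B ==> b <: B ==> m <: B ==>
  T.pt a b \<odot>\<^bsub>twisted_bimodule K B \<mu>\<^esub> m = a \<otimes>\<^sub>B m \<otimes>\<^sub>B \<mu> b"
 unfolding twisted_bimodule_def
 by (simp add: T.lift_pure[OF assoc_algebra_module[OF B] twisted_bilinear])

lemma twisted_lin: "m <: B ==> (%s. s \<odot>\<^bsub>twisted_bimodule K B \<mu>\<^esub> m) \<in> mhom K T.T B"
 unfolding twisted_bimodule_def
 using T.lift_hom[OF assoc_algebra_module[OF B] twisted_bilinear] by simp

lemma twisted_lin': "s <: T.T ==> (%m. s \<odot>\<^bsub>twisted_bimodule K B \<mu>\<^esub> m) \<in> mhom K B B"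
 unfolding twisted_bimodule_def
 using \<mu>_facts by (auto intro!: T.lift_linear assoc_algebra_module B mult_left_lin mult_right_lin ident_lin)

lemma twisted_lmodule: "lmodule Be (twisted_bimodule K B \<mu>)"
proof -
 let ?M = "twisted_bimodule K B \<mu>"
 note l = twisted_lin and l' = twisted_lin' and c = mhom_closed[OF twisted_lin']
 have g: "abelian_group ?M" by (rule abelian_group_cong[OF B.is_abelian_group]) auto
 have "(s \<otimes>\<^sub>Be t) \<odot>\<^sub>?M m = s \<odot>\<^sub>?M (t \<odot>\<^sub>?M m)"
  if s: "s <: T.T" and t: "t <: T.T" and m: "m <: B" for s t m
  using s
 proof (induction rule: T.tensor_induct)
  case (pure a b)
  note ab = pure
  show ?case
   using t
  proof (induction rule: T.tensor_induct)
   case (pure a' b')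
   then show ?case using ab m \<mu>_facts by (simp add: env_pure twisted_pure B.m_assoc)
  next
   case (add s t)
   then show ?case
    using ab m c T.pure_closed[OF ab] env_closed
    by (simp add: env_add mhom_add[OF l] mhom_add[OF l'])
  qed
 next
  case (add s t)
  then show ?case using t m c env_closed by (simp add: env_add mhom_add[OF l])
 qed
 then show ?thesis
  by (intro lmodule.intro g E.ring_axioms lmodule_axioms.intro)
   (auto simp: c mhom_add[OF l] mhom_add[OF l'] twisted_pure \<mu>_facts)
qed

end

lemma id_algebra_hom: "id \<in> algebra_hom K B B"
 by (auto simp: algebra_hom_def ring_hom_def module_hom_def)

end

text \<open>\<open>co\<close> is the slice map \<phi>_e \<otimes> id, which reads off the second
  factor of a tensor along a basis of the first.\<close>

lemma coordinate_facts:
 assumes T: "tensor K V W" and db: "dual_basis K V E (%e. e) \<phi>" and e: "e \<in> E"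
 defines "co \<equiv> tensor_lift K W (%v w. \<phi> e v \<odot>\<^sub>W w)"
 shows "co \<in> mhom K (tensor_module K V W) W"
  and "v <: V ==> w <: W ==> co (pure_tensor K V W v w) = \<phi> e v \<odot>\<^sub>W w"
proof -
 interpret tensor K V W by (rule T)
 note \<phi> = dual_basis_hom[OF db e]
 have \<phi>c: "\<phi> e v <: K" if "v <: V" for v using dual_basis_coord[OF db e that] .
 have bl: "bilinear K V W W (%v w. \<phi> e v \<odot>\<^sub>W w)"
  using \<phi>c
  by (intro bilinearI mhomI)
   (auto simp: W.smult_r_distr W.smult_l_distr W.smult_assoc1[symmetric] V.R.m_comm
    mhom_add[OF \<phi>] mhom_smult[OF \<phi>])
 show "co \<in> mhom K (tensor_module K V W) W" unfolding co_def by (rule lift_hom[OF W bl])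
 show "v <: V ==> w <: W ==> co (pure_tensor K V W v w) = \<phi> e v \<odot>\<^sub>W w"
  unfolding co_def by (rule lift_pure[OF W bl])
qed

text \<open>For a pure tensor, expand the first factor in the basis; for a sum, unite the two finite
  supports.\<close>

lemma tensor_coords:
 assumes T: "tensor K V W" and db: "dual_basis K V E (%e. e) \<phi>" and u: "u <: (tensor_module K V W)"
 defines "co \<equiv> %e. tensor_lift K W (%v w. \<phi> e v \<odot>\<^sub>W w)"
 obtains S where "finite S" "S \<subseteq> E" "!!e. e \<in> E - S ==> co e u = \<zero>\<^sub>W"
  "u = (\<Oplus>\<^sub>(tensor_module K V W)e\<in>S. pure_tensor K V W e (co e u))"
proof -
 interpret tensor K V W by (rule T)
 note Ec = dual_basis_closed[OF db]
 have \<phi>c: "\<phi> e v <: K" if "e \<in> E" "v <: V" for e v using dual_basis_coord[OF db that] .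
 have co: "co e \<in> mhom K T W" if "e \<in> E" for e
  unfolding co_def by (rule coordinate_facts(1)[OF T db that])
 have cop: "co e (pt v w) = \<phi> e v \<odot>\<^sub>W w" if "e \<in> E" "v <: V" "w <: W" for e v w
  unfolding co_def by (rule coordinate_facts(2)[OF T db that])
 have coc: "co e s <: W" if "e \<in> E" "s <: T" for e s using mhom_closed[OF co] that by auto
 have pe: "pt e (co e s) <: T" if "e \<in> E" "s <: T" for e s
  using that coc Ec by (intro pure_closed) auto
 have p0: "pt e \<zero>\<^sub>W = \<zero>\<^sub>T" if "e \<in> E" for e
  using additive_zero[OF W.M.ag T_group mhom_additive[OF bilinear_right[OF pure_bilinear Ec[OF that]]]] .
 have ext: "(\<Oplus>\<^sub>T e\<in>S'. pt e (co e s)) = (\<Oplus>\<^sub>T e\<in>S. pt e (co e s))"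
  if "finite S'" "S \<subseteq> S'" "S' \<subseteq> E" "\<forall>e\<in>E - S. co e s = \<zero>\<^sub>W" "s <: T" for S S' s
  using that pe p0 by (intro T.M.finsum_supset[symmetric]) (auto simp: subset_iff)
 have "\<exists>S. finite S \<and> S \<subseteq> E \<and> (\<forall>e\<in>E - S. co e u = \<zero>\<^sub>W) \<and> u = (\<Oplus>\<^sub>T e\<in>S. pt e (co e u))"
  using u
 proof (induction rule: tensor_induct)
  case (pure v w)
  let ?S = "{e\<in>E. \<phi> e v \<noteq> \<zero>\<^sub>K}"
  have f: "finite ?S" by (rule dual_basis_finite[OF db pure(1)])
  have "v = (\<Oplus>\<^sub>V e\<in>?S. \<phi> e v \<odot>\<^sub>V e)" using dual_basis_sum[OF V.lmodule db pure(1) f] by simp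
  then have "pt v w = pt (\<Oplus>\<^sub>V e\<in>?S. \<phi> e v \<odot>\<^sub>V e) w" by simp
  also have "... = (\<Oplus>\<^sub>T e\<in>?S. pt (\<phi> e v \<odot>\<^sub>V e) w)"
   using \<phi>c Ec pure
   by (intro additive_finsum[where g = "%x. pt x w", OF V.M.ag T_group mhom_additive[OF bilinear_left[OF pure_bilinear]]]) auto
  also have "... = (\<Oplus>\<^sub>T e\<in>?S. pt e (co e (pt v w)))"
  proof (rule T.M.finsum_eqI)
   fix e assume e: "e \<in> ?S"
   show "pt (\<phi> e v \<odot>\<^sub>V e) w = pt e (co e (pt v w))"
    using e pure \<phi>c Ec
    by (simp add: cop mhom_smult[OF bilinear_left[OF pure_bilinear]] mhom_smult[OF bilinear_right[OF pure_bilinear]])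
   show "pt e (co e (pt v w)) <: T" using e pure pe pure_closed by auto
  qed
  finally have eq: "pt v w = (\<Oplus>\<^sub>T e\<in>?S. pt e (co e (pt v w)))" .
  have z: "\<forall>e\<in>E - ?S. co e (pt v w) = \<zero>\<^sub>W" using pure by (auto simp: cop)
  show ?case using f z eq by (intro exI[of _ ?S] conjI) auto
 next
  case (add s t)
  from add.IH obtain S S' where S: "finite S" "S \<subseteq> E" "\<forall>e\<in>E - S. co e s = \<zero>\<^sub>W" "s = (\<Oplus>\<^sub>T e\<in>S. pt e (co e s))"
   "finite S'" "S' \<subseteq> E" "\<forall>e\<in>E - S'. co e t = \<zero>\<^sub>W" "t = (\<Oplus>\<^sub>T e\<in>S'. pt e (co e t))"
   by (elim exE conjE)
  have "s \<oplus>\<^sub>T t = (\<Oplus>\<^sub>T e\<in>S \<union> S'. pt e (co e s)) \<oplus>\<^sub>T (\<Oplus>\<^sub>T e\<in>S \<union> S'. pt e (co e t))"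
   using S add.hyps ext[of "S \<union> S'" S s] ext[of "S \<union> S'" S' t] by simp
  also have "... = (\<Oplus>\<^sub>T e\<in>S \<union> S'. pt e (co e s) \<oplus>\<^sub>T pt e (co e t))"
   using S(2,6) add.hyps pe by (intro T.M.finsum_plus[symmetric]) auto
  also have "... = (\<Oplus>\<^sub>T e\<in>S \<union> S'. pt e (co e (s \<oplus>\<^sub>T t)))"
  proof (rule T.M.finsum_eqI)
   fix e assume "e \<in> S \<union> S'"
   then have e: "e \<in> E" using S by auto
   show "pt e (co e s) \<oplus>\<^sub>T pt e (co e t) = pt e (co e (s \<oplus>\<^sub>T t))"
    using e add.hyps coc Ec by (simp add: mhom_add[OF co] mhom_add[OF bilinear_right[OF pure_bilinear]])
   show "pt e (co e (s \<oplus>\<^sub>T t)) <: T" using e add.hyps by (intro pe) auto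
  qed
  finally have eq: "s \<oplus>\<^sub>T t = (\<Oplus>\<^sub>T e\<in>S \<union> S'. pt e (co e (s \<oplus>\<^sub>T t)))" .
  have "\<forall>e\<in>E - (S \<union> S'). co e (s \<oplus>\<^sub>T t) = \<zero>\<^sub>W" using S(3,7) add.hyps by (auto simp: mhom_add[OF co])
  then show ?case using S(1,2,5,6) eq by (intro exI[of _ "S \<union> S'"] conjI) auto
 qed
 then obtain S where "finite S" "S \<subseteq> E" "\<forall>e\<in>E - S. co e u = \<zero>\<^sub>W" "u = (\<Oplus>\<^sub>T e\<in>S. pt e (co e u))"
  by (elim exE conjE)
 then show thesis using that by blast
qed

text \<open>Seen through \<open>C\<close>, the ring R acts on the second factor alone, so the slice
  maps along a basis of V are linear over R. Used four times: for \<open>He\<close> over H on either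
  side, and for \<open>Ae\<close> over H on either side along \<open>kappa\<close>.\<close>

lemma coordinates_dual_basis:
 assumes T: "tensor K V W" and db: "dual_basis K V E (%e. e) \<phi>" and P: "lmodule R P"
  and R: "carrier R = carrier W" "add R = add W" "zero R = zero W"
  and Rlin: "!!r. r <: R ==> (%w. r \<otimes>\<^sub>R w) \<in> mhom K W W"
  and C: "additive P (tensor_module K V W) C"
  and act: "!!r s. r <: R ==> s <: P ==>
   C (r \<odot>\<^sub>P s) = tensor_lift K (tensor_module K V W) (%v w. pure_tensor K V W v (r \<otimes>\<^sub>R w)) (C s)"
  and x: "!!v. v <: V ==> x v <: P"
  and \<Gamma>: "additive (tensor_module K V W) P \<Gamma>"
  and \<Gamma>p: "!!v w. v <: V ==> w <: W ==> \<Gamma> (pure_tensor K V W v w) = w \<odot>\<^sub>P x v"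
  and \<Gamma>C: "!!s. s <: P ==> \<Gamma> (C s) = s"
 shows "dual_basis R P E x (%e s. tensor_lift K W (%v w. \<phi> e v \<odot>\<^sub>W w) (C s))"
proof -
 interpret tensor K V W by (rule T)
 interpret P: lmodule R P by (rule P)
 define co where "co = (%e. tensor_lift K W (%v w. \<phi> e v \<odot>\<^sub>W w))"
 have co: "co e \<in> mhom K T W" if "e \<in> E" for e
  unfolding co_def by (rule coordinate_facts(1)[OF T db that])
 have cop: "co e (pt v w) = \<phi> e v \<odot>\<^sub>W w" if "e \<in> E" "v <: V" "w <: W" for e v w
  unfolding co_def by (rule coordinate_facts(2)[OF T db that])
 note Ec = dual_basis_closed[OF db] and Cc = additive_closed[OF C] and coc = mhom_closed[OF co]
 have "dual_basis R P E x (%e s. co e (C s))"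
 proof (rule dual_basisI[OF P])
  show "x b <: P" if "b \<in> E" for b using x Ec that by auto
 next
  fix e assume e: "e \<in> E"
  show "(%s. co e (C s)) \<in> mhom R P (reg R)"
  proof (rule mhomI)
   fix r s assume r: "r <: R" "s <: P"
   have bl: "bilinear K V W T (%v w. pt v (r \<otimes>\<^sub>R w))"
    using mhom_comp[OF Rlin[OF r(1)] bilinear_right[OF pure_bilinear]] Rlin[OF r(1), THEN mhom_closed]
     bilinear_left[OF pure_bilinear] by (intro bilinearI) auto
   have "co e (tensor_lift K T (%v w. pt v (r \<otimes>\<^sub>R w)) u) = r \<otimes>\<^sub>R co e u" if u: "u <: T" for u
   proof (rule tensor_ext[OF mhom_comp[OF lift_hom[OF T_module bl] co[OF e]] mhom_comp[OF co[OF e] Rlin[OF r(1)]] _ u])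
    fix v w assume vw: "v <: V" "w <: W"
    then have "r \<otimes>\<^sub>R w <: W" using mhom_closed[OF Rlin[OF r(1)]] by simp
    then show "co e (tensor_lift K T (%v w. pt v (r \<otimes>\<^sub>R w)) (pt v w)) = r \<otimes>\<^sub>R co e (pt v w)"
     using vw e dual_basis_coord[OF db e vw(1)]
     by (simp add: lift_pure[OF T_module bl] cop mhom_smult[OF Rlin[OF r(1)]])
   qed
   then show "co e (C (r \<odot>\<^sub>P s)) = r \<odot>\<^sub>(reg R) co e (C s)" using act r Cc by simp
  qed (use e Cc coc in \<open>auto simp: R additive_add[OF C] mhom_add[OF co[OF e]]\<close>)
 next
  fix s assume s: "s <: P"
  obtain S where S: "finite S" "S \<subseteq> E" "!!e. e \<in> E - S ==> co e (C s) = \<zero>\<^sub>W"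
   "C s = (\<Oplus>\<^sub>T e\<in>S. pt e (co e (C s)))"
   by (rule tensor_coords[OF T db Cc[OF s]]) (rule that; simp add: co_def)
  have cl: "co e (C s) <: W" if "e \<in> S" for e using that S(2) coc Cc[OF s] by auto
  have "s = \<Gamma> (\<Oplus>\<^sub>T e\<in>S. pt e (co e (C s)))" using \<Gamma>C[OF s] S(4) by simp
  also have "... = (\<Oplus>\<^sub>P e\<in>S. \<Gamma> (pt e (co e (C s))))"
   using cl S(2) Ec
   by (intro additive_finsum[OF T_group P.M.ag \<Gamma>]) (auto intro!: pure_closed)
  also have "... = (\<Oplus>\<^sub>P e\<in>S. co e (C s) \<odot>\<^sub>P x e)"
   using cl S(2) Ec x R(1) by (intro P.M.finsum_eqI P.lsmult_closed) (auto simp: \<Gamma>p subset_iff)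
  finally have "s = (\<Oplus>\<^sub>P e\<in>S. co e (C s) \<odot>\<^sub>P x e)" .
  then show "\<exists>S. finite S \<and> S \<subseteq> E \<and> (\<forall>e\<in>E - S. co e (C s) = \<zero>\<^sub>R) \<and> s = (\<Oplus>\<^sub>P e\<in>S. co e (C s) \<odot>\<^sub>P x e)"
   using S(1-3) by (intro exI[of _ S] conjI) (auto simp: R)
 qed
 then show ?thesis by (simp add: co_def)
qed

text \<open>A dual basis of S as a right R-module, written over the opposite rings, supplies exactly
  the data of \<open>exact_at_base_change\<close>.\<close>

lemma exact_at_base_change':
 fixes R :: "('k1, 'r, 'c1) module_scheme" and S :: "('k2, 's, 'c2) module_scheme"
 assumes R: "ring R" and S: "ring S" and h: "h \<in> ring_hom R S"
  and db: "dual_basis (opp R) (restr h (reg (opp S))) B b c"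
  and cx: "mcomplex R I e D" and ex: "exact_at R I e D j"
 shows "exact_at S I (%n i j. h (e n i j)) (%n i j. h (D n i j)) j"
proof (rule exact_at_base_change[OF R S h _ _ _ _ _ cx ex, where B = B and b = b and c = c])
 let ?P = "restr h (reg (opp S))"
 have lm: "lmodule (opp R) ?P"
  by (intro lmodule_restrict[OF lmodule_regular] ring_opposite R S ring_hom_opposite h)
 show "b i <: S" if "i \<in> B" for i using dual_basis_closed[OF db that] by simp
 show "s = (\<Oplus>\<^sub>S i\<in>U. b i \<otimes>\<^sub>S h (c i s))"
  if "s <: S" "finite U" "U \<subseteq> B" "{i\<in>B. c i s \<noteq> \<zero>\<^sub>R} \<subseteq> U" for s U
  using dual_basis_sum[OF lm db, of s U] that by simp
 show "finite {i\<in>B. c i s \<noteq> \<zero>\<^sub>R}" if "s <: S" for s using dual_basis_finite[OF db, of s] that by simp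
 fix i assume i: "i \<in> B"
 note ch = dual_basis_hom[OF db i]
 show "additive S R (c i)" using mhom_additive[OF ch] by (simp add: additive_def)
 show "c i (s \<otimes>\<^sub>S h r) = c i s \<otimes>\<^sub>R r" if "s <: S" "r <: R" for s r
  using mhom_smult[OF ch, of r s] that by simp
qed

section \<open>From the bimodule resolution to the trivial module\<close>

lemma (in lmodule) mres_augmentation:
 assumes res: "mres R M I e D m"
 shows "x <: M ==> \<exists>q\<in>carrier (row_module R (I 0) (e 0)). lcomb M (I 0) q m = x"
  and "q \<in> carrier (row_module R (I 0) (e 0)) ==> lcomb M (I 0) q m = \<zero>\<^sub>M \<longleftrightarrow>
   (\<exists>p\<in>Vec R (I (Suc 0)). q = vec_mat R (I (Suc 0)) p (D 0))"
proof -
 note r = mresD[OF res]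
 note c = mcomplexD[OF r(1)]
 note eM = MatD(1)[OF c(2)] and DM = MatD(1)[OF c(3)]
 show "\<exists>q\<in>carrier (row_module R (I 0) (e 0)). lcomb M (I 0) q m = x" if x: "x <: M"
 proof -
  obtain q where q: "q \<in> Vec R (I 0)" "x = lcomb M (I 0) q m" using r(5)[OF x] by blast
  note qc = VecD(1)[OF q(1)]
  have "lcomb M (I 0) (vec_mat R (I 0) q (e 0)) m = lcomb M (I 0) q (%i. lcomb M (I 0) (e 0 i) m)"
   by (rule lcomb_vec_mat[OF c(1) c(1) _ c(2)]) (use qc r(2) in auto)
  also have "... = x"
   unfolding q(2) using r(2,3) qc by (intro lcomb_cong) auto
  finally show ?thesis using R.vec_mat_in_row[OF c(1) c(1) c(2) c(2) c(4) q(1)] by blast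
 qed
 assume q: "q \<in> carrier (row_module R (I 0) (e 0))"
 have "lcomb M (I 0) (vec_mat R (I (Suc 0)) p (D 0)) m = \<zero>\<^sub>M" if p: "p \<in> Vec R (I (Suc 0))" for p
 proof -
  note pc = VecD(1)[OF p]
  have "lcomb M (I 0) (vec_mat R (I (Suc 0)) p (D 0)) m =
    lcomb M (I (Suc 0)) p (%i. lcomb M (I 0) (D 0 i) m)"
   by (rule lcomb_vec_mat[OF c(1) c(1) _ c(3)]) (use pc r(2) in auto)
  also have "... = \<zero>\<^sub>M" using r(4) pc by (rule lcomb_zero)
  finally show ?thesis .
 qed
 then show "lcomb M (I 0) q m = \<zero>\<^sub>M \<longleftrightarrow> (\<exists>p\<in>Vec R (I (Suc 0)). q = vec_mat R (I (Suc 0)) p (D 0))"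
  using r(6)[of q] q by (auto simp: row_module_simps)
qed

section \<open>Reduction of the enveloping algebra of H by the counit of its right factor\<close>

sublocale hopf_algebra \<subseteq> HE: enveloping K H by unfold_locales

context hopf_algebra
begin

abbreviation He where "He \<equiv> enveloping_algebra K H"

lemma pt_closed [simp]: "a <: H ==> b <: H ==> pt a b <: HT"
 by (rule HH.t.pure_closed)

text \<open>The algebra map id \<otimes> \<epsilon>. Base change along it is tensoring with the
  trivial module over the right factor.\<close>

definition red where "red = tensor_lift K H (%a b. eps b *s a)"

lemma red_lin: "red \<in> mhom K HT H"
 unfolding red_def by (intro HH.t.lift_hom[OF H_module] lins) auto

lemma red_pure: "a <: H ==> b <: H ==> red (pt a b) = eps b *s a"
 unfolding red_def by (intro HH.t.lift_pure[OF H_module] lins) auto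

lemma red_closed: "s <: HT ==> red s <: H"
 by (rule mhom_closed[OF red_lin])

lemma red_mult:
 assumes s: "s <: HT" and t: "t <: HT"
 shows "red (s \<otimes>\<^sub>He t) = red s ** red t"
proof (rule HH.t.tensor_ext[OF mhom_comp[OF HE.env_lin(1)[OF t] red_lin] _ _ s])
 show "(%s. red s ** red t) \<in> mhom K HT H"
  by (rule mhom_comp[OF red_lin HH.mult_left_lin(2)[OF red_closed[OF t]]])
 fix a b assume ab: "a <: H" "b <: H"
 have p: "pt a b <: HT" and r: "red (pt a b) <: H" using ab red_closed by auto
 show "red (pt a b \<otimes>\<^sub>He t) = red (pt a b) ** red t"
 proof (rule HH.t.tensor_ext[OF mhom_comp[OF HE.env_lin(2)[OF p] red_lin]
    mhom_comp[OF red_lin HH.mult_left_lin(1)[OF r]] _ t])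
  fix c d assume "c <: H" "d <: H"
  then show "red (pt a b \<otimes>\<^sub>He pt c d) = red (pt a b) ** red (pt c d)"
   using ab by (simp add: HE.env_pure red_pure smult_mult_left smult_mult_right smult_assoc1[symmetric])
 qed
qed

lemma red_ring_hom: "red \<in> ring_hom He H"
 by (rule ring_hom_memI) (auto simp: red_closed red_mult red_pure mhom_add[OF red_lin])

lemma He_ring: "ring He" by (rule assoc_algebra_ring[OF HE.env_algebra])

lemma right_inclusion: "(%g. pt oneH g) \<in> ring_hom (opp H) He"
 by (rule ring_hom_memI)
  (auto simp: HE.env_pure mhom_add[OF bilinear_right[OF pt_bil]])

lemma right_inclusion': "(%g. pt oneH g) \<in> ring_hom H (opp He)"
 using ring_hom_opposite[OF right_inclusion] by simp

lemma H_tensor: "tensor K H H" by (rule HH.tensor_axioms')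

context
 fixes E \<phi> assumes db: "dual_basis K H E (%e. e) \<phi>"
begin

abbreviation co where "co e \<equiv> tensor_lift K H (%v w. \<phi> e v *s w)"

text \<open>Multiplying by 1 \<otimes> g from the left multiplies the second factor by g from the
  right, hence the opposite algebra; from the right it is the other way round
  (\<open>He_dual_basis'\<close>).\<close>

lemma He_dual_basis:
 "dual_basis (opp H) (restr (%g. pt oneH g) (reg He)) E (%b. pt b oneH) co"
proof (rule coordinates_dual_basis[OF H_tensor db, where C = "%s. s" and \<Gamma> = "%s. s"])
 show "lmodule (opp H) (restr (%g. pt oneH g) (reg He))"
  by (intro lmodule_restrict[OF lmodule_regular] He_ring ring_opposite ring_axioms right_inclusion)
 fix r s assume "r <: (opp H)"
  and s: "s \<in> carrier (restr (%g. pt oneH g) (reg He))"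
 then have r: "r <: H" and s: "s <: HT" by auto
 have p: "pt oneH r <: HT" using r by simp
 have bl: "bil HT (%v w. pt v (w ** r))" using r by (intro lins) auto
 have "pt oneH r \<otimes>\<^sub>He s = tensor_lift K HT (%v w. pt v (w ** r)) s"
  by (rule HH.t.tensor_ext[OF HE.env_lin(2)[OF p] HH.t.lift_hom[OF HT_module bl] _ s])
   (simp add: r HE.env_pure HH.t.lift_pure[OF HT_module bl])
 then show "r \<odot>\<^bsub>restr (%g. pt oneH g) (reg He)\<^esub> s =
  tensor_lift K HT (%v w. pt v (r \<otimes>\<^sub>(opp H) w)) s" by simp
qed (auto simp: additive_def HE.env_pure intro!: lins)

lemma He_dual_basis':
 "dual_basis H (restr (%g. pt oneH g) (reg (opp He))) E (%b. pt b oneH) co"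
proof (rule coordinates_dual_basis[OF H_tensor db, where C = "%s. s" and \<Gamma> = "%s. s"])
 show "lmodule H (restr (%g. pt oneH g) (reg (opp He)))"
  by (intro lmodule_restrict[OF lmodule_regular] He_ring ring_opposite ring_axioms right_inclusion')
 fix r s assume r: "r <: H"
  and s: "s \<in> carrier (restr (%g. pt oneH g) (reg (opp He)))"
 then have s: "s <: HT" by auto
 have p: "pt oneH r <: HT" using r by simp
 have bl: "bil HT (%v w. pt v (r ** w))" using r by (intro lins) auto
 have "s \<otimes>\<^sub>He pt oneH r = tensor_lift K HT (%v w. pt v (r ** w)) s"
  by (rule HH.t.tensor_ext[OF HE.env_lin(1)[OF p] HH.t.lift_hom[OF HT_module bl] _ s])
   (simp add: r HE.env_pure HH.t.lift_pure[OF HT_module bl])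
 then show "r \<odot>\<^bsub>restr (%g. pt oneH g) (reg (opp He))\<^esub> s =
  tensor_lift K HT (%v w. pt v (r ** w)) s" by simp
qed (auto simp: additive_def HE.env_pure intro!: lins)

text \<open>\<epsilon>(co_e s) = \<phi>_e(red s), which is checked on pure tensors. So the
  coordinates of an element killed by \<open>red\<close> lie in the kernel of \<epsilon>, as
  \<open>reduction\<close> requires.\<close>

lemma red_kernel:
 assumes s: "s <: HT" "red s = \<zero>\<^sub>H" and e: "e \<in> E"
 shows "red (pt oneH (co e s)) = \<zero>\<^sub>H"
proof -
 note cf = coordinate_facts[OF H_tensor db e] and \<phi> = dual_basis_hom[OF db e]
 have "eps (co e s) = \<phi> e (red s)"
 proof (rule HH.t.tensor_ext[OF mhom_comp[OF cf(1) eps_lin] mhom_comp[OF red_lin \<phi>] _ s(1)])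
  fix v w assume vw: "v <: H" "w <: H"
  then show "eps (co e (pt v w)) = \<phi> e (red (pt v w))"
   using dual_basis_coord[OF db e vw(1)]
   by (simp add: cf(2) red_pure mhom_smult[OF eps_lin] mhom_smult[OF \<phi>] K.m_comm)
 qed
 also have "... = \<zero>"
  using additive_zero[OF is_abelian_group module.axioms(2)[OF KK_module] mhom_additive[OF \<phi>]] s(2) by simp
 finally show ?thesis using mhom_closed[OF cf(1) s(1)] by (simp add: red_pure)
qed

lemma red_surj: "carrier H \<subseteq> red ` carrier HT"
proof
 fix h assume "h <: H"
 then have "h = red (pt h oneH)" "pt h oneH <: HT" by (auto simp: red_pure)
 then show "h \<in> red ` carrier HT" by blast
qed

text \<open>This instance serves the resolution; \<open>reduction_right\<close>, over the opposite
  rings, serves its dual.\<close>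

lemma reduction_left: "reduction He (opp H) H (%g. pt oneH g) red E (%b. pt b oneH) co"
 by (intro reduction.intro He_ring ring_opposite ring_axioms right_inclusion red_ring_hom He_dual_basis)
  (use red_kernel red_surj in auto)

lemma reduction_right:
 "reduction (opp He) H (opp H) (%g. pt oneH g) red E (%b. pt b oneH) co"
 by (intro reduction.intro He_ring ring_opposite ring_axioms right_inclusion' ring_hom_opposite red_ring_hom He_dual_basis')
  (use red_kernel red_surj in auto)

end

lemma eps_null: "eps \<zero>\<^sub>H = \<zero>"
 using additive_zero[OF is_abelian_group module.axioms(2)[OF KK_module] mhom_additive[OF eps_lin]] by simp

abbreviation triv where "triv \<equiv> character_module K eps"

lemma character_simps [simp]: "carrier (character_module K \<chi>) = carrier K" "add (character_module K \<chi>) = add K"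
 "zero (character_module K \<chi>) = zero K" "smult (character_module K \<chi>) = (%h x. \<chi> h \<otimes> x)"
 "finsum (character_module K \<chi>) = finsum K"
 by (auto simp: character_module_def finsum_def finprod_def fun_eq_iff)

lemma triv_lmodule: "lmodule H triv"
proof -
 have "abelian_group triv" by (rule abelian_group_cong[OF K.is_abelian_group]) auto
 then show ?thesis
  by (intro lmodule.intro ring_axioms lmodule_axioms.intro)
   (auto simp: mhom_add[OF eps_lin] K.l_distr K.r_distr K.m_assoc)
qed

abbreviation Hid where "Hid \<equiv> twisted_bimodule K H id"

lemma Hid_lmodule: "lmodule He Hid"
 by (rule HE.twisted_lmodule[OF HE.id_algebra_hom])

text \<open>\<epsilon>(a h b) = \<epsilon>(a) \<epsilon>(b) \<epsilon>(h): the counit is a map of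
  modules along \<open>red\<close>.\<close>

lemma eps_combination:
 assumes q: "!!i. i \<in> I ==> q i <: HT" and m: "!!i. i \<in> I ==> m i <: H"
 shows "eps (lcomb Hid I q m) = lcomb triv I (%i. red (q i)) (%i. eps (m i))"
proof -
 interpret lmodule He Hid by (rule Hid_lmodule)
 have s: "eps (s \<odot>\<^sub>Hid h) = eps (red s) \<otimes> eps h" if s: "s <: HT" and h: "h <: H" for s h
 proof (rule HH.t.tensor_ext[OF mhom_comp[OF HE.twisted_lin[OF HE.id_algebra_hom h] eps_lin] _ _ s])
  show "(%s. eps (red s) \<otimes> eps h) \<in> mhom K HT KK"
   using h mhom_comp[OF red_lin lin_kmulL[OF eps_lin, of "eps h"]] by simp
  fix a b assume ab: "a <: H" "b <: H"
  then show "eps (pt a b \<odot>\<^sub>Hid h) = eps (red (pt a b)) \<otimes> eps h"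
   using h by (simp add: HE.twisted_pure[OF HE.id_algebra_hom] red_pure mhom_smult[OF eps_lin] K.m_ac)
 qed
 have "eps (lcomb Hid I q m) = (\<Oplus>i\<in>I. eps (q i \<odot>\<^sub>Hid m i))"
  unfolding lcomb_def HE.twisted_simps[OF HE.id_algebra_hom]
  using additive_finsum[OF is_abelian_group module.axioms(2)[OF KK_module] mhom_additive[OF eps_lin],
    of "%i. q i \<odot>\<^sub>Hid m i" I] lsmult_closed q m
  by (simp add: Pi_def HE.twisted_simps[OF HE.id_algebra_hom])
 also have "... = lcomb triv I (%i. red (q i)) (%i. eps (m i))"
  unfolding lcomb_def character_simps using q m red_closed
  by (intro K.finsum_eqI) (auto simp: s)
 finally show ?thesis .
qed

text \<open>Without its augmentation the complex has the single homology H in degree 0, which is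
  free of rank one for right multiplication. So \<open>reduce_exact\<close> applies with w = 0 and
  the augmentation as functional; exactness at the augmentation itself is shown by hand.\<close>

lemma triv_mres:
 assumes res: "mres He Hid I e D m"
 shows "mres H triv I (%n i j. red (e n i j)) (%n i j. red (D n i j)) (%j. eps (m j))"
proof -
 interpret M: lmodule He Hid by (rule Hid_lmodule)
 note tsimps [simp] = HE.twisted_simps[OF HE.id_algebra_hom]
 note r = mresD[OF res]
 note c = mcomplexD[OF r(1)]
 note eM = MatD(1)[OF c(2)] and DM = MatD(1)[OF c(3)]
 have mc: "m j <: H" if "j \<in> I 0" for j using r(2)[OF that] by simp
 obtain E \<phi> where db: "dual_basis K H E (%e. e) \<phi>"
  using vector_space_dual_basis[OF K.field_axioms H_module] by metis
 interpret Q: reduction He "opp H" H "%g. pt oneH g" red E "%b. pt b oneH" "%e. tensor_lift K H (%v w. \<phi> e v *s w)"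
  by (rule reduction_left[OF db])
 let ?Z = "carrier (row_module He (I 0) (e 0))"
 define l where "l = (%y. lcomb Hid (I 0) y m)"
 interpret row: lmodule He "row_module He (I 0) (e 0)" by (rule ring.lmodule_row[OF He_ring c(1,2)])
 have yV: "y \<in> Vec He (I 0)" if "y \<in> ?Z" for y using that by (simp add: row_module_simps)
 note ch = M.lcomb_hom[of "I 0" m, OF r(2), simplified]
 have lh: "l \<in> mhom He (row_module He (I 0) (e 0)) Hid"
  unfolding l_def using yV mhom_closed[OF ch] mhom_add[OF ch] mhom_smult[OF ch]
  by (intro mhomI) (auto simp: row_module_simps(2-4) free_module_simps)
 have lc: "l y <: H" if "y \<in> ?Z" for y using mhom_closed[OF lh that] by simp
 have l0: "l y = \<zero>\<^sub>H \<longleftrightarrow> (\<exists>p\<in>Vec He (I (Suc 0)). y = vec_mat He (I (Suc 0)) p (D 0))" if "y \<in> ?Z" for y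
  using M.mres_augmentation(2)[OF res that] by (simp add: l_def)
 have l1: "\<exists>y\<in>?Z. l y = x" if "x <: H" for x
  using M.mres_augmentation(1)[OF res, of x] that by (simp add: l_def)
 obtain z where z: "z \<in> ?Z" "l z = oneH" using l1 by blast
 have lt: "l (%i. pt oneH t \<otimes>\<^sub>He y i) = l y ** t" if "t <: H" "y \<in> ?Z" for t y
  using mhom_smult[OF lh, of "pt oneH t" y] that lc
  by (simp add: row_module_simps(4) HE.twisted_pure[OF HE.id_algebra_hom])
 have el: "eps (l y) = lcomb triv (I 0) (%i. red (y i)) (%j. eps (m j))" if "!!i. y i <: HT" for y
  unfolding l_def using that mc by (intro eps_combination) auto
 have ex: "exact_at H I (%n i j. red (e n i j)) (%n i j. red (D n i j)) j" if "j \<noteq> 0" for j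
 proof (rule Q.reduce_exact[where l = l and z = z, OF r(1) _ _ _ _ _ _ _ that])
  show "exact_at He I e D j" if "j \<noteq> 0" for j
   using r(7)[of "j - 1"] that by (simp add: row_exact_iff)
  fix y y' assume "y \<in> {y \<in> ?Z. \<forall>k. 0 = Suc k \<longrightarrow> vec_mat He (I 0) y (D k) = (%_. \<zero>\<^sub>He)}"
   "y' \<in> {y \<in> ?Z. \<forall>k. 0 = Suc k \<longrightarrow> vec_mat He (I 0) y (D k) = (%_. \<zero>\<^sub>He)}"
  then show "l (%i. y i \<oplus>\<^sub>He y' i) = l y \<oplus>\<^sub>(opp H) l y'"
   using mhom_add[OF lh, of y y'] by (simp add: row_module_simps(2))
 qed (use lc lt l0 z in auto)
 show ?thesis
  unfolding mres_def
 proof (intro conjI ballI allI impI)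
  show "mcomplex H I (%n i j. red (e n i j)) (%n i j. red (D n i j))"
   by (rule mcomplex_map[OF He_ring ring_axioms red_ring_hom r(1)])
  show "eps (m j) <: triv" if "j \<in> I 0" for j using mc[OF that] by simp
  show "lcomb triv (I 0) (%k. red (e 0 j k)) (%j. eps (m j)) = eps (m j)" if "j \<in> I 0" for j
   using el[of "e 0 j"] eM[of 0 j] r(3)[OF that] by (simp add: l_def)
  show "lcomb triv (I 0) (%k. red (D 0 j k)) (%j. eps (m j)) = \<zero>\<^sub>triv" if "j \<in> I (Suc 0)" for j
   using el[of "D 0 j"] DM[of 0 j] r(4)[OF that] eps_null by (simp add: l_def)
  show "row_exact H I (%n i j. red (e n i j)) (%n i j. red (D n i j)) i" for i
   unfolding row_exact_iff by (rule ex) simp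
 next
  fix x assume x: "x <: triv"
  then have "x *s oneH <: H" by simp
  from l1[OF this] obtain y where y: "y \<in> ?Z" "l y = x *s oneH" by blast
  have "x = lcomb triv (I 0) (%i. red (y i)) (%j. eps (m j))"
   using el[of y] VecD(1)[OF yV[OF y(1)]] y(2) x by (simp add: mhom_smult[OF eps_lin])
  moreover have "(%i. red (y i)) \<in> Vec H (I 0)"
   by (rule ring_hom_Vec[OF He_ring ring_axioms red_ring_hom c(1) yV[OF y(1)]])
  ultimately show "\<exists>q\<in>Vec H (I 0). x = lcomb triv (I 0) q (%j. eps (m j))" by blast
 next
  fix q assume q: "q \<in> Vec H (I 0)" "vec_mat H (I 0) q (%i j. red (e 0 i j)) = q"
   "lcomb triv (I 0) q (%j. eps (m j)) = \<zero>\<^sub>triv"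
  obtain y where y: "y \<in> ?Z" "!!i. red (y i) = q i" using Q.lift_row[OF c(1,2,4) q(1,2)] by blast
  have yc: "y i <: HT" and zc: "z i <: HT" for i
   using VecD(1)[OF yV[OF y(1)]] VecD(1)[OF yV[OF z(1)]] by auto
  have g: "l y <: H" "eps (l y) = \<zero>" using lc[OF y(1)] el[OF yc] y(2) q(3) by auto
  \<comment> \<open>u has the same augmentation as y, so that y - u is a boundary. It reduces to
    zero, because the augmentation of y lies in the kernel of \<epsilon>; subtracting it does not
    disturb the lift of q.\<close>
  define u where "u = (%i. pt oneH (l y) \<otimes>\<^sub>He z i)"
  have u: "u \<in> ?Z" using row.lsmult_closed[of "pt oneH (l y)" z] z(1) g by (simp add: row_module_simps(4) u_def)
  have lu: "l u = l y" using lt[OF g(1) z(1)] z(2) g by (simp add: u_def)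
  let ?w = "y \<ominus>\<^sub>(row_module He (I 0) (e 0)) u"
  have w: "?w \<in> ?Z" using y u by (intro row.M.minus_closed)
  have "l ?w = \<zero>\<^sub>H"
   using additive_diff[OF row.M.ag M.M.ag mhom_additive[OF lh] y(1) u] lu
    M.M.minus_self[of "l y"] g(1) by simp
  then obtain p where p: "p \<in> Vec He (I (Suc 0))" "?w = vec_mat He (I (Suc 0)) p (D 0)" using l0[OF w] by blast
  have rw: "red (?w i) = q i" for i
  proof -
   have ad: "additive (row_module He (I 0) (e 0)) H (%y. red (y i))"
    using VecD(1)[OF yV] by (intro additiveI) (auto simp: row_module_simps(2) mhom_add[OF red_lin] red_closed)
   have "red (?w i) = red (y i) \<ominus>\<^sub>H red (u i)"
    by (rule additive_diff[OF row.M.ag is_abelian_group ad y(1) u])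
   moreover have "red (u i) = \<zero>\<^sub>H"
    using zc g red_closed[OF zc] by (simp add: u_def red_mult red_pure)
   ultimately show ?thesis using y(2) VecD(1)[OF q(1)] minus_zero_right by simp
  qed
  have "q = vec_mat H (I (Suc 0)) (%i. red (p i)) (%i j. red (D 0 i j))"
  proof
   fix j
   have "q j = red (vec_mat He (I (Suc 0)) p (D 0) j)" using rw[of j] p(2) by simp
   also have "... = vec_mat H (I (Suc 0)) (%i. red (p i)) (%i j. red (D 0 i j)) j"
    using VecD(1)[OF p(1)] by (intro ring_hom_vec_mat[OF He_ring ring_axioms red_ring_hom _ c(3)])
   finally show "q j = vec_mat H (I (Suc 0)) (%i. red (p i)) (%i j. red (D 0 i j)) j" .
  qed
  moreover have "(%i. red (p i)) \<in> Vec H (I (Suc 0))"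
   by (rule ring_hom_Vec[OF He_ring ring_axioms red_ring_hom c(1) p(1)])
  ultimately show "\<exists>p\<in>Vec H (I (Suc 0)). q = vec_mat H (I (Suc 0)) p (%i j. red (D 0 i j))" by blast
 qed
qed

end

section \<open>Resolution of the trivial module, vanishing of its Ext, and the integral\<close>

context hopf_algebra
begin

text \<open>The dual of the bimodule resolution has as its only cohomology H twisted by \<mu>, free
  of rank one for left multiplication, so \<open>coexact_reduce\<close> carries the vanishing from
  \<open>He\<close> to H. The index type stays open because two instances are used at the
  end.\<close>

lemma hopf_resolution:
 assumes CY: "twisted_CY K H d" and inf: "infinite (UNIV :: 'x set)"
 obtains I :: "nat => 'x set" and e D m N where "mres H triv I e D m"
  "!!n. N < n ==> I n = {}" "!!n. n \<noteq> d ==> coexact_at H I e D n"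
proof -
 interpret M: lmodule He Hid by (rule Hid_lmodule)
 obtain \<mu> where sm: "homologically_smooth K H" and nak: "nakayama_automorphism K H d \<mu>"
  using CY by (auto simp: twisted_CY_def twisted_CY_with_def)
 have \<mu>: "\<mu> \<in> algebra_hom K H H" using nak by (simp add: nakayama_automorphism_def)
 note ts [simp] = HE.twisted_simps[OF \<mu>]
 obtain P :: "nat => (('a, 'c, 'c) tensor, (('a, 'c, 'c) tensor, 'c) resolution_carrier) module" and \<delta> \<epsilon> N
  where P: "projective_resolution He Hid P \<delta> \<epsilon>" "!!n. finitely_generated_module He (P n)"
   "!!n. N \<le> n ==> carrier (P n) = {\<zero>\<^sub>(P n)}"
  using sm unfolding homologically_smooth_def by metis
 obtain I :: "nat => 'x set" and e D m where res: "mres He Hid I e D m"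
  and bd': "!!n. carrier (P n) = {\<zero>\<^sub>(P n)} ==> I n = {}"
  using mres_exists[OF Hid_lmodule P(1,2) inf] by metis
 have bd: "I n = {}" if "N < n" for n using that P(3) bd' by simp
 have cx: "mcomplex He I e D" by (rule mresD(1)[OF res])
 \<comment> \<open>Two distinct values of the scalar type, as \<open>row_module_projective\<close>
   asks.\<close>
 have distinct: "{} \<noteq> (UNIV :: ('a, 'c, 'c) tensor)" by simp
 have ex: "coexact_at He I e D n" if n: "n \<noteq> d" for n
 proof -
  obtain \<Theta> where "presents He (Ext_regular He Hid n) (I n) (mat_cocycles He I e D n) (mat_coboundary He I D n) \<Theta>"
   using Ext_mres[OF Hid_lmodule res distinct] P(1) by blast
  note p = presentsD[OF this]
  have "carrier (Ext_enveloping K H n) = {\<zero>\<^sub>(Ext_enveloping K H n)}"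
   using nak n by (simp add: nakayama_automorphism_def)
  then have "carrier (Ext_regular He Hid n) = {\<zero>\<^sub>(Ext_regular He Hid n)}"
   by (simp add: Ext_enveloping_def Let_def)
  then have "\<Theta> c = \<zero>\<^sub>(Ext_regular He Hid n)" if "c \<in> mat_cocycles He I e D n" for c
   using imageI[OF that, of \<Theta>] p(2) by simp
  then show ?thesis unfolding coexact_at_def using p(5) by blast
 qed
 let ?E = "Ext_regular He Hid d" and ?Z = "mat_cocycles He I e D d"
 obtain \<Theta> where \<Theta>: "presents He ?E (I d) ?Z (mat_coboundary He I D d) \<Theta>"
  using Ext_mres[OF Hid_lmodule res distinct] P(1) by blast
 note p = presentsD[OF \<Theta>]
 obtain f where f: "f \<in> mhom He (Ext_enveloping K H d) (twisted_bimodule K H \<mu>)"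
  "bij_betw f (carrier (Ext_enveloping K H d)) (carrier (twisted_bimodule K H \<mu>))"
  using nak by (auto simp: nakayama_automorphism_def module_isomorphic_def)
 have E: "carrier (Ext_enveloping K H d) = carrier ?E" "add (Ext_enveloping K H d) = add ?E"
  "smult (Ext_enveloping K H d) = (%t e. tensor_flip K H t \<odot>\<^sub>?E e)"
  by (simp_all add: Ext_enveloping_def Let_def)
 have fc: "f x <: H" if "x <: ?E" for x using mhom_closed[OF f(1)] that E by simp
 have fadd: "additive ?E H f"
  using fc mhom_add[OF f(1)] by (intro additiveI) (simp_all add: E)
 have \<Theta>c: "\<Theta> y <: ?E" if "y \<in> ?Z" for y using p(2) that by auto
 have f0: "f x = \<zero>\<^sub>H \<longleftrightarrow> x = \<zero>\<^sub>?E" if "x <: ?E" for x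
 proof -
  have z: "\<zero>\<^sub>?E <: ?E" by (rule abelian_groupE(2)[OF p(1)])
  have "f \<zero>\<^sub>?E = \<zero>\<^sub>H" by (rule additive_zero[OF p(1) is_abelian_group fadd])
  then show ?thesis using f(2) that z by (auto simp: bij_betw_def E inj_on_def)
 qed
 have "oneH \<in> f ` carrier ?E" using f(2) by (simp add: bij_betw_def E)
 then obtain z where z: "z \<in> ?Z" "f (\<Theta> z) = oneH" unfolding p(2) by force
 obtain B \<phi> where db: "dual_basis K H B (%e. e) \<phi>"
  using vector_space_dual_basis[OF K.field_axioms H_module] by metis
 have co: "coexact_at H I (%n i j. red (e n i j)) (%n i j. red (D n i j)) n" if "n \<noteq> d" for n
 proof (rule coexact_reduce[OF reduction_right[OF db] He_ring ring_axioms red_ring_hom cx ex bd, where l = "%y. f (\<Theta> y)" and z = z])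
  \<comment> \<open>Right multiplication by 1 \<otimes> t is flipped into the action of t \<otimes>
    1, which on the twisted bimodule is plain left multiplication: the twist affects only the other
    factor.\<close>
  fix t y assume t: "t <: H" and y: "y \<in> ?Z"
  have "\<Theta> (%i. y i \<otimes>\<^sub>He pt oneH t) = pt oneH t \<odot>\<^sub>?E \<Theta> y"
   using t by (intro p(4)[OF y]) simp
  also have "... = pt t oneH \<odot>\<^sub>(Ext_enveloping K H d) \<Theta> y" using t by (simp add: E HE.flip_pure)
  also have "f ... = pt t oneH \<odot>\<^bsub>twisted_bimodule K H \<mu>\<^esub> f (\<Theta> y)"
   using t \<Theta>c[OF y] by (intro mhom_smult[OF f(1)]) (simp_all add: E)
  also have "... = t ** f (\<Theta> y)"
   using t fc[OF \<Theta>c[OF y]] HE.\<mu>_facts[OF \<mu>] by (simp add: HE.twisted_pure[OF \<mu>])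
  finally show "f (\<Theta> (%i. y i \<otimes>\<^sub>He pt oneH t)) = t ** f (\<Theta> y)" .
 next
  fix y y' assume y: "y \<in> ?Z" "y' \<in> ?Z"
  show "f (\<Theta> (%i. y i \<oplus>\<^sub>He y' i)) = f (\<Theta> y) \<oplus>\<^sub>H f (\<Theta> y')"
   unfolding p(3)[OF y] by (rule additive_add[OF fadd \<Theta>c[OF y(1)] \<Theta>c[OF y(2)]])
 qed (use fc \<Theta>c z that f0[OF \<Theta>c] p(5) in auto)
 show thesis by (rule that[OF triv_mres[OF res] bd co])
qed

text \<open>The isomorphism from the integral to the character module, pulled back to cocycles. The
  integral is made a left module through the antipode, hence the S h in the equivariance.\<close>

lemma hopf_integral:
 assumes res: "mres H triv (I :: nat => 'x set) e D m" and int: "left_integral_is K H d \<xi>"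
  and ex: "\<exists>(P :: nat => ('c, ('c, 'a) resolution_carrier) module) \<delta> \<epsilon>. projective_resolution H triv P \<delta> \<epsilon>"
 obtains l z where "!!c. c \<in> mat_cocycles H I e D d ==> l c <: K"
  "!!c c'. c \<in> mat_cocycles H I e D d ==> c' \<in> mat_cocycles H I e D d ==>
   l (%i. c i \<oplus>\<^sub>H c' i) = l c \<oplus> l c'"
  "!!c h. c \<in> mat_cocycles H I e D d ==> h <: H ==> l (%i. c i ** S h) = \<xi> h \<otimes> l c"
  "!!c. c \<in> mat_cocycles H I e D d ==> l c = \<zero> \<longleftrightarrow> mat_coboundary H I D d c"
  "z \<in> mat_cocycles H I e D d" "l z = \<one>"
proof -
 have ne: "oneH \<noteq> \<zero>\<^sub>H" using eps_null eps_one by fastforce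
 let ?E = "Ext_regular H triv d" and ?Z = "mat_cocycles H I e D d"
 obtain \<Theta> where \<Theta>: "presents H ?E (I d) ?Z (mat_coboundary H I D d) \<Theta>"
  using Ext_mres[OF triv_lmodule res ne ex] by blast
 note p = presentsD[OF \<Theta>]
 let ?L = "left_via_antipode H ?E"
 obtain f where f: "f \<in> mhom H ?L (character_module K \<xi>)"
  "bij_betw f (carrier ?L) (carrier (character_module K \<xi>))"
  using int by (auto simp: left_integral_is_def left_homological_integral_def module_isomorphic_def)
 have E: "carrier ?L = carrier ?E" "add ?L = add ?E" "smult ?L = (%h e. S h \<odot>\<^sub>?E e)"
  by (simp_all add: left_via_antipode_def)
 have fc: "f x <: K" if "x <: ?E" for x using mhom_closed[OF f(1)] that E by simp
 have fadd: "additive ?E K f"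
  using fc mhom_add[OF f(1)] by (intro additiveI) (simp_all add: E)
 have \<Theta>c: "\<Theta> y <: ?E" if "y \<in> ?Z" for y using p(2) that by auto
 have f0: "f x = \<zero> \<longleftrightarrow> x = \<zero>\<^sub>?E" if "x <: ?E" for x
 proof -
  have z: "\<zero>\<^sub>?E <: ?E" by (rule abelian_groupE(2)[OF p(1)])
  have "f \<zero>\<^sub>?E = \<zero>" by (rule additive_zero[OF p(1) K.is_abelian_group fadd])
  then show ?thesis using f(2) that z by (auto simp: bij_betw_def E inj_on_def)
 qed
 have "\<one> \<in> f ` carrier ?E" using f(2) by (simp add: bij_betw_def E)
 then obtain z where z: "z \<in> ?Z" "f (\<Theta> z) = \<one>" unfolding p(2) by force
 show thesis
 proof (rule that[of "%y. f (\<Theta> y)" z])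
  fix c h assume c: "c \<in> ?Z" and h: "h <: H"
  have "\<Theta> (%i. c i ** S h) = h \<odot>\<^sub>?L \<Theta> c" using h p(4)[OF c] by (simp add: E)
  also have "f ... = \<xi> h \<otimes> f (\<Theta> c)" using mhom_smult[OF f(1) h, of "\<Theta> c"] \<Theta>c[OF c] by (simp add: E)
  finally show "f (\<Theta> (%i. c i ** S h)) = \<xi> h \<otimes> f (\<Theta> c)" .
 next
  fix c c' assume "c \<in> ?Z" "c' \<in> ?Z"
  then show "f (\<Theta> (%i. c i \<oplus>\<^sub>H c' i)) = f (\<Theta> c) \<oplus> f (\<Theta> c')"
   using additive_add[OF fadd \<Theta>c \<Theta>c] by (simp add: p(3))
 qed (use fc \<Theta>c z f0[OF \<Theta>c] p(5) in auto)
qed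

end

section \<open>The cleft object over the Hopf algebra\<close>

sublocale hopf_cocycle \<subseteq> AE: enveloping K "right_cleft_object K H \<sigma>"
 by (rule enveloping.intro[OF A_algebra])

context hopf_cocycle
begin

lemma A_tensor [simp]: "tensor_module K A A = HT" "pure_tensor K A A = pt"
 by (rule tensor_cong; simp)+

abbreviation Ae where "Ae \<equiv> enveloping_algebra K A"

lemma Ae_simps [simp]: "carrier Ae = carrier HT" "add Ae = add HT" "zero Ae = zero HT" "smult Ae = smult HT"
 "one Ae = pt oneH oneH" "finsum Ae = finsum HT"
 using AE.env_simps by (simp_all only: A_tensor A_simps)

lemma Ae_pure:
 "a <: H ==> b <: H ==> c <: H ==> d <: H ==>
  pt a b \<otimes>\<^sub>Ae pt c d = pt (amul a c) (amul d b)"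
 using AE.env_pure[of a b c d] by (simp add: A_tensor)

lemma Ae_lin: "u <: HT ==> (%s. s \<otimes>\<^sub>Ae u) \<in> mhom K HT HT"
 "u <: HT ==> (%s. u \<otimes>\<^sub>Ae s) \<in> mhom K HT HT"
 using AE.env_lin by (simp_all add: A_tensor)

lemma Ae_ring: "ring Ae" by (rule assoc_algebra_ring[OF AE.env_algebra])

lemma Ae_closed [simp]: "s <: HT ==> u <: HT ==> s \<otimes>\<^sub>Ae u <: HT"
 by (rule mhom_closed[OF Ae_lin(1)])

lemma Ae_assoc: "s <: HT ==> u <: HT ==> z <: HT ==>
  (s \<otimes>\<^sub>Ae u) \<otimes>\<^sub>Ae z = s \<otimes>\<^sub>Ae (u \<otimes>\<^sub>Ae z)"
 using monoid.m_assoc[OF ring.is_monoid[OF Ae_ring], of s u z] by simp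

lemma Ae_one: "s <: HT ==> pt oneH oneH \<otimes>\<^sub>Ae s = s"
 using monoid.l_one[OF ring.is_monoid[OF Ae_ring], of s] by simp

lemma Ae_sw:
 assumes "h <: H" "s <: HT" "!!a b. a <: H ==> b <: H ==> f a b <: HT"
 shows "sw HT h f \<otimes>\<^sub>Ae s = sw HT h (%a b. f a b \<otimes>\<^sub>Ae s)"
  "s \<otimes>\<^sub>Ae sw HT h f = sw HT h (%a b. s \<otimes>\<^sub>Ae f a b)"
 using assms by (intro sw_comp[OF HT_module HT_module Ae_lin(1)] sw_comp[OF HT_module HT_module Ae_lin(2)]; simp)+

section \<open>The map from H to the enveloping algebra of the cleft object, and Galois maps\<close>

abbreviation Li where "Li \<equiv> inv_into (carrier H) L"

lemma Li_L [simp]: "h <: H ==> Li (L h) = h"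
 by (rule bij_betw_inv_into_left[OF L_bij])

lemma L_surj:
 assumes "x <: H"
 obtains v where "v <: H" "x = L v"
 using assms L_bij by (auto simp: bij_betw_def)

lemma lin_Li: "f \<in> lin H ==> (%x. Li (f x)) \<in> lin H"
 by (rule mhom_comp[OF _ inverse_lin[OF L_lin L_bij]])

text \<open>The inverse antipode is there for multiplicativity: the translation map v -> L(v1)
  \<otimes> v2 itself reverses products.\<close>

definition kappa where "kappa h = sw HT (Si h) (%a b. pt (L a) b)"

lemma kappa_S: "h <: H ==> kappa (S h) = sw HT h (%a b. pt (L a) b)"
 by (simp add: kappa_def)

lemma kappa_lin: "kappa \<in> lin HT"
 unfolding kappa_def by (intro lin_Si lin_L lins) auto

lemma kappa_closed [simp]: "h <: H ==> kappa h <: HT"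
 by (rule mhom_closed[OF kappa_lin])

lemma lin_Ae: "f \<in> lin HT ==> s <: HT ==> (%x. f x \<otimes>\<^sub>Ae s) \<in> lin HT"
 "f \<in> lin HT ==> s <: HT ==> (%x. s \<otimes>\<^sub>Ae f x) \<in> lin HT"
 using mhom_comp[OF _ Ae_lin(1)] mhom_comp[OF _ Ae_lin(2)] by blast+

text \<open>A Galois map, x \<otimes> y -> x.y1 \<otimes> S(y2). It straightens the action of H:
  right multiplication by \<open>kappa h\<close> becomes right multiplication by h on the second
  factor (\<open>can_kappa\<close>).\<close>

definition can where "can = tensor_lift K HT (%x y. sw HT y (%c d. pt (amul x c) (S d)))"
definition can_inv where "can_inv = tensor_lift K HT (%a h. pt a oneH \<otimes>\<^sub>Ae kappa h)"

lemma can_bil: "bil HT (%x y. sw HT y (%c d. pt (amul x c) (S d)))"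
 by (intro lin_amul lins) auto

lemma can_inv_bil: "bil HT (%a h. pt a oneH \<otimes>\<^sub>Ae kappa h)"
 by (intro lin_Ae kappa_lin lins) auto

lemma can_lin: "can \<in> mhom K HT HT" and can_inv_lin: "can_inv \<in> mhom K HT HT"
 unfolding can_def can_inv_def by (intro HH.t.lift_hom HT_module can_bil can_inv_bil)+

lemma can_pure: "x <: H ==> y <: H ==> can (pt x y) = sw HT y (%c d. pt (amul x c) (S d))"
 and can_inv_pure: "x <: H ==> y <: H ==> can_inv (pt x y) = pt x oneH \<otimes>\<^sub>Ae kappa y"
 unfolding can_def can_inv_def by (intro HH.t.lift_pure HT_module can_bil can_inv_bil; assumption)+

lemma pt_kappa:
 assumes "a <: H" "b <: H" "v <: H"
 shows "pt a b \<otimes>\<^sub>Ae kappa (S v) = sw HT v (%p q. pt (amul a (L p)) (amul q b))"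
 using assms by (auto simp: kappa_S Ae_sw Ae_pure intro!: sw_cong)

lemma kappa_pt:
 assumes "a <: H" "b <: H" "v <: H"
 shows "kappa (S v) \<otimes>\<^sub>Ae pt a b = sw HT v (%p q. pt (amul (L p) a) (amul b q))"
 using assms by (auto simp: kappa_S Ae_sw Ae_pure intro!: sw_cong)

lemma pt_smult: "c <: K ==> a <: H ==> b <: H ==> pt (c *s a) b = c \<odot>\<^sub>HT pt a b"
 "c <: K ==> a <: H ==> b <: H ==> pt a (c *s b) = c \<odot>\<^sub>HT pt a b"
 by (rule mhom_smult[OF bilinear_left[OF pt_bil]]; assumption)
  (rule mhom_smult[OF bilinear_right[OF pt_bil]]; assumption)

lemma pt_swL: "h <: H ==> c <: H ==> (!!a b. a <: H ==> b <: H ==> f a b <: H) ==>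
  pt (sw H h f) c = sw HT h (%a b. pt (f a b) c)"
 by (rule sw_comp[OF H_module HT_module bilinear_left[OF pt_bil]])

lemma pt_swR: "h <: H ==> c <: H ==> (!!a b. a <: H ==> b <: H ==> f a b <: H) ==>
  pt c (sw H h f) = sw HT h (%a b. pt c (f a b))"
 by (rule sw_comp[OF H_module HT_module bilinear_right[OF pt_bil]])

text \<open>The inner pair y1.L(y2) collapses to the counit by \<open>L_right\<close>.\<close>

lemma can_inv_can:
 assumes s: "s <: HT"
 shows "can_inv (can s) = s"
proof (rule HH.t.tensor_ext[OF mhom_comp[OF can_lin can_inv_lin] _ _ s])
 show "(%s. s) \<in> mhom K HT HT" by (auto simp: module_hom_def)
 fix x y assume x: "x <: H" and y: "y <: H"
 have "can_inv (can (pt x y)) = sw HT y (%c d. pt (amul x c) oneH \<otimes>\<^sub>Ae kappa (S d))"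
  using x y by (auto simp: can_pure sw_comp[OF HT_module HT_module can_inv_lin] can_inv_pure intro!: sw_cong)
 also have "... = sw HT y (%c X. sw HT X (%p q. pt (amul (amul x c) (L p)) q))"
  using x y by (intro sw_cong) (auto simp: pt_kappa amul_one intro!: sw_cong)
 also have "... = sw HT y (%X q. sw HT X (%c p. pt (amul (amul x c) (L p)) q))"
  using x by (intro sw_coassoc[symmetric] y lin_L lin_amul lins) auto
 also have "... = sw HT y (%X q. eps X \<odot>\<^sub>HT pt x q)"
 proof (rule sw_cong[OF y])
  fix X q assume Xq: "X <: H" "q <: H"
  have "sw HT X (%c p. pt (amul (amul x c) (L p)) q) = pt (amul x (sw H X (%c p. amul c (L p)))) q"
   using Xq x by (auto simp: sw_amulR pt_swL amul_assoc intro!: sw_cong)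
  then show "sw HT X (%c p. pt (amul (amul x c) (L p)) q) = eps X \<odot>\<^sub>HT pt x q"
   using Xq x by (simp add: L_right amul_linear amul_one pt_smult)
 qed
 also have "... = pt x y" using x by (intro counitL y lins)
 finally show "can_inv (can (pt x y)) = pt x y" .
qed

lemma rmul_bil: "h <: H ==> bil HT (%v w. pt v (w ** h))"
 by (intro lins) auto

lemma lmul_bil: "h <: H ==> bil HT (%v w. pt v (h ** w))"
 by (intro lins) auto

text \<open>For h = S v the product puts L(v1) to the right of x and v2 to the left of y. After
  taking the coproduct of v2.y, the pair L(v1).v2 cancels, and S(v3) is left on the right of the
  second factor.\<close>

lemma can_kappa:
 assumes s: "s <: HT" and h: "h <: H"
 shows "can (s \<otimes>\<^sub>Ae kappa h) = tensor_lift K HT (%v w. pt v (w ** h)) (can s)"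
proof (rule HH.t.tensor_ext[OF mhom_comp[OF Ae_lin(1)[OF kappa_closed[OF h]] can_lin]
   mhom_comp[OF can_lin HH.t.lift_hom[OF HT_module rmul_bil[OF h]]] _ s])
 fix x y assume x: "x <: H" and y: "y <: H"
 obtain v where v: "v <: H" "h = S v" using S_surj h by metis
 let ?M = "tensor_lift K HT (%v w. pt v (w ** h))"
 have "can (pt x y \<otimes>\<^sub>Ae kappa h) = sw HT v (%p q. can (pt (amul x (L p)) (amul q y)))"
  unfolding v(2) using x y v by (auto simp: pt_kappa sw_comp[OF HT_module HT_module can_lin])
 also have "... = sw HT v (%p q. sw HT q (%a b. sw HT y (%c d. pt (amul (amul x (L p)) (amul a c)) (S d ** S b))))"
 proof (rule sw_cong[OF v(1)])
  fix p q assume pq: "p <: H" "q <: H"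
  have "can (pt (amul x (L p)) (amul q y)) = sww HT q y (%a c b d. pt (amul (amul x (L p)) (amul a c)) (S (b ** d)))"
  proof -
   have c: "amul x (L p) <: H" "amul q y <: H" using x y pq by auto
   show ?thesis unfolding can_pure[OF c] using x y pq by (intro sww_amul lin_amul lins) auto
  qed
  then show "can (pt (amul x (L p)) (amul q y)) =
   sw HT q (%a b. sw HT y (%c d. pt (amul (amul x (L p)) (amul a c)) (S d ** S b)))"
   unfolding sww_def using x y pq by (auto simp: S_mult intro!: sw_cong)
 qed
 also have "... = sw HT v (%X b. sw HT X (%p a. sw HT y (%c d. pt (amul (amul x (L p)) (amul a c)) (S d ** S b))))"
  using x y by (intro sw_coassoc[symmetric] v lin_L lin_amul lins) auto
 also have "... = sw HT v (%X b. eps X \<odot>\<^sub>HT sw HT y (%c d. pt (amul x c) (S d ** S b)))"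
 proof (rule sw_cong[OF v(1)])
  fix X b assume Xb: "X <: H" "b <: H"
  have g: "(%u. sw HT y (%c d. pt (amul (amul x u) c) (S d ** S b))) \<in> lin HT"
   using x y Xb by (intro lin_amul lins) auto
  have "sw HT X (%p a. sw HT y (%c d. pt (amul (amul x (L p)) (amul a c)) (S d ** S b))) =
    sw HT X (%p a. sw HT y (%c d. pt (amul (amul x (amul (L p) a)) c) (S d ** S b)))"
   using x y Xb by (intro sw_cong) (auto simp: amul_assoc)
  also have "... = sw HT y (%c d. pt (amul (amul x (sw H X (%p a. amul (L p) a))) c) (S d ** S b))"
   using x y Xb by (intro sw_comp[OF H_module HT_module g, symmetric]) auto
  also have "... = eps X \<odot>\<^sub>HT sw HT y (%c d. pt (amul x c) (S d ** S b))"
   using x Xb mhom_smult[OF g, of "eps X" "oneH"] by (simp add: L_left amul_one)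
  finally show "sw HT X (%p a. sw HT y (%c d. pt (amul (amul x (L p)) (amul a c)) (S d ** S b))) =
    eps X \<odot>\<^sub>HT sw HT y (%c d. pt (amul x c) (S d ** S b))" .
 qed
 also have "... = sw HT y (%c d. pt (amul x c) (S d ** S v))"
  using x y by (intro counitL v lin_amul lins) auto
 also have "... = ?M (can (pt x y))"
  using x y h v by (auto simp: can_pure sw_comp[OF HT_module HT_module HH.t.lift_hom[OF HT_module rmul_bil]]
    HH.t.lift_pure[OF HT_module rmul_bil] intro!: sw_cong)
 finally show "can (pt x y \<otimes>\<^sub>Ae kappa h) = ?M (can (pt x y))" .
qed

lemma can_one: "can (pt oneH oneH) = pt oneH oneH"
proof -
 have o: "oneH <: H" by simp
 have "can (pt oneH oneH) = pt (amul oneH oneH) (S oneH)"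
  unfolding can_pure[OF o o] by (intro sw_one lin_amul lins) auto
 then show ?thesis by (simp add: amul_one)
qed

lemma can_of_kappa: "h <: H ==> can (kappa h) = pt oneH h"
 using can_kappa[of "pt oneH oneH" h] by (simp add: Ae_one can_one HH.t.lift_pure[OF HT_module rmul_bil])

text \<open>\<open>can\<close> is injective by \<open>can_inv_can\<close>, so multiplicativity may
  be tested after applying it. By \<open>can_kappa\<close> both sides then become 1 \<otimes> x
  y.\<close>

lemma kappa_ring_hom: "kappa \<in> ring_hom H Ae"
proof (rule ring_hom_memI)
 have inj: "s = u" if "s <: HT" "u <: HT" "can s = can u" for s u
  using that can_inv_can by metis
 show "kappa (x ** y) = kappa x \<otimes>\<^sub>Ae kappa y" if "x <: H" "y <: H" for x y
  using that by - (rule inj, simp_all add: can_of_kappa can_kappa HH.t.lift_pure[OF HT_module rmul_bil])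
 show "kappa oneH = \<one>\<^sub>Ae" by (rule inj) (simp_all add: can_of_kappa can_one)
qed (simp_all add: mhom_add[OF kappa_lin])

lemmas kappa_mult = ring_hom_mult[OF kappa_ring_hom]

lemma Ae_dual_basis:
 assumes db: "dual_basis K H E (%e. e) \<phi>"
 shows "dual_basis (opp H) (restr kappa (reg (opp Ae))) E
  (%b. pt b oneH) (%e s. tensor_lift K H (%v w. \<phi> e v *s w) (can s))"
proof (rule coordinates_dual_basis[OF H_tensor db, where \<Gamma> = can_inv])
 show "lmodule (opp H) (restr kappa (reg (opp Ae)))"
  by (intro lmodule_restrict[OF lmodule_regular] Ae_ring ring_opposite ring_axioms ring_hom_opposite kappa_ring_hom)
qed (use mhom_additive[OF can_lin] mhom_additive[OF can_inv_lin] in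
  \<open>auto simp: additive_def can_kappa can_inv_pure can_inv_can intro!: lins\<close>)

text \<open>The counterpart of \<open>can\<close> for left multiplication by \<open>kappa h\<close>.
  With x = L(v) it sends x \<otimes> y to y.t(v2) \<otimes> S(v1); the inverse of L extracts
  v.\<close>

definition dcan where "dcan = tensor_lift K HT (%x y. sw HT (Li x) (%a b. pt (amul y (t b)) (S a)))"
definition dcan_inv where "dcan_inv = tensor_lift K HT (%y h. kappa h \<otimes>\<^sub>Ae pt oneH y)"

lemma dcan_bil: "bil HT (%x y. sw HT (Li x) (%a b. pt (amul y (t b)) (S a)))"
 using mhom_closed[OF inverse_lin[OF L_lin L_bij]] by (intro lin_amul lin_t lin_Li lins) auto

lemma dcan_inv_bil: "bil HT (%y h. kappa h \<otimes>\<^sub>Ae pt oneH y)"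
 by (intro lin_Ae kappa_lin lins) auto

lemma dcan_lin: "dcan \<in> mhom K HT HT" and dcan_inv_lin: "dcan_inv \<in> mhom K HT HT"
 unfolding dcan_def dcan_inv_def by (intro HH.t.lift_hom HT_module dcan_bil dcan_inv_bil)+

lemma dcan_pure: "v <: H ==> y <: H ==>
  dcan (pt (L v) y) = sw HT v (%a b. pt (amul y (t b)) (S a))"
 unfolding dcan_def by (simp add: HH.t.lift_pure[OF HT_module dcan_bil])

lemma dcan_inv_pure: "y <: H ==> h <: H ==> dcan_inv (pt y h) = kappa h \<otimes>\<^sub>Ae pt oneH y"
 unfolding dcan_inv_def by (rule HH.t.lift_pure[OF HT_module dcan_inv_bil])

lemma dcan_closed: "s <: HT ==> dcan s <: HT"
 by (rule mhom_closed[OF dcan_lin])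

lemma dcan_inv_dcan:
 assumes s: "s <: HT"
 shows "dcan_inv (dcan s) = s"
proof (rule HH.t.tensor_ext[OF mhom_comp[OF dcan_lin dcan_inv_lin] _ _ s])
 show "(%s. s) \<in> mhom K HT HT" by (auto simp: module_hom_def)
 fix x y assume x: "x <: H" and y: "y <: H"
 obtain v where v: "v <: H" "x = L v" using L_surj[OF x] .
 have "dcan_inv (dcan (pt x y)) = sw HT v (%X b. kappa (S X) \<otimes>\<^sub>Ae pt oneH (amul y (t b)))"
  unfolding v(2) using v y
  by (auto simp: dcan_pure sw_comp[OF HT_module HT_module dcan_inv_lin] dcan_inv_pure intro!: sw_cong)
 also have "... = sw HT v (%X b. sw HT X (%p q. pt (L p) (amul (amul y (t b)) q)))"
  using v y by (intro sw_cong) (auto simp: kappa_pt amul_one intro!: sw_cong)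
 also have "... = sw HT v (%p X. sw HT X (%q b. pt (L p) (amul (amul y (t b)) q)))"
  using y by (intro sw_coassoc v lin_L lin_t lin_amul lins) auto
 also have "... = sw HT v (%p X. eps X \<odot>\<^sub>HT pt (L p) y)"
 proof (rule sw_cong[OF v(1)])
  fix p X assume pX: "p <: H" "X <: H"
  have "sw HT X (%q b. pt (L p) (amul (amul y (t b)) q)) = pt (L p) (amul y (sw H X (%q b. amul (t b) q)))"
   using pX y by (auto simp: sw_amulR pt_swR amul_assoc intro!: sw_cong)
  then show "sw HT X (%q b. pt (L p) (amul (amul y (t b)) q)) = eps X \<odot>\<^sub>HT pt (L p) y"
   using pX y by (simp add: t_left amul_linear amul_one pt_smult)
 qed
 also have "... = pt x y" unfolding v(2) using y by (intro counitR v lin_L lins)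
 finally show "dcan_inv (dcan (pt x y)) = pt x y" .
qed

lemma dcan_dcan_inv:
 assumes u: "u <: HT"
 shows "dcan (dcan_inv u) = u"
proof (rule HH.t.tensor_ext[OF mhom_comp[OF dcan_inv_lin dcan_lin] _ _ u])
 show "(%s. s) \<in> mhom K HT HT" by (auto simp: module_hom_def)
 fix y h assume y: "y <: H" and h: "h <: H"
 obtain v where v: "v <: H" "h = S v" using S_surj h by metis
 have "dcan (dcan_inv (pt y h)) = sw HT v (%p q. dcan (pt (L p) (amul y q)))"
  unfolding v(2) using v y
  by (auto simp: dcan_inv_pure kappa_pt sw_comp[OF HT_module HT_module dcan_lin] amul_one intro!: sw_cong)
 also have "... = sw HT v (%X q. sw HT X (%a b. pt (amul (amul y q) (t b)) (S a)))"
  using v y by (intro sw_cong) (auto simp: dcan_pure)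
 also have "... = sw HT v (%a X. sw HT X (%b q. pt (amul (amul y q) (t b)) (S a)))"
  using y by (intro sw_coassoc v lin_t lin_amul lins) auto
 also have "... = sw HT v (%a X. eps X \<odot>\<^sub>HT pt y (S a))"
 proof (rule sw_cong[OF v(1)])
  fix a X assume aX: "a <: H" "X <: H"
  have "sw HT X (%b q. pt (amul (amul y q) (t b)) (S a)) = pt (amul y (sw H X (%b q. amul q (t b)))) (S a)"
   using aX y by (auto simp: sw_amulR pt_swL amul_assoc intro!: sw_cong)
  then show "sw HT X (%b q. pt (amul (amul y q) (t b)) (S a)) = eps X \<odot>\<^sub>HT pt y (S a)"
   using aX y by (simp add: t_right amul_linear amul_one pt_smult)
 qed
 also have "... = pt y h" unfolding v(2) using y by (intro counitR v lins)
 finally show "dcan (dcan_inv (pt y h)) = pt y h" .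
qed

lemma kappa_dcan_inv:
 assumes h: "h <: H" and u: "u <: HT"
 shows "kappa h \<otimes>\<^sub>Ae dcan_inv u = dcan_inv (tensor_lift K HT (%v w. pt v (h ** w)) u)"
proof (rule HH.t.tensor_ext[OF mhom_comp[OF dcan_inv_lin Ae_lin(2)[OF kappa_closed[OF h]]]
   mhom_comp[OF HH.t.lift_hom[OF HT_module lmul_bil[OF h]] dcan_inv_lin] _ u])
 fix y g assume "y <: H" "g <: H"
 then show "kappa h \<otimes>\<^sub>Ae dcan_inv (pt y g) = dcan_inv (tensor_lift K HT (%v w. pt v (h ** w)) (pt y g))"
  using h by (simp add: dcan_inv_pure HH.t.lift_pure[OF HT_module lmul_bil] kappa_mult Ae_assoc)
qed

text \<open>For \<open>dcan_inv\<close> the equivariance is just multiplicativity of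
  \<open>kappa\<close> and associativity. As the two maps are inverse to each other, it passes to
  \<open>dcan\<close>.\<close>

lemma dcan_kappa:
 assumes h: "h <: H" and s: "s <: HT"
 shows "dcan (kappa h \<otimes>\<^sub>Ae s) = tensor_lift K HT (%v w. pt v (h ** w)) (dcan s)"
 using kappa_dcan_inv[OF h dcan_closed[OF s]] dcan_inv_dcan[OF s]
  dcan_dcan_inv[OF mhom_closed[OF HH.t.lift_hom[OF HT_module lmul_bil[OF h]] dcan_closed[OF s]]] by simp

lemma Ae_dual_basis':
 assumes db: "dual_basis K H E (%e. e) \<phi>"
 shows "dual_basis H (restr kappa (reg Ae)) E
  (%b. pt oneH b) (%e s. tensor_lift K H (%v w. \<phi> e v *s w) (dcan s))"
proof (rule coordinates_dual_basis[OF H_tensor db, where \<Gamma> = dcan_inv])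
 show "lmodule H (restr kappa (reg Ae))"
  by (intro lmodule_restrict[OF lmodule_regular] Ae_ring ring_axioms kappa_ring_hom)
qed (use mhom_additive[OF dcan_lin] mhom_additive[OF dcan_inv_lin] in
  \<open>auto simp: additive_def dcan_kappa dcan_inv_pure dcan_inv_dcan intro!: lins\<close>)

end

section \<open>The candidate for the Nakayama automorphism\<close>

context hopf_cocycle
begin

definition nakayama where
 "nakayama \<xi> x = sw H x (%x1 x2. \<xi> (S x2) *s
   cocycle_antipode_inv K H \<sigma> (trivial_cocycle K H) (cocycle_antipode_inv K H (trivial_cocycle K H) \<sigma> x1))"

context
 fixes \<xi> assumes \<xi>: "\<xi> \<in> algebra_hom K H KK"
begin

abbreviation \<mu> where "\<mu> \<equiv> nakayama \<xi>"
abbreviation \<chi> where "\<chi> h \<equiv> \<xi> (S h)"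

lemma \<xi>_lin: "\<xi> \<in> lin KK"
 and \<xi>_closed: "x <: H ==> \<xi> x <: K"
 and \<xi>_mult: "x <: H ==> y <: H ==> \<xi> (x ** y) = \<xi> x \<otimes> \<xi> y"
 and \<xi>_one: "\<xi> oneH = \<one>"
 using \<xi> by (auto simp: algebra_hom_def ring_hom_def)

lemmas lin_\<xi> = lin_\<phi>[OF \<xi>_lin]

text \<open>The coproduct of L(v) is L(v2) \<otimes> S(v1), so \<xi> S is evaluated at S(v1), where
  \<open>character_S2\<close> gives \<xi>(v1).\<close>

lemma nakayama_L:
 assumes v: "v <: H"
 shows "\<mu> (L v) = t (lact \<xi> v)"
proof -
 have "\<mu> (L v) = sw H (L v) (%x y. \<chi> y *s t (Li x))"
  unfolding nakayama_def
 proof (rule sw_cong)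
  fix x y assume x: "x <: H"
  obtain w where "w <: H" "x = L w" using L_surj[OF x] .
  then show "\<chi> y *s cocycle_antipode_inv K H \<sigma> (trivial_cocycle K H)
    (cocycle_antipode_inv K H (trivial_cocycle K H) \<sigma> x) = \<chi> y *s t (Li x)"
   by (simp add: antipode_inv_L antipode_inv_t)
 qed (use v in simp)
 also have "... = sw H v (%a b. \<xi> (S (S a)) *s t (Li (L b)))"
  using \<xi>_closed mhom_closed[OF inverse_lin[OF L_lin L_bij]]
  by (intro sw_L v lin_\<xi> lin_t lin_Li lins) auto
 also have "... = sw H v (%a b. t (\<xi> a *s b))"
  using v by (intro sw_cong) (auto simp: character_S2[OF \<xi>] mhom_smult[OF t_lin] \<xi>_closed)
 also have "... = t (lact \<xi> v)"
  unfolding lact_def using v \<xi>_closed by (intro sw_comp[OF H_module H_module t_lin, symmetric]) auto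
 finally show ?thesis .
qed

lemma \<mu>_closed: "x <: H ==> \<mu> x <: H"
 by (metis L_surj nakayama_L t_closed lact_closed \<xi>_lin)

text \<open>The quotient map of \<open>Ae\<close> by the relations kappa(h) s = \<xi>(S h) s, with
  the quotient identified with the cleft object. It sends x \<otimes> y to y.\<mu>(x)
  (\<open>Psi_pure\<close>); \<open>transport\<close> is its universal property.\<close>

definition Psi where "Psi s = tensor_lift K H (%y h. \<chi> h *s y) (dcan s)"

lemma \<chi>_bil: "bil H (%y h. \<chi> h *s y)"
 using \<xi>_closed by (intro lin_\<xi> lins) auto

lemmas \<chi>_lift_lin = HH.t.lift_hom[OF H_module \<chi>_bil]
lemmas \<chi>_lift_pure = HH.t.lift_pure[OF H_module \<chi>_bil]

lemma Psi_lin: "Psi \<in> mhom K HT H"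
 unfolding Psi_def by (rule mhom_comp[OF dcan_lin \<chi>_lift_lin])

lemma Psi_pure:
 assumes x: "x <: H" and y: "y <: H"
 shows "Psi (pt x y) = amul y (\<mu> x)"
proof -
 obtain v where v: "v <: H" "x = L v" using L_surj[OF x] .
 have "Psi (pt x y) = sw H v (%a b. \<xi> (S (S a)) *s amul y (t b))"
  unfolding Psi_def v(2) using v y
  by (auto simp: dcan_pure sw_comp[OF HT_module H_module \<chi>_lift_lin] \<chi>_lift_pure intro!: sw_cong)
 also have "... = sw H v (%a b. amul y (t (\<xi> a *s b)))"
  using v y by (intro sw_cong) (auto simp: character_S2[OF \<xi>] mhom_smult[OF t_lin] \<xi>_closed amul_linear)
 also have "... = amul y (t (lact \<xi> v))"
  unfolding lact_def using v y \<xi>_closed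
  by (simp add: sw_comp[OF H_module H_module t_lin] sw_amulR)
 finally show ?thesis using v by (simp add: nakayama_L)
qed

lemma Psi_kappa:
 assumes h: "h <: H" and s: "s <: HT"
 shows "Psi (kappa h \<otimes>\<^sub>Ae s) = Psi (\<chi> h \<odot>\<^sub>HT s)"
proof -
 have "tensor_lift K H (%y g. \<chi> g *s y) (tensor_lift K HT (%v w. pt v (h ** w)) u) =
  \<chi> h *s tensor_lift K H (%y g. \<chi> g *s y) u" if u: "u <: HT" for u
 proof (rule HH.t.tensor_ext[OF mhom_comp[OF HH.t.lift_hom[OF HT_module lmul_bil[OF h]] \<chi>_lift_lin] _ _ u])
  show "(%u. \<chi> h *s tensor_lift K H (%y g. \<chi> g *s y) u) \<in> mhom K HT H"
   using h \<xi>_closed by (intro mhom_comp[OF \<chi>_lift_lin] lins) auto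
  fix y g assume "y <: H" "g <: H"
  then show "tensor_lift K H (%y g. \<chi> g *s y) (tensor_lift K HT (%v w. pt v (h ** w)) (pt y g)) =
    \<chi> h *s tensor_lift K H (%y g. \<chi> g *s y) (pt y g)"
   using h by (simp add: HH.t.lift_pure[OF HT_module lmul_bil] \<chi>_lift_pure S_mult \<xi>_mult \<xi>_closed
     smult_assoc1[symmetric] K.m_comm)
 qed
 then show ?thesis
  using h s \<xi>_closed by (simp add: mhom_smult[OF Psi_lin]) (simp add: Psi_def dcan_kappa dcan_closed)
qed

text \<open>Through \<open>dcan_inv\<close> every element is a sum of terms kappa(h) (1 \<otimes>
  y), in which F may replace kappa(h) by the scalar \<xi>(S h).\<close>

lemma transport:
 assumes U: "abelian_group U" and F: "additive HT U F" and s: "s <: HT"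
  and \<kappa>: "!!h s. h <: H ==> s <: HT ==> F (kappa h \<otimes>\<^sub>Ae s) = F (\<chi> h \<odot>\<^sub>HT s)"
 shows "F s = F (pt oneH (Psi s))"
proof -
 let ?l = "tensor_lift K H (%y h. \<chi> h *s y)"
 note ptl = bilinear_right[OF pt_bil, of "oneH"]
 have "F (dcan_inv u) = F (pt oneH (?l u))" if u: "u <: HT" for u
  using u
 proof (induction rule: HH.t.tensor_induct)
  case (pure y h)
  then show ?case by (simp add: dcan_inv_pure \<chi>_lift_pure \<kappa> pt_smult \<xi>_closed)
 next
  case (add s u)
  then show ?case
   using mhom_closed[OF dcan_inv_lin] mhom_closed[OF \<chi>_lift_lin]
   by (simp add: mhom_add[OF dcan_inv_lin] mhom_add[OF \<chi>_lift_lin] mhom_add[OF ptl]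
     additive_add[OF F])
 qed
 from this[OF dcan_closed[OF s]] show ?thesis by (simp add: dcan_inv_dcan[OF s] Psi_def)
qed

text \<open>\<open>transport\<close> is applied to s -> Psi(s (y \<otimes> 1)) at s = x \<otimes> 1.
  One side is \<mu>(x.y), the other Psi(y \<otimes> \<mu>(x)) = \<mu>(x).\<mu>(y), so the cocycle
  never enters explicitly.\<close>

lemma \<mu>_mult:
 assumes x: "x <: H" and y: "y <: H"
 shows "\<mu> (amul x y) = amul (\<mu> x) (\<mu> y)"
proof -
 have y1: "pt y oneH <: HT" using y by simp
 let ?F = "%s. Psi (s \<otimes>\<^sub>Ae pt y oneH)"
 have Fl: "?F \<in> mhom K HT H" by (rule mhom_comp[OF Ae_lin(1)[OF y1] Psi_lin])
 have "?F (pt x oneH) = ?F (pt oneH (Psi (pt x oneH)))"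
 proof (rule transport[OF is_abelian_group mhom_additive[OF Fl]])
  fix h s assume h: "h <: H" and s: "s <: HT"
  show "?F (kappa h \<otimes>\<^sub>Ae s) = ?F (\<chi> h \<odot>\<^sub>HT s)"
   using h s y1 \<xi>_closed by (simp add: Ae_assoc Psi_kappa mhom_smult[OF Ae_lin(1)])
 qed (use x in simp)
 then show ?thesis
  using x y \<mu>_closed by (simp add: Ae_pure Psi_pure amul_one)
qed

lemma \<mu>_linear: "\<mu> \<in> lin H"
proof (rule mhomI)
 have m: "\<mu> x = Psi (pt x oneH)" if "x <: H" for x
  using that by (simp add: Psi_pure amul_one \<mu>_closed)
 have l: "(%x. Psi (pt x oneH)) \<in> lin H"
  by (rule mhom_comp[OF bilinear_left[OF pt_bil] Psi_lin]) simp
 show "\<mu> x <: H" if "x <: H" for x using \<mu>_closed[OF that] .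
 show "\<mu> (x \<oplus>\<^sub>H y) = \<mu> x \<oplus>\<^sub>H \<mu> y" if "x <: H" "y <: H" for x y
  using mhom_add[OF l, of x y] that by (simp add: m)
 show "\<mu> (a *s x) = a *s \<mu> x" if "a <: K" "x <: H" for a x
  using mhom_smult[OF l, of a x] that by (simp add: m)
qed

text \<open>By \<open>nakayama_L\<close>, \<mu> is the inverse of L followed by the action of \<xi>
  and by t. The action of \<xi> is undone by that of \<xi> S.\<close>

lemma \<mu>_bij: "bij_betw \<mu> (carrier H) (carrier H)"
proof -
 have \<chi>l: "(%h. \<chi> h) \<in> lin KK" by (intro lin_\<xi> lins)
 have 1: "sw KK h (%a b. \<xi> a \<otimes> \<chi> b) = eps h" "sw KK h (%a b. \<chi> a \<otimes> \<xi> b) = eps h" if h: "h <: H" for h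
 proof -
  have "sw KK h (%a b. \<xi> a \<otimes> \<chi> b) = sw KK h (%a b. \<xi> (a ** S b))"
   "sw KK h (%a b. \<chi> a \<otimes> \<xi> b) = sw KK h (%a b. \<xi> (S a ** b))"
   using h by (intro sw_cong; simp add: \<xi>_mult)+
  then show "sw KK h (%a b. \<xi> a \<otimes> \<chi> b) = eps h" "sw KK h (%a b. \<chi> a \<otimes> \<xi> b) = eps h"
   using antiR[OF KK_module h \<xi>_lin] antiL[OF KK_module h \<xi>_lin] h by (simp_all add: \<xi>_one)
 qed
 have "bij_betw (lact \<xi>) (carrier H) (carrier H)"
  by (rule bij_betw_byWitness[where f' = "lact (%h. \<chi> h)"])
   (use 1 \<xi>_lin \<chi>l lact_closed in \<open>auto simp: lact_lact\<close>)
 then have "bij_betw (t \<circ> (lact \<xi> \<circ> Li)) (carrier H) (carrier H)"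
  using bij_betw_inv_into[OF L_bij] t_bij by (intro bij_betw_trans)
 moreover have "(t \<circ> (lact \<xi> \<circ> Li)) x = \<mu> x" if x: "x <: H" for x
 proof -
  obtain v where "v <: H" "x = L v" using L_surj[OF x] .
  then show ?thesis by (simp add: nakayama_L)
 qed
 ultimately show ?thesis by (rule bij_betw_cong[THEN iffD1, rotated])
qed

lemma \<mu>_algebra_hom: "\<mu> \<in> algebra_hom K A A"
proof -
 \<comment> \<open>The unit is preserved by surjectivity: if \<mu>(x) = 1, then \<mu>(1) =
   \<mu>(1).\<mu>(x) = \<mu>(x) = 1.\<close>
 have "oneH \<in> \<mu> ` carrier H" using \<mu>_bij by (simp add: bij_betw_def)
 then obtain x where x: "x <: H" "\<mu> x = oneH" by force
 then have "\<mu> oneH = oneH"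
  using \<mu>_mult[of "oneH" x] \<mu>_closed[of "oneH"] by (simp add: amul_one)
 then show ?thesis
  using \<mu>_linear \<mu>_mult \<mu>_closed
  by (auto simp: algebra_hom_def module_hom_def ring_hom_def)
qed

end

section \<open>The cleft object as a module induced from the trivial module\<close>

abbreviation Aid where "Aid \<equiv> twisted_bimodule K A id"

lemma Aid_lmodule: "lmodule Ae Aid"
 by (rule AE.twisted_lmodule[OF AE.id_algebra_hom])

lemma Aid_simps [simp]: "carrier Aid = carrier H" "zero Aid = zero H" "add Aid = add H" "finsum Aid = finsum H"
 using AE.twisted_simps[OF AE.id_algebra_hom] by simp_all

lemma Aid_pure: "a <: H ==> b <: H ==> m <: H ==> pt a b \<odot>\<^sub>Aid m = amul (amul a m) b"
 using AE.twisted_pure[OF AE.id_algebra_hom, of a b m] by simp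

lemma Aid_lin: "m <: H ==> (%s. s \<odot>\<^sub>Aid m) \<in> mhom K HT H"
 using AE.twisted_lin[OF AE.id_algebra_hom, of m] by (simp add: module_hom_def)

lemma Aid_smult: "s <: HT ==> c <: K ==> m <: H ==>
  s \<odot>\<^sub>Aid (c *s m) = c *s (s \<odot>\<^sub>Aid m)"
 using mhom_smult[OF AE.twisted_lin'[OF AE.id_algebra_hom, of s], of c m] by simp

text \<open>L(v1).v2 is the counit, so along \<open>kappa\<close> the algebra H acts on the unit
  through \<epsilon>. This gives the map from Ae \<otimes>_H k to the cleft object.\<close>

lemma Aid_kappa:
 assumes h: "h <: H"
 shows "kappa h \<odot>\<^sub>Aid oneH = eps h *s oneH"
proof -
 obtain v where v: "v <: H" "h = S v" using S_surj h by metis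
 have "kappa h \<odot>\<^sub>Aid oneH = sw H v (%a b. pt (L a) b \<odot>\<^sub>Aid oneH)"
  unfolding v(2) kappa_S[OF v(1)] using v by (intro sw_comp[OF HT_module H_module Aid_lin]) auto
 also have "... = sw H v (%a b. amul (L a) b)" using v by (intro sw_cong) (auto simp: Aid_pure amul_one)
 finally show ?thesis using v by (simp add: L_left)
qed

text \<open>In coordinates the action on the unit is \<open>can\<close> followed by \<epsilon> on
  the second factor. Hence an element annihilates the unit exactly when its coordinates over H lie
  in the kernel of \<epsilon>, which is the injectivity of the map from Ae \<otimes>_H k.\<close>

lemma Aid_coordinate:
 assumes db: "dual_basis K H E (%e. e) \<phi>" and e: "e \<in> E" and s: "s <: HT"
 shows "\<phi> e (s \<odot>\<^sub>Aid oneH) = eps (tensor_lift K H (%v w. \<phi> e v *s w) (can s))"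
proof -
 let ?co = "tensor_lift K H (%v w. \<phi> e v *s w)"
 note cf = coordinate_facts[OF H_tensor db e] and \<phi> = dual_basis_hom[OF db e]
 have \<phi>c: "\<phi> e x <: K" if "x <: H" for x using dual_basis_coord[OF db e that] .
 show ?thesis
 proof (rule HH.t.tensor_ext[OF mhom_comp[OF Aid_lin \<phi>] mhom_comp[OF can_lin mhom_comp[OF cf(1) eps_lin]] _ s])
  fix x y assume x: "x <: H" and y: "y <: H"
  note l = mhom_comp[OF cf(1) eps_lin]
  have l2: "(%c. \<phi> e (amul x c)) \<in> lin KK"
   by (rule mhom_comp[OF bilinear_right[OF amul_bil x] \<phi>])
  have "eps (?co (can (pt x y))) = sw KK y (%c d. eps (?co (pt (amul x c) (S d))))"
   using x y by (simp add: can_pure) (intro sw_comp[OF HT_module KK_module l]; simp)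
  also have "... = sw KK y (%c d. eps d \<odot>\<^sub>KK \<phi> e (amul x c))"
   using x y by (intro sw_cong) (auto simp: cf(2) mhom_smult[OF eps_lin] \<phi>c K.m_comm)
  also have "... = \<phi> e (amul x y)" by (rule counitR[OF KK_module y l2])
  finally show "\<phi> e (pt x y \<odot>\<^sub>Aid oneH) = eps (?co (can (pt x y)))"
   using x y by (simp add: Aid_pure amul_one)
 qed simp
qed

end

section \<open>Base change to the enveloping algebra of the cleft object\<close>

context hopf_cocycle
begin

lemma Ae_coordinate:
 assumes db: "dual_basis K H E (%e. e) \<phi>" and e: "e \<in> E"
 defines "\<gamma> \<equiv> %s. tensor_lift K H (%v w. \<phi> e v *s w) (can s)"
 shows "additive Ae H \<gamma>" "s <: HT ==> \<gamma> s <: H"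
  "s <: HT ==> h <: H ==> \<gamma> (s \<otimes>\<^sub>Ae kappa h) = \<gamma> s ** h"
proof -
 have ch: "\<gamma> \<in> mhom (opp H) (restr kappa (reg (opp Ae))) (reg (opp H))"
  unfolding \<gamma>_def by (rule dual_basis_hom[OF Ae_dual_basis[OF db] e])
 show "additive Ae H \<gamma>" using mhom_additive[OF ch] by (simp add: additive_def)
 show "s <: HT ==> \<gamma> s <: H" using mhom_closed[OF ch, of s] by simp
 show "s <: HT ==> h <: H ==> \<gamma> (s \<otimes>\<^sub>Ae kappa h) = \<gamma> s ** h"
  using mhom_smult[OF ch, of h s] by simp
qed

lemma Aid_combination_kappa:
 assumes q: "!!i. i \<in> I ==> q i <: H" and m: "!!i. i \<in> I ==> m i <: K"
 shows "lcomb Aid I (%i. kappa (q i)) (%i. m i *s oneH) = lcomb triv I q m *s oneH"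
proof -
 have "additive K H (%c. c *s oneH)" by (rule additiveI) (auto simp: smult_l_distr)
 from additive_finsum[OF K.is_abelian_group is_abelian_group this, of "%i. eps (q i) \<otimes> m i" I]
 have "lcomb triv I q m *s oneH = (\<Oplus>\<^sub>H i\<in>I. (eps (q i) \<otimes> m i) *s oneH)"
  using q m by (simp add: lcomb_def Pi_def)
 also have "... = lcomb Aid I (%i. kappa (q i)) (%i. m i *s oneH)"
  unfolding lcomb_def Aid_simps
 proof (rule finsum_eqI)
  fix i assume i: "i \<in> I"
  have "kappa (q i) \<odot>\<^sub>Aid (m i *s oneH) = (m i \<otimes> eps (q i)) *s oneH"
   using q[OF i] m[OF i] by (simp add: Aid_smult Aid_kappa smult_assoc1)
  then show "(eps (q i) \<otimes> m i) *s oneH = kappa (q i) \<odot>\<^sub>Aid (m i *s oneH)"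
   "kappa (q i) \<odot>\<^sub>Aid (m i *s oneH) <: H"
   using q[OF i] m[OF i] by (simp_all add: K.m_comm)
 qed
 finally show ?thesis by simp
qed

lemma Aid_combination_coordinate:
 assumes db: "dual_basis K H E (%e. e) \<phi>" and e: "e \<in> E"
  and q: "!!i. i \<in> I ==> q i <: HT" and m: "!!i. i \<in> I ==> m i <: K"
 shows "\<phi> e (lcomb Aid I q (%i. m i *s oneH)) =
  lcomb triv I (%i. tensor_lift K H (%v w. \<phi> e v *s w) (can (q i))) m"
proof -
 let ?co = "%s. tensor_lift K H (%v w. \<phi> e v *s w) (can s)"
 note \<phi> = dual_basis_hom[OF db e] and coc = Ae_coordinate(2)[OF db e]
 have ac: "s \<odot>\<^sub>Aid oneH <: H" if "s <: HT" for s
  using mhom_closed[OF Aid_lin that] by simp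
 have "\<phi> e (lcomb Aid I q (%i. m i *s oneH)) = (\<Oplus>\<^sub>KK i\<in>I. \<phi> e (q i \<odot>\<^sub>Aid (m i *s oneH)))"
  unfolding lcomb_def Aid_simps using q m ac
  by (intro additive_finsum[OF is_abelian_group module.axioms(2)[OF KK_module] mhom_additive[OF \<phi>]])
   (auto simp: Aid_smult)
 also have "... = (\<Oplus>i\<in>I. \<phi> e (q i \<odot>\<^sub>Aid (m i *s oneH)))" by simp
 also have "... = lcomb triv I (%i. ?co (q i)) m"
  unfolding lcomb_def character_simps
 proof (rule K.finsum_eqI)
  fix i assume i: "i \<in> I"
  show "\<phi> e (q i \<odot>\<^sub>Aid (m i *s oneH)) = eps (?co (q i)) \<otimes> m i"
   using q[OF i] m[OF i] ac coc
   by (simp add: Aid_smult mhom_smult[OF \<phi>] Aid_coordinate[OF db e] K.m_comm)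
  show "eps (?co (q i)) \<otimes> m i <: K" using q[OF i] m[OF i] coc by simp
 qed
 finally show ?thesis .
qed

text \<open>Above degree 0, exactness is base change along the dual basis of \<open>Ae\<close> over
  H. At the augmentation the target is no module of rows, and \<open>flat_lift\<close> is applied to
  coordinates directly.\<close>

lemma A_mres:
 assumes res: "mres H triv I e D m"
 shows "mres Ae Aid I (%n i j. kappa (e n i j)) (%n i j. kappa (D n i j)) (%j. m j *s oneH)"
proof -
 interpret M: lmodule Ae Aid by (rule Aid_lmodule)
 interpret Ht: lmodule H triv by (rule triv_lmodule)
 note r = mresD[OF res]
 note c = mcomplexD[OF r(1)]
 note eM = MatD(1)[OF c(2)] and DM = MatD(1)[OF c(3)]
 have mc: "m j <: K" if "j \<in> I 0" for j using r(2)[OF that] by simp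
 obtain E \<phi> where db: "dual_basis K H E (%e. e) \<phi>"
  using vector_space_dual_basis[OF K.field_axioms H_module] by metis
 show ?thesis
  unfolding mres_def
 proof (intro conjI ballI allI impI)
  show "mcomplex Ae I (%n i j. kappa (e n i j)) (%n i j. kappa (D n i j))"
   by (rule mcomplex_map[OF ring_axioms Ae_ring kappa_ring_hom r(1)])
  show "m j *s oneH <: Aid" if "j \<in> I 0" for j using mc[OF that] by simp
  show "lcomb Aid (I 0) (%k. kappa (e 0 j k)) (%j. m j *s oneH) = m j *s oneH" if "j \<in> I 0" for j
   using Aid_combination_kappa[of "I 0" "e 0 j" m] eM mc r(3)[OF that] by simp
  show "lcomb Aid (I 0) (%k. kappa (D 0 j k)) (%j. m j *s oneH) = \<zero>\<^sub>Aid" if "j \<in> I (Suc 0)" for j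
   using Aid_combination_kappa[of "I 0" "D 0 j" m] DM mc r(4)[OF that] by simp
  show "row_exact Ae I (%n i j. kappa (e n i j)) (%n i j. kappa (D n i j)) i" for i
   using exact_at_base_change'[OF ring_axioms Ae_ring kappa_ring_hom Ae_dual_basis[OF db] r(1)] r(7)[of i]
   by (simp add: row_exact_iff)
 next
  fix a assume "a <: Aid"
  then have a: "a <: H" by simp
  \<comment> \<open>A row over H that hits 1 in the trivial module hits the unit after
    \<open>kappa\<close>; multiplication by a \<otimes> 1 then reaches a.\<close>
  obtain q where q: "q \<in> Vec H (I 0)" "\<one> = lcomb triv (I 0) q m" using r(5)[of \<one>] by auto
  have kq: "(%i. kappa (q i)) \<in> Vec Ae (I 0)" by (rule ring_hom_Vec[OF ring_axioms Ae_ring kappa_ring_hom c(1) q(1)])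
  note ch = M.lcomb_hom[of "I 0" "%j. m j *s oneH"]
  interpret F: lmodule Ae "free_module Ae (I 0)" by (rule lmodule_free[OF Ae_ring])
  let ?q = "pt a oneH \<odot>\<^sub>(free_module Ae (I 0)) (%i. kappa (q i))"
  have "lcomb Aid (I 0) ?q (%j. m j *s oneH) = pt a oneH \<odot>\<^sub>Aid (\<one> *s oneH)"
   using a kq mc Aid_combination_kappa[of "I 0" q m] q(2) VecD(1)[OF q(1)]
   by (subst mhom_smult[OF ch]) simp_all
  also have "... = a" using a by (simp add: Aid_pure amul_one)
  finally have "a = lcomb Aid (I 0) ?q (%j. m j *s oneH)" by simp
  moreover have "?q \<in> Vec Ae (I 0)" using a kq by (intro F.lsmult_closed) simp_all
  ultimately show "\<exists>q\<in>Vec Ae (I 0). a = lcomb Aid (I 0) q (%j. m j *s oneH)" by blast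
 next
  fix q assume q: "q \<in> Vec Ae (I 0)" "vec_mat Ae (I 0) q (%i j. kappa (e 0 i j)) = q"
   "lcomb Aid (I 0) q (%j. m j *s oneH) = \<zero>\<^sub>Aid"
  note qc = VecD(1)[OF q(1), simplified]
  let ?co = "%e s. tensor_lift K H (%v w. \<phi> e v *s w) (can s)"
  note db' = Ae_dual_basis[OF db]
  have lm: "lmodule (opp H) (restr kappa (reg (opp Ae)))"
   by (intro lmodule_restrict[OF lmodule_regular] Ae_ring ring_opposite ring_axioms ring_hom_opposite kappa_ring_hom)
  \<comment> \<open>Each coordinate row of q is fixed by the idempotent and has augmentation zero by
    \<open>Aid_combination_coordinate\<close>, so it is a boundary over H.\<close>
  show "\<exists>p\<in>Vec Ae (I (Suc 0)). q = vec_mat Ae (I (Suc 0)) p (%i j. kappa (D 0 i j))"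
  proof (rule flat_lift[OF ring_axioms Ae_ring kappa_ring_hom, where B = E and b = "%b. pt b oneH" and c = ?co,
     OF _ _ _ c(1) c(1) q(1) c(3)])
   show "pt b oneH <: Ae" if "b \<in> E" for b using dual_basis_closed[OF db that] by simp
   show "s = (\<Oplus>\<^sub>Ae i\<in>U. pt i oneH \<otimes>\<^sub>Ae kappa (?co i s))"
    if "s <: Ae" "finite U" "U \<subseteq> E" "{i\<in>E. ?co i s \<noteq> \<zero>\<^sub>H} \<subseteq> U" for s U
    using dual_basis_sum[OF lm db', of s U] that by simp
   show "finite {i\<in>E. ?co i s \<noteq> \<zero>\<^sub>H}" if "s <: Ae" for s using dual_basis_finite[OF db', of s] that by simp
  next
   fix b assume b: "b \<in> E"
   note co = Ae_coordinate[OF db b]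
   have c0: "?co b \<zero>\<^sub>HT = \<zero>\<^sub>H"
    using additive_zero[OF ring.is_abelian_group[OF Ae_ring] is_abelian_group co(1)] by simp
   have V: "(%j. ?co b (q j)) \<in> Vec H (I 0)"
    using VecD(2)[OF q(1)] by (intro VecI[OF c(1)]) (simp_all add: co(2) qc c0)
   have row: "vec_mat H (I 0) (%j. ?co b (q j)) (e 0) = (%j. ?co b (q j))"
   proof
    fix l
    have "?co b (q l) = ?co b (vec_mat Ae (I 0) q (%i j. kappa (e 0 i j)) l)" by (simp only: q(2))
    also have "... = (\<Oplus>\<^sub>H k\<in>I 0. ?co b (q k \<otimes>\<^sub>Ae kappa (e 0 k l)))"
     unfolding vec_mat_def using qc eM
     by (intro additive_finsum[OF ring.is_abelian_group[OF Ae_ring] is_abelian_group co(1)]) simp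
    also have "... = vec_mat H (I 0) (%j. ?co b (q j)) (e 0) l"
     unfolding vec_mat_def using qc eM co(2,3) by (intro finsum_eqI) simp_all
    finally show "vec_mat H (I 0) (%j. ?co b (q j)) (e 0) l = ?co b (q l)" by simp
   qed
   have "lcomb triv (I 0) (%j. ?co b (q j)) m = \<phi> b \<zero>\<^sub>H"
    using Aid_combination_coordinate[OF db b, of "I 0" q m] qc mc q(3) by simp
   then have "lcomb triv (I 0) (%j. ?co b (q j)) m = \<zero>\<^sub>triv"
    using additive_zero[OF is_abelian_group module.axioms(2)[OF KK_module] mhom_additive[OF dual_basis_hom[OF db b]]] by simp
   from r(6)[OF V row this]
   show "\<exists>p\<in>Vec H (I (Suc 0)). (%j. ?co b (q j)) = vec_mat H (I (Suc 0)) p (D 0)" .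
  qed
 qed
qed

text \<open>The dual complex lives over the opposite rings, so here the dual basis of
  \<open>Ae\<close> as a left H-module, the one from \<open>dcan\<close>, is the relevant
  one.\<close>

lemma A_coexact:
 assumes cx: "mcomplex H I e D" and bd: "!!n. N < n ==> I n = {}" and ex: "coexact_at H I e D n"
 shows "coexact_at Ae I (%n i j. kappa (e n i j)) (%n i j. kappa (D n i j)) n"
proof -
 obtain E \<phi> where db: "dual_basis K H E (%e. e) \<phi>"
  using vector_space_dual_basis[OF K.field_axioms H_module] by metis
 define M where "M = max N n"
 have M: "n \<le> M" "I (Suc M) = {}" using bd by (auto simp: M_def)
 have "exact_at (opp H) (rev_I M I) (rev_e H M e) (rev_D H M D) (M - n)"
  using exact_at_rev[OF ring_axioms cx M] ex by simp
 moreover have "dual_basis (opp (opp H))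
  (restr kappa (reg (opp (opp Ae)))) E (%b. pt oneH b)
  (%e s. tensor_lift K H (%v w. \<phi> e v *s w) (dcan s))"
  unfolding opposite_simps by (rule Ae_dual_basis'[OF db])
 ultimately have "exact_at (opp Ae) (rev_I M I) (%n i j. kappa (rev_e H M e n i j)) (%n i j. kappa (rev_D H M D n i j)) (M - n)"
  by (intro exact_at_base_change'[OF ring_opposite[OF ring_axioms] ring_opposite[OF Ae_ring]
    ring_hom_opposite[OF kappa_ring_hom] _ mcomplex_rev[OF ring_axioms cx]])
 then show ?thesis
  unfolding transposed_map[where h = kappa, OF ring_hom_null[OF ring_axioms Ae_ring kappa_ring_hom]]
  using exact_at_rev[OF Ae_ring mcomplex_map[OF ring_axioms Ae_ring kappa_ring_hom cx] M] by simp
qed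

text \<open>With this index type the rows over \<open>Ae\<close> belong to the very type on which
  \<open>homologically_smooth\<close> asks for a resolution.\<close>

lemma A_smooth:
 assumes res: "mres H triv (I :: nat => ((('a, 'c, 'c) tensor \<times> 'c) list) set) e D m"
  and bd: "!!n. N < n ==> I n = {}"
 shows "homologically_smooth K A"
proof -
 interpret M: lmodule Ae Aid by (rule Aid_lmodule)
 let ?e = "%n i j. kappa (e n i j)"
 let ?P = "%n. row_module Ae (I n) (?e n)"
 note r = A_mres[OF res]
 note c = mcomplexD[OF mresD(1)[OF r]]
 have "{} \<noteq> (UNIV :: ('a, 'c, 'c) tensor)" by simp
 from M.mres_projective_resolution[OF r this]
 have 1: "\<exists>\<delta> \<epsilon>. projective_resolution Ae Aid ?P \<delta> \<epsilon>" by blast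
 have 2: "finitely_generated_module Ae (?P n)" for n
  by (rule ring.row_module_fg[OF Ae_ring c(1,2,4)])
 have 3: "carrier (?P n) = {\<zero>\<^sub>(?P n)}" if "N < n" for n
 proof -
  interpret P: lmodule Ae "?P n" by (rule ring.lmodule_row[OF Ae_ring c(1,2)])
  have "q = \<zero>\<^sub>(?P n)" if "q <: (?P n)" for q
  proof
   fix i
   have "q \<in> Vec Ae (I n)" using that unfolding row_module_simps(1) by blast
   from VecD(2)[OF this, of i] show "q i = \<zero>\<^sub>(?P n) i" using bd[OF \<open>N < n\<close>] unfolding row_module_simps(3) by blast
  qed
  then show ?thesis using P.M.zero_closed by blast
 qed
 from 1 obtain \<delta> \<epsilon> where "projective_resolution Ae Aid ?P \<delta> \<epsilon>" by blast
 moreover have "\<exists>k. \<forall>n\<ge>k. carrier (?P n) = {\<zero>\<^sub>(?P n)}" using 3 by (intro exI[of _ "Suc N"]) auto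
 ultimately show ?thesis unfolding homologically_smooth_def using 2 by blast
qed

lemma Ext_enveloping_trivial:
 assumes res: "mres Ae Aid (I :: nat => 'x set) e D m" and ex: "coexact_at Ae I e D n"
  and sm: "homologically_smooth K A"
 shows "carrier (Ext_enveloping K A n) = {\<zero>\<^sub>(Ext_enveloping K A n)}"
proof -
 let ?E = "Ext_regular Ae Aid n"
 have ne: "{} \<noteq> (UNIV :: ('a, 'c, 'c) tensor)" by simp
 obtain \<Theta> where "presents Ae ?E (I n) (mat_cocycles Ae I e D n) (mat_coboundary Ae I D n) \<Theta>"
  using Ext_mres[OF Aid_lmodule res ne] sm unfolding homologically_smooth_def by blast
 note p = presentsD[OF this]
 have "carrier ?E \<subseteq> {\<zero>\<^sub>?E}" unfolding p(2) using ex p(5) by (auto simp: coexact_at_def)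
 then have "carrier ?E = {\<zero>\<^sub>?E}" using abelian_groupE(2)[OF p(1)] by blast
 then show ?thesis by (simp add: Ext_enveloping_def Let_def)
qed

end

section \<open>Cocycles under ring homomorphisms and under coordinates\<close>

lemma mat_vec_map:
 assumes R: "ring R" and S: "ring S" and h: "h \<in> ring_hom R S" and A: "A \<in> Mat R I J"
  and c: "!!j. j \<in> J ==> c j <: R" and s: "s <: S"
 shows "mat_vec S J (%i j. h (A i j)) (%j. h (c j) \<otimes>\<^sub>S s) i = h (mat_vec R J A c i) \<otimes>\<^sub>S s"
proof -
 interpret S: ring S by (rule S)
 have "mat_vec S J (%i j. h (A i j)) (%j. h (c j) \<otimes>\<^sub>S s) i = dot S J (%j. h (A i j)) (%j. h (c j)) \<otimes>\<^sub>S s"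
  unfolding mat_vec_def using ring_hom_closed[OF h] MatD(1)[OF A] c s
  by (subst S.dot_mult_right[symmetric]) (auto simp: dot_def)
 also have "dot S J (%j. h (A i j)) (%j. h (c j)) = h (mat_vec R J A c i)"
  using ring_hom_dot[OF R S h, of J "A i" c] MatD(1)[OF A] c by (simp add: mat_vec_def dot_def)
 finally show ?thesis .
qed

text \<open>Matrices act from the left, so a factor s on the right passes through them. In
  \<open>Ext_top\<close> every class of the top Ext turns out to be of this form.\<close>

lemma mat_cocycles_map:
 assumes R: "ring R" and S: "ring S" and h: "h \<in> ring_hom R S" and cx: "mcomplex R I e D"
  and s: "s <: S"
 shows "c \<in> mat_cocycles R I e D n ==>
   (%i. h (c i) \<otimes>\<^sub>S s) \<in> mat_cocycles S I (%n i j. h (e n i j)) (%n i j. h (D n i j)) n"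
  and "mat_coboundary R I D n c ==> mat_coboundary S I (%n i j. h (D n i j)) n (%i. h (c i) \<otimes>\<^sub>S s)"
proof -
 interpret S: ring S by (rule S)
 note x = mcomplexD[OF cx] and h0 = ring_hom_null[OF R S h]
 have V: "(%i. h (c i) \<otimes>\<^sub>S s) \<in> Vec S (I k)" if "c \<in> Vec R (I k)" for c k
  using ring_hom_closed[OF h] VecD[OF that] s by (intro VecI[OF x(1)]) (simp_all add: h0)
 note mv = mat_vec_map[OF R S h _ _ s]
 show "(%i. h (c i) \<otimes>\<^sub>S s) \<in> mat_cocycles S I (%n i j. h (e n i j)) (%n i j. h (D n i j)) n"
  if c: "c \<in> mat_cocycles R I e D n"
 proof -
  have c': "c \<in> Vec R (I n)" "mat_vec R (I n) (e n) c = c" "mat_vec R (I n) (D n) c = (%_. \<zero>\<^sub>R)"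
   using c by (auto simp: mat_cocycles_def)
  have "mat_vec S (I n) (%i j. h (e n i j)) (%i. h (c i) \<otimes>\<^sub>S s) = (%i. h (c i) \<otimes>\<^sub>S s)"
   "mat_vec S (I n) (%i j. h (D n i j)) (%i. h (c i) \<otimes>\<^sub>S s) = (%_. \<zero>\<^sub>S)"
   using mv[OF x(2), of n c] mv[OF x(3), of n c] VecD(1)[OF c'(1)] s
   by (intro ext; simp add: c'(2,3) h0)+
  then show ?thesis using V[OF c'(1)] by (simp add: mat_cocycles_def)
 qed
 show "mat_coboundary S I (%n i j. h (D n i j)) n (%i. h (c i) \<otimes>\<^sub>S s)" if c: "mat_coboundary R I D n c"
 proof (cases n)
  case 0
  then show ?thesis using c s by (simp add: mat_coboundary_def h0)
 next
  case (Suc k)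
  then obtain b where b: "b \<in> Vec R (I k)" "c = mat_vec R (I k) (D k) b" using c by (auto simp: mat_coboundary_def)
  have "(%i. h (c i) \<otimes>\<^sub>S s) = mat_vec S (I k) (%i j. h (D k i j)) (%i. h (b i) \<otimes>\<^sub>S s)"
   using mv[OF x(3), of k b] VecD(1)[OF b(1)] by (intro ext) (simp add: b(2))
  then show ?thesis using V[OF b(1)] Suc by (auto simp: mat_coboundary_def)
 qed
qed

lemma mat_cocycles_plus:
 assumes R: "ring R" and cx: "mcomplex R I e D"
  and c: "c \<in> mat_cocycles R I e D n" "c' \<in> mat_cocycles R I e D n"
 shows "(%i. c i \<oplus>\<^sub>R c' i) \<in> mat_cocycles R I e D n"
proof -
 interpret ring R by (rule R)
 note x = mcomplexD[OF cx]
 have c': "c \<in> Vec R (I n)" "mat_vec R (I n) (e n) c = c" "mat_vec R (I n) (D n) c = (%_. \<zero>\<^sub>R)"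
   "c' \<in> Vec R (I n)" "mat_vec R (I n) (e n) c' = c'" "mat_vec R (I n) (D n) c' = (%_. \<zero>\<^sub>R)"
  using c by (auto simp: mat_cocycles_def)
 note cc = VecD(1)[OF c'(1)] VecD(1)[OF c'(4)]
 have p: "mat_vec R (I n) A (%i. c i \<oplus>\<^sub>R c' i) = (%i. mat_vec R (I n) A c i \<oplus>\<^sub>R mat_vec R (I n) A c' i)"
  if "A \<in> Mat R J (I n)" for A J
  using MatD(1)[OF that] cc by (intro ext) (simp add: mat_vec_dot dot_plus_right)
 have "(%i. c i \<oplus>\<^sub>R c' i) \<in> Vec R (I n)"
  using VecD(2)[OF c'(1)] VecD(2)[OF c'(4)] cc by (intro VecI[OF x(1)]) simp_all
 then show ?thesis
  using p[OF x(2)] p[OF x(3)] c'(2,3,5,6) by (simp add: mat_cocycles_def)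
qed

lemma mat_cocycles_mult:
 assumes R: "ring R" and cx: "mcomplex R I e D" and c: "c \<in> mat_cocycles R I e D n" and a: "a <: R"
 shows "(%i. c i \<otimes>\<^sub>R a) \<in> mat_cocycles R I e D n"
proof -
 have "(%x. x) \<in> ring_hom R R" by (auto simp: ring_hom_def)
 from mat_cocycles_map(1)[OF R R this cx a c] show ?thesis .
qed

text \<open>\<open>g\<close> is linear for left multiplication by R along \<open>h\<close>, so it
  commutes with matrices coming from R.\<close>

lemma mat_cocycles_coordinate:
 assumes R: "ring R" and S: "ring S" and h: "h \<in> ring_hom R S" and cx: "mcomplex R I e D"
  and g: "additive S R g" and gh: "!!r s. r <: R ==> s <: S ==> g (h r \<otimes>\<^sub>S s) = r \<otimes>\<^sub>R g s"
 shows "c \<in> mat_cocycles S I (%n i j. h (e n i j)) (%n i j. h (D n i j)) n ==>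
   (%i. g (c i)) \<in> mat_cocycles R I e D n"
  and "mat_coboundary S I (%n i j. h (D n i j)) n c ==> mat_coboundary R I D n (%i. g (c i))"
proof -
 interpret R: ring R by (rule R)
 interpret S: ring S by (rule S)
 note x = mcomplexD[OF cx]
 have g0: "g \<zero>\<^sub>S = \<zero>\<^sub>R" by (rule additive_zero[OF S.is_abelian_group R.is_abelian_group g])
 have V: "(%i. g (c i)) \<in> Vec R (I k)" if "c \<in> Vec S (I k)" for c k
  using additive_closed[OF g] VecD[OF that] by (intro VecI[OF x(1)]) (simp_all add: g0)
 have mv: "g (mat_vec S J (%i j. h (A i j)) c i) = mat_vec R J A (%i. g (c i)) i"
  if A: "A \<in> Mat R I' J" and c: "!!j. c j <: S" for A I' J c i
 proof -
  have "g (mat_vec S J (%i j. h (A i j)) c i) = (\<Oplus>\<^sub>R j\<in>J. g (h (A i j) \<otimes>\<^sub>S c j))"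
   unfolding mat_vec_def using MatD(1)[OF A] ring_hom_closed[OF h] c
   by (intro additive_finsum[OF S.is_abelian_group R.is_abelian_group g]) auto
  also have "... = mat_vec R J A (%i. g (c i)) i"
   unfolding mat_vec_def using MatD(1)[OF A] additive_closed[OF g] c gh by (intro R.finsum_eqI) auto
  finally show ?thesis .
 qed
 show "(%i. g (c i)) \<in> mat_cocycles R I e D n"
  if c: "c \<in> mat_cocycles S I (%n i j. h (e n i j)) (%n i j. h (D n i j)) n"
 proof -
  have c': "c \<in> Vec S (I n)" "mat_vec S (I n) (%i j. h (e n i j)) c = c"
   "mat_vec S (I n) (%i j. h (D n i j)) c = (%_. \<zero>\<^sub>S)"
   using c by (auto simp: mat_cocycles_def)
  have "mat_vec R (I n) (e n) (%i. g (c i)) = (%i. g (c i))"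
   "mat_vec R (I n) (D n) (%i. g (c i)) = (%_. \<zero>\<^sub>R)"
   unfolding fun_eq_iff mv[OF x(2) VecD(1)[OF c'(1)], symmetric] mv[OF x(3) VecD(1)[OF c'(1)], symmetric] c'(2,3) g0
   by (rule allI, rule refl)+
  then show ?thesis using V[OF c'(1)] by (simp add: mat_cocycles_def)
 qed
 show "mat_coboundary R I D n (%i. g (c i))" if c: "mat_coboundary S I (%n i j. h (D n i j)) n c"
 proof (cases n)
  case 0
  then show ?thesis using c by (simp add: mat_coboundary_def g0)
 next
  case (Suc k)
  then obtain b where b: "b \<in> Vec S (I k)" "c = mat_vec S (I k) (%i j. h (D k i j)) b" using c by (auto simp: mat_coboundary_def)
  have "(%i. g (c i)) = mat_vec R (I k) (D k) (%i. g (b i))"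
   unfolding b(2) mv[OF x(3) VecD(1)[OF b(1)]] ..
  then show ?thesis using V[OF b(1)] Suc by (auto simp: mat_coboundary_def)
 qed
qed

section \<open>The top Ext group as a bimodule over the cleft object\<close>

context hopf_cocycle
begin

lemma Ext_top:
 fixes I :: "nat => 'x set"
 assumes \<xi>: "\<xi> \<in> algebra_hom K H KK" and res: "mres H triv I e D m" and sm: "homologically_smooth K A"
  and l: "!!c c'. c \<in> mat_cocycles H I e D d ==> c' \<in> mat_cocycles H I e D d ==>
    l (%i. c i \<oplus>\<^sub>H c' i) = l c \<oplus> l c'"
   "!!c. c \<in> mat_cocycles H I e D d ==> l c <: K"
   "!!c h. c \<in> mat_cocycles H I e D d ==> h <: H ==> l (%i. c i ** S h) = \<xi> h \<otimes> l c"
   "!!c. c \<in> mat_cocycles H I e D d ==> l c = \<zero> \<longleftrightarrow> mat_coboundary H I D d c"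
  and z: "z \<in> mat_cocycles H I e D d" "l z = \<one>"
 shows "module_isomorphic Ae (Ext_enveloping K A d) (twisted_bimodule K A (nakayama \<xi>))"
proof -
 let ?Z = "mat_cocycles H I e D d" and ?e = "%n i j. kappa (e n i j)" and ?D = "%n i j. kappa (D n i j)"
 let ?E = "Ext_regular Ae Aid d" and ?ZA = "mat_cocycles Ae I ?e ?D d" and ?\<mu> = "nakayama \<xi>"
 have cx: "mcomplex H I e D" by (rule mresD(1)[OF res])
 have fin: "finite (I d)" by (rule mcomplexD(1)[OF cx])
 note map = mat_cocycles_map[OF ring_axioms Ae_ring kappa_ring_hom cx]
 note \<xi>f = \<xi>_closed[OF \<xi>] \<xi>_one[OF \<xi>] character_S2[OF \<xi>] mhom_smult[OF \<xi>_lin[OF \<xi>]]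
 have ne: "{} \<noteq> (UNIV :: ('a, 'c, 'c) tensor)" by simp
 obtain \<Theta> where "presents Ae ?E (I d) ?ZA (mat_coboundary Ae I ?D d) \<Theta>"
  using Ext_mres[OF Aid_lmodule A_mres[OF res] ne] sm unfolding homologically_smooth_def by blast
 note p = presentsD[OF this]
 interpret E: abelian_group ?E by (rule p(1))
 have \<Theta>c: "\<Theta> c <: ?E" if "c \<in> ?ZA" for c unfolding p(2) using that by (rule imageI)
 have Zc: "c i <: H" if "c \<in> ?Z" for c i
  using that VecD(1)[of c H "I d" i] by (simp add: mat_cocycles_def)
 \<comment> \<open>The integral equation concerns S w. Every h is some S w, and \<xi>(w) = \<xi>(S
   (S w)) = \<xi>(S h).\<close>
 have lz: "l (%i. z i ** h) = \<xi> (S h)" if h: "h <: H" for h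
 proof -
  obtain w where w: "w <: H" "h = S w" using S_surj h by metis
  then show ?thesis using l(3)[OF z(1) w(1)] z(2) by (simp add: \<xi>f)
 qed
 have Sc: "S (c *s oneH) = c *s oneH" if "c <: K" for c
  using mhom_smult[OF antipode_linear that, of "oneH"] by simp
 \<comment> \<open>c and z l(c) have the same value under l, so they differ by a coboundary; this
   persists after \<open>kappa\<close> and multiplication by s.\<close>
 have key: "\<Theta> (%i. kappa (c i) \<otimes>\<^sub>Ae s) = \<Theta> (%i. kappa (z i) \<otimes>\<^sub>Ae (l c \<odot>\<^sub>HT s))"
  if c: "c \<in> ?Z" and s: "s <: HT" for c s
 proof -
  define a where "a = \<ominus> (l c)"
  have lc: "l c <: K" and a: "a <: K" using l(2)[OF c] by (auto simp: a_def)
  have a1: "a *s oneH <: H" using a by simp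
  note za = mat_cocycles_mult[OF ring_axioms cx z(1) a1]
  define u where "u = (%i. c i \<oplus>\<^sub>H z i ** (a *s oneH))"
  have u: "u \<in> ?Z" unfolding u_def by (rule mat_cocycles_plus[OF ring_axioms cx c za])
  have "l u = l c \<oplus> a"
   unfolding u_def l(1)[OF c za] lz[OF a1] using a by (simp add: Sc \<xi>f)
  then have "l u = \<zero>" using lc by (simp add: a_def K.r_neg)
  then have cb: "mat_coboundary Ae I ?D d (%i. kappa (u i) \<otimes>\<^sub>Ae s)"
   using l(4)[OF u] map(2)[of s] s by simp
  have us: "(%i. kappa (u i) \<otimes>\<^sub>Ae s) \<in> ?ZA" using map(1)[OF _ u] s by simp
  have zs: "(%i. kappa (z i) \<otimes>\<^sub>Ae (l c \<odot>\<^sub>HT s)) \<in> ?ZA" using map(1)[OF _ z(1)] s lc by simp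
  have "kappa (c i) \<otimes>\<^sub>Ae s = kappa (u i) \<otimes>\<^sub>Ae s \<oplus>\<^sub>Ae kappa (z i) \<otimes>\<^sub>Ae (l c \<odot>\<^sub>HT s)" for i
  proof -
   let ?X = "kappa (z i) \<otimes>\<^sub>Ae s" and ?Y = "kappa (c i) \<otimes>\<^sub>Ae s"
   have cl: "?X <: HT" "?Y <: HT" using Zc[OF z(1)] Zc[OF c] s by auto
   have "kappa (u i) = kappa (c i) \<oplus>\<^sub>HT a \<odot>\<^sub>HT kappa (z i)"
    using Zc[OF z(1)] Zc[OF c] a
    by (simp add: u_def mhom_add[OF kappa_lin] mhom_smult[OF kappa_lin] smult_mult_right)
   then have "kappa (u i) \<otimes>\<^sub>Ae s = ?Y \<oplus>\<^sub>HT a \<odot>\<^sub>HT ?X"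
    using Zc[OF z(1)] Zc[OF c] a s
    by (simp add: mhom_add[OF Ae_lin(1)] mhom_smult[OF Ae_lin(1)])
   moreover have "kappa (z i) \<otimes>\<^sub>Ae (l c \<odot>\<^sub>HT s) = l c \<odot>\<^sub>HT ?X"
    using Zc[OF z(1)] lc s by (simp add: mhom_smult[OF Ae_lin(2)])
   moreover have "a \<odot>\<^sub>HT ?X \<oplus>\<^sub>HT l c \<odot>\<^sub>HT ?X = \<zero>\<^sub>HT"
   proof -
    have "a \<odot>\<^sub>HT ?X \<oplus>\<^sub>HT l c \<odot>\<^sub>HT ?X = (a \<oplus> l c) \<odot>\<^sub>HT ?X"
     using a lc cl by (simp add: HH.t.T.smult_l_distr)
    also have "a \<oplus> l c = \<zero>" using lc by (simp add: a_def K.l_neg)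
    finally show ?thesis using lmodule.lsmult_zero_left[OF module.lmodule[OF HT_module] cl(1)] by simp
   qed
   ultimately show ?thesis using a lc cl by (simp add: abelian_monoid.a_assoc[OF abelian_group.axioms(1)[OF HH.t.T_group]])
  qed
  then have "\<Theta> (%i. kappa (c i) \<otimes>\<^sub>Ae s) =
   \<Theta> (%i. kappa (u i) \<otimes>\<^sub>Ae s) \<oplus>\<^sub>?E \<Theta> (%i. kappa (z i) \<otimes>\<^sub>Ae (l c \<odot>\<^sub>HT s))"
   using p(3)[OF us zs] by simp
  then show ?thesis using p(5)[OF us] cb \<Theta>c[OF zs] by simp
 qed
 define F where "F = (%s. \<Theta> (%i. kappa (z i) \<otimes>\<^sub>Ae s))"
 have zA: "(%i. kappa (z i) \<otimes>\<^sub>Ae s) \<in> ?ZA" if "s <: HT" for s using map(1)[OF _ z(1)] that by simp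
 have F: "additive HT ?E F"
 proof (rule additiveI)
  show "F s <: ?E" if "s <: HT" for s unfolding F_def by (rule \<Theta>c[OF zA[OF that]])
  show "F (s \<oplus>\<^sub>HT u) = F s \<oplus>\<^sub>?E F u" if "s <: HT" "u <: HT" for s u
   unfolding F_def p(3)[OF zA[OF that(1)] zA[OF that(2)], symmetric]
   using that Zc[OF z(1)] by (simp add: mhom_add[OF Ae_lin(2)])
 qed
 \<comment> \<open>kappa(z) kappa(h) = kappa(z h), and by \<open>key\<close> this may be replaced by
   kappa(z) times the scalar l(z h) = \<xi>(S h). These are the relations behind
   \<open>Psi\<close>.\<close>
 have F_kappa: "F (kappa h \<otimes>\<^sub>Ae s) = F (\<xi> (S h) \<odot>\<^sub>HT s)" if h: "h <: H" and s: "s <: HT" for h s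
 proof -
  have "F (kappa h \<otimes>\<^sub>Ae s) = \<Theta> (%i. kappa (z i ** h) \<otimes>\<^sub>Ae s)"
   unfolding F_def using h s Zc[OF z(1)] by (simp add: kappa_mult Ae_assoc)
  also have "... = F (l (%i. z i ** h) \<odot>\<^sub>HT s)"
   unfolding F_def by (rule key[OF mat_cocycles_mult[OF ring_axioms cx z(1) h] s])
  finally show ?thesis by (simp add: lz[OF h])
 qed
 note F_Psi = transport[OF \<xi> p(1) F _ F_kappa]
 define G where "G = (%y. F (pt oneH y))"
 have ptl: "(%y. pt oneH y) \<in> lin HT" by (rule bilinear_right[OF pt_bil]) simp
 have G: "additive H ?E G"
  unfolding G_def by (rule additive_comp[OF mhom_additive[OF ptl] F])
 note Gc = additive_closed[OF G]
 obtain B \<phi> where db: "dual_basis K H B (%e. e) \<phi>"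
  using vector_space_dual_basis[OF K.field_axioms H_module] by metis
 note db' = Ae_dual_basis'[OF db]
 define \<gamma> where "\<gamma> = (%b s. tensor_lift K H (%v w. \<phi> b v *s w) (dcan s))"
 have lm: "lmodule H (restr kappa (reg Ae))"
  by (intro lmodule_restrict[OF lmodule_regular] Ae_ring ring_axioms kappa_ring_hom)
 have \<gamma>h: "\<gamma> b \<in> mhom H (restr kappa (reg Ae)) (reg H)" if "b \<in> B" for b
  unfolding \<gamma>_def by (rule dual_basis_hom[OF db' that])
 have \<gamma>: "additive Ae H (\<gamma> b)" "!!r s. r <: H ==> s <: Ae ==> \<gamma> b (kappa r \<otimes>\<^sub>Ae s) = r ** \<gamma> b s"
  if "b \<in> B" for b
  using mhom_additive[OF \<gamma>h[OF that]] mhom_smult[OF \<gamma>h[OF that]] by (simp_all add: additive_def)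
 have coord: "(%i. \<gamma> b (c i)) \<in> ?Z" if "b \<in> B" "c \<in> ?ZA" for b c
  by (rule mat_cocycles_coordinate(1)[OF ring_axioms Ae_ring kappa_ring_hom cx \<gamma>[OF that(1)] that(2)])
 have coord': "mat_coboundary H I D d (%i. \<gamma> b (c i))" if "b \<in> B" "mat_coboundary Ae I ?D d c" for b c
  by (rule mat_cocycles_coordinate(2)[OF ring_axioms Ae_ring kappa_ring_hom cx \<gamma>[OF that(1)] that(2)])
 \<comment> \<open>The coordinates of kappa(z_i) (1 \<otimes> y) over H are z_i times those of y,
   since \<open>dcan\<close> undoes \<open>dcan_inv\<close>. If the class is zero, l forces every
   coordinate of y to vanish.\<close>
 have inj: "y = \<zero>\<^sub>H" if y: "y <: H" and G0: "G y = \<zero>\<^sub>?E" for y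
 proof -
  have y1: "pt oneH y <: HT" using y by simp
  have cby: "mat_coboundary Ae I ?D d (%i. kappa (z i) \<otimes>\<^sub>Ae pt oneH y)"
   using p(5)[OF zA[OF y1]] G0 by (simp add: G_def F_def)
  have cb: "mat_coboundary H I D d (%i. \<gamma> b (kappa (z i) \<otimes>\<^sub>Ae pt oneH y))" if "b \<in> B" for b
   by (rule coord'[OF that cby])
  have "\<phi> b y = \<zero>" if b: "b \<in> B" for b
  proof -
   have \<phi>c: "\<phi> b y <: K" by (rule dual_basis_coord[OF db b y])
   have "\<gamma> b (kappa (z i) \<otimes>\<^sub>Ae pt oneH y) = z i ** (\<phi> b y *s oneH)" for i
    using y Zc[OF z(1)] \<phi>c coordinate_facts(2)[OF H_tensor db b, of y "z i"] dcan_dcan_inv[of "pt y (z i)"]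
    by (simp add: \<gamma>_def dcan_inv_pure smult_mult_right)
   then have cb': "mat_coboundary H I D d (%i. z i ** (\<phi> b y *s oneH))" using cb[OF b] by simp
   have p1: "\<phi> b y *s oneH <: H" using \<phi>c by simp
   have "l (%i. z i ** (\<phi> b y *s oneH)) = \<zero>"
    using l(4)[OF mat_cocycles_mult[OF ring_axioms cx z(1) p1]] cb' by simp
   then show ?thesis using lz[OF p1] \<phi>c by (simp add: Sc \<xi>f)
  qed
  then have "finsum H (%b. \<phi> b y *s b) {} = y"
   by (intro dual_basis_sum[OF module.lmodule[OF H_module] db y]) auto
  then show ?thesis by simp
 qed
 \<comment> \<open>Over the left dual basis, c is a finite sum of cocycles kappa(c') (1 \<otimes> b)
   with c' a cocycle over H. By \<open>key\<close> each of them has the class of kappa(z) (1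
   \<otimes> b) up to the scalar l(c').\<close>
 have surj: "\<exists>y\<in>carrier H. \<Theta> c = G y" if c: "c \<in> ?ZA" for c
 proof -
  have cV: "c \<in> Vec Ae (I d)" using c by (simp add: mat_cocycles_def)
  note cc = VecD(1)[OF cV, simplified]
  define U where "U = (\<Union>i\<in>I d. {b\<in>B. \<gamma> b (c i) \<noteq> \<zero>\<^sub>H})"
  have U: "finite U" "U \<subseteq> B"
   using fin dual_basis_finite[OF db', folded \<gamma>_def] cc by (auto simp: U_def \<gamma>_def)
  define w where "w = (%b i. kappa (\<gamma> b (c i)) \<otimes>\<^sub>Ae pt oneH b)"
  have gZ: "(%i. \<gamma> b (c i)) \<in> ?Z" if "b \<in> B" for b by (rule coord[OF that c])
  have b1: "pt oneH b <: HT" "b <: H" if "b \<in> B" for b using dual_basis_closed[OF db that] by simp_all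
  have wc: "w b i <: HT" if "b \<in> B" for b i unfolding w_def using Zc[OF gZ[OF that]] b1[OF that] by simp
  have wZ: "w b \<in> ?ZA" if "b \<in> B" for b
   unfolding w_def using map(1)[OF _ gZ[OF that]] b1[OF that] by simp
  define \<eta> where "\<eta> = (%b. l (%i. \<gamma> b (c i)) *s b)"
  have lc: "\<eta> b <: H" if "b \<in> B" for b unfolding \<eta>_def using l(2)[OF gZ[OF that]] b1[OF that] by simp
  have w\<Theta>: "\<Theta> (w b) = G (\<eta> b)" if b: "b \<in> B" for b
  proof -
   have "\<Theta> (w b) = F (l (%i. \<gamma> b (c i)) \<odot>\<^sub>HT pt oneH b)"
    unfolding w_def F_def by (rule key[OF gZ[OF b] b1(1)[OF b]])
   then show ?thesis unfolding G_def \<eta>_def using l(2)[OF gZ[OF b]] b1[OF b] by (simp add: pt_smult)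
  qed
  \<comment> \<open>The cocycle property is part of the induction because \<Theta> is additive on
    cocycles only.\<close>
  have "(%i. \<Oplus>\<^sub>HT b\<in>V. w b i) \<in> ?ZA \<and> \<Theta> (%i. \<Oplus>\<^sub>HT b\<in>V. w b i) = G (\<Oplus>\<^sub>H b\<in>V. \<eta> b)" if "finite V" "V \<subseteq> B" for V
   using that
  proof (induction V rule: finite_induct)
   case empty
   have 0: "(%i. kappa (z i) \<otimes>\<^sub>Ae \<zero>\<^sub>HT) = (%i. \<zero>\<^sub>HT)"
    using Zc[OF z(1)] additive_zero[OF HH.t.T_group HH.t.T_group mhom_additive[OF Ae_lin(2)]] by simp
   have 1: "pt oneH \<zero>\<^sub>H = \<zero>\<^sub>HT"
    using additive_zero[OF is_abelian_group HH.t.T_group mhom_additive[OF ptl]] .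
   have z0: "\<zero>\<^sub>HT <: HT" using HH.t.T_group abelian_groupE(2) by blast
   show ?case using zA[OF z0] by (simp add: G_def F_def 0 1)
  next
   case (insert b V)
   then have b: "b \<in> B" and V: "V \<subseteq> B" by auto
   have eq: "(%i. \<Oplus>\<^sub>HT b\<in>insert b V. w b i) = (%i. w b i \<oplus>\<^sub>Ae (\<Oplus>\<^sub>HT b\<in>V. w b i))"
    using insert.hyps wc[OF b] wc V by (intro ext) (simp add: HH.t.T.M.finsum_insert subset_iff Pi_def)
   have eq': "(\<Oplus>\<^sub>H b\<in>insert b V. \<eta> b) = \<eta> b \<oplus>\<^sub>H (\<Oplus>\<^sub>H b\<in>V. \<eta> b)"
    using insert.hyps lc[OF b] lc V by (intro finsum_insert) (auto simp: Pi_def)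
   have sc: "(\<Oplus>\<^sub>H b\<in>V. \<eta> b) <: H" using lc V by (intro finsum_in) auto
   note IH = insert.IH[OF V]
   show ?case
    unfolding eq eq' p(3)[OF wZ[OF b] conjunct1[OF IH]] additive_add[OF G lc[OF b] sc]
    using mat_cocycles_plus[OF Ae_ring mcomplex_map[OF ring_axioms Ae_ring kappa_ring_hom cx] wZ[OF b] conjunct1[OF IH]]
     w\<Theta>[OF b] IH by simp
  qed
  from this[OF U] have "\<Theta> (%i. \<Oplus>\<^sub>HT b\<in>U. w b i) = G (\<Oplus>\<^sub>H b\<in>U. \<eta> b)" by simp
  moreover have "\<Theta> c = \<Theta> (%i. \<Oplus>\<^sub>HT b\<in>U. w b i)"
  proof (rule p(6))
   fix i assume i: "i \<in> I d"
   then have "{b\<in>B. \<gamma> b (c i) \<noteq> \<zero>\<^sub>H} \<subseteq> U" by (auto simp: U_def)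
   then show "c i = (\<Oplus>\<^sub>HT b\<in>U. w b i)"
    using dual_basis_sum[OF lm db', of "c i" U] cc U by (simp add: w_def \<gamma>_def)
  qed
  moreover have "(\<Oplus>\<^sub>H b\<in>U. \<eta> b) <: H" using lc U by (intro finsum_in) auto
  ultimately show ?thesis by metis
 qed
 let ?N = "Ext_enveloping K A d" and ?M = "twisted_bimodule K A ?\<mu>"
 note \<mu> = \<mu>_algebra_hom[OF \<xi>]
 have N: "carrier ?N = carrier ?E" "add ?N = add ?E" "smult ?N = (%t e. tensor_flip K A t \<odot>\<^sub>?E e)"
  by (simp_all add: Ext_enveloping_def Let_def)
 have M: "carrier ?M = carrier H" "add ?M = add H" using AE.twisted_simps[OF \<mu>] by simp_all
 have bij: "bij_betw G (carrier ?M) (carrier ?N)"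
 proof (rule bij_betw_imageI)
  show "inj_on G (carrier ?M)"
  proof (rule inj_onI)
   fix x y assume "x <: ?M" "y <: ?M" and eq: "G x = G y"
   then have xy: "x <: H" "y <: H" by (simp_all add: M)
   have "G (x \<ominus>\<^sub>H y) = \<zero>\<^sub>?E"
    using additive_diff[OF is_abelian_group p(1) G xy] eq Gc[OF xy(2)] by (simp add: E.minus_self)
   then have "x \<ominus>\<^sub>H y = \<zero>\<^sub>H" using xy by (intro inj) auto
   then show "x = y" using xy by (simp add: minus_eq_zero_iff)
  qed
  show "G ` carrier ?M = carrier ?N"
   unfolding M(1) N(1) using Gc surj unfolding p(2) by blast
 qed
 have hom: "G \<in> mhom Ae ?M ?N"
 proof (rule mhomI)
  show "G y <: ?N" if "y <: ?M" for y using that Gc by (simp add: M N)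
  show "G (x \<oplus>\<^sub>?M y) = G x \<oplus>\<^sub>?N G y" if "x <: ?M" "y <: ?M" for x y
   using that additive_add[OF G] by (simp add: M N)
  fix s y assume "s <: Ae" "y <: ?M"
  then have s: "s <: HT" and y: "y <: H" by (simp_all add: M)
  have y1: "pt oneH y <: HT" using y by simp
  have fs: "tensor_flip K A s <: HT" using AE.flip_closed[of s] s by simp
  have fl: "tensor_flip K A \<in> mhom K HT HT" using AE.flip_lin by simp
  have Ml: "(%s. s \<odot>\<^sub>?M y) \<in> mhom K HT H"
   using AE.twisted_lin[OF \<mu>, of y] y by (simp add: module_hom_def)
  \<comment> \<open>On pure tensors, 1 \<otimes> y times the flip of a \<otimes> b is b \<otimes>
    a.y, which \<open>Psi\<close> sends to a.y.\<mu>(b). This is how the twist appears.\<close>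
  have "Psi \<xi> (pt oneH y \<otimes>\<^sub>Ae tensor_flip K A s) = s \<odot>\<^sub>?M y"
  proof (rule HH.t.tensor_ext[OF mhom_comp[OF mhom_comp[OF fl Ae_lin(2)[OF y1]] Psi_lin[OF \<xi>]] Ml _ s])
   fix a b assume ab: "a <: H" "b <: H"
   then show "Psi \<xi> (pt oneH y \<otimes>\<^sub>Ae tensor_flip K A (pt a b)) = pt a b \<odot>\<^sub>?M y"
    using y AE.flip_pure[of a b] AE.twisted_pure[OF \<mu>, of a b y] \<mu>_closed[OF \<xi>, of b]
    by (simp add: Ae_pure Psi_pure[OF \<xi>] amul_one)
  qed
  moreover have "s \<odot>\<^sub>?N G y = F (pt oneH y \<otimes>\<^sub>Ae tensor_flip K A s)"
   unfolding N(3) G_def F_def using p(4)[OF zA[OF y1], of "tensor_flip K A s"] fs y1 Zc[OF z(1)]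
   by (simp add: Ae_assoc)
  moreover have "... = G (Psi \<xi> (pt oneH y \<otimes>\<^sub>Ae tensor_flip K A s))"
   unfolding G_def using y1 fs by (intro F_Psi) simp
  ultimately show "G (s \<odot>\<^sub>?M y) = s \<odot>\<^sub>?N G y" by simp
 qed
 show ?thesis
  unfolding module_isomorphic_def
  using mhom_inverse[OF AE.twisted_lmodule[OF \<mu>] hom bij] bij_betw_inv_into[OF bij] by blast
qed

lemma A_twisted_CY:
 assumes CY: "twisted_CY K H d" and \<xi>: "\<xi> \<in> algebra_hom K H KK" and int: "left_integral_is K H d \<xi>"
 shows "twisted_CY_with K A d (nakayama \<xi>)"
proof -
 have inf: "infinite (UNIV :: ('c \<times> 'a) list set)" "infinite (UNIV :: (('a, 'c, 'c) tensor \<times> 'c) list set)"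
  by (simp_all add: infinite_UNIV_listI)
 have ne: "oneH \<noteq> \<zero>\<^sub>H" using eps_null eps_one by fastforce
 \<comment> \<open>With these indices the rows over H live on the type that Ext over H fixes, so
   that \<open>chosen_resolution\<close> is indeed a resolution.\<close>
 obtain J :: "nat => ('c \<times> 'a) list set" and e' D' m' N' where "mres H triv J e' D' m'"
  by (rule hopf_resolution[OF CY inf(1)]) (rule that)
 from lmodule.mres_projective_resolution[OF triv_lmodule this ne]
 have ex: "\<exists>(P :: nat => ('c, ('c, 'a) resolution_carrier) module) \<delta> \<epsilon>. projective_resolution H triv P \<delta> \<epsilon>"
  by blast
 \<comment> \<open>The second copy is indexed so that its base change to \<open>Ae\<close> lives on
   the type that smoothness and Ext over \<open>Ae\<close> fix.\<close>
 obtain I :: "nat => (('a, 'c, 'c) tensor \<times> 'c) list set" and e D m N where res: "mres H triv I e D m"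
  and bd: "!!n. N < n ==> I n = {}" and co: "!!n. n \<noteq> d ==> coexact_at H I e D n"
  by (rule hopf_resolution[OF CY inf(2)]) (rule that)
 note sm = A_smooth[OF res bd]
 note cx = mresD(1)[OF res]
 show ?thesis
 proof (rule hopf_integral[OF res int ex])
  fix l z
  assume l: "!!c. c \<in> mat_cocycles H I e D d ==> l c <: K"
   "!!c c'. c \<in> mat_cocycles H I e D d ==> c' \<in> mat_cocycles H I e D d ==>
    l (%i. c i \<oplus>\<^sub>H c' i) = l c \<oplus> l c'"
   "!!c h. c \<in> mat_cocycles H I e D d ==> h <: H ==> l (%i. c i ** S h) = \<xi> h \<otimes> l c"
   "!!c. c \<in> mat_cocycles H I e D d ==> l c = \<zero> \<longleftrightarrow> mat_coboundary H I D d c"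
   "z \<in> mat_cocycles H I e D d" "l z = \<one>"
  have "module_isomorphic Ae (Ext_enveloping K A d) (twisted_bimodule K A (nakayama \<xi>))"
   by (rule Ext_top[where l = l and z = z and I = I and e = e and D = D and m = m,
     OF \<xi> res sm l(2) l(1) l(3) l(4) l(5) l(6)])
  moreover have "carrier (Ext_enveloping K A n) = {\<zero>\<^sub>(Ext_enveloping K A n)}" if "n \<noteq> d" for n
   by (rule Ext_enveloping_trivial[OF A_mres[OF res] A_coexact[OF cx bd co[OF that]] sm])
  ultimately show ?thesis
   unfolding twisted_CY_with_def nakayama_automorphism_def
   using A_algebra sm \<mu>_algebra_hom[OF \<xi>] \<mu>_bij[OF \<xi>] by simp
 qed
qed

end

theorem theorem0p3:
  fixes K :: "'k ring" and H :: "('k, 'h) hopf" and d :: nat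
    and \<xi> :: "'h \<Rightarrow> 'k" and \<sigma> :: "'h \<Rightarrow> 'h \<Rightarrow> 'k"
  assumes "hopf_algebra K H"
    and "bij_betw (antipode H) (carrier H) (carrier H)"
    and "twisted_CY K H d"
    and "\<xi> \<in> algebra_hom K H (regular_module K)"
    and "left_integral_is K H d \<xi>"
    and "two_cocycle K H \<sigma>"
  shows "twisted_CY_with K (right_cleft_object K H \<sigma>) d
    (\<lambda>x. sweedler2 K H H x (\<lambda>x1 x2.
       \<xi> (antipode H x2) \<odot>\<^bsub>H\<^esub>
         cocycle_antipode_inv K H \<sigma> (trivial_cocycle K H)
           (cocycle_antipode_inv K H (trivial_cocycle K H) \<sigma> x1)))"
proof -
  interpret hopf_cocycle K H \<sigma>
    by (intro hopf_cocycle.intro hopf_cocycle_axioms.intro assms)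
  show ?thesis using A_twisted_CY[OF assms(3-5)] unfolding nakayama_def .
qed

end
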